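(* Let $\mathbb K$ be $\mathbb R$ or $\mathbb C$ and let $\theta\subset\{1,\dots,d-1\}$ be symmetric. If $\Gamma\subset\mathsf{PGL}(d,\mathbb K)$ is $P_\theta$-transverse, then for any $k\in\theta$ such that $k\le d-k$, there exist $d_0\in\mathbb N$, a properly convex domain $\Omega\subset\mathbb P(\mathbb R^{d_0})$, a projectively visible subgroup $\Gamma_0\subset\mathrm{Aut}(\Omega)$, and a faithful $P_\theta$-transverse representation $\rho:\Gamma_0\to\mathsf{PGL}(d,\mathbb K)$ with limit map $\xi:\Lambda_\Omega(\Gamma_0)\to\mathcal F_\theta$ such that (1) $\rho(\Gamma_0)=\Gamma$; (2) $\xi(\Lambda_\Omega(\Gamma_0))=\Lambda_\theta(\Gamma)$; (3) $\alpha_1(\kappa(\gamma))=\alpha_k(\kappa(\rho(\gamma)))$ for all $\gamma\in\Gamma_0$.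
   Context: Transverse groups. For $g\in\mathsf{PGL}(d,\mathbb K)$ let $\sigma_1(g)\ge\dots\ge\sigma_d(g)>0$ be the singular values of a lift with determinant of modulus $1$, $\kappa(g)=\mathrm{diag}(\log\sigma_1(g),\dots,\log\sigma_d(g))$ and $\alpha_k(\kappa(g))=\log\frac{\sigma_k(g)}{\sigma_{k+1}(g)}$ (likewise in $\mathsf{PGL}(d_0,\mathbb R)$). Write $g=\ell am$ with $\ell,m$ in the maximal compact subgroup ($\mathsf{PO}(d)$ or $\mathsf{PU}(d)$) and $a$ diagonal with entries $\sigma_1(g),\dots,\sigma_d(g)$; if $\alpha_k(\kappa(g))>0$, $U_k(g)=\ell(\langle e_1,\dots,e_k\rangle)$ is well defined. A subset $\theta=\{k_1<\dots<k_r\}$ is symmetric if $k\in\theta\iff d-k\in\theta$. $\mathcal F_\theta$ is the space of partial flags in $\mathbb K^d$ with one subspace $F^k$ of each dimension $k\in\theta$; $F,G\in\mathcal F_\theta$ are transverse if $F^k$ and $G^{d-k}$ are transverse for all $k\in\theta$, and $X\subset\mathcal F_\theta$ is transverse if distinct elements of $X$ are transverse. $\Gamma$ is $P_k$-divergent if $\alpha_k(\kappa(\gamma_n))\to\infty$ for every sequence of pairwise distinct elements. If $\Gamma$ is $P_k$-divergent for all $k\in\theta$, $\Lambda_\theta(\Gamma)\subset\mathcal F_\theta$ is the set of all limits of $U_\theta(\gamma_n)=(U_k(\gamma_n))_{k\in\theta}$ along sequences of pairwise distinct elements. $\Gamma$ is $P_\theta$-transverse if it is $P_k$-divergent for all $k\in\theta$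 and $\Lambda_\theta(\Gamma)$ is transverse. Projectively visible groups. A domain $\Omega\subset\mathbb P(\mathbb R^{d_0})$ is properly convex if it is a bounded convex subset of some affine chart; $\mathrm{Aut}(\Omega)\subset\mathsf{PGL}(d_0,\mathbb R)$ is its stabilizer. For $\Gamma_0\subset\mathrm{Aut}(\Omega)$, $\Lambda_\Omega(\Gamma_0)=\{z\in\partial\Omega:z=\lim\gamma_n(x)\text{ for some }x\in\Omega,\ \{\gamma_n\}\subset\Gamma_0\}$. A discrete subgroup $\Gamma_0\subset\mathrm{Aut}(\Omega)$ is projectively visible if every $x\in\Lambda_\Omega(\Gamma_0)$ lies in a unique supporting hyperplane to $\Omega$, and for all distinct $x,y\in\Lambda_\Omega(\Gamma_0)$ the open projective line segment in $\overline\Omega$ joining them is contained in $\Omega$. Transverse representations. For a projectively visible $\Gamma_0\subset\mathrm{Aut}(\Omega)$, a representation $\rho:\Gamma_0\to\mathsf{PGL}(d,\mathbb K)$ is $P_\theta$-transverse, with limit map $\xi$, if $\xi:\Lambda_\Omega(\Gamma_0)\to\mathcal F_\theta$ is a continuous embedding such that: $\xi$ is $\rho$-equivariant; $\xi(\Lambda_\Omega(\Gamma_0))$ is a transverse subset of $\mathcal F_\theta$; and if $\{\gamma_n\}\subset\Gamma_0$ satisfies $\gamma_n(b_0)\to x\in\Lambda_\Omega(\Gamma_0)$ and $\gamma_n^{-1}(b_0)\to y\in\Lambda_\Omega(\Gamma_0)$ for some (any) $b_0\in\Omega$, then $\rho(\gamma_n)(F)\to\xi(x)$ for every $F\in\mathcal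 F_\theta$ transverse to $\xi(y)$. *)

theory Defs
  imports
    "HOL-Analysis.Function_Topology"
    "HOL-Algebra.Coset"
    "Jordan_Normal_Form.VS_Connect"
    "Jordan_Normal_Form.Schur_Decomposition"
begin

text \<open>
  Dimensions are natural numbers throughout, so matrices and vectors are those of
  Jordan Normal Form. The scalar type is only ever instantiated to \<^typ>\<open>real\<close> or
  \<^typ>\<open>complex\<close>, where \<^const>\<open>conjugate\<close> is the identity, respectively complex conjugation.
\<close>

subsection \<open>Quotient topologies\<close>

definition quotient_topology :: "('a \<Rightarrow> 'b) \<Rightarrow> 'a topology \<Rightarrow> 'b topology" where
  "quotient_topology f X =
     topology (\<lambda>U. U \<subseteq> f ` topspace X \<and> openin X {x \<in> topspace X. f x \<in> U})"

lemma openin_quotient_topology: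
  "openin (quotient_topology f X) U \<longleftrightarrow>
     U \<subseteq> f ` topspace X \<and> openin X {x \<in> topspace X. f x \<in> U}"
proof -
  let ?P = "\<lambda>U. U \<subseteq> f ` topspace X \<and> openin X {x \<in> topspace X. f x \<in> U}"
  have "istopology ?P"
    unfolding istopology_def
  proof (intro conjI allI impI)
    fix S T assume S: "?P S" and T: "?P T"
    have "{x \<in> topspace X. f x \<in> S \<inter> T} =
        {x \<in> topspace X. f x \<in> S} \<inter> {x \<in> topspace X. f x \<in> T}" by auto
    then show "openin X {x \<in> topspace X. f x \<in> S \<inter> T}" using S T by auto
    show "S \<inter> T \<subseteq> f ` topspace X" using S by auto
  next
    fix K assume K: "\<forall>U\<in>K. ?P U"
    have "{x \<in> topspace X. f x \<in> \<Union>K} = (\<Union>U\<in>K. {x \<in> topspace X. f x \<in> U})" by auto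
    then show "openin X {x \<in> topspace X. f x \<in> \<Union>K}" using K by auto
    show "\<Union>K \<subseteq> f ` topspace X" using K by auto
  qed
  then show ?thesis by (simp add: quotient_topology_def topology_inverse')
qed

lemma topspace_quotient_topology: "topspace (quotient_topology f X) = f ` topspace X"
proof (rule antisym)
  show "topspace (quotient_topology f X) \<subseteq> f ` topspace X"
    unfolding topspace_def openin_quotient_topology by auto
  have "{x \<in> topspace X. f x \<in> f ` topspace X} = topspace X" by auto
  then have "openin (quotient_topology f X) (f ` topspace X)"
    by (simp add: openin_quotient_topology)
  then show "f ` topspace X \<subseteq> topspace (quotient_topology f X)" by (rule openin_subset)
qed

lemma quotient_map_quotient_topology: "quotient_map X (quotient_topology f X) f"
  by (auto simp: quotient_map_def topspace_quotient_topology openin_quotient_topology)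


subsection \<open>The group PGL\<close>

definition GL :: "nat \<Rightarrow> ('a :: field) mat monoid" where
  "GL d = units_of (ring_mat TYPE('a) d ())"

definition scalar_mats :: "nat \<Rightarrow> ('a :: field) mat set" where
  "scalar_mats d = {c \<cdot>\<^sub>m 1\<^sub>m d | c. c \<noteq> 0}"

text \<open>An element of \<open>PGL d\<close> is a coset, i.e. the set of all its lifts to \<open>GL d\<close>.\<close>

definition PGL :: "nat \<Rightarrow> ('a :: field) mat set monoid" where
  "PGL d = GL d Mod scalar_mats d"

definition mat_topology :: "nat \<Rightarrow> nat \<Rightarrow> ('a :: topological_space) mat topology" where
  "mat_topology m n = pullback_topology (carrier_mat m n)
     (\<lambda>A. restrict (\<lambda>ij. A $$ ij) ({..<m} \<times> {..<n}))
     (product_topology (\<lambda>_. euclidean) ({..<m} \<times> {..<n}))"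

definition PGL_topology :: "nat \<Rightarrow> ('a :: real_normed_field) mat set topology" where
  "PGL_topology d = quotient_topology (\<lambda>A. scalar_mats d #>\<^bsub>GL d\<^esub> A)
     (subtopology (mat_topology d d) (carrier (GL d)))"

definition discrete_subgroup :: "nat \<Rightarrow> ('a :: real_normed_field) mat set set \<Rightarrow> bool" where
  "discrete_subgroup d \<Gamma> \<longleftrightarrow>
     subgroup \<Gamma> (PGL d) \<and> subtopology (PGL_topology d) \<Gamma> = discrete_topology \<Gamma>"


subsection \<open>Grassmannians and flags\<close>

definition Gr :: "nat \<Rightarrow> nat \<Rightarrow> ('a :: field) vec set set" where
  "Gr d k = {W. subspace class_ring W (module_vec TYPE('a) d) \<and>
     vectorspace.dim class_ring ((module_vec TYPE('a) d)\<lparr>carrier := W\<rparr>) = k}"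

definition column_space :: "nat \<Rightarrow> ('a :: field) mat \<Rightarrow> 'a vec set" where
  "column_space k A = {A *\<^sub>v v | v. v \<in> carrier_vec k}"

text \<open>The quotient of the space of \<open>k\<close>-frames, a frame being a \<open>d \<times> k\<close> matrix of rank \<open>k\<close>.\<close>

definition Gr_topology :: "nat \<Rightarrow> nat \<Rightarrow> ('a :: real_normed_field) vec set topology" where
  "Gr_topology d k = quotient_topology (column_space k)
     (subtopology (mat_topology d k) {A. column_space k A \<in> Gr d k})"

text \<open>Since \<open>W\<close> is invariant under nonzero scalars, taking all lifts \<open>A \<in> g\<close> gives the same
  subspace as taking any one of them.\<close>

definition act :: "('a :: field) mat set \<Rightarrow> 'a vec set \<Rightarrow> 'a vec set" where
  "act g W = {A *\<^sub>v w | A w. A \<in> g \<and> w \<in> W}"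

definition flags :: "nat \<Rightarrow> nat set \<Rightarrow> (nat \<Rightarrow> ('a :: field) vec set) set" where
  "flags d \<theta> = {F \<in> extensional \<theta>. (\<forall>k\<in>\<theta>. F k \<in> Gr d k) \<and>
     (\<forall>k\<in>\<theta>. \<forall>l\<in>\<theta>. k \<le> l \<longrightarrow> F k \<subseteq> F l)}"

definition flag_topology ::
    "nat \<Rightarrow> nat set \<Rightarrow> (nat \<Rightarrow> ('a :: real_normed_field) vec set) topology" where
  "flag_topology d \<theta> = subtopology (product_topology (Gr_topology d) \<theta>) (flags d \<theta>)"

definition flag_act ::
    "nat set \<Rightarrow> ('a :: field) mat set \<Rightarrow> (nat \<Rightarrow> 'a vec set) \<Rightarrow> nat \<Rightarrow> 'a vec set" where
  "flag_act \<theta> g F = restrict (\<lambda>k. act g (F k)) \<theta>"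

definition symmetric_type :: "nat \<Rightarrow> nat set \<Rightarrow> bool" where
  "symmetric_type d \<theta> \<longleftrightarrow> \<theta> \<subseteq> {1..<d} \<and> (\<forall>k\<in>{1..<d}. k \<in> \<theta> \<longleftrightarrow> d - k \<in> \<theta>)"

definition transverse_subspaces :: "nat \<Rightarrow> ('a :: field) vec set \<Rightarrow> 'a vec set \<Rightarrow> bool" where
  "transverse_subspaces d V W \<longleftrightarrow> {v + w | v w. v \<in> V \<and> w \<in> W} = carrier_vec d"

definition transverse_flags ::
    "nat \<Rightarrow> nat set \<Rightarrow> (nat \<Rightarrow> ('a :: field) vec set) \<Rightarrow> (nat \<Rightarrow> 'a vec set) \<Rightarrow> bool" where
  "transverse_flags d \<theta> F G \<longleftrightarrow> (\<forall>k\<in>\<theta>. transverse_subspaces d (F k) (G (d - k)))"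

definition transverse_set :: "nat \<Rightarrow> nat set \<Rightarrow> (nat \<Rightarrow> ('a :: field) vec set) set \<Rightarrow> bool" where
  "transverse_set d \<theta> X \<longleftrightarrow>
     X \<subseteq> flags d \<theta> \<and> (\<forall>F\<in>X. \<forall>G\<in>X. F \<noteq> G \<longrightarrow> transverse_flags d \<theta> F G)"


subsection \<open>Singular values\<close>

text \<open>The square roots of the eigenvalues of \<open>A\<^sup>*A\<close>, with multiplicity, in decreasing order.\<close>

definition singular_values :: "('a :: {conjugatable_field, real_normed_field}) mat \<Rightarrow> real list" where
  "singular_values A = (THE s. sorted_wrt (\<ge>) s \<and> (\<forall>x\<in>set s. 0 \<le> x) \<and>
     char_poly (mat_adjoint A * A) = (\<Prod>x\<leftarrow>s. [:- of_real (x\<^sup>2), 1:]))"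

text \<open>Counted from 1. The lifts with determinant of modulus 1 differ by scalars of modulus 1,
  so the choice does not matter.\<close>

definition sv :: "('a :: {conjugatable_field, real_normed_field}) mat set \<Rightarrow> nat \<Rightarrow> real" where
  "sv g i = singular_values (SOME A. A \<in> g \<and> norm (det A) = 1) ! (i - 1)"

definition root_gap :: "nat \<Rightarrow> ('a :: {conjugatable_field, real_normed_field}) mat set \<Rightarrow> real" where
  "root_gap k g = ln (sv g k / sv g (k + 1))"

definition unitary :: "nat \<Rightarrow> ('a :: conjugatable_field) mat \<Rightarrow> bool" where
  "unitary d L \<longleftrightarrow> L \<in> carrier_mat d d \<and> mat_adjoint L * L = 1\<^sub>m d"

text \<open>\<open>U\<^sub>k(g)\<close>; independent of \<open>L\<close> and \<open>M\<close> when \<open>root_gap k g > 0\<close>. The last conjunct describes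
  \<open>L\<langle>e\<^sub>1, \<dots>, e\<^sub>k\<rangle>\<close>.\<close>

definition U_sub ::
    "nat \<Rightarrow> nat \<Rightarrow> ('a :: {conjugatable_field, real_normed_field}) mat set \<Rightarrow> 'a vec set" where
  "U_sub d k g = (THE W. \<exists>L M. unitary d L \<and> unitary d M \<and>
     L * mat_diag d (\<lambda>i. of_real (sv g (i + 1))) * M \<in> g \<and>
     W = {L *\<^sub>v v | v. v \<in> carrier_vec d \<and> (\<forall>i<d. k \<le> i \<longrightarrow> v $ i = 0)})"


subsection \<open>Transverse groups\<close>

definition P_divergent ::
    "nat \<Rightarrow> ('a :: {conjugatable_field, real_normed_field}) mat set set \<Rightarrow> bool" where
  "P_divergent k \<Gamma> \<longleftrightarrow> (\<forall>\<gamma> :: nat \<Rightarrow> _. inj \<gamma> \<and> range \<gamma> \<subseteq> \<Gamma> \<longrightarrow>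
     filterlim (\<lambda>n. root_gap k (\<gamma> n)) at_top sequentially)"

definition flag_limit_set ::
    "nat \<Rightarrow> nat set \<Rightarrow> ('a :: {conjugatable_field, real_normed_field}) mat set set \<Rightarrow>
      (nat \<Rightarrow> 'a vec set) set" where
  "flag_limit_set d \<theta> \<Gamma> = {F. \<exists>\<gamma> :: nat \<Rightarrow> _. inj \<gamma> \<and> range \<gamma> \<subseteq> \<Gamma> \<and>
     limitin (flag_topology d \<theta>) (\<lambda>n. restrict (\<lambda>k. U_sub d k (\<gamma> n)) \<theta>) F sequentially}"

definition transverse_group ::
    "nat \<Rightarrow> nat set \<Rightarrow> ('a :: {conjugatable_field, real_normed_field}) mat set set \<Rightarrow> bool" where
  "transverse_group d \<theta> \<Gamma> \<longleftrightarrow> subgroup \<Gamma> (PGL d) \<and> (\<forall>k\<in>\<theta>. P_divergent k \<Gamma>) \<and>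
     transverse_set d \<theta> (flag_limit_set d \<theta> \<Gamma>)"


subsection \<open>Properly convex domains\<close>

text \<open>Points of projective space are lines, i.e. elements of \<open>Gr d 1\<close>.\<close>

definition line :: "real vec \<Rightarrow> real vec set" where
  "line v = {c \<cdot>\<^sub>v v | c. True}"

text \<open>The covector \<open>f\<close> determines the affine chart of lines on which \<open>f\<close> does not vanish,
  identified with the affine hyperplane \<open>f = 1\<close>; \<open>S\<close> is \<open>\<Omega>\<close> seen in that chart.\<close>

definition properly_convex_domain :: "nat \<Rightarrow> real vec set set \<Rightarrow> bool" where
  "properly_convex_domain d \<Omega> \<longleftrightarrow>
     openin (Gr_topology d 1) \<Omega> \<and> connectedin (Gr_topology d 1) \<Omega> \<and> \<Omega> \<noteq> {} \<and>
     (\<exists>f\<in>carrier_vec d. (\<forall>x\<in>\<Omega>. \<exists>v\<in>x. f \<bullet> v \<noteq> 0) \<and>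
        (let S = {v \<in> carrier_vec d. f \<bullet> v = 1 \<and> line v \<in> \<Omega>} in
           (\<forall>u\<in>S. \<forall>v\<in>S. \<forall>t\<in>{0..1}. (1 - t) \<cdot>\<^sub>v u + t \<cdot>\<^sub>v v \<in> S) \<and>
           (\<exists>C. \<forall>v\<in>S. \<forall>i<d. \<bar>v $ i\<bar> \<le> C)))"

definition Aut :: "nat \<Rightarrow> real vec set set \<Rightarrow> real mat set set" where
  "Aut d \<Omega> = {g \<in> carrier (PGL d). act g ` \<Omega> = \<Omega>}"

definition orbit_limit_set ::
    "nat \<Rightarrow> real vec set set \<Rightarrow> real mat set set \<Rightarrow> real vec set set" where
  "orbit_limit_set d \<Omega> \<Gamma> = {z \<in> Gr_topology d 1 frontier_of \<Omega>.
     \<exists>x\<in>\<Omega>. \<exists>\<gamma> :: nat \<Rightarrow> _. range \<gamma> \<subseteq> \<Gamma> \<and>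
       limitin (Gr_topology d 1) (\<lambda>n. act (\<gamma> n) x) z sequentially}"

text \<open>Hyperplanes of projective space are linear subspaces of codimension 1.\<close>

definition supporting_hyperplane ::
    "nat \<Rightarrow> real vec set set \<Rightarrow> real vec set \<Rightarrow> real vec set \<Rightarrow> bool" where
  "supporting_hyperplane d \<Omega> x H \<longleftrightarrow>
     (\<exists>k. k + 1 = d \<and> H \<in> Gr d k) \<and> x \<subseteq> H \<and> (\<forall>y\<in>\<Omega>. \<not> y \<subseteq> H)"

text \<open>The two open projective line segments with endpoints \<open>x \<noteq> y\<close>; both arise,
  as \<open>v\<close> may be replaced by \<open>-v\<close>.\<close>

definition open_proj_segments :: "real vec set \<Rightarrow> real vec set \<Rightarrow> real vec set set set" where
  "open_proj_segments x y =
     {{line (u + t \<cdot>\<^sub>v v) | t. 0 < t} | u v. x = line u \<and> y = line v}"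

definition projectively_visible ::
    "nat \<Rightarrow> real vec set set \<Rightarrow> real mat set set \<Rightarrow> bool" where
  "projectively_visible d \<Omega> \<Gamma> \<longleftrightarrow> discrete_subgroup d \<Gamma> \<and> \<Gamma> \<subseteq> Aut d \<Omega> \<and>
     (\<forall>x\<in>orbit_limit_set d \<Omega> \<Gamma>. \<exists>!H. supporting_hyperplane d \<Omega> x H) \<and>
     (\<forall>x\<in>orbit_limit_set d \<Omega> \<Gamma>. \<forall>y\<in>orbit_limit_set d \<Omega> \<Gamma>. x \<noteq> y \<longrightarrow>
        (\<forall>I\<in>open_proj_segments x y. I \<subseteq> Gr_topology d 1 closure_of \<Omega> \<longrightarrow> I \<subseteq> \<Omega>))"


subsection \<open>Transverse representations\<close>

definition transverse_rep ::
    "nat \<Rightarrow> real vec set set \<Rightarrow> real mat set set \<Rightarrow> nat \<Rightarrow> nat set \<Rightarrow>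
      (real mat set \<Rightarrow> ('a :: real_normed_field) mat set) \<Rightarrow>
      (real vec set \<Rightarrow> nat \<Rightarrow> 'a vec set) \<Rightarrow> bool" where
  "transverse_rep d\<^sub>0 \<Omega> \<Gamma>\<^sub>0 d \<theta> \<rho> \<xi> \<longleftrightarrow>
     \<rho> \<in> hom ((PGL d\<^sub>0)\<lparr>carrier := \<Gamma>\<^sub>0\<rparr>) (PGL d) \<and>
     embedding_map (subtopology (Gr_topology d\<^sub>0 1) (orbit_limit_set d\<^sub>0 \<Omega> \<Gamma>\<^sub>0))
       (flag_topology d \<theta>) \<xi> \<and>
     (\<forall>\<gamma>\<in>\<Gamma>\<^sub>0. \<forall>x\<in>orbit_limit_set d\<^sub>0 \<Omega> \<Gamma>\<^sub>0. \<xi> (act \<gamma> x) = flag_act \<theta> (\<rho> \<gamma>) (\<xi> x)) \<and>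
     transverse_set d \<theta> (\<xi> ` orbit_limit_set d\<^sub>0 \<Omega> \<Gamma>\<^sub>0) \<and>
     (\<forall>\<gamma> :: nat \<Rightarrow> _. \<forall>b\<in>\<Omega>. \<forall>x\<in>orbit_limit_set d\<^sub>0 \<Omega> \<Gamma>\<^sub>0. \<forall>y\<in>orbit_limit_set d\<^sub>0 \<Omega> \<Gamma>\<^sub>0.
        range \<gamma> \<subseteq> \<Gamma>\<^sub>0 \<and>
        limitin (Gr_topology d\<^sub>0 1) (\<lambda>n. act (\<gamma> n) b) x sequentially \<and>
        limitin (Gr_topology d\<^sub>0 1) (\<lambda>n. act (inv\<^bsub>PGL d\<^sub>0\<^esub> (\<gamma> n)) b) y sequentially \<longrightarrow>
        (\<forall>F\<in>flags d \<theta>. transverse_flags d \<theta> F (\<xi> y) \<longrightarrow>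
           limitin (flag_topology d \<theta>) (\<lambda>n. flag_act \<theta> (\<rho> (\<gamma> n)) F) (\<xi> x) sequentially))"

end

theory Submission
  imports Defs "Jordan_Normal_Form.Spectral_Radius" "HOL-Analysis.Topology_Euclidean_Space"
begin

text \<open>
  Let \<open>\<Phi>(g)\<close> be the action \<open>X \<mapsto> C X C\<^sup>*\<close> on Hermitian forms, where \<open>C\<close> is the \<open>k\<close>-th compound
  matrix of a lift of \<open>g\<close>. Its two largest singular values have the ratio \<open>\<sigma>\<^sub>k(g) / \<sigma>\<^sub>k\<^sub>+\<^sub>1(g)\<close>, and it
  permutes the rank one forms \<open>p(V)\<close> attached to the \<open>k\<close>-planes \<open>V\<close>. By divergence, along pairwise
  distinct elements of \<open>\<Gamma>\<close> the normalised matrices \<open>\<Phi>(\<gamma>\<^sub>n)\<close> accumulate at rank one matrices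
  \<open>p(F\<^sup>k) q(G)\<^sup>T\<close>, where \<open>F\<close> and \<open>G\<close> are limit flags and \<open>q(G) \<bullet> p(V) = 0\<close> exactly if \<open>V\<close> is not
  transverse to \<open>G\<^sup>d\<^sup>-\<^sup>k\<close>.

  Hence the normalised functionals \<open>\<Phi>(\<gamma>)\<^sup>T \<kappa>\<close>, for \<open>\<kappa>\<close> in a finite set of perturbations of the trace,
  form together with all \<open>q(G)\<close> a compact set \<open>S\<close>. The domain \<open>\<Omega>\<close> is the cone on which \<open>S\<close> is positive.
  Since \<open>k \<le> d - k\<close>, the planes \<open>F\<^sup>k \<subseteq> F\<^sup>d\<^sup>-\<^sup>k\<close> are not transverse, whereas different limit flags
  are; so \<open>q(F)\<close> is the only element of \<open>S\<close> that vanishes at \<open>p(F\<^sup>k)\<close>. By compactness of \<open>S\<close> this makes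
  the supporting hyperplane at \<open>p(F\<^sup>k)\<close> unique, and it keeps the segments between two such points
  inside \<open>\<Omega>\<close>. The image of \<open>\<Gamma>\<close> is discrete because a matrix of rank one has determinant \<open>0\<close>.
\<close>

text \<open>The k-th exterior power alone has the right gap, but its pairings carry an undetermined
  sign or phase and give no invariant convex cone. Passing from c to its rank one form replaces a
  pairing det by |det|^2, which is nonnegative; it also makes the representation real over both
  fields and lets all lifts of g act with the same sign. The functionals q(G) alone need not cut out
  a bounded domain: the limit flags may fail to span, and there are none if \<Gamma> is finite. The
  perturbed traces are strictly positive on all p(V), so adding their orbit makes the dual cone
  bounded without creating new zeros at the points p(F^k). Each orbit functional is scaled to the
  value 1 at the identity form. With this scaling, distinct elements of \<Gamma> accumulate only at
  the q(G), whichever perturbation is used, and this is what closes S up.\<close>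

hide_type (open) Finite_Cartesian_Product.vec
hide_const (open) Finite_Cartesian_Product.vec Finite_Cartesian_Product.mat
  Finite_Cartesian_Product.row Finite_Cartesian_Product.column
unbundle no vec_syntax and no inner_syntax

text \<open>Both scalar fields at once. \<open>emb\<close> is an isometric field embedding into the
  complex numbers that respects conjugation; eigenvalues are found and minors compared there.
  \<open>heine_borel\<close> supplies limits of bounded sequences of matrix entries.\<close>

class rc_field = conjugatable_ordered_field + real_normed_field + heine_borel +
  fixes emb :: "'a \<Rightarrow> complex"
  assumes emb_add: "emb (x + y) = emb x + emb y"
    and emb_mult: "emb (x * y) = emb x * emb y"
    and emb_scaleR: "emb (scaleR r x) = complex_of_real r * emb x"
    and emb_one: "emb 1 = 1"
    and emb_conjugate: "emb (conjugate x) = cnj (emb x)"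
    and cmod_emb: "cmod (emb x) = norm x"

instantiation real :: rc_field
begin
definition emb_real :: "real \<Rightarrow> complex" where "emb_real x = complex_of_real x"
instance by standard (auto simp: emb_real_def)
end

instantiation complex :: rc_field
begin
definition emb_complex :: "complex \<Rightarrow> complex" where "emb_complex x = x"
instance by standard (auto simp: emb_complex_def scaleR_conv_of_real)
end

subsection \<open>The embedding into the complex numbers\<close>

lemma emb_of_real: "emb (of_real r) = complex_of_real r"
  by (simp add: of_real_def emb_scaleR emb_one)

lemma emb_zero [simp]: "emb 0 = 0" using cmod_emb[of 0] by simp

lemma emb_eq_0_iff [simp]: "emb x = 0 \<longleftrightarrow> x = 0"
  using cmod_emb[of x] by (metis norm_eq_zero)

lemma emb_uminus: "emb (- x) = - emb x"
  using emb_add[of x "- x"] by (simp add: eq_neg_iff_add_eq_0 add.commute)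

lemma emb_diff: "emb (x - y) = emb x - emb y"
  using emb_add[of x "- y"] by (simp add: emb_uminus)

lemma emb_eq_iff [simp]: "emb x = emb y \<longleftrightarrow> x = y"
  using emb_eq_0_iff[of "x - y"] by (simp add: emb_diff)

lemma comm_ring_hom_emb: "comm_ring_hom (emb :: 'a :: rc_field \<Rightarrow> complex)"
  by standard (auto simp: emb_add emb_mult emb_one)

lemma emb_sum: "emb (sum f X) = (\<Sum>x\<in>X. emb (f x))"
  by (induct X rule: infinite_finite_induct) (auto simp: emb_add)

lemma emb_prod: "emb (prod f X) = (\<Prod>x\<in>X. emb (f x))"
  by (induct X rule: infinite_finite_induct) (auto simp: emb_mult emb_one)

lemma norm_conjugate [simp]: "norm (conjugate (x :: 'a :: rc_field)) = norm x"
  by (metis cmod_emb emb_conjugate complex_mod_cnj)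

lemma conjugate_of_real [simp]: "conjugate (of_real r :: 'a :: rc_field) = of_real r"
  by (metis emb_conjugate emb_eq_iff emb_of_real complex_cnj_complex_of_real)

lemma conjugate_1 [simp]: "conjugate (1 :: 'a :: rc_field) = 1"
  using conjugate_of_real[of 1] by simp

lemma conjugate_mult_self: "conjugate (x :: 'a :: rc_field) * x = of_real ((norm x)\<^sup>2)"
proof -
  have "emb (conjugate x * x) = emb (of_real ((norm x)\<^sup>2) :: 'a)"
    using complex_norm_square[of "emb x"]
    by (simp add: emb_mult emb_conjugate emb_of_real cmod_emb mult.commute del: of_real_power)
  then show ?thesis by (simp only: emb_eq_iff)
qed

lemma conjugate_diff: "conjugate (x - y :: 'a :: rc_field) = conjugate x - conjugate y"
  by (metis conjugate_dist_add conjugate_neg diff_conv_add_uminus)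

lemma tendsto_conjugate [tendsto_intros]:
  assumes "(f \<longlongrightarrow> (l :: 'a :: rc_field)) F"
  shows "((\<lambda>x. conjugate (f x)) \<longlongrightarrow> conjugate l) F"
  using assms by (simp add: tendsto_iff dist_norm flip: conjugate_diff)

lemma tendsto_emb [tendsto_intros]:
  assumes "(f \<longlongrightarrow> (l :: 'a :: rc_field)) F"
  shows "((\<lambda>x. emb (f x)) \<longlongrightarrow> emb l) F"
  using assms by (simp add: tendsto_iff dist_norm cmod_emb flip: emb_diff)

subsection \<open>Adjoints and unitary matrices\<close>

lemma adj_dim [simp]: "dim_row (mat_adjoint A) = dim_col A" "dim_col (mat_adjoint A) = dim_row A"
  by (auto simp: mat_adjoint_def)

lemma adj_carrier [simp, intro]: "A \<in> carrier_mat m n \<Longrightarrow> mat_adjoint A \<in> carrier_mat n m"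
  by (metis adj_dim carrier_matD carrier_matI)

lemma adj_index [simp]:
  "i < dim_col A \<Longrightarrow> j < dim_row A \<Longrightarrow> mat_adjoint A $$ (i, j) = conjugate (A $$ (j, i))"
  by (auto simp: mat_adjoint_def mat_of_rows_def)

lemma adj_adj [simp]: "mat_adjoint (mat_adjoint A) = A"
  by (rule eq_matI) auto

lemma adj_one [simp]: "mat_adjoint (1\<^sub>m n :: 'a :: rc_field mat) = 1\<^sub>m n"
  by (rule eq_matI) auto

lemma index_mult_sum:
  assumes "A \<in> carrier_mat m n" "B \<in> carrier_mat n p" "i < m" "j < p"
  shows "(A * B) $$ (i, j) = (\<Sum>l=0..<n. A $$ (i, l) * B $$ (l, j))"
  using assms by (auto simp: scalar_prod_def)

lemma index_mult_vec_sum: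
  assumes "A \<in> carrier_mat m n" "v \<in> carrier_vec n" "i < m"
  shows "(A *\<^sub>v v) $ i = (\<Sum>l=0..<n. A $$ (i, l) * v $ l)"
  using assms by (auto simp: scalar_prod_def)

lemma adj_mult:
  assumes "A \<in> carrier_mat m n" "(B :: 'a :: rc_field mat) \<in> carrier_mat n p"
  shows "mat_adjoint (A * B) = mat_adjoint B * mat_adjoint A"
proof (rule eq_matI)
  fix i j assume "i < dim_row (mat_adjoint B * mat_adjoint A)" "j < dim_col (mat_adjoint B * mat_adjoint A)"
  then have ij: "i < p" "j < m" using assms by auto
  have "mat_adjoint (A * B) $$ (i, j) = conjugate (\<Sum>l=0..<n. A $$ (j, l) * B $$ (l, i))"
    using assms ij by (simp add: index_mult_sum del: index_mult_mat(1))
  also have "\<dots> = (\<Sum>l=0..<n. mat_adjoint B $$ (i, l) * mat_adjoint A $$ (l, j))"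
    using assms ij by (auto simp: sum_conjugate conjugate_dist_mul mult.commute intro!: sum.cong)
  also have "\<dots> = (mat_adjoint B * mat_adjoint A) $$ (i, j)"
    using assms ij by (subst index_mult_sum[of _ p n _ m]) auto
  finally show "mat_adjoint (A * B) $$ (i, j) = (mat_adjoint B * mat_adjoint A) $$ (i, j)" .
qed (use assms in auto)

lemma conjugate_of_int [simp]: "conjugate (of_int z :: 'a :: rc_field) = of_int z"
  using conjugate_of_real[of "of_int z"] by simp

lemma conjugate_prod: "conjugate (prod f X :: 'a :: rc_field) = (\<Prod>x\<in>X. conjugate (f x))"
  by (induct X rule: infinite_finite_induct) (auto simp: conjugate_dist_mul)

lemma det_adj:
  assumes "(A :: 'a :: rc_field mat) \<in> carrier_mat n n"
  shows "det (mat_adjoint A) = conjugate (det A)"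
proof -
  let ?B = "mat_adjoint A"
  have B: "?B \<in> carrier_mat n n" using assms by auto
  have "det ?B = det (transpose_mat ?B)" using det_transpose[OF B] by simp
  also have "\<dots> = conjugate (det A)"
    unfolding det_def'[OF assms] det_def'[OF transpose_carrier_mat[THEN iffD2, OF B]] using assms
    by (subst sum_conjugate) (auto simp: conjugate_dist_mul conjugate_prod permutes_in_image finite_permutations
       intro!: sum.cong prod.cong)
  finally show ?thesis .
qed

lemma adj_mult_self_eq_one_iff:
  assumes "(U :: 'a :: rc_field mat) \<in> carrier_mat d r"
  shows "mat_adjoint U * U = 1\<^sub>m r \<longleftrightarrow>
    (\<forall>a<r. \<forall>b<r. (\<Sum>i=0..<d. conjugate (U $$ (i, a)) * U $$ (i, b)) = (if a = b then 1 else 0))"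
    (is "?l \<longleftrightarrow> ?r")
proof -
  have *: "(mat_adjoint U * U) $$ (a, b) = (\<Sum>i=0..<d. conjugate (U $$ (i, a)) * U $$ (i, b))"
    if "a < r" "b < r" for a b
    using that assms by (subst index_mult_sum[of _ r d _ r]) auto
  show ?thesis
  proof
    assume ?l then show ?r by (simp add: *[symmetric])
  next
    assume r: ?r
    show ?l
    proof (rule eq_matI)
      fix i j assume "i < dim_row (1\<^sub>m r :: 'a mat)" "j < dim_col (1\<^sub>m r :: 'a mat)"
      then have ij: "i < r" "j < r" by auto
      show "(mat_adjoint U * U) $$ (i, j) = 1\<^sub>m r $$ (i, j)"
        unfolding *[OF ij] using r ij by auto
    qed (use assms in auto)
  qed
qed

lemma unitaryD:
  assumes "unitary d (L :: 'a :: rc_field mat)"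
  shows "L \<in> carrier_mat d d" "mat_adjoint L * L = 1\<^sub>m d" "L * mat_adjoint L = 1\<^sub>m d"
proof -
  show 1: "L \<in> carrier_mat d d" and 2: "mat_adjoint L * L = 1\<^sub>m d"
    using assms by (auto simp: unitary_def)
  show "L * mat_adjoint L = 1\<^sub>m d"
    using mat_mult_left_right_inverse[OF _ 1 2] 1 by auto
qed

lemma unitary_adj: 
  assumes "unitary d (L :: 'a :: rc_field mat)"
  shows "unitary d (mat_adjoint L)"
  using unitaryD[OF assms] by (simp add: unitary_def)

lemma unitary_one: "unitary d (1\<^sub>m d :: 'a :: rc_field mat)"
  by (auto simp: unitary_def)

lemma unitary_mult:
  assumes "unitary d (L :: 'a :: rc_field mat)" "unitary d M"
  shows "unitary d (L * M)"
proof -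
  note L = unitaryD[OF assms(1)] and M = unitaryD[OF assms(2)]
  have "mat_adjoint (L * M) * (L * M) = (mat_adjoint M * mat_adjoint L) * (L * M)"
    using L M by (simp add: adj_mult[of _ d d _ d])
  also have "\<dots> = mat_adjoint M * ((mat_adjoint L * L) * M)"
    using L(1) M(1) by (simp add: assoc_mult_mat[of _ d d _ d _ d])
  also have "\<dots> = 1\<^sub>m d" using L M by simp
  finally show ?thesis using L M by (auto simp: unitary_def)
qed

lemma unitary_det:
  assumes "unitary d (L :: 'a :: rc_field mat)"
  shows "norm (det L) = 1"
proof -
  note L = unitaryD[OF assms]
  have "det (mat_adjoint L) * det L = 1"
    using L det_mult[of "mat_adjoint L" d L] by (metis adj_carrier det_one)
  then have "conjugate (det L) * det L = 1" using det_adj[OF L(1)] by simp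
  then have "of_real ((norm (det L))\<^sup>2) = (1 :: 'a)" by (simp add: conjugate_mult_self)
  then have "(norm (det L))\<^sup>2 = 1" by (metis of_real_1 of_real_eq_iff)
  then show ?thesis by (metis norm_ge_zero one_power2 power2_eq_iff_nonneg zero_le_one)
qed

lemma isometric_entry_le:
  assumes "(U :: 'a :: rc_field mat) \<in> carrier_mat d r" "mat_adjoint U * U = 1\<^sub>m r" "i < d" "j < r"
  shows "norm (U $$ (i, j)) \<le> 1"
proof -
  have "(\<Sum>i=0..<d. conjugate (U $$ (i, j)) * U $$ (i, j)) = 1"
    using adj_mult_self_eq_one_iff[OF assms(1)] assms by auto
  then have "of_real (\<Sum>i=0..<d. (norm (U $$ (i, j)))\<^sup>2) = (1 :: 'a)"
    by (simp add: conjugate_mult_self)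
  then have s: "(\<Sum>i=0..<d. (norm (U $$ (i, j)))\<^sup>2) = 1"
    by (metis of_real_1 of_real_eq_iff)
  have "(norm (U $$ (i, j)))\<^sup>2 \<le> 1"
    unfolding s[symmetric] using assms by (intro member_le_sum) auto
  then show ?thesis by (simp add: abs_square_le_1)
qed

subsection \<open>Orthonormal frames\<close>

text \<open>Padded with zero rows to size k, \<open>B\<close> becomes a singular square matrix, and
  a kernel vector of that matrix is one of \<open>B\<close>.\<close>

lemma wide_matrix_kernel:
  assumes "(B :: 'a :: field mat) \<in> carrier_mat j k" "j < k"
  shows "\<exists>v\<in>carrier_vec k. v \<noteq> 0\<^sub>v k \<and> B *\<^sub>v v = 0\<^sub>v j"
proof -
  let ?c = "\<lambda>i. if i < j then row B i else 0\<^sub>v k"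
  let ?B = "mat\<^sub>r k k (\<lambda>i. if i = j then 0\<^sub>v k else ?c i)"
  have "det ?B = 0" by (rule det_row_0) (use assms in auto)
  moreover have B: "?B \<in> carrier_mat k k" by auto
  ultimately obtain v where v: "v \<in> carrier_vec k" "v \<noteq> 0\<^sub>v k" "?B *\<^sub>v v = 0\<^sub>v k"
    using det_0_iff_vec_prod_zero_field[OF B] by auto
  have "B *\<^sub>v v = 0\<^sub>v j"
  proof (rule eq_vecI)
    fix i assume "i < dim_vec (0\<^sub>v j :: 'a vec)"
    then have i: "i < j" by simp
    have "(?B *\<^sub>v v) $ i = row B i \<bullet> v" using i assms v(1) by (auto simp: row_mat_of_row_fun)
    then have "row B i \<bullet> v = 0" using i assms(2) unfolding v(3) by simp
    then show "(B *\<^sub>v v) $ i = 0\<^sub>v j $ i" using i assms v by auto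
  qed (use assms in auto)
  then show ?thesis using v by blast
qed

lemma column_space_carrier: "B \<in> carrier_mat d k \<Longrightarrow> column_space k B \<subseteq> carrier_vec d"
  by (auto simp: column_space_def)

text \<open>A dimension count takes the place of orthogonal projection: for r < k the matrix
  \<open>mat_adjoint U * B\<close> has more columns than rows. The image under \<open>B\<close> of a
  kernel vector is orthogonal to the columns of \<open>U\<close>, and it is nonzero because
  \<open>B\<close> is injective.\<close>

lemma onb_step:
  assumes U: "(U :: 'a :: rc_field mat) \<in> carrier_mat d r"
    and B: "B \<in> carrier_mat d k" "\<And>v. v \<in> carrier_vec k \<Longrightarrow> B *\<^sub>v v = 0\<^sub>v d \<Longrightarrow> v = 0\<^sub>v k"
    and "r < k"
  shows "\<exists>x\<in>column_space k B. (\<Sum>i=0..<d. (norm (x $ i))\<^sup>2) = 1 \<and>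
    (\<forall>a<r. (\<Sum>i=0..<d. conjugate (U $$ (i, a)) * x $ i) = 0)"
proof -
  obtain v where v: "v \<in> carrier_vec k" "v \<noteq> 0\<^sub>v k" "(mat_adjoint U * B) *\<^sub>v v = 0\<^sub>v r"
    using wide_matrix_kernel[of "mat_adjoint U * B" r k] mult_carrier_mat[OF adj_carrier[OF U] B(1)] \<open>r < k\<close> by auto
  define y where "y = B *\<^sub>v v"
  have y: "y \<in> carrier_vec d" using B v by (auto simp: y_def)
  have y0: "y \<noteq> 0\<^sub>v d" using B v by (auto simp: y_def)
  have Uy: "mat_adjoint U *\<^sub>v y = 0\<^sub>v r"
    using v U B by (simp add: y_def assoc_mult_mat_vec[of _ r d _ k])
  define s where "s = (\<Sum>i=0..<d. (norm (y $ i))\<^sup>2)"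
  obtain i0 where "i0 < d" "y $ i0 \<noteq> 0" using y y0 by (metis carrier_vecD eq_vecI index_zero_vec(1) index_zero_vec(2))
  then have "0 < (norm (y $ i0))\<^sup>2" "(norm (y $ i0))\<^sup>2 \<le> s"
    unfolding s_def by (auto intro!: member_le_sum)
  then have s: "s > 0" by linarith
  define c :: 'a where "c = of_real (1 / sqrt s)"
  define x where "x = c \<cdot>\<^sub>v y"
  have xi: "x $ i = c * y $ i" if "i < d" for i using y that by (auto simp: x_def)
  have "(\<Sum>i=0..<d. (norm (x $ i))\<^sup>2) = (\<Sum>i=0..<d. (1 / s) * (norm (y $ i))\<^sup>2)"
    using s by (intro sum.cong) (auto simp: xi c_def norm_mult norm_divide power_mult_distrib power_divide)
  also have "\<dots> = 1" unfolding sum_distrib_left[symmetric] s_def[symmetric] using s by simp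
  finally have 1: "(\<Sum>i=0..<d. (norm (x $ i))\<^sup>2) = 1" .
  have 2: "(\<Sum>i=0..<d. conjugate (U $$ (i, a)) * x $ i) = 0" if a: "a < r" for a
  proof -
    have "(\<Sum>i=0..<d. conjugate (U $$ (i, a)) * x $ i) = c * (\<Sum>i=0..<d. conjugate (U $$ (i, a)) * y $ i)"
      by (auto simp: xi sum_distrib_left ac_simps intro!: sum.cong)
    also have "(\<Sum>i=0..<d. conjugate (U $$ (i, a)) * y $ i) = (mat_adjoint U *\<^sub>v y) $ a"
      using U y a by (subst index_mult_vec_sum[of _ r d]) auto
    finally show ?thesis using Uy a by simp
  qed
  have "x = B *\<^sub>v (c \<cdot>\<^sub>v v)" using B v by (simp add: x_def y_def mult_mat_vec[of _ d k])
  then have "x \<in> column_space k B" using v by (auto simp: column_space_def)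
  with 1 2 show ?thesis by blast
qed

text \<open>With r = 0 this finds an orthonormal basis inside a column space; with the identity for
  \<open>B\<close> it completes an orthonormal family to a unitary matrix.\<close>

lemma onb_extend:
  assumes U: "(U :: 'a :: rc_field mat) \<in> carrier_mat d r" "mat_adjoint U * U = 1\<^sub>m r"
    and B: "B \<in> carrier_mat d k" "\<And>v. v \<in> carrier_vec k \<Longrightarrow> B *\<^sub>v v = 0\<^sub>v d \<Longrightarrow> v = 0\<^sub>v k"
    and "r \<le> m" "m \<le> k"
  shows "\<exists>V\<in>carrier_mat d m. mat_adjoint V * V = 1\<^sub>m m \<and>
    (\<forall>i<d. \<forall>j<r. V $$ (i, j) = U $$ (i, j)) \<and> (\<forall>j. r \<le> j \<longrightarrow> j < m \<longrightarrow> col V j \<in> column_space k B)"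
  using assms(5,6)
proof (induction m rule: dec_induct)
  case base
  then show ?case using U by (intro bexI[of _ U]) auto
next
  case (step n)
  then obtain V where V: "V \<in> carrier_mat d n" "mat_adjoint V * V = 1\<^sub>m n"
    "\<And>i j. i < d \<Longrightarrow> j < r \<Longrightarrow> V $$ (i, j) = U $$ (i, j)"
    "\<And>j. r \<le> j \<Longrightarrow> j < n \<Longrightarrow> col V j \<in> column_space k B" by auto
  obtain x where x: "x \<in> column_space k B" "(\<Sum>i=0..<d. (norm (x $ i))\<^sup>2) = 1"
    "\<And>a. a < n \<Longrightarrow> (\<Sum>i=0..<d. conjugate (V $$ (i, a)) * x $ i) = 0"
    using onb_step[OF V(1) B] step(4) by auto
  have xd: "x \<in> carrier_vec d" using column_space_carrier[OF B(1)] x(1) by auto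
  define W where "W = mat d (Suc n) (\<lambda>(i, j). if j < n then V $$ (i, j) else x $ i)"
  have W: "W \<in> carrier_mat d (Suc n)" by (auto simp: W_def)
  have xx: "(\<Sum>i=0..<d. conjugate (x $ i) * x $ i) = 1"
    by (simp add: conjugate_mult_self del: of_real_power flip: of_real_sum) (simp add: x)
  have x': "(\<Sum>i=0..<d. conjugate (x $ i) * V $$ (i, a)) = 0" if "a < n" for a
  proof -
    have "conjugate (\<Sum>i=0..<d. conjugate (V $$ (i, a)) * x $ i) = 0" using x(3)[OF that] by simp
    then show ?thesis by (simp add: sum_conjugate conjugate_dist_mul mult.commute)
  qed
  have "mat_adjoint W * W = 1\<^sub>m (Suc n)"
    unfolding adj_mult_self_eq_one_iff[OF W]
  proof (intro allI impI)
    fix a b assume ab: "a < Suc n" "b < Suc n"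
    have Vab: "(\<Sum>i=0..<d. conjugate (V $$ (i, a)) * V $$ (i, b)) = (if a = b then 1 else 0)"
      if "a < n" "b < n" using adj_mult_self_eq_one_iff[OF V(1)] V(2) that by auto
    show "(\<Sum>i=0..<d. conjugate (W $$ (i, a)) * W $$ (i, b)) = (if a = b then 1 else 0)"
      using ab Vab x(3)[of a] x'[of b] xx
      by (cases "a < n"; cases "b < n") (auto simp: W_def less_Suc_eq)
  qed
  moreover have "col W j \<in> column_space k B" if "r \<le> j" "j < Suc n" for j
  proof -
    have "col W j = (if j < n then col V j else x)"
      using that V(1) xd by (auto simp: W_def intro!: eq_vecI)
    then show ?thesis using V(4) x(1) that by auto
  qed
  ultimately show ?case using W V(3) step(1) by (intro bexI[of _ W]) (auto simp: W_def)
qed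

definition lcols :: "nat \<Rightarrow> 'a mat \<Rightarrow> 'a mat" where
  "lcols k A = mat (dim_row A) k (\<lambda>(i, j). A $$ (i, j))"

lemma lcols_carrier [simp, intro]: "A \<in> carrier_mat d n \<Longrightarrow> lcols k A \<in> carrier_mat d k"
  by (auto simp: lcols_def)

lemma lcols_index [simp]: "i < dim_row A \<Longrightarrow> j < k \<Longrightarrow> lcols k A $$ (i, j) = A $$ (i, j)"
  by (auto simp: lcols_def)

lemma lcols_mult:
  assumes "A \<in> carrier_mat m n" "B \<in> carrier_mat n p" "k \<le> p"
  shows "lcols k (A * B) = A * lcols k B"
  using assms by (intro eq_matI) (auto simp: lcols_def scalar_prod_def)

lemma isometric_lcols:
  assumes "(U :: 'a :: rc_field mat) \<in> carrier_mat d n" "mat_adjoint U * U = 1\<^sub>m n" "k \<le> n"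
  shows "mat_adjoint (lcols k U) * lcols k U = 1\<^sub>m k"
  using adj_mult_self_eq_one_iff[OF assms(1)] assms
  by (subst adj_mult_self_eq_one_iff[of _ d]) auto

lemma unitary_lcols:
  assumes "unitary d (L :: 'a :: rc_field mat)" "k \<le> d"
  shows "mat_adjoint (lcols k L) * lcols k L = 1\<^sub>m k"
  using isometric_lcols unitaryD(1,2)[OF assms(1)] assms(2) by blast

lemma isometric_injective:
  assumes "(U :: 'a :: rc_field mat) \<in> carrier_mat d k" "mat_adjoint U * U = 1\<^sub>m k"
    "v \<in> carrier_vec k" "U *\<^sub>v v = 0\<^sub>v d"
  shows "v = 0\<^sub>v k"
proof -
  have "v = (mat_adjoint U * U) *\<^sub>v v" using assms by simp
  also have "\<dots> = mat_adjoint U *\<^sub>v (U *\<^sub>v v)" using assms by (intro assoc_mult_mat_vec) auto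
  also have "\<dots> = 0\<^sub>v k" using assms by auto
  finally show ?thesis .
qed

lemma isometric_completion:
  assumes U: "(U :: 'a :: rc_field mat) \<in> carrier_mat d k" "mat_adjoint U * U = 1\<^sub>m k"
  shows "k \<le> d" "\<exists>L. unitary d L \<and> lcols k L = U"
proof -
  show kd: "k \<le> d"
  proof (rule ccontr)
    assume "\<not> k \<le> d"
    then obtain v where "v \<in> carrier_vec k" "v \<noteq> 0\<^sub>v k" "U *\<^sub>v v = 0\<^sub>v d"
      using wide_matrix_kernel[OF U(1)] by auto
    then show False using isometric_injective[OF U] by auto
  qed
  obtain V where V: "V \<in> carrier_mat d d" "mat_adjoint V * V = 1\<^sub>m d"
    "\<forall>i<d. \<forall>j<k. V $$ (i, j) = U $$ (i, j)"
    using onb_extend[OF U, of "1\<^sub>m d" d d] kd by auto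
  have "lcols k V = U" using V U by (intro eq_matI) (auto simp: lcols_def)
  then show "\<exists>L. unitary d L \<and> lcols k L = U" using V by (auto simp: unitary_def)
qed

lemma column_space_mult:
  assumes "B \<in> carrier_mat d k" "T \<in> carrier_mat k k" "T' \<in> carrier_mat k k" "T * T' = 1\<^sub>m k"
  shows "column_space k (B * T) = column_space k (B :: 'a :: field mat)"
proof (intro equalityI subsetI)
  fix x assume "x \<in> column_space k (B * T)"
  then obtain v where v: "v \<in> carrier_vec k" "x = (B * T) *\<^sub>v v" by (auto simp: column_space_def)
  then have "x = B *\<^sub>v (T *\<^sub>v v)" using assms by (simp add: assoc_mult_mat_vec[of _ d k _ k])
  then show "x \<in> column_space k B" using v assms by (auto simp: column_space_def)
next
  fix x assume "x \<in> column_space k B"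
  then obtain v where v: "v \<in> carrier_vec k" "x = B *\<^sub>v v" by (auto simp: column_space_def)
  have "(B * T) *\<^sub>v (T' *\<^sub>v v) = B *\<^sub>v ((T * T') *\<^sub>v v)"
    using assms(1-3) v(1) by (simp add: assoc_mult_mat_vec[of _ d k _ k] assoc_mult_mat_vec[of _ k k _ k])
  then have "x = (B * T) *\<^sub>v (T' *\<^sub>v v)" using assms v by simp
  then show "x \<in> column_space k (B * T)"
    using v assms by (auto simp: column_space_def intro!: exI[of _ "T' *\<^sub>v v"])
qed

lemma factor_through_column_space:
  assumes "B \<in> carrier_mat d k" "U \<in> carrier_mat d r" "\<And>j. j < r \<Longrightarrow> col U j \<in> column_space k B"
  shows "\<exists>T\<in>carrier_mat k r. U = B * T"
proof -
  have "\<exists>v. \<forall>j<r. v j \<in> carrier_vec k \<and> col U j = B *\<^sub>v v j"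
    using assms(3) unfolding column_space_def by (intro choice) fastforce
  then obtain v where v: "\<And>j. j < r \<Longrightarrow> v j \<in> carrier_vec k \<and> col U j = B *\<^sub>v v j" by auto
  define T where "T = mat k r (\<lambda>(i, j). v j $ i)"
  have colT: "col T j = v j" if "j < r" for j using v[OF that] that by (auto simp: T_def)
  have "U = B * T"
  proof (rule mat_col_eqI)
    fix j assume "j < dim_col (B * T)"
    then have j: "j < r" by (simp add: T_def)
    have "col (B * T) j = B *\<^sub>v col T j" using j assms by (auto simp: T_def)
    then show "col U j = col (B * T) j" using v[OF j] colT[OF j] by simp
  qed (use assms in \<open>auto simp: T_def\<close>)
  then show ?thesis by (auto simp: T_def)
qed

lemma mult_eq_one_det: 
  assumes "A \<in> carrier_mat n n" "B \<in> carrier_mat n n" "A * B = (1\<^sub>m n :: 'a :: field mat)"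
  shows "det A * det B = 1"
  using det_mult[OF assms(1,2)] assms(3) by simp

lemma det_inverse:
  assumes A: "A \<in> carrier_mat n n" and "det A \<noteq> (0 :: 'a :: field)"
  shows "\<exists>B\<in>carrier_mat n n. A * B = 1\<^sub>m n \<and> B * A = 1\<^sub>m n \<and> det B \<noteq> 0"
proof -
  obtain B where "B \<in> carrier_mat n n" "A * B = 1\<^sub>m n" "B * A = 1\<^sub>m n"
    using det_non_zero_imp_unit[OF assms, of "()"] unfolding Units_def ring_mat_def by auto
  moreover from this have "det B \<noteq> 0" using mult_eq_one_det[OF A] by force
  ultimately show ?thesis by auto
qed

lemma onb_of_frame:
  assumes B: "(B :: 'a :: rc_field mat) \<in> carrier_mat d k"
    "\<And>v. v \<in> carrier_vec k \<Longrightarrow> B *\<^sub>v v = 0\<^sub>v d \<Longrightarrow> v = 0\<^sub>v k"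
  shows "\<exists>L. unitary d L \<and> column_space k (lcols k L) = column_space k B"
proof -
  have e: "mat d 0 (\<lambda>_. 0) \<in> carrier_mat d 0"
    "mat_adjoint (mat d 0 (\<lambda>_. 0) :: 'a mat) * mat d 0 (\<lambda>_. 0) = 1\<^sub>m 0" by (auto intro!: eq_matI)
  obtain V where V: "V \<in> carrier_mat d k" "mat_adjoint V * V = 1\<^sub>m k"
    "\<forall>j. j < k \<longrightarrow> col V j \<in> column_space k B"
    using onb_extend[OF e B, of k] by auto
  obtain T where T: "T \<in> carrier_mat k k" "V = B * T"
    using factor_through_column_space[OF B(1) V(1)] V(3) by auto
  \<comment> \<open>Since \<open>V = B * T\<close>, this product is
    \<open>mat_adjoint V * V\<close>. So \<open>T\<close> is invertible, and \<open>V\<close> spans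
    all of the column space of \<open>B\<close>.\<close>
  have "(mat_adjoint V * B) * T = 1\<^sub>m k"
    using V(1,2) T B(1) by (simp add: assoc_mult_mat[of _ k d _ k _ k])
  then have "T * (mat_adjoint V * B) = 1\<^sub>m k"
    by (rule mat_mult_left_right_inverse[rotated 2]) (use V(1) T(1) B(1) in auto)
  then have "column_space k V = column_space k B"
    unfolding T(2) by (intro column_space_mult[of _ d]) (use V(1) T(1) B(1) in auto)
  moreover obtain L where "unitary d L" "lcols k L = V" using isometric_completion[OF V(1,2)] by auto
  ultimately show ?thesis by auto
qed

subsection \<open>Grassmannians\<close>

abbreviation mat_image :: "'a :: semiring_0 mat \<Rightarrow> 'a vec set \<Rightarrow> 'a vec set" where
  "mat_image A W \<equiv> (\<lambda>w. A *\<^sub>v w) ` W"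

lemma smult_zero_vec_eq: "v \<in> carrier_vec n \<Longrightarrow> (0 :: 'a :: semiring_0) \<cdot>\<^sub>v v = 0\<^sub>v n"
  by (intro eq_vecI) auto

lemma subspace_module_vecD:
  assumes "subspace class_ring W (module_vec TYPE('a :: field) d)"
  shows "W \<subseteq> carrier_vec d" "0\<^sub>v d \<in> W" "\<And>v w. v \<in> W \<Longrightarrow> w \<in> W \<Longrightarrow> v + w \<in> W"
    "\<And>c v. v \<in> W \<Longrightarrow> c \<cdot>\<^sub>v v \<in> W"
proof -
  interpret submodule class_ring W "module_vec TYPE('a) d" using assms by (simp add: subspace_def)
  show "W \<subseteq> carrier_vec d" "0\<^sub>v d \<in> W" "\<And>v w. v \<in> W \<Longrightarrow> w \<in> W \<Longrightarrow> v + w \<in> W"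
    "\<And>c v. v \<in> W \<Longrightarrow> c \<cdot>\<^sub>v v \<in> W"
    using subset m_closed zero_closed smult_closed
    by (auto simp: module_vec_simps class_ring_simps)
qed

lemma subspace_module_vecI:
  assumes "W \<subseteq> carrier_vec d" "0\<^sub>v d \<in> W" "\<And>v w. v \<in> W \<Longrightarrow> w \<in> W \<Longrightarrow> v + w \<in> W"
    "\<And>c v. v \<in> W \<Longrightarrow> c \<cdot>\<^sub>v v \<in> W"
  shows "subspace class_ring W (module_vec TYPE('a :: field) d)"
  using assms vec_module[where 'a='a and n=d] vec_vs[where 'a='a and n=d]
  by (auto simp: subspace_def submodule_def module_vec_simps class_ring_simps)

lemma subspace_column_space:
  assumes B: "(B :: 'a :: field mat) \<in> carrier_mat d k"
  shows "subspace class_ring (column_space k B) (module_vec TYPE('a) d)"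
proof (rule subspace_module_vecI)
  show "column_space k B \<subseteq> carrier_vec d" by (rule column_space_carrier[OF B])
  show "0\<^sub>v d \<in> column_space k B"
    using B by (auto simp: column_space_def intro!: exI[of _ "0\<^sub>v k"])
  fix v w assume "v \<in> column_space k B" "w \<in> column_space k B"
  then obtain v' w' where "v' \<in> carrier_vec k" "v = B *\<^sub>v v'" "w' \<in> carrier_vec k" "w = B *\<^sub>v w'"
    by (auto simp: column_space_def)
  then show "v + w \<in> column_space k B"
    using B by (auto simp: column_space_def mult_add_distrib_mat_vec intro!: exI[of _ "v' + w'"])
next
  fix c v assume "v \<in> column_space k B"
  then obtain v' where "v' \<in> carrier_vec k" "v = B *\<^sub>v v'" by (auto simp: column_space_def)
  then show "c \<cdot>\<^sub>v v \<in> column_space k B"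
    using B by (auto simp: column_space_def mult_mat_vec intro!: exI[of _ "c \<cdot>\<^sub>v v'"])
qed

text \<open>\<open>B\<close> is a linear isomorphism from the space of k-vectors onto its column
  space, and isomorphisms preserve the dimension.\<close>

lemma Gr_column_space:
  assumes B: "(B :: 'a :: field mat) \<in> carrier_mat d k"
    "\<And>v. v \<in> carrier_vec k \<Longrightarrow> B *\<^sub>v v = 0\<^sub>v d \<Longrightarrow> v = 0\<^sub>v k"
  shows "column_space k B \<in> Gr d k"
proof -
  let ?V = "module_vec TYPE('a) k" and ?W = "(module_vec TYPE('a) d)\<lparr>carrier := column_space k B\<rparr>"
  interpret V: vec_space "TYPE('a)" k .
  interpret D: vec_space "TYPE('a)" d .
  have sub: "subspace class_ring (column_space k B) (module_vec TYPE('a) d)"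
    by (rule subspace_column_space[OF B(1)])
  interpret W: vectorspace "class_ring :: 'a ring" ?W
    by (rule vectorspace.subspace_is_vs[OF vec_vs sub])
  interpret L: linear_map "class_ring :: 'a ring" ?V ?W "\<lambda>v. B *\<^sub>v v"
    using vec_vs[where 'a='a and n=k] W.vectorspace_axioms B(1)
    by (auto simp: linear_map_def mod_hom_def mod_hom_axioms_def vectorspace_def module_hom_def
       module_vec_simps class_ring_simps column_space_def mult_add_distrib_mat_vec mult_mat_vec)
  have inj: "inj_on (\<lambda>v. B *\<^sub>v v) (carrier ?V)"
  proof (rule inj_onI)
    fix x y assume "x \<in> carrier ?V" "y \<in> carrier ?V" and e: "B *\<^sub>v x = B *\<^sub>v y"
    then have xy: "x \<in> carrier_vec k" "y \<in> carrier_vec k" by (auto simp: module_vec_simps)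
    have "B *\<^sub>v (x - y) = B *\<^sub>v x - B *\<^sub>v y" using B(1) xy by (intro mult_minus_distrib_mat_vec)
    also have "\<dots> = 0\<^sub>v d" using e B(1) xy by simp
    finally have "x - y = 0\<^sub>v k" using B(2) xy by simp
    then show "x = y" using xy
      by (metis (no_types, lifting) carrier_vecD eq_vecI index_minus_vec(1) index_zero_vec(1) right_minus_eq)
  qed
  have surj: "(\<lambda>v. B *\<^sub>v v) ` carrier ?V = carrier ?W"
    by (auto simp: column_space_def module_vec_simps)
  have "vectorspace.dim class_ring ?W = V.dim"
    by (rule L.dim_eq[OF _ inj surj, symmetric]) simp
  then show ?thesis using sub by (auto simp: Gr_def V.dim_is_n)
qed

lemma Gr_unique_dim: "W \<in> Gr d k \<Longrightarrow> W \<in> Gr d l \<Longrightarrow> k = l"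
  by (auto simp: Gr_def)

lemma subspace_closed_mult_vec:
  assumes "subspace class_ring W (module_vec TYPE('a :: field) d)"
    "U \<in> carrier_mat d r" "\<And>j. j < r \<Longrightarrow> col U j \<in> W" "v \<in> carrier_vec r"
  shows "U *\<^sub>v v \<in> W"
  using assms(2-4)
proof (induction r arbitrary: U v)
  case 0
  then have "U *\<^sub>v v = 0\<^sub>v d" by (intro eq_vecI) (auto simp: scalar_prod_def)
  then show ?case using subspace_module_vecD(2)[OF assms(1)] by simp
next
  case (Suc r)
  define v' where "v' = vec r (\<lambda>i. v $ i)"
  have "U *\<^sub>v v = lcols r U *\<^sub>v v' + v $ r \<cdot>\<^sub>v col U r"
    using Suc.prems(1,3) by (intro eq_vecI) (auto simp: scalar_prod_def lcols_def v'_def mult.commute)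
  moreover have "lcols r U *\<^sub>v v' \<in> W"
  proof (rule Suc.IH)
    fix j assume "j < r"
    then have "col (lcols r U) j = col U j" using Suc.prems(1) by (intro eq_vecI) (auto simp: lcols_def)
    then show "col (lcols r U) j \<in> W" using Suc.prems(2) \<open>j < r\<close> by simp
  qed (use Suc.prems in \<open>auto simp: v'_def\<close>)
  ultimately show ?case using subspace_module_vecD(3,4)[OF assms(1)] Suc.prems(2) by simp
qed

text \<open>A maximal orthonormal family in \<open>W\<close> spans \<open>W\<close>: with a vector
  \<open>w\<close> outside its span, the frame formed by the family and \<open>w\<close> would be
  injective, and \<open>onb_extend\<close> would find one more orthonormal vector in
  \<open>W\<close>. From here on the abstract dimension in \<open>Gr\<close> is replaced by unitary
  frames.\<close>

theorem Gr_unitary: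
  assumes "W \<in> Gr d k"
  shows "k \<le> d" "\<exists>L. unitary d (L :: 'a :: rc_field mat) \<and> W = column_space k (lcols k L)"
proof -
  have sub: "subspace class_ring W (module_vec TYPE('a) d)" using assms by (auto simp: Gr_def)
  define P where "P r \<longleftrightarrow> (\<exists>U\<in>carrier_mat d r. mat_adjoint U * U = (1\<^sub>m r :: 'a mat) \<and> (\<forall>j<r. col U j \<in> W))" for r
  have P0: "P 0" unfolding P_def by (intro bexI[of _ "mat d 0 (\<lambda>_. 0)"]) (auto intro!: eq_matI)
  have Pd: "P r \<Longrightarrow> r \<le> d" for r unfolding P_def using isometric_completion(1) by auto
  define r where "r = (GREATEST r. P r)"
  have Pr: "P r" unfolding r_def using GreatestI_nat[where P = P and k = 0 and b = d, OF P0] Pd by blast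
  have nP: "\<not> P (Suc r)" using Greatest_le_nat[of P "Suc r" d] Pd r_def by auto
  obtain U where U: "U \<in> carrier_mat d r" "mat_adjoint U * U = 1\<^sub>m r" "\<And>j. j < r \<Longrightarrow> col U j \<in> W"
    using Pr unfolding P_def by auto
  have "column_space r U = W"
  proof (intro equalityI subsetI)
    fix x assume "x \<in> column_space r U"
    then show "x \<in> W" using subspace_closed_mult_vec[OF sub U(1,3)] by (auto simp: column_space_def)
  next
    fix w assume w: "w \<in> W"
    show "w \<in> column_space r U"
    proof (rule ccontr)
      assume nw: "w \<notin> column_space r U"
      have wd: "w \<in> carrier_vec d" using subspace_module_vecD(1)[OF sub] w by auto
      define B where "B = mat d (Suc r) (\<lambda>(i, j). if j < r then U $$ (i, j) else w $ i)"
      have B: "B \<in> carrier_mat d (Suc r)" by (auto simp: B_def)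
      have Bv: "B *\<^sub>v v = U *\<^sub>v vec r (\<lambda>i. v $ i) + v $ r \<cdot>\<^sub>v w" if "v \<in> carrier_vec (Suc r)" for v
        using that U(1) wd by (intro eq_vecI) (auto simp: scalar_prod_def B_def mult.commute)
      have inj: "v = 0\<^sub>v (Suc r)" if v: "v \<in> carrier_vec (Suc r)" "B *\<^sub>v v = 0\<^sub>v d" for v
      proof -
        let ?v = "vec r (\<lambda>i. v $ i)"
        have s: "U *\<^sub>v ?v + v $ r \<cdot>\<^sub>v w = 0\<^sub>v d" using Bv[OF v(1)] v(2) by simp
        \<comment> \<open>Otherwise the relation could be solved for \<open>w\<close>, which would
          then lie in the column space of \<open>U\<close>.\<close>
        have "v $ r = 0"
        proof (rule ccontr)
          assume c: "v $ r \<noteq> 0"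
          have "w = U *\<^sub>v ((- 1 / v $ r) \<cdot>\<^sub>v ?v)"
          proof (rule eq_vecI)
            fix i assume "i < dim_vec (U *\<^sub>v ((- 1 / v $ r) \<cdot>\<^sub>v ?v))"
            then have i: "i < d" using U(1) by simp
            have "(U *\<^sub>v ?v + v $ r \<cdot>\<^sub>v w) $ i = 0" unfolding s using i by simp
            then have "(U *\<^sub>v ?v) $ i + v $ r * w $ i = 0" using i U(1) wd by simp
            then have "w $ i = (- 1 / v $ r) * (U *\<^sub>v ?v) $ i" using c
              by (simp add: field_simps eq_neg_iff_add_eq_0)
            then show "w $ i = (U *\<^sub>v ((- 1 / v $ r) \<cdot>\<^sub>v ?v)) $ i"
              using mult_mat_vec[OF U(1), of ?v] i U(1) by simp
          qed (use U(1) wd in auto)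
          then show False using nw unfolding column_space_def by auto
        qed
        moreover from this have "U *\<^sub>v ?v = 0\<^sub>v d"
          using s smult_zero_vec_eq[OF wd] mult_mat_vec_carrier[OF U(1), of ?v] by simp
        then have "?v = 0\<^sub>v r" using isometric_injective[OF U(1,2)] by auto
        then have "v $ i = 0" if "i < r" for i using that by (metis index_vec index_zero_vec(1))
        ultimately show ?thesis using v(1) by (intro eq_vecI) (auto simp: less_Suc_eq)
      qed
      obtain V where V: "V \<in> carrier_mat d (Suc r)" "mat_adjoint V * V = 1\<^sub>m (Suc r)"
        "\<forall>i<d. \<forall>j<r. V $$ (i, j) = U $$ (i, j)" "col V r \<in> column_space (Suc r) B"
        using onb_extend[OF U(1,2) B inj, of "Suc r"] by auto
      have "col V j \<in> W" if "j < Suc r" for j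
      proof (cases "j < r")
        case True
        then have "col V j = col U j" using V(1,3) U(1) by (intro eq_vecI) auto
        then show ?thesis using U(3) True by simp
      next
        case False
        then have j: "j = r" using that by simp
        obtain v where v: "v \<in> carrier_vec (Suc r)" "col V r = B *\<^sub>v v" using V(4) by (auto simp: column_space_def)
        have "U *\<^sub>v vec r (\<lambda>i. v $ i) \<in> W" using subspace_closed_mult_vec[OF sub U(1,3)] by auto
        then show ?thesis unfolding j v(2) Bv[OF v(1)] using subspace_module_vecD(3,4)[OF sub] w by auto
      qed
      then have "P (Suc r)" unfolding P_def using V(1,2) by blast
      then show False using nP by simp
    qed
  qed
  moreover have "column_space r U \<in> Gr d r"
    by (rule Gr_column_space[OF U(1)]) (use isometric_injective[OF U(1,2)] in auto)
  ultimately have "r = k" using Gr_unique_dim assms by blast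
  moreover obtain L where "unitary d L" "lcols r L = U" using isometric_completion[OF U(1,2)] by auto
  ultimately show "k \<le> d" "\<exists>L. unitary d L \<and> W = column_space k (lcols k L)"
    using \<open>column_space r U = W\<close> Pd[OF Pr] by auto
qed

lemma unitary_Gr:
  assumes "unitary d (L :: 'a :: rc_field mat)" "k \<le> d"
  shows "column_space k (lcols k L) \<in> Gr d k"
  using isometric_injective[OF lcols_carrier[OF unitaryD(1)[OF assms(1)]] unitary_lcols[OF assms]]
    lcols_carrier[OF unitaryD(1)[OF assms(1)]]
  by (intro Gr_column_space) auto

subsection \<open>Spectral theorem and singular value decomposition\<close>

lemma mat_diag_carrier_index:
  "mat_diag n f \<in> carrier_mat n n" "i < n \<Longrightarrow> j < n \<Longrightarrow> mat_diag n f $$ (i, j) = (if i = j then f j else 0)"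
  by (auto simp: mat_diag_def)

abbreviation rdiag :: "nat \<Rightarrow> (nat \<Rightarrow> real) \<Rightarrow> 'a :: rc_field mat" where
  "rdiag n s \<equiv> mat_diag n (\<lambda>i. of_real (s i))"

text \<open>The image of \<open>H\<close> under \<open>emb\<close> has a complex eigenvalue.
  Evaluating the form at an eigenvector in two ways shows that it is real, so it comes from a scalar
  of the original field, where the characteristic determinant vanishes as well because
  \<open>emb\<close> is injective.\<close>

lemma hermitian_eigenvector:
  assumes H: "(H :: 'a :: rc_field mat) \<in> carrier_mat n n" "mat_adjoint H = H" and "n > 0"
  shows "\<exists>r v. v \<in> carrier_vec n \<and> v \<noteq> 0\<^sub>v n \<and> H *\<^sub>v v = of_real r \<cdot>\<^sub>v v"
proof -
  let ?E = "map_mat emb H"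
  have E: "?E \<in> carrier_mat n n" using H by auto
  obtain l where "l \<in> spectrum ?E" using spectrum_non_empty[OF E \<open>n > 0\<close>] by auto
  then have ev: "eigenvalue ?E l" by (auto simp: spectrum_def)
  then obtain z where z: "z \<in> carrier_vec n" "z \<noteq> 0\<^sub>v n" "?E *\<^sub>v z = l \<cdot>\<^sub>v z"
    using H by (auto simp: eigenvalue_def eigenvector_def)
  have sym: "emb (H $$ (i, j)) = cnj (emb (H $$ (j, i)))" if "i < n" "j < n" for i j
  proof -
    have "H $$ (i, j) = mat_adjoint H $$ (i, j)" using H(2) by simp
    also have "\<dots> = conjugate (H $$ (j, i))" using that H(1) by auto
    finally show ?thesis by (simp add: emb_conjugate)
  qed
  define s where "s = (\<Sum>i=0..<n. cnj (z $ i) * z $ i)"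
  have Ez: "(\<Sum>j=0..<n. emb (H $$ (i, j)) * z $ j) = l * z $ i" if "i < n" for i
  proof -
    have "(?E *\<^sub>v z) $ i = (\<Sum>j=0..<n. emb (H $$ (i, j)) * z $ j)"
      using that H(1) z(1) by (subst index_mult_vec_sum[of _ n n]) auto
    then show ?thesis unfolding z(3) using that z(1) by simp
  qed
  define q where "q = (\<Sum>i=0..<n. \<Sum>j=0..<n. cnj (z $ i) * emb (H $$ (i, j)) * z $ j)"
  have "q = (\<Sum>i=0..<n. cnj (z $ i) * (\<Sum>j=0..<n. emb (H $$ (i, j)) * z $ j))"
    unfolding q_def sum_distrib_left by (simp only: mult.assoc)
  also have "\<dots> = (\<Sum>i=0..<n. l * (cnj (z $ i) * z $ i))" by (intro sum.cong refl) (simp add: Ez)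
  also have "\<dots> = l * s" by (simp only: s_def sum_distrib_left)
  finally have q: "q = l * s" .
  have "cnj q = (\<Sum>i=0..<n. \<Sum>j=0..<n. cnj (z $ j) * emb (H $$ (j, i)) * z $ i)"
    unfolding q_def cnj_sum
  proof (intro sum.cong refl)
    fix i j assume "i \<in> {0..<n}" "j \<in> {0..<n}"
    then have "cnj (emb (H $$ (i, j))) = emb (H $$ (j, i))" using sym[of j i] by simp
    then show "cnj (cnj (z $ i) * emb (H $$ (i, j)) * z $ j) = cnj (z $ j) * emb (H $$ (j, i)) * z $ i"
      by simp
  qed
  also have "\<dots> = q" unfolding q_def by (rule sum.swap)
  finally have qr: "cnj q = q" .
  have s: "s = of_real (\<Sum>i=0..<n. (cmod (z $ i))\<^sup>2)"
    unfolding of_real_sum complex_norm_square s_def by (simp add: mult.commute)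
  obtain i0 where "i0 < n" "z $ i0 \<noteq> 0" using z(1,2) by (metis carrier_vecD eq_vecI index_zero_vec)
  then have "0 < (cmod (z $ i0))\<^sup>2" "(cmod (z $ i0))\<^sup>2 \<le> (\<Sum>i=0..<n. (cmod (z $ i))\<^sup>2)"
    by (auto intro!: member_le_sum)
  then have s0: "s \<noteq> 0" unfolding s by (metis of_real_eq_0_iff linorder_not_less)
  have "cnj l = l"
  proof -
    have "cnj s = s" by (simp add: s)
    then show ?thesis using qr s0 unfolding q by simp
  qed
  then have l: "l = of_real (Re l)" by (simp add: complex_eq_iff)
  let ?r = "of_real (Re l) :: 'a"
  have "map_mat emb (char_matrix H ?r) = char_matrix ?E l"
    by (rule eq_matI) (use H(1) in \<open>auto simp: char_matrix_def emb_add emb_diff emb_mult emb_uminus emb_of_real l[symmetric] emb_one\<close>)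
  moreover have "det (map_mat emb (char_matrix H ?r)) = emb (det (char_matrix H ?r))"
    by (rule comm_ring_hom.hom_det[OF comm_ring_hom_emb])
  ultimately have "eigenvalue H ?r"
    using ev unfolding eigenvalue_det[OF E] eigenvalue_det[OF H(1)] by simp
  then show ?thesis using H(1) unfolding eigenvalue_def eigenvector_def by auto
qed

lemma adj_sandwich_index:
  assumes "(L :: 'a :: rc_field mat) \<in> carrier_mat n n" "H \<in> carrier_mat n n" "i < n" "j < n"
  shows "(mat_adjoint L * H * L) $$ (i, j) =
    (\<Sum>a=0..<n. \<Sum>b=0..<n. conjugate (L $$ (a, i)) * H $$ (a, b) * L $$ (b, j))"
proof -
  have "(mat_adjoint L * H * L) $$ (i, j) = (\<Sum>b=0..<n. (mat_adjoint L * H) $$ (i, b) * L $$ (b, j))"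
    using assms by (intro index_mult_sum) auto
  also have "\<dots> = (\<Sum>b=0..<n. (\<Sum>a=0..<n. conjugate (L $$ (a, i)) * H $$ (a, b)) * L $$ (b, j))"
    using assms by (intro sum.cong refl, subst index_mult_sum[of _ n n _ n]) auto
  also have "\<dots> = (\<Sum>b=0..<n. \<Sum>a=0..<n. conjugate (L $$ (a, i)) * H $$ (a, b) * L $$ (b, j))"
    by (simp add: sum_distrib_right)
  also have "\<dots> = (\<Sum>a=0..<n. \<Sum>b=0..<n. conjugate (L $$ (a, i)) * H $$ (a, b) * L $$ (b, j))"
    by (rule sum.swap)
  finally show ?thesis .
qed

lemma adj_hermitian_sandwich:
  assumes "(L :: 'a :: rc_field mat) \<in> carrier_mat n m" "H \<in> carrier_mat n n" "mat_adjoint H = H"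
  shows "mat_adjoint (mat_adjoint L * H * L) = mat_adjoint L * H * L"
proof -
  have "mat_adjoint (mat_adjoint L * (H * L)) = mat_adjoint (H * L) * L"
    using adj_mult[of "mat_adjoint L" m n "H * L" m] assms(1,2) by simp
  also have "\<dots> = mat_adjoint L * H * L" using adj_mult[OF assms(2,1)] assms(3) by simp
  finally show ?thesis using assoc_mult_mat[of "mat_adjoint L" m n H n L m] assms(1,2) by simp
qed

text \<open>Deflation: a unit eigenvector becomes the first column of a unitary matrix
  \<open>L\<close>. In that basis the first column is diagonal, hence by symmetry also the first
  row, and the induction applies to the remaining block.\<close>

theorem hermitian_diagonalization:
  assumes "(H :: 'a :: rc_field mat) \<in> carrier_mat n n" "mat_adjoint H = H"
  shows "\<exists>L s. unitary n L \<and> mat_adjoint L * H * L = rdiag n s"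
  using assms
proof (induction n arbitrary: H)
  case 0
  then show ?case by (intro exI[of _ "1\<^sub>m 0"] exI[of _ "\<lambda>_. 0"]) (auto simp: unitary_one mat_diag_def intro!: eq_matI)
next
  case (Suc n)
  note H = Suc.prems
  obtain r v where v: "v \<in> carrier_vec (Suc n)" "v \<noteq> 0\<^sub>v (Suc n)" "H *\<^sub>v v = of_real r \<cdot>\<^sub>v v"
    using hermitian_eigenvector[OF H] by auto
  define B where "B = mat (Suc n) 1 (\<lambda>(i, j). v $ i)"
  have B: "B \<in> carrier_mat (Suc n) 1" by (auto simp: B_def)
  have Bw: "B *\<^sub>v w = w $ 0 \<cdot>\<^sub>v v" if "w \<in> carrier_vec 1" for w
    using that v(1) by (intro eq_vecI) (auto simp: B_def scalar_prod_def mult.commute)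
  have inj: "w = 0\<^sub>v 1" if w: "w \<in> carrier_vec 1" "B *\<^sub>v w = 0\<^sub>v (Suc n)" for w
  proof -
    obtain i0 where i0: "i0 < Suc n" "v $ i0 \<noteq> 0" using v(1,2) by (metis carrier_vecD eq_vecI index_zero_vec)
    have "(w $ 0 \<cdot>\<^sub>v v) $ i0 = 0" using w(2) i0 unfolding Bw[OF w(1)] by simp
    then have "w $ 0 = 0" using i0 v(1) by simp
    then show ?thesis using w(1) by (intro eq_vecI) auto
  qed
  obtain L where L: "unitary (Suc n) L" "column_space 1 (lcols 1 L) = column_space 1 B"
    using onb_of_frame[OF B inj] by auto
  have Lc: "L \<in> carrier_mat (Suc n) (Suc n)" using unitaryD(1)[OF L(1)] .
  have "lcols 1 L *\<^sub>v unit_vec 1 0 \<in> column_space 1 B"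
    using L(2) unit_vec_carrier[of 1 0] unfolding column_space_def by blast
  moreover have "lcols 1 L *\<^sub>v unit_vec 1 0 = col L 0"
    using Lc by (intro eq_vecI) (auto simp: lcols_def scalar_prod_def)
  ultimately obtain c where c: "col L 0 = c \<cdot>\<^sub>v v" by (auto simp: column_space_def Bw)
  have HL: "H *\<^sub>v col L 0 = of_real r \<cdot>\<^sub>v col L 0"
    unfolding c using mult_mat_vec[OF H(1) v(1)] v by (simp add: smult_smult_assoc mult.commute)
  define K where "K = mat_adjoint L * H * L"
  have K: "K \<in> carrier_mat (Suc n) (Suc n)" "mat_adjoint K = K"
    using Lc H adj_hermitian_sandwich[OF Lc H] by (auto simp: K_def)
  have K0: "K $$ (i, 0) = (if i = 0 then of_real r else 0)" if i: "i < Suc n" for i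
  proof -
    have "K = mat_adjoint L * (H * L)" unfolding K_def using Lc H by (intro assoc_mult_mat) auto
    then have "K $$ (i, 0) = (\<Sum>a=0..<Suc n. conjugate (L $$ (a, i)) * (H * L) $$ (a, 0))"
      using Lc H i by (simp only:) (subst index_mult_sum[of _ "Suc n" "Suc n" _ "Suc n"], auto)
    also have "\<dots> = (\<Sum>a=0..<Suc n. of_real r * (conjugate (L $$ (a, i)) * L $$ (a, 0)))"
    proof (rule sum.cong[OF refl])
      fix a assume "a \<in> {0..<Suc n}"
      then have a: "a < Suc n" by simp
      have "(H * L) $$ (a, 0) = (H *\<^sub>v col L 0) $ a" using Lc H(1) a by simp
      also have "\<dots> = of_real r * L $$ (a, 0)" unfolding HL using a Lc by simp
      finally show "conjugate (L $$ (a, i)) * (H * L) $$ (a, 0) = of_real r * (conjugate (L $$ (a, i)) * L $$ (a, 0))"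
        by simp
    qed
    also have "\<dots> = of_real r * (\<Sum>a=0..<Suc n. conjugate (L $$ (a, i)) * L $$ (a, 0))"
      by (simp only: sum_distrib_left)
    also have "(\<Sum>a=0..<Suc n. conjugate (L $$ (a, i)) * L $$ (a, 0)) = (if i = 0 then 1 else 0)"
      using adj_mult_self_eq_one_iff[OF Lc] unitaryD(2)[OF L(1)] i by blast
    finally show ?thesis by simp
  qed
  have Ks: "K $$ (i, j) = conjugate (K $$ (j, i))" if "i < Suc n" "j < Suc n" for i j
  proof -
    have "mat_adjoint K $$ (i, j) = conjugate (K $$ (j, i))" using that K(1) by auto
    then show ?thesis using K(2) by simp
  qed
  have K0': "K $$ (0, i) = (if i = 0 then of_real r else 0)" if "i < Suc n" for i
    using Ks[of 0 i] K0[OF that] that by simp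
  define K' where "K' = mat n n (\<lambda>(i, j). K $$ (Suc i, Suc j))"
  have K': "K' \<in> carrier_mat n n" by (auto simp: K'_def)
  have "mat_adjoint K' = K'"
  proof (rule eq_matI)
    fix i j assume "i < dim_row K'" "j < dim_col K'"
    then show "mat_adjoint K' $$ (i, j) = K' $$ (i, j)"
      using Ks[of "Suc j" "Suc i"] by (simp add: K'_def)
  qed (auto simp: K'_def)
  then obtain M t where M: "unitary n M" "mat_adjoint M * K' * M = rdiag n t"
    using Suc.IH[OF K'] by auto
  note Mc = unitaryD(1)[OF M(1)]
  \<comment> \<open>The block diagonal matrix with blocks 1 and \<open>M\<close>.\<close>
  define N where "N = mat (Suc n) (Suc n) (\<lambda>(i, j). if i = 0 \<or> j = 0 then (if i = j then 1 else 0) else M $$ (i - 1, j - 1))"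
  have N: "N \<in> carrier_mat (Suc n) (Suc n)" by (auto simp: N_def)
  have N0: "N $$ (0, j) = (if j = 0 then 1 else 0)" "N $$ (j, 0) = (if j = 0 then 1 else 0)" if "j < Suc n" for j
    using that by (auto simp: N_def)
  have NS: "N $$ (Suc i, Suc j) = M $$ (i, j)" if "i < n" "j < n" for i j using that by (auto simp: N_def)
  have split: "sum f {0..<Suc n} = f 0 + (\<Sum>i=0..<n. f (Suc i))" for f :: "nat \<Rightarrow> 'a"
    by (rule sum.atLeast0_lessThan_Suc_shift[unfolded o_def])
  have uN: "unitary (Suc n) N"
    unfolding unitary_def adj_mult_self_eq_one_iff[OF N]
  proof (intro conjI N allI impI)
    fix a b assume ab: "a < Suc n" "b < Suc n"
    have "(\<Sum>i=0..<n. conjugate (M $$ (i, a)) * M $$ (i, b)) = (if a = b then 1 else 0)"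
      if "a < n" "b < n" for a b
      using adj_mult_self_eq_one_iff[OF Mc] unitaryD(2)[OF M(1)] that by blast
    then show "(\<Sum>i=0..<Suc n. conjugate (N $$ (i, a)) * N $$ (i, b)) = (if a = b then 1 else 0)"
      using ab unfolding split by (cases a; cases b) (auto simp: N0 NS)
  qed
  define s where "s i = (case i of 0 \<Rightarrow> r | Suc i \<Rightarrow> t i)" for i
  have "mat_adjoint N * K * N = rdiag (Suc n) s"
  proof (rule eq_matI)
    fix i j assume "i < dim_row (rdiag (Suc n) s :: 'a mat)"
      "j < dim_col (rdiag (Suc n) s :: 'a mat)"
    then have ij: "i < Suc n" "j < Suc n" by (auto simp: mat_diag_def)
    have KS: "K $$ (Suc a, Suc b) = K' $$ (a, b)" if "a < n" "b < n" for a b using that by (auto simp: K'_def)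
    have MM: "(\<Sum>a=0..<n. \<Sum>b=0..<n. conjugate (M $$ (a, i)) * K' $$ (a, b) * M $$ (b, j)) = (if i = j then of_real (t j) else 0)"
      if "i < n" "j < n" for i j
      using adj_sandwich_index[OF Mc K' that] M(2) that by (simp add: mat_diag_carrier_index)
    have "(mat_adjoint N * K * N) $$ (i, j) =
      (\<Sum>a=0..<Suc n. \<Sum>b=0..<Suc n. conjugate (N $$ (a, i)) * K $$ (a, b) * N $$ (b, j))"
      by (rule adj_sandwich_index[OF N K(1) ij])
    also have "\<dots> = (if i = j then of_real (s j) else 0)"
      using ij MM unfolding split by (cases i; cases j) (auto simp: N0 NS K0 K0' KS s_def)
    finally show "(mat_adjoint N * K * N) $$ (i, j) = rdiag (Suc n) s $$ (i, j)"
      using ij by (simp add: mat_diag_carrier_index)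
  qed (use N in \<open>auto simp: mat_diag_def\<close>)
  moreover have "mat_adjoint (L * N) * H * (L * N) = mat_adjoint N * K * N"
    unfolding K_def using Lc N H(1)
    by (simp add: adj_mult[of _ "Suc n" "Suc n" _ "Suc n"] assoc_mult_mat[of _ "Suc n" "Suc n" _ "Suc n" _ "Suc n"] mult_carrier_mat[of _ "Suc n" "Suc n"])
  ultimately show ?case using unitary_mult[OF L(1) uN] by (intro exI[of _ "L * N"] exI[of _ s]) simp
qed

lemma exists_decreasing_permutation:
  fixes s :: "nat \<Rightarrow> real"
  shows "\<exists>p. p permutes {0..<n} \<and> (\<forall>i j. i \<le> j \<longrightarrow> j < n \<longrightarrow> s (p j) \<le> s (p i))"
proof -
  let ?xs = "map s [0..<n]" and ?ys = "rev (sort (map s [0..<n]))"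
  have "mset ?ys = mset ?xs" by simp
  then obtain p where p: "p permutes {..<length ?xs}" "permute_list p ?xs = ?ys"
    using mset_eq_permutation[of ?ys ?xs] by auto
  have "s (p j) \<le> s (p i)" if "i \<le> j" "j < n" for i j
  proof -
    have pn: "p l < n" if "l < n" for l using permutes_in_image[OF p(1), of l] that by simp
    have "?ys ! l = s (p l)" if "l < n" for l
      using that pn[OF that] by (subst p(2)[symmetric]) (simp add: permute_list_nth[OF p(1)])
    moreover have "?ys ! j \<le> ?ys ! i"
      using sorted_rev_nth_mono[of ?ys i j] that by simp
    ultimately show ?thesis using that by simp
  qed
  then show ?thesis using p(1) by (intro exI[of _ p]) (auto simp: lessThan_atLeast0)
qed

text \<open>Let \<open>M\<close> diagonalize the product of \<open>A\<close> with its adjoint, with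
  decreasing entries \<open>t\<close>. Then the columns of \<open>A * M\<close> are orthogonal with
  squared lengths \<open>t\<close>, which are positive because \<open>A\<close> is invertible;
  divided by their lengths they form \<open>L\<close>.\<close>

theorem svd:
  assumes A: "(A :: 'a :: rc_field mat) \<in> carrier_mat n n" "det A \<noteq> 0"
  shows "\<exists>L M s. unitary n L \<and> unitary n M \<and> A = L * rdiag n s * M \<and>
    (\<forall>i<n. 0 < s i) \<and> (\<forall>i j. i \<le> j \<longrightarrow> j < n \<longrightarrow> s j \<le> s i)"
proof -
  define H where "H = mat_adjoint A * A"
  have H: "H \<in> carrier_mat n n" "mat_adjoint H = H"
    using A(1) adj_mult[of "mat_adjoint A" n n A n] by (auto simp: H_def)
  obtain M0 t0 where M0: "unitary n M0" "mat_adjoint M0 * H * M0 = rdiag n t0"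
    using hermitian_diagonalization[OF H] by auto
  note M0c = unitaryD(1)[OF M0(1)]
  obtain p where p: "p permutes {0..<n}" "\<And>i j. i \<le> j \<Longrightarrow> j < n \<Longrightarrow> t0 (p j) \<le> t0 (p i)"
    using exists_decreasing_permutation[of n t0] by blast
  have pn: "p i < n" if "i < n" for i using permutes_in_image[OF p(1), of i] that by simp
  have pinj: "p i = p j \<longleftrightarrow> i = j" for i j using permutes_inj[OF p(1)] by (auto dest: injD)
  define M where "M = mat n n (\<lambda>(i, j). M0 $$ (i, p j))"
  have Mc: "M \<in> carrier_mat n n" by (auto simp: M_def)
  define t where "t i = t0 (p i)" for i
  have uM: "unitary n M"
    unfolding unitary_def adj_mult_self_eq_one_iff[OF Mc]
    using adj_mult_self_eq_one_iff[OF M0c] unitaryD(2)[OF M0(1)] pn pinj Mc by (auto simp: M_def)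
  have MHM: "mat_adjoint M * H * M = rdiag n t"
  proof (rule eq_matI)
    fix i j assume "i < dim_row (rdiag n t :: 'a mat)"
      "j < dim_col (rdiag n t :: 'a mat)"
    then have ij: "i < n" "j < n" by (auto simp: mat_diag_def)
    have "(mat_adjoint M * H * M) $$ (i, j) = (mat_adjoint M0 * H * M0) $$ (p i, p j)"
      unfolding adj_sandwich_index[OF Mc H(1) ij] adj_sandwich_index[OF M0c H(1) pn[OF ij(1)] pn[OF ij(2)]]
      using ij by (auto simp: M_def intro!: sum.cong)
    also have "\<dots> = rdiag n t $$ (i, j)"
      unfolding M0(2) using ij pn by (simp add: mat_diag_carrier_index pinj t_def)
    finally show "(mat_adjoint M * H * M) $$ (i, j) = rdiag n t $$ (i, j)" .
  qed (use Mc in \<open>auto simp: mat_diag_def\<close>)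
  define X where "X = A * M"
  have X: "X \<in> carrier_mat n n" using A Mc by (auto simp: X_def)
  have XX: "mat_adjoint X * X = rdiag n t"
    unfolding MHM[symmetric] H_def X_def using A(1) Mc
    by (simp add: adj_mult[of _ n n _ n] assoc_mult_mat[of _ n n _ n _ n] mult_carrier_mat[of _ n n])
  have XXi: "(\<Sum>a=0..<n. conjugate (X $$ (a, i)) * X $$ (a, j)) = (if i = j then of_real (t i) else 0)"
    if "i < n" "j < n" for i j
  proof -
    have "(mat_adjoint X * X) $$ (i, j) = (\<Sum>a=0..<n. conjugate (X $$ (a, i)) * X $$ (a, j))"
      using that X by (subst index_mult_sum[of _ n n _ n]) auto
    then show ?thesis unfolding XX using that by (auto simp: mat_diag_carrier_index)
  qed
  have tpos: "0 < t i" if i: "i < n" for i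
  proof -
    have "(of_real (t i) :: 'a) = of_real (\<Sum>a=0..<n. (norm (X $$ (a, i)))\<^sup>2)"
      using XXi[OF i i] by (simp add: conjugate_mult_self)
    then have t: "t i = (\<Sum>a=0..<n. (norm (X $$ (a, i)))\<^sup>2)" by (simp only: of_real_eq_iff)
    have "det X \<noteq> 0" using A(2) unitary_det[OF uM] det_mult[OF A(1) Mc] by (auto simp: X_def)
    have "\<exists>a<n. X $$ (a, i) \<noteq> 0"
    proof (rule ccontr)
      assume "\<not> (\<exists>a<n. X $$ (a, i) \<noteq> 0)"
      then have "X *\<^sub>v unit_vec n i = 0\<^sub>v n" using X i by (intro eq_vecI) auto
      moreover have "unit_vec n i \<noteq> (0\<^sub>v n :: 'a vec)" using i by (metis index_unit_vec(1) index_zero_vec(1) zero_neq_one)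
      ultimately have "det X = 0" using det_0_iff_vec_prod_zero_field[OF X] unit_vec_carrier[of n i] by blast
      then show False using \<open>det X \<noteq> 0\<close> by simp
    qed
    then obtain a where "a < n" "X $$ (a, i) \<noteq> 0" by auto
    then have "0 < (norm (X $$ (a, i)))\<^sup>2" "(norm (X $$ (a, i)))\<^sup>2 \<le> t i"
      unfolding t by (auto intro!: member_le_sum)
    then show ?thesis by linarith
  qed
  define s where "s i = sqrt (t i)" for i
  have spos: "0 < s i" if "i < n" for i using tpos[OF that] by (simp add: s_def)
  define L where "L = X * mat_diag n (\<lambda>i. of_real (1 / s i))"
  have Lc: "L \<in> carrier_mat n n" using X by (auto simp: L_def)
  have Li: "L $$ (a, i) = X $$ (a, i) * of_real (1 / s i)" if "a < n" "i < n" for a i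
    using that X by (simp add: L_def mat_diag_mult_right)
  have uL: "unitary n L"
    unfolding unitary_def adj_mult_self_eq_one_iff[OF Lc]
  proof (intro conjI Lc allI impI)
    fix a b assume ab: "a < n" "b < n"
    have "(\<Sum>i=0..<n. conjugate (L $$ (i, a)) * L $$ (i, b)) =
      of_real (1 / s a) * of_real (1 / s b) * (\<Sum>i=0..<n. conjugate (X $$ (i, a)) * X $$ (i, b))"
      unfolding sum_distrib_left using ab
      by (intro sum.cong refl) (simp add: Li conjugate_dist_mul del: of_real_divide)
    also have "\<dots> = (if a = b then of_real (1 / s a * (1 / s a) * t a) else 0)"
      using ab by (simp add: XXi)
    also have "\<dots> = (if a = b then 1 else 0)"
      using tpos[OF ab(1)] by (auto simp: s_def real_div_sqrt field_simps)
    finally show "(\<Sum>i=0..<n. conjugate (L $$ (i, a)) * L $$ (i, b)) = (if a = b then 1 else 0)" .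
  qed
  have "L * rdiag n s = X * (mat_diag n (\<lambda>i. of_real (1 / s i)) * rdiag n s)"
    unfolding L_def using X by (intro assoc_mult_mat[of _ n n _ n _ n]) auto
  also have "mat_diag n (\<lambda>i. of_real (1 / s i)) * rdiag n s = (1\<^sub>m n :: 'a mat)"
    unfolding mat_diag_diag
  proof (rule eq_matI)
    fix i j assume "i < dim_row (1\<^sub>m n :: 'a mat)" "j < dim_col (1\<^sub>m n :: 'a mat)"
    then show "mat_diag n (\<lambda>i. of_real (1 / s i) * of_real (s i)) $$ (i, j) = (1\<^sub>m n :: 'a mat) $$ (i, j)"
      using spos[of j] by (simp add: mat_diag_carrier_index)
  qed (auto simp: mat_diag_def)
  finally have "L * rdiag n s = X" using X by simp
  then have "L * rdiag n s * mat_adjoint M = A * (M * mat_adjoint M)"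
    unfolding X_def using A(1) Mc by (simp add: assoc_mult_mat[of _ n n _ n _ n])
  also have "\<dots> = A" using unitaryD(3)[OF uM] A(1) by simp
  finally have "A = L * rdiag n s * mat_adjoint M" by simp
  moreover have "s j \<le> s i" if "i \<le> j" "j < n" for i j using p(2)[OF that] by (simp add: s_def t_def)
  ultimately show ?thesis using uL unitary_adj[OF uM] spos by blast
qed

subsection \<open>Singular values\<close>

text \<open>Root multiplicities recover the multiset of linear factors; this gives the uniqueness of
  the list described in \<open>singular_values\<close>.\<close>

lemma order_prod_linear:
  "order (a :: 'a :: field) (\<Prod>x\<leftarrow>xs. [:- x, 1:]) = count (mset xs) a"
proof (induction xs)
  case (Cons x xs)
  have nz: "(\<Prod>x\<leftarrow>xs. [:- x, 1:]) \<noteq> (0 :: 'a poly)" by (auto simp: prod_list_zero_iff)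
  have "order a ([:- x, 1:] * (\<Prod>x\<leftarrow>xs. [:- x, 1:])) = order a [:- x, 1:] + order a (\<Prod>x\<leftarrow>xs. [:- x, 1:])"
    by (rule order_mult) (use nz pCons_eq_0_iff[of "- x" "[:1:]"] in \<open>simp only: mult_eq_0_iff one_pCons[symmetric] one_neq_zero simp_thms\<close>)
  moreover have "order a [:- x, 1:] = (if a = x then 1 else 0)"
    by (auto simp: order_0I)
  ultimately show ?case using Cons.IH by simp
qed (simp add: order_0I)

lemma prod_linear_eq_imp_mset_eq:
  "(\<Prod>x\<leftarrow>xs. [:- x, 1:]) = (\<Prod>x\<leftarrow>ys. [:- (x :: 'a :: field), 1:]) \<Longrightarrow> mset xs = mset ys"
  by (rule multiset_eqI) (metis order_prod_linear)

lemma sorted_wrt_ge_unique: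
  assumes "sorted_wrt (\<ge>) s" "sorted_wrt (\<ge>) (s' :: real list)" "mset s = mset s'"
  shows "s = s'"
proof -
  have "sorted (rev s)" "sorted (rev s')" using assms by (auto simp: sorted_wrt_rev)
  then have "rev s = rev s'" using assms(3) by (metis mset_rev properties_for_sort)
  then show ?thesis by simp
qed

text \<open>The characteristic polynomial is invariant under conjugation by \<open>M\<close>, which
  leaves the diagonal matrix of squares. The entries \<open>t\<close> may come in any order, as they
  do for \<open>Phi\<close>, whose diagonal is indexed by pairs of subsets.\<close>

lemma singular_values_svd:
  assumes L: "unitary n (L :: 'a :: rc_field mat)" and M: "unitary n M" and t: "\<And>i. i < n \<Longrightarrow> 0 \<le> t i"
  shows "singular_values (L * rdiag n t * M) = rev (sort (map t [0..<n]))"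
proof -
  let ?D = "rdiag n t :: 'a mat"
  let ?A = "L * ?D * M" and ?E = "mat_diag n (\<lambda>i. of_real ((t i)\<^sup>2)) :: 'a mat"
  let ?s = "rev (sort (map t [0..<n]))"
  note Lc = unitaryD[OF L] and Mc = unitaryD[OF M]
  have Dc: "?D \<in> carrier_mat n n" "?E \<in> carrier_mat n n" by auto
  have aD: "mat_adjoint ?D = ?D" by (rule eq_matI) (auto simp: mat_diag_def)
  have "mat_adjoint ?A * ?A = mat_adjoint M * (?D * ((mat_adjoint L * L) * (?D * M)))"
    using Lc(1) Mc(1) Dc
    by (simp add: adj_mult[of _ n n _ n] aD assoc_mult_mat[of _ n n _ n _ n] mult_carrier_mat[of _ n n] del: mat_diag_diag)
  also have "\<dots> = mat_adjoint M * ((?D * ?D) * M)"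
    unfolding Lc(2) using Mc(1) Dc by (simp add: assoc_mult_mat[of _ n n _ n _ n] mult_carrier_mat[of _ n n]
      left_mult_one_mat[of _ n n] del: mat_diag_diag)
  also have "?D * ?D = ?E" by (simp add: power2_eq_square)
  finally have AA: "mat_adjoint ?A * ?A = mat_adjoint M * (?E * M)" .
  have "similar_mat (mat_adjoint ?A * ?A) ?E"
    unfolding similar_mat_def similar_mat_wit_def Let_def
    by (intro exI[of _ "mat_adjoint M"] exI[of _ M])
      (use Lc(1) Mc Dc AA in \<open>auto simp: assoc_mult_mat[of _ n n _ n _ n]\<close>)
  then have "char_poly (mat_adjoint ?A * ?A) = char_poly ?E" by (rule char_poly_similar)
  also have "\<dots> = (\<Prod>a\<leftarrow>diag_mat ?E. [:- a, 1:])"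
    by (rule char_poly_upper_triangular[OF Dc(2)]) (auto simp: mat_diag_def)
  also have "diag_mat ?E = map (\<lambda>x. of_real (x\<^sup>2)) (map t [0..<n])"
    by (auto simp: diag_mat_def mat_diag_def)
  finally have cp: "char_poly (mat_adjoint ?A * ?A) = (\<Prod>a\<leftarrow>map (\<lambda>x. of_real (x\<^sup>2)) (map t [0..<n]). [:- a, 1:])" .
  show ?thesis
    unfolding singular_values_def
  proof (rule the_equality)
    have "mset (map (\<lambda>x. [:- of_real (x\<^sup>2), 1:] :: 'a poly) ?s) = mset (map (\<lambda>x. [:- of_real (x\<^sup>2), 1:]) (map t [0..<n]))"
      by (simp only: mset_map mset_rev mset_sort)
    then have "(\<Prod>x\<leftarrow>?s. [:- of_real (x\<^sup>2), 1:] :: 'a poly) = (\<Prod>x\<leftarrow>map t [0..<n]. [:- of_real (x\<^sup>2), 1:])"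
      by (metis prod_mset_prod_list)
    moreover have "sorted_wrt (\<ge>) ?s" by (simp add: sorted_wrt_rev)
    ultimately show "sorted_wrt (\<ge>) ?s \<and> (\<forall>x\<in>set ?s. 0 \<le> x) \<and>
      char_poly (mat_adjoint ?A * ?A) = (\<Prod>x\<leftarrow>?s. [:- of_real (x\<^sup>2), 1:])"
      using t cp by (auto simp: o_def)
  next
    fix s assume s: "sorted_wrt (\<ge>) s \<and> (\<forall>x\<in>set s. 0 \<le> x) \<and>
      char_poly (mat_adjoint ?A * ?A) = (\<Prod>x\<leftarrow>s. [:- of_real (x\<^sup>2), 1:])"
    then have "(\<Prod>a\<leftarrow>map (\<lambda>x. of_real (x\<^sup>2)) s. [:- (a :: 'a), 1:]) = (\<Prod>a\<leftarrow>map (\<lambda>x. of_real (x\<^sup>2)) (map t [0..<n]). [:- a, 1:])"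
      using cp by (simp add: o_def)
    then have m: "mset (map (\<lambda>x. of_real (x\<^sup>2) :: 'a) s) = mset (map (\<lambda>x. of_real (x\<^sup>2)) (map t [0..<n]))"
      by (rule prod_linear_eq_imp_mset_eq)
    \<comment> \<open>This inverts squaring on nonnegative entries, so equal multisets of squares
      come from equal multisets of entries.\<close>
    let ?g = "\<lambda>y :: 'a. sqrt (norm y)"
    have g: "mset l = image_mset ?g (mset (map (\<lambda>x. of_real (x\<^sup>2) :: 'a) l))" if "\<forall>x\<in>set l. 0 \<le> x" for l
      using that by (induct l) (auto simp: norm_power)
    have "\<forall>x\<in>set (map t [0..<n]). 0 \<le> x" using t by auto
    then have "mset s = mset (map t [0..<n])" using g[of s] g[of "map t [0..<n]"] m s by simp
    then show "s = ?s" using s by (intro sorted_wrt_ge_unique) (auto simp: sorted_wrt_rev)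
  qed
qed

subsection \<open>Enumerating \<open>k\<close>-subsets\<close>

definition ksets :: "nat \<Rightarrow> nat \<Rightarrow> nat set set" where
  "ksets d k = {I. I \<subseteq> {0..<d} \<and> card I = k}"

definition nks :: "nat \<Rightarrow> nat \<Rightarrow> nat" where
  "nks d k = card (ksets d k)"

text \<open>Index 0 is reserved for the first k indices. Then the leading minor has index 0, and so
  has the largest product of k singular values.\<close>

definition kset :: "nat \<Rightarrow> nat \<Rightarrow> nat \<Rightarrow> nat set" where
  "kset d k = (SOME f. bij_betw f {0..<nks d k} (ksets d k) \<and> f 0 = {0..<k})"

definition kel :: "nat \<Rightarrow> nat \<Rightarrow> nat \<Rightarrow> nat \<Rightarrow> nat" where
  "kel d k i a = sorted_list_of_set (kset d k i) ! a"

lemma finite_ksets [simp]: "finite (ksets d k)"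
  by (rule finite_subset[of _ "Pow {0..<d}"]) (auto simp: ksets_def)

lemma kset_bij:
  assumes "k \<le> d"
  shows "bij_betw (kset d k) {0..<nks d k} (ksets d k)" "kset d k 0 = {0..<k}" "0 < nks d k"
proof -
  obtain g where g: "bij_betw g {0..<nks d k} (ksets d k)"
    using ex_bij_betw_nat_finite[OF finite_ksets] unfolding nks_def by blast
  have m: "{0..<k} \<in> ksets d k" using assms by (auto simp: ksets_def)
  then obtain i0 where i0: "i0 \<in> {0..<nks d k}" "g i0 = {0..<k}" using g by (metis bij_betw_iff_bijections)
  then have z: "0 \<in> {0..<nks d k}" by auto
  have "bij_betw (g \<circ> Transposition.transpose 0 i0) {0..<nks d k} (ksets d k)"
    using permutes_swap_id[OF z i0(1)] g permutes_imp_bij bij_betw_trans by blast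
  moreover have "(g \<circ> Transposition.transpose 0 i0) 0 = {0..<k}" using i0 by simp
  ultimately have "\<exists>f. bij_betw f {0..<nks d k} (ksets d k) \<and> f 0 = {0..<k}" by blast
  from someI_ex[OF this] show "bij_betw (kset d k) {0..<nks d k} (ksets d k)" "kset d k 0 = {0..<k}"
    unfolding kset_def by blast+
  show "0 < nks d k" using z by simp
qed

lemma kset_in:
  assumes "k \<le> d" "i < nks d k"
  shows "kset d k i \<subseteq> {0..<d} \<and> card (kset d k i) = k \<and> finite (kset d k i)"
proof -
  have "kset d k i \<in> ksets d k" using bij_betwE[OF kset_bij(1)[OF assms(1)]] assms(2) by simp
  then show ?thesis using finite_subset[of "kset d k i" "{0..<d}"] by (simp add: ksets_def)
qed

lemma kset_inj: "k \<le> d \<Longrightarrow> i < nks d k \<Longrightarrow> j < nks d k \<Longrightarrow> kset d k i = kset d k j \<longleftrightarrow> i = j"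
  using bij_betw_imp_inj_on[OF kset_bij(1)] by (auto simp: inj_on_def)

lemma kset_surj:
  assumes "k \<le> d" "I \<subseteq> {0..<d}" "card I = k"
  shows "\<exists>i<nks d k. kset d k i = I"
proof -
  have "I \<in> kset d k ` {0..<nks d k}"
    using bij_betw_imp_surj_on[OF kset_bij(1)[OF assms(1)]] assms(2,3) by (simp add: ksets_def)
  then show ?thesis by auto
qed

lemma kel_image:
  assumes "k \<le> d" "i < nks d k"
  shows "kel d k i ` {0..<k} = kset d k i" "inj_on (kel d k i) {0..<k}"
    "\<And>a. a < k \<Longrightarrow> kel d k i a < d" "\<And>a b. a < b \<Longrightarrow> b < k \<Longrightarrow> kel d k i a < kel d k i b"
proof -
  let ?l = "sorted_list_of_set (kset d k i)"
  note K = kset_in[OF assms]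
  have len: "length ?l = k" using K by (simp add: sorted_list_of_set.length_sorted_key_list_of_set)
  have l: "set ?l = kset d k i" "sorted_wrt (<) ?l" using K by auto
  show 1: "kel d k i ` {0..<k} = kset d k i"
  proof -
    have "(\<lambda>a. ?l ! a) ` {0..<k} = set ?l" using len nth_image[of k ?l] by (simp add: atLeast0LessThan)
    then show ?thesis using l(1) by (simp add: kel_def cong: image_cong)
  qed
  show s: "kel d k i a < kel d k i b" if "a < b" "b < k" for a b
    using sorted_wrt_nth_less[OF l(2) that(1)] that len by (simp add: kel_def)
  show "inj_on (kel d k i) {0..<k}"
    by (rule inj_onI) (metis s atLeastLessThan_iff less_irrefl linorder_neqE_nat)
  show "kel d k i a < d" if "a < k" for a using 1 K that by force
qed

lemma kel_0: "k \<le> d \<Longrightarrow> a < k \<Longrightarrow> kel d k 0 a = a"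
  by (simp add: kel_def kset_bij)

lemma kel_ge: 
  assumes "k \<le> d" "i < nks d k" "a < k"
  shows "a \<le> kel d k i a"
  using assms(3)
proof (induction a)
  case (Suc a)
  then have "kel d k i a < kel d k i (Suc a)" using kel_image(4)[OF assms(1,2), of a "Suc a"] by simp
  then show ?case using Suc by simp
qed simp

text \<open>A k-subset different from the first k indices has to leave them, and it does so with its
  largest element. This is the origin of the quotient of two consecutive singular values at
  k.\<close>

lemma kel_last_ge:
  assumes "k \<le> d" "i < nks d k" "i \<noteq> 0" "0 < k"
  shows "k \<le> kel d k i (k - 1)"
proof (rule ccontr)
  assume "\<not> ?thesis"
  then have l: "kel d k i (k - 1) < k" by simp
  have "kel d k i a < k" if "a < k" for a
  proof (cases "a < k - 1")
    case True
    then show ?thesis using kel_image(4)[OF assms(1,2), of a "k - 1"] that l by simp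
  next
    case False
    then have "a = k - 1" using that by simp
    then show ?thesis using l by simp
  qed
  then have "kset d k i \<subseteq> {0..<k}" unfolding kel_image(1)[OF assms(1,2), symmetric] by auto
  then have "kset d k i = {0..<k}" using kset_in[OF assms(1,2)] by (intro card_subset_eq) auto
  then have "kset d k i = kset d k 0" using kset_bij(2)[OF assms(1)] by simp
  then show False using kset_inj[OF assms(1,2)] kset_bij(3)[OF assms(1)] assms(3) by simp
qed

subsection \<open>The Cauchy--Binet formula\<close>

text \<open>Expanding the rows of the product multilinearly gives a sum over all maps f from row
  indices to {0..<d}. Maps that are not injective contribute equal rows and vanish; the others are
  grouped by their image.\<close>

theorem cauchy_binet:
  fixes F G :: "nat \<Rightarrow> nat \<Rightarrow> 'a :: comm_ring_1"
  assumes "k \<le> d"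
  shows "det (mat k k (\<lambda>(a, b). \<Sum>l=0..<d. F a l * G l b)) =
    (\<Sum>i=0..<nks d k. det (mat k k (\<lambda>(a, b). F a (kel d k i b))) * det (mat k k (\<lambda>(a, b). G (kel d k i a) b)))"
proof -
  let ?U = "{0..<k}" and ?S = "{0..<d}" and ?P = "{p. p permutes {0..<k}}"
  let ?F = "{f. (\<forall>i\<in>?U. f i \<in> ?S) \<and> (\<forall>i. i \<notin> ?U \<longrightarrow> f i = i)}"
  define A where "A = mat k d (\<lambda>(a, l). F a l)"
  define B where "B = mat d k (\<lambda>(l, b). G l b)"
  have A: "A \<in> carrier_mat k d" and B: "B \<in> carrier_mat d k" by (auto simp: A_def B_def)
  have AB: "mat k k (\<lambda>(a, b). \<Sum>l=0..<d. F a l * G l b) = A * B"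
    by (rule eq_matI) (auto simp: A_def B_def scalar_prod_def)
  define r where "r f = (\<Prod>a\<in>?U. F a (f a)) * det (mat k k (\<lambda>(a, b). G (f a) b))" for f
  have "det (A * B) = (\<Sum>f\<in>?F. det (mat\<^sub>r k k (\<lambda>i. A $$ (i, f i) \<cdot>\<^sub>v row B (f i))))"
    unfolding mat_mul_finsum_alt[OF A B] by (rule det_linear_rows_sum) (use A B in auto)
  also have "\<dots> = (\<Sum>f\<in>?F. r f)"
  proof (rule sum.cong[OF refl])
    fix f assume f: "f \<in> ?F"
    have "det (mat\<^sub>r k k (\<lambda>i. A $$ (i, f i) \<cdot>\<^sub>v row B (f i))) =
      prod (\<lambda>i. A $$ (i, f i)) {0..<k} * det (mat\<^sub>r k k (\<lambda>i. row B (f i)))"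
      by (rule det_rows_mul) (use f B in auto)
    also have "mat\<^sub>r k k (\<lambda>i. row B (f i)) = mat k k (\<lambda>(a, b). G (f a) b)"
      by (rule eq_matI) (use f in \<open>auto simp: B_def\<close>)
    also have "prod (\<lambda>i. A $$ (i, f i)) {0..<k} = (\<Prod>a\<in>?U. F a (f a))"
      by (rule prod.cong) (use f in \<open>auto simp: A_def\<close>)
    finally show "det (mat\<^sub>r k k (\<lambda>i. A $$ (i, f i) \<cdot>\<^sub>v row B (f i))) = r f" by (simp add: r_def)
  qed
  also have "\<dots> = (\<Sum>f\<in>{f \<in> ?F. inj_on f ?U}. r f)"
  proof (rule sum.mono_neutral_right)
    show "finite ?F" by (rule finite_bounded_functions) auto
    show "\<forall>f\<in>?F - {f \<in> ?F. inj_on f ?U}. r f = 0"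
    proof
      fix f assume "f \<in> ?F - {f \<in> ?F. inj_on f ?U}"
      then obtain a b where ab: "a < k" "b < k" "a \<noteq> b" "f a = f b" by (auto simp: inj_on_def)
      have "det (mat k k (\<lambda>(a, b). G (f a) b)) = 0"
        by (rule det_identical_rows[of _ k a b]) (use ab in auto)
      then show "r f = 0" by (simp add: r_def)
    qed
  qed auto
  also have "\<dots> = (\<Sum>(i, p)\<in>{0..<nks d k} \<times> ?P. r (\<lambda>a. if a < k then kel d k i (p a) else a))"
  proof -
    let ?h = "\<lambda>(i, p). \<lambda>a. if a < k then kel d k i (p a) else a"
    \<comment> \<open>An injective map is determined by its image, the i-th subset, and by the order
      in which it runs through that image, the permutation p.\<close>
    have "bij_betw ?h ({0..<nks d k} \<times> ?P) {f \<in> ?F. inj_on f ?U}"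
      unfolding bij_betw_def
    proof (intro conjI)
      have img: "?h (i, p) ` ?U = kset d k i" if "i < nks d k" "p permutes ?U" for i p
      proof -
        have "?h (i, p) ` ?U = kel d k i ` (p ` ?U)" by auto
        then show ?thesis using permutes_image[OF that(2)] kel_image(1)[OF assms that(1)] by simp
      qed
      show "inj_on ?h ({0..<nks d k} \<times> ?P)"
      proof (rule inj_onI)
        fix x y assume x: "x \<in> {0..<nks d k} \<times> ?P" and y: "y \<in> {0..<nks d k} \<times> ?P" and e: "?h x = ?h y"
        obtain i p j q where xy: "x = (i, p)" "y = (j, q)" by (cases x, cases y)
        have i: "i < nks d k" "p permutes ?U" and j: "j < nks d k" "q permutes ?U" using x y xy by auto
        have "?h (i, p) ` ?U = ?h (j, q) ` ?U" using e unfolding xy by (rule arg_cong[where f = "\<lambda>f. f ` ?U"])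
        then have "kset d k i = kset d k j" unfolding img[OF i] img[OF j] .
        then have ij: "i = j" using kset_inj[OF assms i(1) j(1)] by simp
        have "p a = q a" for a
        proof (cases "a < k")
          case True
          have "kel d k i (p a) = kel d k i (q a)" using fun_cong[OF e, of a] True xy ij by simp
          moreover have "p a \<in> ?U" "q a \<in> ?U" using permutes_in_image i j True by fastforce+
          ultimately show ?thesis using kel_image(2)[OF assms i(1)] by (auto dest: inj_onD)
        next
          case False
          then show ?thesis using i(2) j(2) by (auto simp: permutes_def)
        qed
        then show "x = y" using xy ij by auto
      qed
      show "?h ` ({0..<nks d k} \<times> ?P) = {f \<in> ?F. inj_on f ?U}"
      proof (intro equalityI subsetI)
        fix f assume "f \<in> ?h ` ({0..<nks d k} \<times> ?P)"
        then obtain i p where ip: "i < nks d k" "p permutes ?U" "f = ?h (i, p)" by auto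
        have pk: "p a < k" if "a < k" for a using permutes_in_image[OF ip(2), of a] that by simp
        have "inj_on f ?U"
        proof (rule inj_onI)
          fix a b assume ab: "a \<in> ?U" "b \<in> ?U" "f a = f b"
          then have "kel d k i (p a) = kel d k i (p b)" using ip(3) by simp
          then have "p a = p b" using kel_image(2)[OF assms ip(1)] pk ab by (auto dest: inj_onD)
          then show "a = b" using permutes_inj[OF ip(2)] by (auto dest: injD)
        qed
        moreover have "f \<in> ?F" using ip(3) kel_image(3)[OF assms ip(1)] pk by auto
        ultimately show "f \<in> {f \<in> ?F. inj_on f ?U}" by simp
      next
        fix f assume f: "f \<in> {f \<in> ?F. inj_on f ?U}"
        then have "f ` ?U \<subseteq> {0..<d}" "card (f ` ?U) = k" by (auto simp: card_image)
        then obtain i where i: "i < nks d k" "kset d k i = f ` ?U" using kset_surj[OF assms] by blast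
        define p where "p a = (if a < k then inv_into ?U (kel d k i) (f a) else a)" for a
        have fk: "f a \<in> kel d k i ` ?U" if "a < k" for a using kel_image(1)[OF assms i(1)] i(2) that by auto
        have kp: "kel d k i (p a) = f a" "p a < k" if "a < k" for a
          using f_inv_into_f[OF fk[OF that]] inv_into_into[OF fk[OF that]] that by (auto simp: p_def)
        have "inj_on p ?U"
        proof (rule inj_onI)
          fix a b assume ab: "a \<in> ?U" "b \<in> ?U" "p a = p b"
          then have "f a = f b" using kp(1)[of a] kp(1)[of b] by simp
          then show "a = b" using f ab by (auto dest: inj_onD)
        qed
        then have "p permutes ?U"
          using kp(2) by (intro inj_on_nat_permutes) (auto simp: p_def)
        moreover have "f = ?h (i, p)" using kp(1) f by (auto simp: fun_eq_iff)
        ultimately show "f \<in> ?h ` ({0..<nks d k} \<times> ?P)" using i(1) by (auto intro!: image_eqI[of _ _ "(i, p)"])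
      qed
    qed
    then show ?thesis by (subst sum.reindex_bij_betw[symmetric, of ?h]) (auto intro!: sum.cong)
  qed
  also have "\<dots> = (\<Sum>i=0..<nks d k. \<Sum>p\<in>?P. r (\<lambda>a. if a < k then kel d k i (p a) else a))"
    by (rule sum.cartesian_product[symmetric])
  also have "\<dots> = (\<Sum>i=0..<nks d k. det (mat k k (\<lambda>(a, b). F a (kel d k i b))) * det (mat k k (\<lambda>(a, b). G (kel d k i a) b)))"
  proof (rule sum.cong[OF refl])
    fix i assume "i \<in> {0..<nks d k}"
    let ?A = "mat k k (\<lambda>(a, b). F a (kel d k i b))" and ?B = "mat k k (\<lambda>(a, b). G (kel d k i a) b)"
    have Ac: "?A \<in> carrier_mat k k" and Bc: "?B \<in> carrier_mat k k" by auto
    have "(\<Sum>p\<in>?P. r (\<lambda>a. if a < k then kel d k i (p a) else a)) =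
      (\<Sum>p\<in>?P. (signof p * (\<Prod>a\<in>?U. ?A $$ (a, p a))) * det ?B)"
    proof (rule sum.cong[OF refl])
      fix p assume "p \<in> ?P"
      then have p: "p permutes ?U" by simp
      have pk: "p a < k" if "a < k" for a using permutes_in_image[OF p, of a] that by simp
      have "mat k k (\<lambda>(a, b). G (if a < k then kel d k i (p a) else a) b) = mat k k (\<lambda>(a, b). ?B $$ (p a, b))"
        by (rule eq_matI) (use pk in auto)
      \<comment> \<open>The rows of the minor of \<open>G\<close> appear permuted by p. The sign
        from sorting them turns the products of entries of \<open>F\<close> into the Leibniz sum of
        the other minor.\<close>
      then have "det (mat k k (\<lambda>(a, b). G (if a < k then kel d k i (p a) else a) b)) = signof p * det ?B"
        using det_permute_rows[OF Bc p] by simp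
      moreover have "(\<Prod>a\<in>?U. F a (if a < k then kel d k i (p a) else a)) = (\<Prod>a\<in>?U. ?A $$ (a, p a))"
        by (rule prod.cong) (use pk in auto)
      ultimately show "r (\<lambda>a. if a < k then kel d k i (p a) else a) = (signof p * (\<Prod>a\<in>?U. ?A $$ (a, p a))) * det ?B"
        by (simp add: r_def mult_ac)
    qed
    also have "\<dots> = det ?A * det ?B" unfolding det_def'[OF Ac] by (rule sum_distrib_right[symmetric])
    finally show "(\<Sum>p\<in>?P. r (\<lambda>a. if a < k then kel d k i (p a) else a)) = det ?A * det ?B" .
  qed
  finally show ?thesis unfolding AB .
qed

subsection \<open>Compound matrices\<close>

text \<open>The minors of a square matrix and the maximal minors of a frame, i.e. the entries of the compound
  matrix and the Pluecker coordinates; both are taken in \<open>\<complex>\<close> to treat the two fields at once.\<close>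

definition cme :: "nat \<Rightarrow> nat \<Rightarrow> ('a :: rc_field) mat \<Rightarrow> nat \<Rightarrow> nat \<Rightarrow> complex" where
  "cme d k A i j = emb (det (mat k k (\<lambda>(a, b). A $$ (kel d k i a, kel d k j b))))"

definition cve :: "nat \<Rightarrow> nat \<Rightarrow> ('a :: rc_field) mat \<Rightarrow> nat \<Rightarrow> complex" where
  "cve d k B i = emb (det (mat k k (\<lambda>(a, b). B $$ (kel d k i a, b))))"

lemma cve_mult:
  assumes "k \<le> d" "A \<in> carrier_mat d d" "B \<in> carrier_mat d k" "i < nks d k"
  shows "cve d k (A * B) i = (\<Sum>j=0..<nks d k. cme d k A i j * cve d k B j)"
proof -
  have "mat k k (\<lambda>(a, b). (A * B) $$ (kel d k i a, b)) =
    mat k k (\<lambda>(a, b). \<Sum>l=0..<d. A $$ (kel d k i a, l) * B $$ (l, b))"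
    using assms kel_image(3)[OF assms(1,4)] by (intro eq_matI) (auto simp: index_mult_sum simp del: index_mult_mat(1))
  then show ?thesis unfolding cve_def cme_def emb_mult[symmetric] emb_sum[symmetric]
    by (simp only: cauchy_binet[OF assms(1), of "\<lambda>a l. A $$ (kel d k i a, l)" "\<lambda>l b. B $$ (l, b)"])
qed

lemma cme_mult:
  assumes "k \<le> d" "A \<in> carrier_mat d d" "B \<in> carrier_mat d d" "i < nks d k" "j < nks d k"
  shows "cme d k (A * B) i j = (\<Sum>l=0..<nks d k. cme d k A i l * cme d k B l j)"
proof -
  have "mat k k (\<lambda>(a, b). (A * B) $$ (kel d k i a, kel d k j b)) =
    mat k k (\<lambda>(a, b). \<Sum>l=0..<d. A $$ (kel d k i a, l) * B $$ (l, kel d k j b))"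
    using assms kel_image(3)[OF assms(1,4)] kel_image(3)[OF assms(1,5)]
    by (intro eq_matI) (auto simp: index_mult_sum simp del: index_mult_mat(1))
  then show ?thesis unfolding cme_def emb_mult[symmetric] emb_sum[symmetric]
    by (simp only: cauchy_binet[OF assms(1), of "\<lambda>a l. A $$ (kel d k i a, l)" "\<lambda>l b. B $$ (l, kel d k j b)"])
qed

lemma cme_adj:
  assumes "k \<le> d" "A \<in> carrier_mat d d" "i < nks d k" "j < nks d k"
  shows "cme d k (mat_adjoint A) i j = cnj (cme d k A j i)"
proof -
  let ?A = "mat k k (\<lambda>(a, b). A $$ (kel d k j a, kel d k i b))"
  have "mat k k (\<lambda>(a, b). mat_adjoint A $$ (kel d k i a, kel d k j b)) = mat_adjoint ?A"
    using assms(2) kel_image(3)[OF assms(1,3)] kel_image(3)[OF assms(1,4)] by (intro eq_matI) auto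
  then show ?thesis using det_adj[of ?A k] by (simp add: cme_def emb_conjugate)
qed

lemma cme_diag:
  assumes "k \<le> d" "i < nks d k" "j < nks d k"
  shows "cme d k (mat_diag d f) i j = (if i = j then (\<Prod>a=0..<k. emb (f (kel d k i a))) else 0)"
proof (cases "i = j")
  case True
  let ?M = "mat k k (\<lambda>(a, b). mat_diag d f $$ (kel d k i a, kel d k i b))"
  have "?M = mat_diag k (\<lambda>a. f (kel d k i a))"
    using kel_image(2,3)[OF assms(1,2)]
    by (intro eq_matI) (auto simp: mat_diag_def dest: inj_onD)
  moreover have "det (mat_diag k (\<lambda>a. f (kel d k i a))) = prod_list (diag_mat (mat_diag k (\<lambda>a. f (kel d k i a))))"
    by (rule det_upper_triangular) (auto simp: mat_diag_def)
  moreover have "\<dots> = (\<Prod>a=0..<k. f (kel d k i a))"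
    by (subst prod_list_diag_prod) (auto simp: mat_diag_def)
  ultimately show ?thesis using True by (simp add: cme_def emb_prod)
next
  case False
  \<comment> \<open>Two different subsets of equal size are not nested; an element of the first that
    is missing in the second gives a zero row of the minor.\<close>
  then have "kset d k i \<noteq> kset d k j" using kset_inj[OF assms] by simp
  moreover have "card (kset d k i) = card (kset d k j)" "finite (kset d k j)" using kset_in assms by auto
  ultimately have "\<not> kset d k i \<subseteq> kset d k j" by (metis card_subset_eq)
  then obtain x where "x \<in> kel d k i ` {0..<k}" "x \<notin> kset d k j"
    unfolding kel_image(1)[OF assms(1,2)] by blast
  then obtain a where a: "a < k" "kel d k i a \<notin> kset d k j" by auto
  let ?M = "mat k k (\<lambda>(a, b). mat_diag d f $$ (kel d k i a, kel d k j b))"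
  have "?M = mat\<^sub>r k k (\<lambda>r. if r = a then 0\<^sub>v k else row ?M r)"
    using a kel_image(1)[OF assms(1,3)] kel_image(3)[OF assms(1,2)] kel_image(3)[OF assms(1,3)]
    by (intro eq_matI) (auto simp: mat_diag_def)
  moreover have "det (mat\<^sub>r k k (\<lambda>r. if r = a then 0\<^sub>v k else row ?M r)) = 0"
    by (rule det_row_0) (use a in auto)
  ultimately have "det ?M = 0" by simp
  then show ?thesis using False by (simp add: cme_def)
qed

lemma cme_one:
  assumes "k \<le> d" "i < nks d k" "j < nks d k"
  shows "cme d k (1\<^sub>m d :: 'a :: rc_field mat) i j = (if i = j then 1 else 0)"
  using cme_diag[OF assms, of "\<lambda>_. 1 :: 'a"] by (simp add: emb_one)

lemma cme_smult:
  assumes "k \<le> d" "A \<in> carrier_mat d d" "i < nks d k" "j < nks d k"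
  shows "cme d k (c \<cdot>\<^sub>m A) i j = emb c ^ k * cme d k A i j"
proof -
  let ?A = "mat k k (\<lambda>(a, b). A $$ (kel d k i a, kel d k j b))"
  have "mat k k (\<lambda>(a, b). (c \<cdot>\<^sub>m A) $$ (kel d k i a, kel d k j b)) = c \<cdot>\<^sub>m ?A"
    using assms(2) kel_image(3)[OF assms(1,3)] kel_image(3)[OF assms(1,4)] by (intro eq_matI) auto
  moreover have "emb (c ^ k) = emb c ^ k" by (induct k) (auto simp: emb_mult emb_one)
  ultimately show ?thesis by (simp add: cme_def emb_mult)
qed

lemma cve_mult_right:
  assumes "k \<le> d" "B \<in> carrier_mat d k" "T \<in> carrier_mat k k" "i < nks d k"
  shows "cve d k (B * T) i = cve d k B i * emb (det T)"
proof -
  let ?B = "mat k k (\<lambda>(a, b). B $$ (kel d k i a, b))"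
  have "mat k k (\<lambda>(a, b). (B * T) $$ (kel d k i a, b)) = ?B * T"
    using assms(2,3) kel_image(3)[OF assms(1,4)] by (intro eq_matI) (auto simp: scalar_prod_def)
  then show ?thesis using det_mult[of ?B k T] assms(3) by (simp add: cve_def emb_mult)
qed

lemma cve_lcols:
  assumes "k \<le> d" "A \<in> carrier_mat d d" "i < nks d k"
  shows "cve d k (lcols k A) i = cme d k A i 0"
  unfolding cve_def cme_def
  by (intro arg_cong[of _ _ emb] arg_cong[of _ _ det] eq_matI)
    (use assms kel_image(3)[OF assms(1,3)] in \<open>auto simp: kel_0\<close>)

lemma cve_gram:
  assumes "k \<le> d" "B \<in> carrier_mat d k" "B' \<in> carrier_mat d k"
  shows "(\<Sum>i=0..<nks d k. cve d k B i * cnj (cve d k B' i)) = emb (det (mat_adjoint B' * B))"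
proof -
  have "mat_adjoint B' * B = mat k k (\<lambda>(a, b). \<Sum>l=0..<d. conjugate (B' $$ (l, a)) * B $$ (l, b))"
    using assms by (intro eq_matI) (auto simp: scalar_prod_def)
  moreover have "det (mat k k (\<lambda>(a, b). conjugate (B' $$ (kel d k i b, a)))) = conjugate (det (mat k k (\<lambda>(a, b). B' $$ (kel d k i a, b))))" for i
  proof -
    have "mat k k (\<lambda>(a, b). conjugate (B' $$ (kel d k i b, a))) = mat_adjoint (mat k k (\<lambda>(a, b). B' $$ (kel d k i a, b)))"
      by (rule eq_matI) auto
    then show ?thesis using det_adj[of "mat k k (\<lambda>(a, b). B' $$ (kel d k i a, b))" k] by simp
  qed
  ultimately show ?thesis
    using cauchy_binet[OF assms(1), of "\<lambda>a l. conjugate (B' $$ (l, a))" "\<lambda>l b. B $$ (l, b)"]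
    by (simp add: cve_def emb_sum emb_mult emb_conjugate mult.commute)
qed

lemma tendsto_det [tendsto_intros]:
  fixes A :: "'i \<Rightarrow> nat \<Rightarrow> nat \<Rightarrow> 'a :: rc_field"
  assumes "\<And>a b. a < k \<Longrightarrow> b < k \<Longrightarrow> ((\<lambda>n. A n a b) \<longlongrightarrow> L a b) F"
  shows "((\<lambda>n. det (mat k k (\<lambda>(a, b). A n a b))) \<longlongrightarrow> det (mat k k (\<lambda>(a, b). L a b))) F"
proof -
  have e: "det (mat k k (\<lambda>(a, b). f a b)) = (\<Sum>p\<in>{p. p permutes {0..<k}}. signof p * (\<Prod>i=0..<k. f i (p i)))"
    for f :: "nat \<Rightarrow> nat \<Rightarrow> 'a"
    by (subst det_def'[of _ k]) (auto intro!: sum.cong prod.cong simp: permutes_in_image)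
  show ?thesis unfolding e
    using assms by (intro tendsto_intros) (auto simp: permutes_in_image)
qed

definition mconv :: "nat \<Rightarrow> nat \<Rightarrow> (nat \<Rightarrow> ('a :: topological_space) mat) \<Rightarrow> 'a mat \<Rightarrow> bool" where
  "mconv m n A L \<longleftrightarrow> (\<forall>i<m. \<forall>j<n. (\<lambda>t. A t $$ (i, j)) \<longlonglongrightarrow> L $$ (i, j))"

lemma tendsto_cme:
  assumes "mconv d d A L" "k \<le> d" "i < nks d k" "j < nks d k"
  shows "(\<lambda>t. cme d k (A t) i j) \<longlonglongrightarrow> cme d k L i j"
  unfolding cme_def using assms kel_image(3)[OF assms(2,3)] kel_image(3)[OF assms(2,4)]
  by (intro tendsto_emb tendsto_det) (auto simp: mconv_def)

subsection \<open>The representation on Hermitian forms\<close>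

text \<open>The entry (i, j) of a form is stored at position i * n + j of a vector; sums over
  positions thus become double sums.\<close>

lemma sum_divmod:
  fixes m n :: nat
  shows "(\<Sum>y=0..<m * n. f (y div n) (y mod n)) = (\<Sum>k=0..<m. \<Sum>l=0..<n. f k l :: 'a :: comm_monoid_add)"
proof (induction m)
  case (Suc m)
  have "(\<Sum>y=0..<Suc m * n. f (y div n) (y mod n)) =
    (\<Sum>y=0..<m * n. f (y div n) (y mod n)) + (\<Sum>y\<in>{m * n..<Suc m * n}. f (y div n) (y mod n))"
    by (rule sum.atLeastLessThan_concat[symmetric]) auto
  also have "(\<Sum>y\<in>{m * n..<Suc m * n}. f (y div n) (y mod n)) = (\<Sum>l=0..<n. f ((l + m * n) div n) ((l + m * n) mod n))"
    using sum.shift_bounds_nat_ivl[of "\<lambda>y. f (y div n) (y mod n)" 0 "m * n" n] by (simp add: add.commute)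
  also have "\<dots> = (\<Sum>l=0..<n. f m l)" by (rule sum.cong) auto
  finally show ?case using Suc by simp
qed simp

definition zeta :: "nat \<Rightarrow> (nat \<Rightarrow> nat \<Rightarrow> complex) \<Rightarrow> real vec" where
  "zeta n H = vec (n * n) (\<lambda>x. Re (H (x div n) (x mod n)) + Im (H (x div n) (x mod n)))"

text \<open>The coordinates \<open>Re H\<^sub>i\<^sub>j + Im H\<^sub>i\<^sub>j\<close> identify Hermitian \<open>n \<times> n\<close> matrices isometrically with
  all real \<open>n \<times> n\<close> matrices, since the symmetric and the antisymmetric part are orthogonal. In
  these coordinates the following matrix is \<open>H \<mapsto> C H C\<^sup>*\<close>.\<close>

definition herm_act :: "nat \<Rightarrow> (nat \<Rightarrow> nat \<Rightarrow> complex) \<Rightarrow> real mat" where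
  "herm_act n C = mat (n * n) (n * n) (\<lambda>(x, y).
     Re (C (x div n) (y div n) * cnj (C (x mod n) (y mod n))) +
     Im (C (x div n) (y mod n) * cnj (C (x mod n) (y div n))))"

definition is_herm :: "nat \<Rightarrow> (nat \<Rightarrow> nat \<Rightarrow> complex) \<Rightarrow> bool" where
  "is_herm n H \<longleftrightarrow> (\<forall>i<n. \<forall>j<n. H j i = cnj (H i j))"

lemma is_hermD: "is_herm n H \<Longrightarrow> i < n \<Longrightarrow> j < n \<Longrightarrow> H j i = cnj (H i j)"
  unfolding is_herm_def by blast

lemma zeta_carrier [simp]: "zeta n H \<in> carrier_vec (n * n)" "dim_vec (zeta n H) = n * n"
  by (auto simp: zeta_def)

lemma herm_act_carrier [simp]: "herm_act n C \<in> carrier_mat (n * n) (n * n)"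
  by (auto simp: herm_act_def)

lemma divmod_less: "x < n * n \<Longrightarrow> x div n < n" "x < n * n \<Longrightarrow> x mod (n :: nat) < n"
  by (auto simp: less_mult_imp_div_less) (metis mod_less_divisor mult_0 not_gr_zero not_less_zero)

lemma zeta_cong: "(\<And>i j. i < n \<Longrightarrow> j < n \<Longrightarrow> H i j = H' i j) \<Longrightarrow> zeta n H = zeta n H'"
  by (intro eq_vecI) (auto simp: zeta_def divmod_less)

text \<open>Write u for the product of \<open>C i k\<close> and the conjugate of
  \<open>C j l\<close>. Exchanging k and l in the part with Im u replaces Re H + Im H by Re H - Im
  H, as H is Hermitian, and Re u (Re H + Im H) + Im u (Re H - Im H) = Re (u H) + Im (u H).\<close>

lemma herm_act_zeta:
  assumes H: "is_herm n H"
  shows "herm_act n C *\<^sub>v zeta n H =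
    zeta n (\<lambda>i j. \<Sum>k=0..<n. \<Sum>l=0..<n. C i k * H k l * cnj (C j l))"
proof (rule eq_vecI)
  fix x assume "x < dim_vec (zeta n (\<lambda>i j. \<Sum>k=0..<n. \<Sum>l=0..<n. C i k * H k l * cnj (C j l)))"
  then have x: "x < n * n" by simp
  define i where "i = x div n"
  define j where "j = x mod n"
  define u where "u k l = C i k * cnj (C j l)" for k l
  have "(herm_act n C *\<^sub>v zeta n H) $ x = (\<Sum>y=0..<n * n. herm_act n C $$ (x, y) * zeta n H $ y)"
    using x by (intro index_mult_vec_sum) auto
  also have "\<dots> = (\<Sum>y=0..<n * n. (\<lambda>k l. (Re (u k l) + Im (u l k)) * (Re (H k l) + Im (H k l))) (y div n) (y mod n))"
    using x by (intro sum.cong refl) (auto simp: herm_act_def zeta_def u_def i_def j_def)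
  also have "\<dots> = (\<Sum>k=0..<n. \<Sum>l=0..<n. (Re (u k l) + Im (u l k)) * (Re (H k l) + Im (H k l)))"
    by (rule sum_divmod)
  also have "\<dots> = (\<Sum>k=0..<n. \<Sum>l=0..<n. Re (u k l) * (Re (H k l) + Im (H k l))) +
      (\<Sum>k=0..<n. \<Sum>l=0..<n. Im (u l k) * (Re (H k l) + Im (H k l)))"
    by (simp add: distrib_right sum.distrib)
  also have "(\<Sum>k=0..<n. \<Sum>l=0..<n. Im (u l k) * (Re (H k l) + Im (H k l))) =
      (\<Sum>k=0..<n. \<Sum>l=0..<n. Im (u k l) * (Re (H l k) + Im (H l k)))"
    by (rule sum.swap)
  also have "\<dots> = (\<Sum>k=0..<n. \<Sum>l=0..<n. Im (u k l) * (Re (H k l) - Im (H k l)))"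
  proof (intro sum.cong refl)
    fix k l assume "k \<in> {0..<n}" "l \<in> {0..<n}"
    then have "H l k = cnj (H k l)" by (intro is_hermD[OF H]) simp_all
    then show "Im (u k l) * (Re (H l k) + Im (H l k)) = Im (u k l) * (Re (H k l) - Im (H k l))" by simp
  qed
  also have "(\<Sum>k=0..<n. \<Sum>l=0..<n. Re (u k l) * (Re (H k l) + Im (H k l))) +
      (\<Sum>k=0..<n. \<Sum>l=0..<n. Im (u k l) * (Re (H k l) - Im (H k l))) =
      (\<Sum>k=0..<n. \<Sum>l=0..<n. Re (u k l * H k l) + Im (u k l * H k l))"
    unfolding sum.distrib[symmetric] by (intro sum.cong refl) (simp add: algebra_simps)
  also have "\<dots> = zeta n (\<lambda>i j. \<Sum>k=0..<n. \<Sum>l=0..<n. C i k * H k l * cnj (C j l)) $ x"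
    using x by (simp add: zeta_def u_def i_def j_def sum.distrib mult_ac)
  finally show "(herm_act n C *\<^sub>v zeta n H) $ x =
    zeta n (\<lambda>i j. \<Sum>k=0..<n. \<Sum>l=0..<n. C i k * H k l * cnj (C j l)) $ x" .
qed (auto simp: herm_act_def)

text \<open>The mixed terms Re H Im H' + Im H Re H' are antisymmetric in the two indices and cancel
  in the double sum.\<close>

lemma zeta_scalar_prod:
  assumes "is_herm n H" "is_herm n H'"
  shows "zeta n H \<bullet> zeta n H' = Re (\<Sum>i=0..<n. \<Sum>j=0..<n. H i j * cnj (H' i j))"
proof -
  let ?f = "\<lambda>i j. Re (H i j) * Im (H' i j) + Im (H i j) * Re (H' i j)"
  have "zeta n H \<bullet> zeta n H' = (\<Sum>y=0..<n * n. (\<lambda>i j. (Re (H i j) + Im (H i j)) * (Re (H' i j) + Im (H' i j))) (y div n) (y mod n))"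
    by (auto simp: scalar_prod_def zeta_def intro!: sum.cong)
  also have "\<dots> = (\<Sum>i=0..<n. \<Sum>j=0..<n. (Re (H i j) + Im (H i j)) * (Re (H' i j) + Im (H' i j)))"
    by (rule sum_divmod)
  also have "\<dots> = (\<Sum>i=0..<n. \<Sum>j=0..<n. Re (H i j * cnj (H' i j))) + (\<Sum>i=0..<n. \<Sum>j=0..<n. ?f i j)"
    unfolding sum.distrib[symmetric] by (intro sum.cong refl) (simp add: algebra_simps)
  also have "(\<Sum>i=0..<n. \<Sum>j=0..<n. ?f i j) = 0"
  proof -
    have "(\<Sum>i=0..<n. \<Sum>j=0..<n. ?f i j) = (\<Sum>i=0..<n. \<Sum>j=0..<n. ?f j i)" by (rule sum.swap)
    also have "\<dots> = (\<Sum>i=0..<n. \<Sum>j=0..<n. - ?f i j)"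
    proof (intro sum.cong refl)
      fix i j assume "i \<in> {0..<n}" "j \<in> {0..<n}"
      then have ij: "i < n" "j < n" by simp_all
      have "H j i = cnj (H i j)" "H' j i = cnj (H' i j)"
        by (rule is_hermD[OF assms(1) ij], rule is_hermD[OF assms(2) ij])
      then show "?f j i = - ?f i j" by simp
    qed
    also have "\<dots> = - (\<Sum>i=0..<n. \<Sum>j=0..<n. ?f i j)" by (simp only: sum_negf)
    finally show ?thesis by linarith
  qed
  finally show ?thesis by simp
qed

text \<open>Every coordinate vector is \<open>zeta\<close> of a Hermitian form. Therefore identities
  between matrices \<open>herm_act\<close> can be checked on Hermitian forms, column by
  column.\<close>

lemma herm_act_col:
  assumes "y < n * n"
  shows "\<exists>H. is_herm n H \<and> (\<forall>C. col (herm_act n C) y =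
    zeta n (\<lambda>i j. \<Sum>k=0..<n. \<Sum>l=0..<n. C i k * H k l * cnj (C j l)))"
proof -
  define p where "p = y div n"
  define q where "q = y mod n"
  have pq: "p < n" "q < n" using divmod_less[OF assms] by (auto simp: p_def q_def)
  \<comment> \<open>Re + Im is 1 for \<open>w\<close> and 0 for its conjugate, so only position (p,
    q) of \<open>zeta\<close> is hit. For p = q the two summands of \<open>H\<close> add up to
    1.\<close>
  define w where "w = Complex (1 / 2) (1 / 2)"
  define H where "H k l = (if k = p \<and> l = q then w else 0) + (if k = q \<and> l = p then cnj w else 0)" for k l
  have herm: "is_herm n H"
    unfolding is_herm_def
  proof (intro allI impI)
    fix i j
    show "H j i = cnj (H i j)" unfolding H_def by (cases "i = p"; cases "i = q"; cases "j = p"; cases "j = q") (simp_all add: add.commute)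
  qed
  have s: "(\<Sum>k=0..<n. \<Sum>l=0..<n. C i k * H k l * cnj (C j l)) = w * (C i p * cnj (C j q)) + cnj w * (C i q * cnj (C j p))"
    for C :: "nat \<Rightarrow> nat \<Rightarrow> complex" and i j
  proof -
    have d: "(\<Sum>k=0..<n. \<Sum>l=0..<n. (if k = p \<and> l = q then f k l else 0)) = f p q" if "p < n" "q < n" for p q and f :: "nat \<Rightarrow> nat \<Rightarrow> complex"
    proof -
      have "(\<Sum>k=0..<n. \<Sum>l=0..<n. (if k = p \<and> l = q then f k l else 0)) = (\<Sum>k=0..<n. if k = p then f p q else 0)"
      proof (rule sum.cong[OF refl])
        fix k assume "k \<in> {0..<n}"
        have "(\<Sum>l=0..<n. if k = p \<and> l = q then f k l else 0) = (\<Sum>l=0..<n. if l = q then (if k = p then f p q else 0) else 0)"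
          by (rule sum.cong) auto
        then show "(\<Sum>l=0..<n. if k = p \<and> l = q then f k l else 0) = (if k = p then f p q else 0)"
          using that by simp
      qed
      then show ?thesis using that by simp
    qed
    have "(\<Sum>k=0..<n. \<Sum>l=0..<n. C i k * H k l * cnj (C j l)) =
      (\<Sum>k=0..<n. \<Sum>l=0..<n. (if k = p \<and> l = q then C i k * w * cnj (C j l) else 0) +
         (if k = q \<and> l = p then C i k * cnj w * cnj (C j l) else 0))"
    proof -
      have "x * ((if P then w else 0) + (if Q then cnj w else 0)) * y =
        (if P then x * w * y else 0) + (if Q then x * cnj w * y else 0)" for P Q x y
        by (cases P; cases Q) (simp_all add: algebra_simps)
      then show ?thesis unfolding H_def by (intro sum.cong refl)
    qed
    also have "\<dots> = C i p * w * cnj (C j q) + C i q * cnj w * cnj (C j p)"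
      unfolding sum.distrib d[OF pq, of "\<lambda>k l. C i k * w * cnj (C j l)"]
        d[OF pq(2,1), of "\<lambda>k l. C i k * cnj w * cnj (C j l)"] ..
    also have "\<dots> = w * (C i p * cnj (C j q)) + cnj w * (C i q * cnj (C j p))" by (simp only: mult_ac)
    finally show ?thesis .
  qed
  have "col (herm_act n C) y = zeta n (\<lambda>i j. \<Sum>k=0..<n. \<Sum>l=0..<n. C i k * H k l * cnj (C j l))" for C
    using assms unfolding s
    by (intro eq_vecI) (auto simp: zeta_def herm_act_def p_def q_def w_def field_simps)
  then show ?thesis using herm by blast
qed

lemma is_herm_sandwich:
  assumes "is_herm n H"
  shows "is_herm n (\<lambda>i j. \<Sum>k=0..<n. \<Sum>l=0..<n. C i k * H k l * cnj (C j l))"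
  unfolding is_herm_def
proof (intro allI impI)
  fix i j
  have "(\<Sum>k=0..<n. \<Sum>l=0..<n. C j k * H k l * cnj (C i l)) =
    (\<Sum>k=0..<n. \<Sum>l=0..<n. C j l * H l k * cnj (C i k))" by (rule sum.swap)
  also have "\<dots> = (\<Sum>k=0..<n. \<Sum>l=0..<n. cnj (C i k * H k l * cnj (C j l)))"
  proof (intro sum.cong refl)
    fix k l assume "k \<in> {0..<n}" "l \<in> {0..<n}"
    then have "H l k = cnj (H k l)" by (intro is_hermD[OF assms]) simp_all
    then show "C j l * H l k * cnj (C i k) = cnj (C i k * H k l * cnj (C j l))" by simp
  qed
  finally show "(\<Sum>k=0..<n. \<Sum>l=0..<n. C j k * H k l * cnj (C i l)) =
    cnj (\<Sum>k=0..<n. \<Sum>l=0..<n. C i k * H k l * cnj (C j l))" by (simp add: cnj_sum)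
qed

lemma herm_act_index:
  assumes "x < n * n" "y < n * n"
  shows "herm_act n C $$ (x, y) = Re (C (x div n) (y div n) * cnj (C (x mod n) (y mod n))) +
     Im (C (x div n) (y mod n) * cnj (C (x mod n) (y div n)))"
  using assms by (simp add: herm_act_def)

lemma herm_act_cong:
  assumes "\<And>i j. i < n \<Longrightarrow> j < n \<Longrightarrow> C i j = D i j"
  shows "herm_act n C = herm_act n D"
  by (rule eq_matI) (use assms divmod_less in \<open>auto simp: herm_act_def\<close>)

lemma sum_sum_pair: "(\<Sum>k\<in>S. \<Sum>l\<in>S. g k l) = (\<Sum>x\<in>S \<times> S. g (fst x) (snd x))"
  by (simp add: sum.cartesian_product case_prod_beta)

lemma one_smult_mat: "(1 :: 'a :: semiring_1) \<cdot>\<^sub>m A = A"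
  by (rule eq_matI) auto

text \<open>On each Hermitian form given by \<open>herm_act_col\<close>, both sides are the
  successive congruences by \<open>D\<close> and \<open>C\<close>; what remains is an exchange of
  finite sums.\<close>

lemma herm_act_mult: "herm_act n C * herm_act n D = herm_act n (\<lambda>i j. \<Sum>l=0..<n. C i l * D l j)"
proof (rule mat_col_eqI)
  let ?S = "{0..<n}"
  fix y assume "y < dim_col (herm_act n (\<lambda>i j. \<Sum>l=0..<n. C i l * D l j))"
  then have y: "y < n * n" by (simp add: herm_act_def)
  obtain H where H: "is_herm n H" "\<And>C. col (herm_act n C) y =
    zeta n (\<lambda>i j. \<Sum>k\<in>?S. \<Sum>l\<in>?S. C i k * H k l * cnj (C j l))" using herm_act_col[OF y] by blast
  have "col (herm_act n C * herm_act n D) y = herm_act n C *\<^sub>v col (herm_act n D) y"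
    using y by (intro col_mult2[of _ "n * n" "n * n"]) auto
  also have "\<dots> = zeta n (\<lambda>i j. \<Sum>k\<in>?S. \<Sum>l\<in>?S. C i k * (\<Sum>k'\<in>?S. \<Sum>l'\<in>?S. D k k' * H k' l' * cnj (D l l')) * cnj (C j l))"
    unfolding H(2) by (rule herm_act_zeta[OF is_herm_sandwich[OF H(1)]])
  also have "\<dots> = zeta n (\<lambda>i j. \<Sum>k'\<in>?S. \<Sum>l'\<in>?S. (\<Sum>k\<in>?S. C i k * D k k') * H k' l' * cnj (\<Sum>l\<in>?S. C j l * D l l'))"
  proof (rule zeta_cong)
    fix i j
    have "(\<Sum>k\<in>?S. \<Sum>l\<in>?S. C i k * (\<Sum>k'\<in>?S. \<Sum>l'\<in>?S. D k k' * H k' l' * cnj (D l l')) * cnj (C j l)) =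
      (\<Sum>x\<in>?S \<times> ?S. \<Sum>y\<in>?S \<times> ?S. C i (fst x) * D (fst x) (fst y) * H (fst y) (snd y) * cnj (D (snd x) (snd y)) * cnj (C j (snd x)))"
      unfolding sum_sum_pair sum_distrib_left sum_distrib_right by (simp only: mult.assoc)
    also have "\<dots> = (\<Sum>y\<in>?S \<times> ?S. \<Sum>x\<in>?S \<times> ?S. C i (fst x) * D (fst x) (fst y) * H (fst y) (snd y) * cnj (D (snd x) (snd y)) * cnj (C j (snd x)))"
      by (rule sum.swap)
    also have "\<dots> = (\<Sum>y\<in>?S \<times> ?S. (\<Sum>k\<in>?S. C i k * D k (fst y)) * H (fst y) (snd y) * cnj (\<Sum>l\<in>?S. C j l * D l (snd y)))"
    proof (rule sum.cong[OF refl])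
      fix y
      have "(\<Sum>k\<in>?S. C i k * D k (fst y)) * H (fst y) (snd y) * cnj (\<Sum>l\<in>?S. C j l * D l (snd y)) =
        (\<Sum>k\<in>?S. \<Sum>l\<in>?S. (C i k * D k (fst y)) * H (fst y) (snd y) * cnj (C j l * D l (snd y)))"
        by (simp only: cnj_sum sum_distrib_left sum_distrib_right) 
          (rule sum.swap)
      then show "(\<Sum>x\<in>?S \<times> ?S. C i (fst x) * D (fst x) (fst y) * H (fst y) (snd y) * cnj (D (snd x) (snd y)) * cnj (C j (snd x))) =
        (\<Sum>k\<in>?S. C i k * D k (fst y)) * H (fst y) (snd y) * cnj (\<Sum>l\<in>?S. C j l * D l (snd y))"
        unfolding sum_sum_pair by (simp add: ac_simps)
    qed
    also have "\<dots> = (\<Sum>k'\<in>?S. \<Sum>l'\<in>?S. (\<Sum>k\<in>?S. C i k * D k k') * H k' l' * cnj (\<Sum>l\<in>?S. C j l * D l l'))"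
      unfolding sum_sum_pair ..
    finally show "(\<Sum>k\<in>?S. \<Sum>l\<in>?S. C i k * (\<Sum>k'\<in>?S. \<Sum>l'\<in>?S. D k k' * H k' l' * cnj (D l l')) * cnj (C j l)) =
      (\<Sum>k'\<in>?S. \<Sum>l'\<in>?S. (\<Sum>k\<in>?S. C i k * D k k') * H k' l' * cnj (\<Sum>l\<in>?S. C j l * D l l'))" .
  qed
  also have "\<dots> = col (herm_act n (\<lambda>i j. \<Sum>l=0..<n. C i l * D l j)) y" unfolding H(2) ..
  finally show "col (herm_act n C * herm_act n D) y = col (herm_act n (\<lambda>i j. \<Sum>l=0..<n. C i l * D l j)) y" .
qed (auto simp: herm_act_def)

lemma herm_act_transpose: "transpose_mat (herm_act n C) = herm_act n (\<lambda>i j. cnj (C j i))"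
  by (rule eq_matI) (auto simp: herm_act_def mult.commute)

definition Phi :: "nat \<Rightarrow> nat \<Rightarrow> ('a :: rc_field) mat \<Rightarrow> real mat" where
  "Phi d k A = herm_act (nks d k) (cme d k A)"

text \<open>The rank one form \<open>c c\<^sup>*\<close>, where \<open>c\<close> are the Pluecker coordinates of the frame.\<close>

definition pv :: "nat \<Rightarrow> nat \<Rightarrow> ('a :: rc_field) mat \<Rightarrow> real vec" where
  "pv d k B = zeta (nks d k) (\<lambda>i j. cve d k B i * cnj (cve d k B j))"

text \<open>As a vector this is the identity form; as a functional it is the trace.\<close>

definition evec :: "nat \<Rightarrow> real vec" where
  "evec n = zeta n (\<lambda>i j. if i = j then 1 else 0)"

definition rdim :: "nat \<Rightarrow> nat \<Rightarrow> nat" where "rdim d k = nks d k * nks d k"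

lemma Phi_carrier [simp]: "Phi d k A \<in> carrier_mat (rdim d k) (rdim d k)"
  by (simp add: Phi_def rdim_def)

lemma Phi_dim [simp]: "dim_row (Phi d k A) = rdim d k" "dim_col (Phi d k A) = rdim d k"
  by (rule carrier_matD[OF Phi_carrier])+

lemma pv_carrier [simp]: "pv d k B \<in> carrier_vec (rdim d k)" "dim_vec (pv d k B) = rdim d k"
  by (auto simp: pv_def rdim_def)

lemma evec_carrier [simp]: "evec (nks d k) \<in> carrier_vec (rdim d k)"
  "dim_vec (evec (nks d k)) = rdim d k"
  by (auto simp: evec_def rdim_def)

lemma rdim_pos: "k \<le> d \<Longrightarrow> 0 < rdim d k"
  using kset_bij(3) by (simp add: rdim_def)

lemma is_herm_rank1: "is_herm n (\<lambda>i j. c i * cnj (c j))"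
  unfolding is_herm_def by simp

lemma is_herm_one: "is_herm n (\<lambda>i j. if i = j then 1 else 0)"
  unfolding is_herm_def by simp

lemma Phi_mult:
  assumes "k \<le> d" "A \<in> carrier_mat d d" "B \<in> carrier_mat d d"
  shows "Phi d k (A * B) = Phi d k A * Phi d k B"
  unfolding Phi_def herm_act_mult by (rule herm_act_cong) (rule cme_mult[OF assms])

lemma Phi_adj:
  assumes "k \<le> d" "A \<in> carrier_mat d d"
  shows "Phi d k (mat_adjoint A) = transpose_mat (Phi d k A)"
  unfolding Phi_def herm_act_transpose by (rule herm_act_cong) (rule cme_adj[OF assms])

text \<open>The compound matrix is multiplied by c^k, and forms see this factor together with its
  conjugate. The resulting factor is positive for nonzero c, so all lifts of a projective map
  preserve the same cone and not its negative.\<close>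

lemma Phi_smult:
  assumes "k \<le> d" "A \<in> carrier_mat d d"
  shows "Phi d k (c \<cdot>\<^sub>m A) = (norm c ^ (2 * k)) \<cdot>\<^sub>m Phi d k A"
proof (rule eq_matI)
  fix x y assume "x < dim_row ((norm c ^ (2 * k)) \<cdot>\<^sub>m Phi d k A)" "y < dim_col ((norm c ^ (2 * k)) \<cdot>\<^sub>m Phi d k A)"
  then have xy: "x < nks d k * nks d k" "y < nks d k * nks d k" by (auto simp: rdim_def)
  let ?z = "emb c ^ k"
  have z: "?z * u * cnj (?z * v) = of_real (norm c ^ (2 * k)) * (u * cnj v)" for u v
  proof -
    have "?z * u * cnj (?z * v) = (?z * cnj ?z) * (u * cnj v)" by simp
    moreover have "?z * cnj ?z = of_real ((cmod ?z)\<^sup>2)" by (rule complex_norm_square[symmetric])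
    moreover have "(cmod ?z)\<^sup>2 = norm c ^ (2 * k)"
      by (simp add: norm_power cmod_emb power_mult[symmetric] mult.commute)
    ultimately show ?thesis by simp
  qed
  show "Phi d k (c \<cdot>\<^sub>m A) $$ (x, y) = ((norm c ^ (2 * k)) \<cdot>\<^sub>m Phi d k A) $$ (x, y)"
    using xy divmod_less[OF xy(1)] divmod_less[OF xy(2)]
    by (simp only: Phi_def herm_act_index cme_smult[OF assms] z index_smult_mat(1) herm_act_carrier[THEN carrier_matD(1)]
       herm_act_carrier[THEN carrier_matD(2)] Re_complex_of_real Im_complex_of_real times_complex.sel) (simp add: algebra_simps)
qed (auto simp: Phi_def herm_act_def)

definition sprod :: "nat \<Rightarrow> nat \<Rightarrow> (nat \<Rightarrow> real) \<Rightarrow> nat \<Rightarrow> real" where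
  "sprod d k s i = (\<Prod>a=0..<k. s (kel d k i a))"

lemma Phi_diag:
  assumes "k \<le> d"
  shows "Phi d k (rdiag d s :: 'a :: rc_field mat) =
    mat_diag (rdim d k) (\<lambda>x. sprod d k s (x div nks d k) * sprod d k s (x mod nks d k))"
proof (rule eq_matI)
  let ?D = "rdiag d s :: 'a mat" and ?n = "nks d k"
  let ?R = "mat_diag (rdim d k) (\<lambda>x. sprod d k s (x div ?n) * sprod d k s (x mod ?n))"
  fix x y assume "x < dim_row ?R" "y < dim_col ?R"
  then have xy: "x < ?n * ?n" "y < ?n * ?n" by (auto simp: rdim_def mat_diag_def)
  have c: "cme d k ?D i j = (if i = j then of_real (sprod d k s i) else 0)" if "i < ?n" "j < ?n" for i j
    using cme_diag[OF assms that, of "\<lambda>i. of_real (s i) :: 'a"] by (simp add: emb_of_real sprod_def)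
  have eq: "x = y \<longleftrightarrow> x div ?n = y div ?n \<and> x mod ?n = y mod ?n" by (metis div_mod_decomp)
  have "Phi d k ?D $$ (x, y) = (if x = y then sprod d k s (x div ?n) * sprod d k s (x mod ?n) else 0)"
    unfolding Phi_def herm_act_index[OF xy] eq
    using divmod_less[OF xy(1)] divmod_less[OF xy(2)] by (simp add: c)
  then show "Phi d k ?D $$ (x, y) = ?R $$ (x, y)"
    using xy by (simp add: mat_diag_carrier_index rdim_def)
qed (auto simp: mat_diag_def)

lemma Phi_one:
  assumes "k \<le> d"
  shows "Phi d k (1\<^sub>m d :: 'a :: rc_field mat) = 1\<^sub>m (rdim d k)"
  using Phi_diag[OF assms, of "\<lambda>_. 1", where 'a = 'a] by (simp add: sprod_def)

lemma adj_real: "mat_adjoint (A :: real mat) = transpose_mat A"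
  by (rule eq_matI) auto

lemma Phi_unitary:
  assumes "k \<le> d" "unitary d L"
  shows "unitary (rdim d k) (Phi d k L)"
proof -
  note L = unitaryD[OF assms(2)]
  have "mat_adjoint (Phi d k L) * Phi d k L = Phi d k (mat_adjoint L * L)"
    using Phi_mult[OF assms(1) adj_carrier[OF L(1)] L(1)] Phi_adj[OF assms(1) L(1)] by (simp add: adj_real)
  also have "\<dots> = 1\<^sub>m (rdim d k)" unfolding L(2) by (rule Phi_one[OF assms(1)])
  finally show ?thesis by (simp add: unitary_def)
qed

lemma Phi_pv:
  assumes "k \<le> d" "A \<in> carrier_mat d d" "B \<in> carrier_mat d k"
  shows "Phi d k A *\<^sub>v pv d k B = pv d k (A * B)"
  unfolding Phi_def pv_def herm_act_zeta[OF is_herm_rank1]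
proof (rule zeta_cong)
  fix i j assume ij: "i < nks d k" "j < nks d k"
  show "(\<Sum>ka=0..<nks d k. \<Sum>l=0..<nks d k. cme d k A i ka * (cve d k B ka * cnj (cve d k B l)) * cnj (cme d k A j l)) =
    cve d k (A * B) i * cnj (cve d k (A * B) j)"
    unfolding cve_mult[OF assms ij(1)] cve_mult[OF assms ij(2)] cnj_sum sum_product
    by (intro sum.cong refl) simp
qed

text \<open>Position 0 is the pair (0, 0), and subset 0 consists of the first k indices. This
  identifies the factors of rank one limits with Pluecker forms.\<close>

lemma Phi_col_0:
  assumes "k \<le> d" "A \<in> carrier_mat d d" "x < rdim d k"
  shows "Phi d k A $$ (x, 0) = pv d k (lcols k A) $ x"
proof -
  have x: "x < nks d k * nks d k" using assms(3) by (simp add: rdim_def)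
  have 0: "0 < nks d k * nks d k" by (rule le_less_trans[OF le0 x])
  show ?thesis
    unfolding Phi_def pv_def herm_act_index[OF x 0] zeta_def using x divmod_less[OF x]
    by (simp add: cve_lcols[OF assms(1,2)])
qed

lemma pv_dot:
  assumes "k \<le> d" "B \<in> carrier_mat d k" "B' \<in> carrier_mat d k"
  shows "pv d k B \<bullet> pv d k B' = (norm (det (mat_adjoint B' * B)))\<^sup>2"
proof -
  let ?S = "{0..<nks d k}" and ?z = "\<Sum>i=0..<nks d k. cve d k B i * cnj (cve d k B' i)"
  have "pv d k B \<bullet> pv d k B' = Re (\<Sum>i\<in>?S. \<Sum>j\<in>?S. (cve d k B i * cnj (cve d k B j)) * cnj (cve d k B' i * cnj (cve d k B' j)))"
    unfolding pv_def by (rule zeta_scalar_prod[OF is_herm_rank1 is_herm_rank1])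
  also have "(\<Sum>i\<in>?S. \<Sum>j\<in>?S. (cve d k B i * cnj (cve d k B j)) * cnj (cve d k B' i * cnj (cve d k B' j))) = ?z * cnj ?z"
    unfolding cnj_sum sum_product by (intro sum.cong refl) simp
  also have "?z * cnj ?z = of_real ((cmod ?z)\<^sup>2)" by (rule complex_norm_square[symmetric])
  finally show ?thesis unfolding cve_gram[OF assms] by (simp add: cmod_emb)
qed

lemma evec_zeta:
  assumes "is_herm n H"
  shows "evec n \<bullet> zeta n H = (\<Sum>i=0..<n. Re (H i i))"
proof -
  have "evec n \<bullet> zeta n H = Re (\<Sum>i=0..<n. \<Sum>j=0..<n. (if i = j then 1 else 0) * cnj (H i j))"
    unfolding evec_def by (rule zeta_scalar_prod[OF is_herm_one assms])
  also have "(\<Sum>i=0..<n. \<Sum>j=0..<n. (if i = j then 1 else 0) * cnj (H i j)) = (\<Sum>i=0..<n. cnj (H i i))"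
  proof (rule sum.cong[OF refl])
    fix i assume "i \<in> {0..<n}"
    then have "(\<Sum>j=0..<n. (if i = j then cnj (H i j) else 0)) = cnj (H i i)" by simp
    then show "(\<Sum>j=0..<n. (if i = j then 1 else 0) * cnj (H i j)) = cnj (H i i)"
      by (simp add: if_distrib[of "\<lambda>x. x * _"] cong: if_cong)
  qed
  finally show ?thesis by simp
qed

lemma evec_pv:
  "evec (nks d k) \<bullet> pv d k B = (\<Sum>i=0..<nks d k. (cmod (cve d k B i))\<^sup>2)"
  unfolding pv_def evec_zeta[OF is_herm_rank1] complex_norm_square[symmetric] by simp

lemma evec_pv_nonneg: "0 \<le> evec (nks d k) \<bullet> pv d k B"
  unfolding evec_pv by (intro sum_nonneg) simp

lemma evec_pv_isometric:
  assumes "k \<le> d" "U \<in> carrier_mat d k" "mat_adjoint U * U = 1\<^sub>m k"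
  shows "evec (nks d k) \<bullet> pv d k U = 1"
proof -
  have "of_real (evec (nks d k) \<bullet> pv d k U) = (\<Sum>i=0..<nks d k. cve d k U i * cnj (cve d k U i))"
    unfolding evec_pv of_real_sum complex_norm_square ..
  also have "\<dots> = 1" unfolding cve_gram[OF assms(1,2,2)] assms(3) by (simp add: emb_one)
  finally show ?thesis by (metis of_real_1 of_real_eq_iff)
qed

text \<open>The entry is Re + Im of a product of two Pluecker coordinates u and conjugate v, hence
  at most 2 |u| |v|. This is at most |u|^2 + |v|^2, and each square is at most the trace.\<close>

lemma pv_le:
  assumes "x < rdim d k"
  shows "\<bar>pv d k B $ x\<bar> \<le> 2 * (evec (nks d k) \<bullet> pv d k B)"
proof -
  have x: "x < nks d k * nks d k" using assms by (simp add: rdim_def)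
  define u where "u = cve d k B (x div nks d k)"
  define v where "v = cve d k B (x mod nks d k)"
  have m: "(cmod (cve d k B i))\<^sup>2 \<le> evec (nks d k) \<bullet> pv d k B" if "i < nks d k" for i
    unfolding evec_pv by (rule member_le_sum[of i]) (use that in auto)
  have "pv d k B $ x = Re (u * cnj v) + Im (u * cnj v)"
    using x by (simp add: pv_def zeta_def u_def v_def)
  then have "\<bar>pv d k B $ x\<bar> \<le> \<bar>Re (u * cnj v)\<bar> + \<bar>Im (u * cnj v)\<bar>" by linarith
  also have "\<dots> \<le> cmod (u * cnj v) + cmod (u * cnj v)" by (intro add_mono abs_Re_le_cmod abs_Im_le_cmod)
  also have "\<dots> = 2 * cmod u * cmod v" by (simp add: norm_mult)
  also have "\<dots> \<le> (cmod u)\<^sup>2 + (cmod v)\<^sup>2" by (rule sum_squares_bound)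
  also have "\<dots> \<le> 2 * (evec (nks d k) \<bullet> pv d k B)"
    using m[OF divmod_less(1)[OF x]] m[OF divmod_less(2)[OF x]] by (simp add: u_def v_def)
  finally show ?thesis .
qed

lemma pv_mult_right:
  assumes "k \<le> d" "B \<in> carrier_mat d k" "T \<in> carrier_mat k k"
  shows "pv d k (B * T) = (norm (det T))\<^sup>2 \<cdot>\<^sub>v pv d k B"
proof (rule eq_vecI)
  let ?z = "emb (det T)"
  fix x assume "x < dim_vec ((norm (det T))\<^sup>2 \<cdot>\<^sub>v pv d k B)"
  then have x: "x < nks d k * nks d k" by (simp add: rdim_def)
  have "(u * ?z) * cnj (v * ?z) = of_real ((norm (det T))\<^sup>2) * (u * cnj v)" for u v
  proof -
    have "(u * ?z) * cnj (v * ?z) = (?z * cnj ?z) * (u * cnj v)" by simp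
    then show ?thesis unfolding complex_norm_square[symmetric] cmod_emb .
  qed
  note z = this
  let ?u = "cve d k B (x div nks d k)" and ?v = "cve d k B (x mod nks d k)"
  have "pv d k (B * T) $ x = Re ((?u * ?z) * cnj (?v * ?z)) + Im ((?u * ?z) * cnj (?v * ?z))"
    using x by (simp only: pv_def zeta_def index_vec cve_mult_right[OF assms] divmod_less[OF x])
  also have "\<dots> = (norm (det T))\<^sup>2 * (Re (?u * cnj ?v) + Im (?u * cnj ?v))"
    unfolding z by (simp only: times_complex.sel Re_complex_of_real Im_complex_of_real) (simp add: algebra_simps)
  also have "\<dots> = ((norm (det T))\<^sup>2 \<cdot>\<^sub>v pv d k B) $ x"
    using x by (simp add: pv_def zeta_def)
  finally show "pv d k (B * T) $ x = ((norm (det T))\<^sup>2 \<cdot>\<^sub>v pv d k B) $ x" .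
qed auto

text \<open>The columns of \<open>A\<close> in the m-th subset: their Pluecker coordinates form the
  m-th column of the compound matrix.\<close>

definition colsel :: "nat \<Rightarrow> nat \<Rightarrow> nat \<Rightarrow> 'a mat \<Rightarrow> 'a mat" where
  "colsel d k m A = mat d k (\<lambda>(a, b). A $$ (a, kel d k m b))"

lemma cve_colsel:
  assumes "k \<le> d" "i < nks d k" "m < nks d k"
  shows "cve d k (colsel d k m A) i = cme d k A i m"
  unfolding cve_def cme_def
  by (intro arg_cong[of _ _ emb] arg_cong[of _ _ det] eq_matI)
    (use assms kel_image(3)[OF assms(1,2)] in \<open>auto simp: colsel_def\<close>)

text \<open>The identity form is sent to the compound matrix times its adjoint, which is the sum of
  the rank one forms of the columns of the compound matrix. So bounds for Pluecker forms carry over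
  to the orbit of the identity form.\<close>

lemma Phi_evec_dot:
  assumes "k \<le> d" "y \<in> carrier_vec (rdim d k)"
  shows "y \<bullet> (Phi d k A *\<^sub>v evec (nks d k)) = (\<Sum>m=0..<nks d k. y \<bullet> pv d k (colsel d k m A))"
proof -
  let ?n = "nks d k" and ?S = "{0..<nks d k}"
  have e: "Phi d k A *\<^sub>v evec ?n = zeta ?n (\<lambda>i j. \<Sum>m\<in>?S. cme d k A i m * cnj (cme d k A j m))"
    unfolding Phi_def evec_def herm_act_zeta[OF is_herm_one]
  proof (rule zeta_cong, rule sum.cong[OF refl])
    fix i j m assume m: "m \<in> ?S"
    have "(\<Sum>l\<in>?S. cme d k A i m * (if m = l then 1 else 0) * cnj (cme d k A j l)) =
      (\<Sum>l\<in>?S. if m = l then cme d k A i m * cnj (cme d k A j l) else 0)" by (rule sum.cong) auto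
    then show "(\<Sum>l\<in>?S. cme d k A i m * (if m = l then 1 else 0) * cnj (cme d k A j l)) = cme d k A i m * cnj (cme d k A j m)"
      using m by simp
  qed
  have x: "(Phi d k A *\<^sub>v evec ?n) $ x = (\<Sum>m\<in>?S. pv d k (colsel d k m A) $ x)" if "x < rdim d k" for x
  proof -
    have x: "x < ?n * ?n" using that by (simp add: rdim_def)
    show ?thesis unfolding e pv_def using x divmod_less[OF x]
      by (simp add: zeta_def cve_colsel[OF assms(1)] sum.distrib)
  qed
  have "y \<bullet> (Phi d k A *\<^sub>v evec ?n) = (\<Sum>x=0..<rdim d k. y $ x * (\<Sum>m\<in>?S. pv d k (colsel d k m A) $ x))"
    unfolding scalar_prod_def[of y] by (rule sum.cong) (simp_all add: x del: index_mult_mat_vec)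
  also have "\<dots> = (\<Sum>x=0..<rdim d k. \<Sum>m\<in>?S. y $ x * pv d k (colsel d k m A) $ x)"
    by (simp only: sum_distrib_left)
  also have "\<dots> = (\<Sum>m\<in>?S. \<Sum>x=0..<rdim d k. y $ x * pv d k (colsel d k m A) $ x)" by (rule sum.swap)
  also have "\<dots> = (\<Sum>m\<in>?S. y \<bullet> pv d k (colsel d k m A))" by (simp add: scalar_prod_def)
  finally show ?thesis .
qed

subsection \<open>Singular values of the representation\<close>

lemma sprod_prod:
  assumes "k \<le> d" "i < nks d k"
  shows "sprod d k s i = prod s (kset d k i)"
  unfolding sprod_def kel_image(1)[OF assms, symmetric] using prod.reindex[OF kel_image(2)[OF assms], of s] by simp

lemma sprod_0: "k \<le> d \<Longrightarrow> sprod d k s 0 = (\<Prod>a=0..<k. s a)"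
  by (simp add: sprod_def kel_0)

lemma sprod_pos:
  assumes "k \<le> d" "i < nks d k" "\<And>i. i < d \<Longrightarrow> 0 < s i"
  shows "0 < sprod d k s i"
  unfolding sprod_def using assms kel_image(3)[OF assms(1,2)] by (intro prod_pos) auto

text \<open>The a-th element of a subset is at least a, and the last one is at least k if the subset
  is not the first; \<open>s\<close> is decreasing.\<close>

lemma sprod_le:
  assumes "k \<le> d" "i < nks d k" "i \<noteq> 0" "0 < k"
    and s: "\<And>i. i < d \<Longrightarrow> 0 < s i" "\<And>i j. i \<le> j \<Longrightarrow> j < d \<Longrightarrow> s j \<le> s i"
  shows "sprod d k s i \<le> (\<Prod>a=0..<k - 1. s a) * s k"
proof -
  have k: "{0..<k} = insert (k - 1) {0..<k - 1}" using assms(4) by auto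
  have "sprod d k s i = s (kel d k i (k - 1)) * (\<Prod>a=0..<k - 1. s (kel d k i a))"
    unfolding sprod_def by (subst k) simp
  also have "\<dots> \<le> s k * (\<Prod>a=0..<k - 1. s a)"
  proof (intro mult_mono prod_mono)
    show "s (kel d k i (k - 1)) \<le> s k"
      using s(2)[OF kel_last_ge[OF assms(1-4)]] kel_image(3)[OF assms(1,2), of "k - 1"] assms(4) by simp
    then show "0 \<le> s k" using s(1)[of "kel d k i (k - 1)"] kel_image(3)[OF assms(1,2), of "k - 1"] assms(4) by simp
    show "0 \<le> (\<Prod>a=0..<k - 1. s (kel d k i a))"
      using s(1) kel_image(3)[OF assms(1,2)] by (intro prod_nonneg) (force intro: less_imp_le)
  next
    fix a assume "a \<in> {0..<k - 1}"
    then have a: "a < k" by simp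
    then have "kel d k i a < d" "a \<le> kel d k i a" using kel_image(3)[OF assms(1,2)] kel_ge[OF assms(1,2)] by auto
    then show "0 \<le> s (kel d k i a) \<and> s (kel d k i a) \<le> s a" using s by (simp add: less_imp_le)
  qed
  finally show ?thesis by (simp add: mult.commute)
qed

text \<open>The bound of \<open>sprod_le\<close> is attained by the subset in which k replaces k -
  1.\<close>

lemma sprod_second:
  assumes "k < d" "0 < k"
  shows "\<exists>i<nks d k. i \<noteq> 0 \<and> (\<forall>s. sprod d k s i = (\<Prod>a=0..<k - 1. s a) * s k)"
proof -
  have kd: "k \<le> d" using assms by simp
  let ?I = "insert k {0..<k - 1}"
  have "?I \<subseteq> {0..<d}" "card ?I = k" using assms by auto
  then obtain i where i: "i < nks d k" "kset d k i = ?I" using kset_surj[OF kd] by blast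
  have "i \<noteq> 0"
  proof
    assume "i = 0"
    then have "{0..<k} = ?I" using i(2) kset_bij(2)[OF kd] by simp
    then show False by (metis atLeastLessThan_iff insertI1 less_irrefl)
  qed
  then show ?thesis using i(1) sprod_prod[OF kd i(1)] unfolding i(2) by (intro exI[of _ i]) (auto simp: mult.commute)
qed

lemma sort_top_two:
  fixes t :: "nat \<Rightarrow> real"
  assumes "b < m" "b \<noteq> 0" "t b \<le> t 0" "\<And>i. i < m \<Longrightarrow> i \<noteq> 0 \<Longrightarrow> t i \<le> t b"
  shows "rev (sort (map t [0..<m])) ! 0 = t 0" "rev (sort (map t [0..<m])) ! 1 = t b"
proof -
  let ?l = "map t [0..<m]" and ?R = "{0..<m} - {0, b}"
  let ?r = "map t (sorted_list_of_set ?R)"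
  have m: "{0..<m} = insert 0 (insert b ?R)" using assms(1) by auto
  have "mset ?l = image_mset t (mset_set {0..<m})" by simp
  also have "\<dots> = add_mset (t 0) (add_mset (t b) (image_mset t (mset_set ?R)))"
    using assms(1,2) by (subst m) simp
  also have "mset_set ?R = mset (sorted_list_of_set ?R)"
    by (metis mset_sorted_list_of_multiset sorted_list_of_mset_set)
  also have "add_mset (t 0) (add_mset (t b) (image_mset t \<dots>)) = mset (t 0 # t b # rev (sort ?r))" by simp
  finally have ms: "mset (rev (sort ?l)) = mset (t 0 # t b # rev (sort ?r))" by simp
  have "rev (sort ?l) = t 0 # t b # rev (sort ?r)"
  proof (rule sorted_wrt_ge_unique[OF _ _ ms])
    show "sorted_wrt (\<ge>) (rev (sort ?l))" by (simp add: sorted_wrt_rev)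
    have "\<forall>x\<in>set ?r. x \<le> t b" using assms(4) by auto
    moreover from this have "\<forall>x\<in>set ?r. x \<le> t 0" using assms(3) by force
    ultimately show "sorted_wrt (\<ge>) (t 0 # t b # rev (sort ?r))"
      using assms(3) by (auto simp: sorted_wrt_rev)
  qed
  then show "rev (sort ?l) ! 0 = t 0" "rev (sort ?l) ! 1 = t b" by simp_all
qed

text \<open>\<open>Phi\<close> turns a singular value decomposition into one whose diagonal entries
  are the products of two numbers \<open>sprod\<close>. With m the values of \<open>sprod\<close>
  and i the subset of \<open>sprod_second\<close>, the two largest are m(0)^2 and m(0) m(i). The
  real scalar is split into its sign \<open>u\<close>, absorbed in the orthogonal factor, and its
  modulus \<open>t\<close>, because the lift selected in \<open>sv\<close> is known only up to a
  real factor.\<close>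

lemma singular_values_Phi:
  assumes k: "0 < k" "k < d" and L: "unitary d (L :: 'a :: rc_field mat)" and M: "unitary d M"
    and s: "\<And>i. i < d \<Longrightarrow> 0 < s i" "\<And>i j. i \<le> j \<Longrightarrow> j < d \<Longrightarrow> s j \<le> s i"
    and u: "norm u = 1" "0 < (t :: real)"
  defines "A \<equiv> L * rdiag d s * M"
  shows "singular_values ((u * t) \<cdot>\<^sub>m Phi d k A) ! 0 / singular_values ((u * t) \<cdot>\<^sub>m Phi d k A) ! 1 = s (k - 1) / s k"
proof -
  have kd: "k \<le> d" using k by simp
  let ?n = "nks d k" and ?m = "sprod d k s"
  define f where "f x = t * (?m (x div ?n) * ?m (x mod ?n))" for x
  note Lc = unitaryD(1)[OF L] and Mc = unitaryD(1)[OF M]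
  have uL: "unitary (rdim d k) (u \<cdot>\<^sub>m Phi d k L)"
  proof -
    note U = unitaryD[OF Phi_unitary[OF kd L]]
    have uu: "u * u = 1" using u(1) by (auto simp: abs_if split: if_splits)
    have "mat_adjoint (u \<cdot>\<^sub>m Phi d k L) * (u \<cdot>\<^sub>m Phi d k L) = (u * u) \<cdot>\<^sub>m (mat_adjoint (Phi d k L) * Phi d k L)"
      by (rule eq_matI) (auto simp: scalar_prod_def sum_distrib_left ac_simps)
    then show ?thesis using U uu by (simp add: unitary_def one_smult_mat)
  qed
  have "Phi d k A = Phi d k L * mat_diag (rdim d k) (\<lambda>x. ?m (x div ?n) * ?m (x mod ?n)) * Phi d k M"
    unfolding A_def using Lc Mc by (simp add: Phi_mult[OF kd] mult_carrier_mat[of _ d d] Phi_diag[OF kd])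
  then have "(u * t) \<cdot>\<^sub>m Phi d k A = (u \<cdot>\<^sub>m Phi d k L) * mat_diag (rdim d k) f * Phi d k M"
  proof -
    let ?D = "mat_diag (rdim d k) (\<lambda>x. ?m (x div ?n) * ?m (x mod ?n))"
    have "mat_diag (rdim d k) f = t \<cdot>\<^sub>m ?D" by (rule eq_matI) (auto simp: mat_diag_def f_def)
    then have "(u \<cdot>\<^sub>m Phi d k L) * mat_diag (rdim d k) f = (u * t) \<cdot>\<^sub>m (Phi d k L * ?D)"
      by (intro eq_matI) (auto simp: mat_diag_def scalar_prod_def sum_distrib_left ac_simps intro!: sum.cong)
    moreover have "(u * t) \<cdot>\<^sub>m (Phi d k L * ?D) * Phi d k M = (u * t) \<cdot>\<^sub>m (Phi d k L * ?D * Phi d k M)"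
      by (rule mult_smult_assoc_mat[of _ "rdim d k" "rdim d k" _ "rdim d k"]) (auto intro!: mult_carrier_mat[of _ _ "rdim d k"])
    ultimately show ?thesis using \<open>Phi d k A = _\<close> by simp
  qed
  also have "\<dots> = (u \<cdot>\<^sub>m Phi d k L) * mat_diag (rdim d k) (\<lambda>i. of_real (f i)) * Phi d k M" by simp
  finally have e: "singular_values ((u * t) \<cdot>\<^sub>m Phi d k A) = rev (sort (map f [0..<rdim d k]))"
  proof (simp only:, intro singular_values_svd uL Phi_unitary[OF kd M])
    fix x assume "x < rdim d k"
    then have "x < ?n * ?n" by (simp add: rdim_def)
    then show "0 \<le> f x" using divmod_less sprod_pos[OF kd _ s(1)] u(2) by (simp add: f_def less_imp_le)
  qed
  obtain i where i: "i < ?n" "i \<noteq> 0" "?m i = (\<Prod>a=0..<k - 1. s a) * s k" using sprod_second[OF k(2,1)] by blast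
  define P where "P = (\<Prod>a=0..<k - 1. s a)"
  have m0: "?m 0 = P * s (k - 1)"
  proof -
    have "{0..<k} = insert (k - 1) {0..<k - 1}" using k(1) by auto
    then show ?thesis unfolding sprod_0[OF kd] P_def by simp
  qed
  have n0: "0 < ?n" using i(1) by simp
  have mpos: "0 < ?m j" if "j < ?n" for j using sprod_pos[OF kd that s(1)] .
  have P: "0 < P" unfolding P_def using s(1) k by (intro prod_pos) auto
  have sk: "0 < s k" "0 < s (k - 1)" "s k \<le> s (k - 1)" using s k by auto
  have le: "?m j \<le> ?m i" if "j < ?n" "j \<noteq> 0" for j
    using sprod_le[OF kd that k(1) s] i(3) by simp
  have mi0: "?m i \<le> ?m 0" using P sk i(3) m0 by (simp add: P_def)
  have le0: "?m j \<le> ?m 0" if "j < ?n" for j using le[OF that] mi0 by (cases "j = 0") auto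
  have fi: "f i = t * (?m 0 * ?m i)" using i(1) by (simp add: f_def mult.commute)
  have f0: "f 0 = t * (?m 0 * ?m 0)" by (simp add: f_def)
  have top: "f x \<le> f i" if "x < rdim d k" "x \<noteq> 0" for x
  proof -
    have x: "x < ?n * ?n" using that by (simp add: rdim_def)
    note dm = divmod_less[OF x]
    have "x div ?n \<noteq> 0 \<or> x mod ?n \<noteq> 0" using that(2) by (metis div_mod_decomp add.right_neutral mult_0)
    then have "?m (x div ?n) * ?m (x mod ?n) \<le> ?m 0 * ?m i"
    proof
      assume "x div ?n \<noteq> 0"
      then have "?m (x div ?n) * ?m (x mod ?n) \<le> ?m i * ?m 0"
        using le[OF dm(1)] le0[OF dm(2)] mpos[OF dm(1)] mpos[OF dm(2)] mpos[OF i(1)] by (intro mult_mono) auto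
      then show ?thesis by (simp add: mult.commute)
    next
      assume "x mod ?n \<noteq> 0"
      then show ?thesis
        using le[OF dm(2)] le0[OF dm(1)] mpos[OF dm(1)] mpos[OF dm(2)] mpos[OF n0] by (intro mult_mono) auto
    qed
    then show ?thesis using u(2) by (simp add: fi) (simp add: f_def)
  qed
  have "i < rdim d k"
  proof -
    have "i < ?n * 1" using i(1) by simp
    also have "\<dots> \<le> ?n * ?n" using n0 by (intro mult_le_mono2) simp
    finally show ?thesis by (simp add: rdim_def)
  qed
  moreover have "f i \<le> f 0" unfolding fi f0 using mi0 mpos[OF n0] u(2) by simp
  ultimately have "rev (sort (map f [0..<rdim d k])) ! 0 = f 0" "rev (sort (map f [0..<rdim d k])) ! 1 = f i"
    using sort_top_two[of i "rdim d k" f] i(2) top by auto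
  moreover have "?m i = P * s k" using i(3) by (simp add: P_def)
  ultimately show ?thesis unfolding e fi f0 using u(2) P sk by (simp add: m0)
qed

subsection \<open>Grassmannians through unitary frames\<close>

abbreviation cs :: "nat \<Rightarrow> 'a :: rc_field mat \<Rightarrow> 'a vec set" where
  "cs k A \<equiv> column_space k (lcols k A)"

lemma column_space_mult_left:
  assumes "(A :: 'a :: field mat) \<in> carrier_mat m n" "B \<in> carrier_mat n k"
  shows "column_space k (A * B) = (\<lambda>w. A *\<^sub>v w) ` column_space k B"
proof -
  have i: "column_space k M = (\<lambda>v. M *\<^sub>v v) ` carrier_vec k" for M :: "'a mat"
    by (auto simp: column_space_def)
  show ?thesis
    unfolding i image_image by (rule image_cong[OF refl]) (rule assoc_mult_mat_vec[OF assms])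
qed

text \<open>An orthonormal frame of the same subspace is \<open>B * T\<close>, and its form is that
  of \<open>B\<close> times |det T|^2. Since orthonormal frames have trace 1, the factor is the
  inverse of the trace for \<open>B\<close>.\<close>

lemma frame_pv:
  assumes k: "k \<le> d" and B: "B \<in> carrier_mat d k"
    and L: "unitary d L" "column_space k B = cs k L"
  shows "0 < evec (nks d k) \<bullet> pv d k B"
    "pv d k B = (evec (nks d k) \<bullet> pv d k B) \<cdot>\<^sub>v pv d k (lcols k L)"
proof -
  let ?U = "lcols k L" and ?e = "evec (nks d k)"
  have U: "?U \<in> carrier_mat d k" "mat_adjoint ?U * ?U = 1\<^sub>m k"
    using unitaryD(1)[OF L(1)] unitary_lcols[OF L(1) k] by auto
  have "col ?U j \<in> column_space k B" if "j < k" for j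
  proof -
    have "?U *\<^sub>v unit_vec k j \<in> cs k L" by (auto simp: column_space_def)
    moreover have "?U *\<^sub>v unit_vec k j = col ?U j" using U(1) that by (intro eq_vecI) auto
    ultimately show ?thesis using L(2) by simp
  qed
  then obtain T where T: "T \<in> carrier_mat k k" "?U = B * T" using factor_through_column_space[OF B U(1)] by auto
  have "pv d k ?U = (norm (det T))\<^sup>2 \<cdot>\<^sub>v pv d k B" unfolding T(2) by (rule pv_mult_right[OF k B T(1)])
  moreover have "?e \<bullet> ((norm (det T))\<^sup>2 \<cdot>\<^sub>v pv d k B) = (norm (det T))\<^sup>2 * (?e \<bullet> pv d k B)"
    by (rule scalar_prod_smult_right) simp
  moreover have "?e \<bullet> pv d k ?U = 1" by (rule evec_pv_isometric[OF k U])
  ultimately have e: "(norm (det T))\<^sup>2 * (?e \<bullet> pv d k B) = 1" "pv d k ?U = (norm (det T))\<^sup>2 \<cdot>\<^sub>v pv d k B" by simp_all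
  show "0 < ?e \<bullet> pv d k B"
    using e(1) by (metis less_eq_real_def mult_zero_right evec_pv_nonneg zero_neq_one)
  show "pv d k B = (?e \<bullet> pv d k B) \<cdot>\<^sub>v pv d k ?U"
    unfolding e(2) smult_smult_assoc using e(1) by (simp add: mult.commute)
qed

text \<open>The representative of trace 1 on the Pluecker line of \<open>W\<close>; by
  \<open>frame_pv\<close> it is the same for all orthonormal frames of \<open>W\<close>.\<close>

definition pW :: "nat \<Rightarrow> nat \<Rightarrow> ('a :: rc_field) vec set \<Rightarrow> real vec" where
  "pW d k W = pv d k (lcols k (SOME L. unitary d L \<and> W = cs k L))"

lemma pW_frame:
  assumes k: "k \<le> d" and B: "B \<in> carrier_mat d k" "column_space k B \<in> Gr d k"
  shows "0 < evec (nks d k) \<bullet> pv d k B"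
    "pv d k B = (evec (nks d k) \<bullet> pv d k B) \<cdot>\<^sub>v pW d k (column_space k B)"
proof -
  let ?L = "SOME L. unitary d L \<and> column_space k B = cs k L"
  have "unitary d ?L \<and> column_space k B = cs k ?L"
    by (rule someI_ex) (use Gr_unitary(2)[OF B(2)] in blast)
  then show "0 < evec (nks d k) \<bullet> pv d k B"
    "pv d k B = (evec (nks d k) \<bullet> pv d k B) \<cdot>\<^sub>v pW d k (column_space k B)"
    unfolding pW_def using frame_pv[OF k B(1), of ?L] by simp_all
qed

lemma pW_unitary:
  assumes "k \<le> d" "unitary d L"
  shows "pW d k (cs k L) = pv d k (lcols k L)"
proof -
  have U: "lcols k L \<in> carrier_mat d k" "mat_adjoint (lcols k L) * lcols k L = 1\<^sub>m k"
    using unitaryD(1)[OF assms(2)] unitary_lcols[OF assms(2,1)] by auto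
  show ?thesis
    using pW_frame(2)[OF assms(1) U(1) unitary_Gr[OF assms(2,1)]] evec_pv_isometric[OF assms(1) U]
    by (simp add: one_smult_vec)
qed

lemma pW_carrier [simp]: "pW d k W \<in> carrier_vec (rdim d k)" "dim_vec (pW d k W) = rdim d k"
  by (auto simp: pW_def)

lemma evec_pW:
  assumes "W \<in> Gr d k"
  shows "evec (nks d k) \<bullet> pW d k W = 1"
proof -
  obtain L where L: "unitary d L" "W = cs k L" using Gr_unitary(2)[OF assms] by auto
  have k: "k \<le> d" using Gr_unitary(1)[OF assms] .
  show ?thesis unfolding L(2) pW_unitary[OF k L(1)]
    using unitaryD(1)[OF L(1)] unitary_lcols[OF L(1) k] by (intro evec_pv_isometric[OF k]) auto
qed

lemma Gr_image:
  assumes W: "(W :: 'a :: rc_field vec set) \<in> Gr d k" and A: "A \<in> carrier_mat d d" "det A \<noteq> 0"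
  shows "mat_image A W \<in> Gr d k"
proof -
  obtain L where L: "unitary d L" "W = cs k L" using Gr_unitary(2)[OF W] by auto
  have k: "k \<le> d" using Gr_unitary(1)[OF W] .
  let ?U = "lcols k L"
  have U: "?U \<in> carrier_mat d k" "mat_adjoint ?U * ?U = 1\<^sub>m k"
    using unitaryD(1)[OF L(1)] unitary_lcols[OF L(1) k] by auto
  have "column_space k (A * ?U) \<in> Gr d k"
  proof (rule Gr_column_space)
    fix v assume v: "v \<in> carrier_vec k" "(A * ?U) *\<^sub>v v = 0\<^sub>v d"
    then have "A *\<^sub>v (?U *\<^sub>v v) = 0\<^sub>v d" using A U by (simp add: assoc_mult_mat_vec[of _ d d _ k])
    moreover have "?U *\<^sub>v v \<in> carrier_vec d" using U v by auto
    ultimately have "?U *\<^sub>v v = 0\<^sub>v d" using A det_0_iff_vec_prod_zero_field[OF A(1)] by blast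
    then show "v = 0\<^sub>v k" using isometric_injective[OF U v(1)] by simp
  qed (use A U in auto)
  then show ?thesis unfolding L(2) column_space_mult_left[OF A(1) U(1)] .
qed

lemma Phi_pW:
  assumes W: "W \<in> Gr d k" and A: "A \<in> carrier_mat d d" "det A \<noteq> 0"
  shows "0 < evec (nks d k) \<bullet> (Phi d k A *\<^sub>v pW d k W)"
    "Phi d k A *\<^sub>v pW d k W = (evec (nks d k) \<bullet> (Phi d k A *\<^sub>v pW d k W)) \<cdot>\<^sub>v pW d k (mat_image A W)"
proof -
  obtain L where L: "unitary d L" "W = cs k L" using Gr_unitary(2)[OF W] by auto
  have k: "k \<le> d" using Gr_unitary(1)[OF W] .
  have U: "lcols k L \<in> carrier_mat d k" using unitaryD(1)[OF L(1)] by auto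
  have e: "Phi d k A *\<^sub>v pW d k W = pv d k (A * lcols k L)"
    unfolding L(2) pW_unitary[OF k L(1)] by (rule Phi_pv[OF k A(1) U])
  have i: "column_space k (A * lcols k L) = mat_image A W"
    unfolding L(2) by (rule column_space_mult_left[OF A(1) U])
  show "0 < evec (nks d k) \<bullet> (Phi d k A *\<^sub>v pW d k W)"
    "Phi d k A *\<^sub>v pW d k W = (evec (nks d k) \<bullet> (Phi d k A *\<^sub>v pW d k W)) \<cdot>\<^sub>v pW d k (mat_image A W)"
    unfolding e using pW_frame[OF k, of "A * lcols k L"] A U Gr_image[OF W A] i by auto
qed

lemma cs_iff:
  assumes L: "unitary d L" and k: "k \<le> d"
  shows "w \<in> cs k L \<longleftrightarrow> w \<in> carrier_vec d \<and> (\<forall>i. k \<le> i \<longrightarrow> i < d \<longrightarrow> (mat_adjoint L *\<^sub>v w) $ i = 0)"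
    and "cs k L = {L *\<^sub>v v | v. v \<in> carrier_vec d \<and> (\<forall>i<d. k \<le> i \<longrightarrow> v $ i = 0)}"
proof -
  note Lc = unitaryD[OF L]
  let ?R = "{L *\<^sub>v v | v. v \<in> carrier_vec d \<and> (\<forall>i<d. k \<le> i \<longrightarrow> v $ i = 0)}"
  have split: "(\<Sum>j=0..<d. f j) = (\<Sum>j=0..<k. f j) + (\<Sum>j\<in>{k..<d}. f j)" for f :: "nat \<Rightarrow> 'a"
    using sum.atLeastLessThan_concat[of 0 k d f] k by simp
  have ext: "lcols k L *\<^sub>v vec k (\<lambda>i. v $ i) = L *\<^sub>v v" if "v \<in> carrier_vec d" "\<forall>i<d. k \<le> i \<longrightarrow> v $ i = 0" for v
    using that Lc(1) by (intro eq_vecI) (auto simp: scalar_prod_def split lcols_def)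
  show 1: "cs k L = ?R"
  proof (intro equalityI subsetI)
    fix x assume "x \<in> cs k L"
    then obtain v where v: "v \<in> carrier_vec k" "x = lcols k L *\<^sub>v v" by (auto simp: column_space_def)
    define v' where "v' = vec d (\<lambda>i. if i < k then v $ i else 0)"
    have "vec k (\<lambda>i. v' $ i) = v" using v(1) k by (intro eq_vecI) (auto simp: v'_def)
    then have "x = L *\<^sub>v v'" using ext[of v'] v by (auto simp: v'_def)
    then show "x \<in> ?R" by (auto simp: v'_def intro!: exI[of _ v'])
  next
    fix x assume "x \<in> ?R"
    then obtain v where "v \<in> carrier_vec d" "\<forall>i<d. k \<le> i \<longrightarrow> v $ i = 0" "x = L *\<^sub>v v" by auto
    then show "x \<in> cs k L" using ext[of v] by (auto simp: column_space_def intro!: exI[of _ "vec k (\<lambda>i. v $ i)"])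
  qed
  show "w \<in> cs k L \<longleftrightarrow> w \<in> carrier_vec d \<and> (\<forall>i. k \<le> i \<longrightarrow> i < d \<longrightarrow> (mat_adjoint L *\<^sub>v w) $ i = 0)"
  proof
    assume "w \<in> cs k L"
    then obtain v where v: "v \<in> carrier_vec d" "\<forall>i<d. k \<le> i \<longrightarrow> v $ i = 0" "w = L *\<^sub>v v" unfolding 1 by auto
    have "mat_adjoint L *\<^sub>v w = (mat_adjoint L * L) *\<^sub>v v"
      unfolding v(3) using Lc(1) v(1) by (intro assoc_mult_mat_vec[symmetric]) auto
    then have "mat_adjoint L *\<^sub>v w = v" using Lc(2) v(1) by simp
    then show "w \<in> carrier_vec d \<and> (\<forall>i. k \<le> i \<longrightarrow> i < d \<longrightarrow> (mat_adjoint L *\<^sub>v w) $ i = 0)"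
      using v Lc(1) by auto
  next
    assume w: "w \<in> carrier_vec d \<and> (\<forall>i. k \<le> i \<longrightarrow> i < d \<longrightarrow> (mat_adjoint L *\<^sub>v w) $ i = 0)"
    have "L *\<^sub>v (mat_adjoint L *\<^sub>v w) = (L * mat_adjoint L) *\<^sub>v w"
      using Lc(1) w by (intro assoc_mult_mat_vec[symmetric]) auto
    then have "w = L *\<^sub>v (mat_adjoint L *\<^sub>v w)" using Lc(3) w by simp
    moreover have "mat_adjoint L *\<^sub>v w \<in> carrier_vec d" using Lc(1) w by (intro mult_mat_vec_carrier[of _ d d]) auto
    ultimately show "w \<in> cs k L" unfolding 1 using w by blast
  qed
qed

lemma cs_eqI:
  assumes L: "unitary d L" and M: "unitary d M" and k: "k \<le> d"
    and z: "\<And>i j. k \<le> i \<Longrightarrow> i < d \<Longrightarrow> j < k \<Longrightarrow> (mat_adjoint M * L) $$ (i, j) = 0"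
  shows "cs k L \<subseteq> cs k M"
proof
  note Lc = unitaryD[OF L] and Mc = unitaryD[OF M]
  fix w assume "w \<in> cs k L"
  then obtain v where v: "v \<in> carrier_vec d" "\<forall>i<d. k \<le> i \<longrightarrow> v $ i = 0" "w = L *\<^sub>v v" unfolding cs_iff(2)[OF L k] by auto
  have T: "mat_adjoint M * L \<in> carrier_mat d d" using Lc Mc by auto
  have "mat_adjoint M *\<^sub>v w = (mat_adjoint M * L) *\<^sub>v v"
    unfolding v(3) using Lc(1) Mc(1) v(1) by (intro assoc_mult_mat_vec[symmetric]) auto
  moreover have "((mat_adjoint M * L) *\<^sub>v v) $ i = 0" if "k \<le> i" "i < d" for i
    unfolding index_mult_vec_sum[OF T v(1) that(2)]
  proof (rule sum.neutral, rule ballI)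
    fix l assume "l \<in> {0..<d}"
    then show "(mat_adjoint M * L) $$ (i, l) * v $ l = 0" using z[OF that, of l] v(2) by (cases "l < k") auto
  qed
  ultimately show "w \<in> cs k M" unfolding cs_iff(1)[OF M k] using v(1,3) Lc(1) by auto
qed

subsection \<open>The Pluecker embedding is injective\<close>

text \<open>The leading k rows \<open>B0\<close> form an invertible block, and dividing by it makes
  the leading block of \<open>X\<close> the identity. Then the minors in which one leading index is
  exchanged are, up to sign, single entries of \<open>X\<close>.\<close>

lemma plucker_block:
  assumes k: "k \<le> d" and B: "B \<in> carrier_mat d k"
    and z: "\<And>i. i < nks d k \<Longrightarrow> i \<noteq> 0 \<Longrightarrow> cve d k B i = 0" and nz: "cve d k B 0 \<noteq> 0"
    and b: "k \<le> b" "b < d" and a: "a < k"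
  shows "B $$ (b, a) = 0"
proof -
  define B0 where "B0 = mat k k (\<lambda>(a, b). B $$ (a, b))"
  have B0: "B0 \<in> carrier_mat k k" by (simp add: B0_def)
  have "mat k k (\<lambda>(a, b). B $$ (kel d k 0 a, b)) = B0" by (rule eq_matI) (auto simp: B0_def kel_0[OF k])
  then have "det B0 \<noteq> 0" using nz by (simp add: cve_def)
  then obtain Y where Y: "Y \<in> carrier_mat k k" "B0 * Y = 1\<^sub>m k" "Y * B0 = 1\<^sub>m k" using det_inverse[OF B0] by auto
  define X where "X = B * Y"
  have X: "X \<in> carrier_mat d k" using B Y by (simp add: X_def)
  have Xtop: "X $$ (i, j) = (if i = j then 1 else 0)" if "i < k" "j < k" for i j
  proof -
    have "X $$ (i, j) = (\<Sum>l=0..<k. B $$ (i, l) * Y $$ (l, j))"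
      unfolding X_def by (rule index_mult_sum[OF B Y(1)]) (use that k in auto)
    also have "\<dots> = (\<Sum>l=0..<k. B0 $$ (i, l) * Y $$ (l, j))" using that by (intro sum.cong) (auto simp: B0_def)
    also have "\<dots> = (B0 * Y) $$ (i, j)" by (rule index_mult_sum[OF B0 Y(1) that, symmetric])
    finally have "X $$ (i, j) = (B0 * Y) $$ (i, j)" .
    then show ?thesis using Y(2) that by simp
  qed
  have zX: "cve d k X i = 0" if "i < nks d k" "i \<noteq> 0" for i
    unfolding X_def cve_mult_right[OF k B Y(1) that(1)] using z[OF that] by simp
  have Xb: "X $$ (b, a) = 0" if a: "a < k" for a
  proof (rule ccontr)
    assume n: "X $$ (b, a) \<noteq> 0"
    \<comment> \<open>The minor on these rows vanishes. A kernel vector has to be zero at every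
      index other than a because of the identity rows, and at a because of row b, since the entry
      there is assumed nonzero.\<close>
    let ?I = "insert b ({0..<k} - {a})"
    have "card ?I = k" "?I \<subseteq> {0..<d}" using a b k by auto
    then obtain i where i: "i < nks d k" "kset d k i = ?I" using kset_surj[OF k] by blast
    have "i \<noteq> 0"
    proof
      assume "i = 0"
      then have "b \<in> {0..<k}" using i(2) kset_bij(2)[OF k] by (metis insertI1)
      then show False using b(1) by simp
    qed
    let ?M = "mat k k (\<lambda>(r, c). X $$ (kel d k i r, c))"
    have M: "?M \<in> carrier_mat k k" by auto
    have "det ?M = 0" using zX[OF i(1) \<open>i \<noteq> 0\<close>] by (simp add: cve_def)
    then obtain v where v: "v \<in> carrier_vec k" "v \<noteq> 0\<^sub>v k" "?M *\<^sub>v v = 0\<^sub>v k"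
      using det_0_iff_vec_prod_zero_field[OF M] by auto
    have row: "(\<Sum>c=0..<k. X $$ (r, c) * v $ c) = 0" if "r \<in> ?I" for r
    proof -
      have "r \<in> kel d k i ` {0..<k}" unfolding kel_image(1)[OF k i(1)] i(2) by (rule that)
      then obtain r' where r': "r' < k" "kel d k i r' = r" by auto
      have "(?M *\<^sub>v v) $ r' = (\<Sum>c=0..<k. X $$ (r, c) * v $ c)"
        unfolding index_mult_vec_sum[OF M v(1) r'(1)] using r' by (intro sum.cong) auto
      then show ?thesis using v(3) r'(1) by simp
    qed
    have vr: "v $ r = 0" if "r < k" "r \<noteq> a" for r
    proof -
      have "(\<Sum>c=0..<k. X $$ (r, c) * v $ c) = (\<Sum>c=0..<k. if r = c then v $ c else 0)"
        using that by (intro sum.cong) (auto simp: Xtop)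
      then show ?thesis using row[of r] that by simp
    qed
    have "(\<Sum>c=0..<k. X $$ (b, c) * v $ c) = (\<Sum>c=0..<k. if c = a then X $$ (b, a) * v $ a else 0)"
      by (intro sum.cong) (auto simp: vr)
    then have "v $ a = 0" using row[of b] a n by simp
    then have "v $ r = 0" if "r < k" for r using vr[OF that] by (cases "r = a") auto
    then have "v = 0\<^sub>v k" using v(1) by (intro eq_vecI) auto
    then show False using v(2) by simp
  qed
  have "B = X * B0" unfolding X_def using B Y B0 by (simp add: assoc_mult_mat[of _ d k _ k _ k])
  then have "B $$ (b, a) = (\<Sum>l=0..<k. X $$ (b, l) * B0 $$ (l, a))"
    using index_mult_sum[OF X B0 b(2) a] by simp
  also have "\<dots> = 0" using Xb by (intro sum.neutral) auto
  finally show ?thesis .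
qed

text \<open>Moving both frames by the adjoint of \<open>M\<close> makes the second one standard, and
  only its leading Pluecker coordinate is nonzero. Equality of the forms forces the same for the
  first frame, whose lower rows then vanish by \<open>plucker_block\<close>.\<close>

theorem pv_injective:
  assumes k: "k \<le> d" and L: "unitary d L" and M: "unitary d M"
    and e: "pv d k (lcols k L) = pv d k (lcols k M)"
  shows "cs k L = cs k M"
proof -
  have sub: "cs k L \<subseteq> cs k M" if L: "unitary d L" and M: "unitary d M"
    and e: "pv d k (lcols k L) = pv d k (lcols k M)" for L M :: "'a mat"
  proof -
    note Lc = unitaryD[OF L] and Mc = unitaryD[OF M]
    let ?T = "mat_adjoint M * L" and ?n = "nks d k"
    have T: "?T \<in> carrier_mat d d" using Lc Mc by auto
    have uT: "unitary d ?T" by (intro unitary_mult unitary_adj L M)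
    have n0: "0 < ?n" using kset_bij(3)[OF k] .
    have "pv d k (lcols k ?T) = pv d k (mat_adjoint M * lcols k L)"
      using lcols_mult[of "mat_adjoint M" d d L d k] Lc Mc k by simp
    also have "\<dots> = pv d k (mat_adjoint M * lcols k M)"
      unfolding Phi_pv[OF k adj_carrier[OF Mc(1)] lcols_carrier[OF Lc(1)], symmetric] e
      by (rule Phi_pv[OF k adj_carrier[OF Mc(1)] lcols_carrier[OF Mc(1)]])
    also have "mat_adjoint M * lcols k M = lcols k (1\<^sub>m d)"
      using lcols_mult[of "mat_adjoint M" d d M d k] Mc k by simp
    finally have pT: "pv d k (lcols k ?T) = pv d k (lcols k (1\<^sub>m d :: 'a mat))" .
    \<comment> \<open>The diagonal entry (i, i) of the form sits at position i * n + i; it is real,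
      so Re + Im is the entry itself.\<close>
    have diag: "(cmod (cve d k B i))\<^sup>2 = pv d k B $ (i * ?n + i)" if "i < ?n" for B :: "'a mat" and i
    proof -
      have "i * ?n + i < ?n * ?n" using that by (metis add.commute add_less_le_mono mult_Suc Suc_leI mult_le_mono1 add_lessD1 less_le_trans nat_add_left_cancel_less)
      then have "pv d k B $ (i * ?n + i) = Re (cve d k B i * cnj (cve d k B i)) + Im (cve d k B i * cnj (cve d k B i))"
        using that by (simp add: pv_def zeta_def)
      then show ?thesis unfolding complex_norm_square[symmetric] by simp
    qed
    have c: "cmod (cve d k (lcols k ?T) i) = (if i = 0 then 1 else 0)" if "i < ?n" for i
    proof -
      have "(cmod (cve d k (lcols k ?T) i))\<^sup>2 = (cmod (cve d k (lcols k (1\<^sub>m d :: 'a mat)) i))\<^sup>2"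
        using diag[OF that, of "lcols k ?T"] diag[OF that, of "lcols k (1\<^sub>m d)"] pT by simp
      also have "cve d k (lcols k (1\<^sub>m d :: 'a mat)) i = (if i = 0 then 1 else 0)"
        using cve_lcols[OF k one_carrier_mat that, where 'a = 'a] cme_one[OF k that n0, where 'a = 'a] by simp
      finally show ?thesis by (auto split: if_splits simp: power2_eq_1_iff)
    qed
    have "lcols k ?T \<in> carrier_mat d k" using T by auto
    note pb = plucker_block[OF k this]
    show ?thesis
    proof (rule cs_eqI[OF L M k])
      fix i j assume ij: "k \<le> i" "i < d" "j < k"
      have "lcols k ?T $$ (i, j) = 0"
      proof (rule pb[OF _ _ ij])
        show "cve d k (lcols k ?T) i = 0" if "i < ?n" "i \<noteq> 0" for i using c[OF that(1)] that(2) by simp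
        show "cve d k (lcols k ?T) 0 \<noteq> 0" using c[OF n0] by auto
      qed
      then show "?T $$ (i, j) = 0" using ij Mc(1) by simp
    qed
  qed
  show ?thesis using sub[OF L M e] sub[OF M L e[symmetric]] by simp
qed

lemma pW_injective:
  assumes "V \<in> Gr d k" "W \<in> Gr d k" "pW d k V = pW d k W"
  shows "V = W"
proof -
  obtain L where L: "unitary d L" "V = cs k L" using Gr_unitary(2)[OF assms(1)] by auto
  obtain M where M: "unitary d M" "W = cs k M" using Gr_unitary(2)[OF assms(2)] by auto
  have k: "k \<le> d" using Gr_unitary(1)[OF assms(1)] .
  show ?thesis using pv_injective[OF k L(1) M(1)] assms(3) unfolding L(2) M(2)
    by (simp add: pW_unitary[OF k] L(1) M(1))
qed

subsection \<open>Orthogonal complements and transversality\<close>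

definition perp :: "nat \<Rightarrow> ('a :: rc_field) vec set \<Rightarrow> 'a vec set" where
  "perp d W = {v \<in> carrier_vec d. \<forall>w\<in>W. (\<Sum>i=0..<d. conjugate (w $ i) * v $ i) = 0}"

text \<open>Reversing the columns of a unitary matrix moves its last columns to the front, so
  orthogonal complements of spans of first columns are again spans of first columns. The same
  reversal restores the decreasing order of singular values for inverses.\<close>

definition revc :: "'a mat \<Rightarrow> 'a mat" where
  "revc L = mat (dim_row L) (dim_col L) (\<lambda>(i, j). L $$ (i, dim_col L - 1 - j))"

lemma revc_carrier [simp]: "L \<in> carrier_mat n d \<Longrightarrow> revc L \<in> carrier_mat n d"
  by (auto simp: revc_def)

lemma revc_dim [simp]: "dim_row (revc L) = dim_row L" "dim_col (revc L) = dim_col L"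
  by (auto simp: revc_def)

lemma revc_index: "L \<in> carrier_mat n d \<Longrightarrow> i < n \<Longrightarrow> j < d \<Longrightarrow> revc L $$ (i, j) = L $$ (i, d - 1 - j)"
  by (auto simp: revc_def)

lemma revc_revc: "L \<in> carrier_mat n d \<Longrightarrow> revc (revc L) = L"
  by (rule eq_matI) (auto simp: revc_def)

lemma revc_unitary:
  assumes "unitary d (L :: 'a :: rc_field mat)"
  shows "unitary d (revc L)"
  using adj_mult_self_eq_one_iff[OF unitaryD(1)[OF assms]] unitaryD(1,2)[OF assms]
  unfolding unitary_def adj_mult_self_eq_one_iff[OF revc_carrier[OF unitaryD(1)[OF assms]]]
  by (auto simp: revc_index)

lemma adj_revc_vec:
  assumes "(L :: 'a :: rc_field mat) \<in> carrier_mat d d" "w \<in> carrier_vec d" "i < d"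
  shows "(mat_adjoint (revc L) *\<^sub>v w) $ i = (mat_adjoint L *\<^sub>v w) $ (d - 1 - i)"
  using assms revc_carrier[OF assms(1)]
  by (subst (1 2) index_mult_vec_sum[of _ d d]) (auto simp: revc_index intro!: sum.cong)

lemma adj_inner:
  assumes X: "(X :: 'a :: rc_field mat) \<in> carrier_mat d d" and w: "w \<in> carrier_vec d" and v: "v \<in> carrier_vec d"
  shows "(\<Sum>i=0..<d. conjugate ((X *\<^sub>v w) $ i) * v $ i) = (\<Sum>i=0..<d. conjugate (w $ i) * (mat_adjoint X *\<^sub>v v) $ i)"
proof -
  have "(\<Sum>i=0..<d. conjugate ((X *\<^sub>v w) $ i) * v $ i) = (\<Sum>i=0..<d. \<Sum>l=0..<d. conjugate (X $$ (i, l)) * conjugate (w $ l) * v $ i)"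
    by (intro sum.cong refl) (simp add: index_mult_vec_sum[OF X w] sum_conjugate conjugate_dist_mul sum_distrib_right)
  also have "\<dots> = (\<Sum>l=0..<d. \<Sum>i=0..<d. conjugate (X $$ (i, l)) * conjugate (w $ l) * v $ i)" by (rule sum.swap)
  also have "\<dots> = (\<Sum>i=0..<d. conjugate (w $ i) * (mat_adjoint X *\<^sub>v v) $ i)"
  proof (intro sum.cong refl)
    fix l assume "l \<in> {0..<d}"
    then have "(mat_adjoint X *\<^sub>v v) $ l = (\<Sum>i=0..<d. conjugate (X $$ (i, l)) * v $ i)"
      using index_mult_vec_sum[OF adj_carrier[OF X] v, of l] X by simp
    then show "(\<Sum>i=0..<d. conjugate (X $$ (i, l)) * conjugate (w $ l) * v $ i) = conjugate (w $ l) * (mat_adjoint X *\<^sub>v v) $ l"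
      by (simp only: sum_distrib_left mult_ac)
  qed
  finally show ?thesis .
qed

lemma perp_revc:
  assumes L: "unitary d L" and k: "k \<le> d"
  shows "perp d (cs (d - k) (revc L)) = cs k L"
proof (intro equalityI subsetI)
  note Lc = unitaryD[OF L] and uR = revc_unitary[OF L]
  note Rc = unitaryD[OF uR]
  note inner = adj_inner[OF Rc(1)]
  {
    fix v assume "v \<in> perp d (cs (d - k) (revc L))"
    then have v: "v \<in> carrier_vec d" "\<And>w. w \<in> cs (d - k) (revc L) \<Longrightarrow> (\<Sum>i=0..<d. conjugate (w $ i) * v $ i) = 0"
      by (auto simp: perp_def)
    have "(mat_adjoint L *\<^sub>v v) $ i = 0" if i: "k \<le> i" "i < d" for i
    proof -
      let ?x = "unit_vec d (d - 1 - i) :: 'a vec"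
      have "revc L *\<^sub>v ?x \<in> cs (d - k) (revc L)"
        unfolding cs_iff(2)[OF uR diff_le_self] using i by (auto intro!: exI[of _ ?x])
      then have "(\<Sum>j=0..<d. conjugate (?x $ j) * (mat_adjoint (revc L) *\<^sub>v v) $ j) = 0"
        using v(2) inner[OF _ v(1), of ?x] by simp
      moreover have "(\<Sum>j=0..<d. conjugate (?x $ j) * (mat_adjoint (revc L) *\<^sub>v v) $ j) =
        (\<Sum>j=0..<d. if j = d - 1 - i then (mat_adjoint (revc L) *\<^sub>v v) $ j else 0)"
        using i by (intro sum.cong) auto
      ultimately have "(mat_adjoint (revc L) *\<^sub>v v) $ (d - 1 - i) = 0" using i by simp
      then show ?thesis using adj_revc_vec[OF Lc(1) v(1), of "d - 1 - i"] i by simp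
    qed
    then show "v \<in> cs k L" unfolding cs_iff(1)[OF L k] using v(1) by simp
  }
  {
    fix v assume "v \<in> cs k L"
    then have v: "v \<in> carrier_vec d" "\<And>i. k \<le> i \<Longrightarrow> i < d \<Longrightarrow> (mat_adjoint L *\<^sub>v v) $ i = 0"
      unfolding cs_iff(1)[OF L k] by auto
    have "(\<Sum>i=0..<d. conjugate (w $ i) * v $ i) = 0" if wR: "w \<in> cs (d - k) (revc L)" for w
    proof -
      obtain x where x: "x \<in> carrier_vec d" "\<forall>i<d. d - k \<le> i \<longrightarrow> x $ i = 0" "w = revc L *\<^sub>v x"
        using wR unfolding cs_iff(2)[OF uR diff_le_self] by blast
      have "conjugate (x $ j) * (mat_adjoint (revc L) *\<^sub>v v) $ j = 0" if j: "j < d" for j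
        using x(2) j v(2)[of "d - 1 - j"] adj_revc_vec[OF Lc(1) v(1) j] by (cases "d - k \<le> j") auto
      then show ?thesis unfolding x(3) inner[OF x(1) v(1)] by (intro sum.neutral) auto
    qed
    then show "v \<in> perp d (cs (d - k) (revc L))" using v(1) by (auto simp: perp_def)
  }
qed

lemma Gr_codim_unitary:
  assumes "W \<in> Gr d (d - k)" "k \<le> d"
  shows "\<exists>M. unitary d M \<and> W = cs (d - k) (revc M) \<and> perp d W = cs k M"
proof -
  obtain L where L: "unitary d L" "W = cs (d - k) L" using Gr_unitary(2)[OF assms(1)] by auto
  have "revc (revc L) = L" by (rule revc_revc[OF unitaryD(1)[OF L(1)]])
  then show ?thesis
    using perp_revc[OF revc_unitary[OF L(1)] assms(2)] revc_unitary[OF L(1)] L(2) by (intro exI[of _ "revc L"]) auto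
qed

text \<open>The orthogonal complement of a (d - k)-plane is a k-plane, so the functional is given by
  a vector of the same space through the scalar product.\<close>

definition qW :: "nat \<Rightarrow> nat \<Rightarrow> ('a :: rc_field) vec set \<Rightarrow> real vec" where
  "qW d k W = pW d k (perp d W)"

lemma qW_carrier [simp]: "qW d k W \<in> carrier_vec (rdim d k)" "dim_vec (qW d k W) = rdim d k"
  by (auto simp: qW_def)

lemma perp_Gr: "W \<in> Gr d (d - k) \<Longrightarrow> k \<le> d \<Longrightarrow> perp d W \<in> Gr d k"
  using Gr_codim_unitary unitary_Gr by metis

lemma pW_dot_nonneg:
  assumes "(V :: 'a :: rc_field vec set) \<in> Gr d k" "W \<in> Gr d k"
  shows "0 \<le> pW d k V \<bullet> pW d k (W :: 'a :: rc_field vec set)"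
proof -
  obtain L where L: "unitary d L" "V = cs k L" using Gr_unitary(2)[OF assms(1)] by auto
  obtain M where M: "unitary d M" "W = cs k M" using Gr_unitary(2)[OF assms(2)] by auto
  have k: "k \<le> d" using Gr_unitary(1)[OF assms(1)] .
  show ?thesis
    unfolding L(2) M(2) pW_unitary[OF k L(1)] pW_unitary[OF k M(1)]
    using pv_dot[OF k, of "lcols k L" "lcols k M"] unitaryD(1)[OF L(1)] unitaryD(1)[OF M(1)] by simp
qed

text \<open>\<open>V\<close> and \<open>W\<close> span everything exactly if the orthogonal
  projection of \<open>V\<close> to the complement of \<open>W\<close> is onto. In orthonormal bases
  this projection has the matrix \<open>?X\<close>, and the scalar product of the two forms is |det
  X|^2.\<close>

theorem transverse_iff:
  assumes V: "V \<in> Gr d k" and W: "(W :: 'a :: rc_field vec set) \<in> Gr d (d - k)"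
  shows "transverse_subspaces d V W \<longleftrightarrow> pW d k V \<bullet> qW d k W \<noteq> 0"
proof -
  have k: "k \<le> d" using Gr_unitary(1)[OF V] .
  obtain L where L: "unitary d L" "V = cs k L" using Gr_unitary(2)[OF V] by auto
  obtain M where M: "unitary d M" "W = cs (d - k) (revc M)" "perp d W = cs k M" using Gr_codim_unitary[OF W k] by auto
  note Lc = unitaryD[OF L(1)] and Mc = unitaryD[OF M(1)]
  let ?X = "mat_adjoint (lcols k M) * lcols k L"
  have X: "?X \<in> carrier_mat k k" using Lc Mc by (intro mult_carrier_mat[of _ k d]) auto
  have dot: "pW d k V \<bullet> qW d k W = (norm (det ?X))\<^sup>2"
    unfolding qW_def L(2) M(3) pW_unitary[OF k L(1)] pW_unitary[OF k M(1)]
    by (rule pv_dot[OF k lcols_carrier[OF Lc(1)] lcols_carrier[OF Mc(1)]])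
  have Xx: "?X *\<^sub>v x = vec k (\<lambda>i. (mat_adjoint M *\<^sub>v (lcols k L *\<^sub>v x)) $ i)" if "x \<in> carrier_vec k" for x
  proof -
    have "?X *\<^sub>v x = mat_adjoint (lcols k M) *\<^sub>v (lcols k L *\<^sub>v x)"
      using that Lc(1) Mc(1) by (intro assoc_mult_mat_vec[of _ k d _ k]) auto
    also have "\<dots> = vec k (\<lambda>i. (mat_adjoint M *\<^sub>v (lcols k L *\<^sub>v x)) $ i)"
    proof (rule eq_vecI)
      fix i assume "i < dim_vec (vec k (\<lambda>i. (mat_adjoint M *\<^sub>v (lcols k L *\<^sub>v x)) $ i))"
      then have i: "i < k" by simp
      have y: "lcols k L *\<^sub>v x \<in> carrier_vec d" using that Lc(1) by (intro mult_mat_vec_carrier[of _ d k]) auto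
      have "(mat_adjoint (lcols k M) *\<^sub>v (lcols k L *\<^sub>v x)) $ i = (mat_adjoint M *\<^sub>v (lcols k L *\<^sub>v x)) $ i"
        using i k Mc(1) y index_mult_vec_sum[OF adj_carrier[OF lcols_carrier[OF Mc(1)]] y i]
          index_mult_vec_sum[OF adj_carrier[OF Mc(1)] y, of i]
        by (auto simp: lcols_def)
      then show "(mat_adjoint (lcols k M) *\<^sub>v (lcols k L *\<^sub>v x)) $ i = vec k (\<lambda>i. (mat_adjoint M *\<^sub>v (lcols k L *\<^sub>v x)) $ i) $ i"
        using i by simp
    qed (use Mc in \<open>auto simp: lcols_def\<close>)
    finally show ?thesis .
  qed
  have inW: "w \<in> W \<longleftrightarrow> w \<in> carrier_vec d \<and> (\<forall>i<k. (mat_adjoint M *\<^sub>v w) $ i = 0)" for w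
  proof -
    have "w \<in> W \<longleftrightarrow> w \<in> carrier_vec d \<and> (\<forall>i. d - k \<le> i \<longrightarrow> i < d \<longrightarrow> (mat_adjoint (revc M) *\<^sub>v w) $ i = 0)"
      unfolding M(2) by (rule cs_iff(1)[OF revc_unitary[OF M(1)] diff_le_self])
    also have "\<dots> \<longleftrightarrow> w \<in> carrier_vec d \<and> (\<forall>i<k. (mat_adjoint M *\<^sub>v w) $ i = 0)"
    proof (intro conj_cong refl iffI allI impI)
      fix i assume w: "w \<in> carrier_vec d" and a: "\<forall>i. d - k \<le> i \<longrightarrow> i < d \<longrightarrow> (mat_adjoint (revc M) *\<^sub>v w) $ i = 0" and i: "i < k"
      have "(mat_adjoint (revc M) *\<^sub>v w) $ (d - 1 - i) = 0" using a i k by simp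
      then show "(mat_adjoint M *\<^sub>v w) $ i = 0" using adj_revc_vec[OF Mc(1) w, of "d - 1 - i"] i k by simp
    next
      fix i assume w: "w \<in> carrier_vec d" and a: "\<forall>i<k. (mat_adjoint M *\<^sub>v w) $ i = 0" and i: "d - k \<le> i" "i < d"
      show "(mat_adjoint (revc M) *\<^sub>v w) $ i = 0" using adj_revc_vec[OF Mc(1) w i(2)] a i by simp
    qed
    finally show ?thesis .
  qed
  have MM: "mat_adjoint M *\<^sub>v (M *\<^sub>v y) = y" if "y \<in> carrier_vec d" for y
    using assoc_mult_mat_vec[of "mat_adjoint M" d d M d y] Mc that by simp
  have "transverse_subspaces d V W \<longleftrightarrow> det ?X \<noteq> 0"
  proof
    assume t: "transverse_subspaces d V W"
    have "col (1\<^sub>m k) j \<in> column_space k ?X" if j: "j < k" for j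
    proof -
      let ?y = "unit_vec d j :: 'a vec"
      have "M *\<^sub>v ?y \<in> carrier_vec d" using Mc(1) by auto
      then have "M *\<^sub>v ?y \<in> {v + w | v w. v \<in> V \<and> w \<in> W}" using t unfolding transverse_subspaces_def by simp
      then obtain v w where vw: "v \<in> V" "w \<in> W" "M *\<^sub>v ?y = v + w" by blast
      obtain x where x: "x \<in> carrier_vec k" "v = lcols k L *\<^sub>v x" using vw(1) L(2) by (auto simp: column_space_def)
      have vc: "v \<in> carrier_vec d" using x Lc(1) by (auto intro: mult_mat_vec_carrier[of _ d k])
      have wc: "w \<in> carrier_vec d" and w0: "\<And>i. i < k \<Longrightarrow> (mat_adjoint M *\<^sub>v w) $ i = 0" using inW vw(2) by auto
      have "?y = mat_adjoint M *\<^sub>v v + mat_adjoint M *\<^sub>v w"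
        using MM[of ?y] vw(3) mult_add_distrib_mat_vec[OF adj_carrier[OF Mc(1)] vc wc] by simp
      then have "?y $ i = (mat_adjoint M *\<^sub>v v) $ i" if "i < k" for i
        using w0[OF that] that k Mc(1) by simp
      then have "col (1\<^sub>m k) j = ?X *\<^sub>v x"
        unfolding Xx[OF x(1)] x(2)[symmetric] using j k by (intro eq_vecI) (auto simp: unit_vec_def)
      then show ?thesis using x(1) by (auto simp: column_space_def)
    qed
    then obtain T where T: "T \<in> carrier_mat k k" "1\<^sub>m k = ?X * T"
      using factor_through_column_space[OF X one_carrier_mat] by auto
    show "det ?X \<noteq> 0" using mult_eq_one_det[OF X T(1) T(2)[symmetric]] by auto
  next
    assume "det ?X \<noteq> 0"
    then obtain Y where Y: "Y \<in> carrier_mat k k" "?X * Y = 1\<^sub>m k" using det_inverse[OF X] by auto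
    have "z \<in> {v + w | v w. v \<in> V \<and> w \<in> W}" if z: "z \<in> carrier_vec d" for z
    proof -
      let ?y = "vec k (\<lambda>i. (mat_adjoint M *\<^sub>v z) $ i)"
      let ?x = "Y *\<^sub>v ?y"
      have x: "?x \<in> carrier_vec k" using Y by auto
      have "?X *\<^sub>v ?x = (?X * Y) *\<^sub>v ?y" using X Y(1) by (intro assoc_mult_mat_vec[symmetric]) auto
      then have Xy: "?X *\<^sub>v ?x = ?y" unfolding Y(2) by simp
      let ?v = "lcols k L *\<^sub>v ?x"
      have v: "?v \<in> V" "?v \<in> carrier_vec d" using x Lc(1) unfolding L(2) column_space_def
        by (auto intro: mult_mat_vec_carrier[of _ d k])
      have "(mat_adjoint M *\<^sub>v (z - ?v)) $ i = 0" if "i < k" for i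
      proof -
        have "(mat_adjoint M *\<^sub>v ?v) $ i = ?y $ i" using Xx[OF x] Xy that by (metis index_vec)
        then show ?thesis using mult_minus_distrib_mat_vec[OF adj_carrier[OF Mc(1)] z v(2)] that k Mc(1) by simp
      qed
      then have "z - ?v \<in> W" unfolding inW using minus_carrier_vec[OF z v(2)] by simp
      moreover have "z = v + (z - v)" if "v \<in> carrier_vec d" for v using z that by (intro eq_vecI) auto
      from this[OF v(2)] have "z = ?v + (z - ?v)" .
      ultimately show ?thesis using v(1) by blast
    qed
    moreover have "V \<subseteq> carrier_vec d" unfolding L(2) by (rule column_space_carrier) (use Lc in auto)
    ultimately show "transverse_subspaces d V W" unfolding transverse_subspaces_def using inW by auto
  qed
  then show ?thesis unfolding dot by simp
qed

lemma not_transverse_nested: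
  assumes "V \<subseteq> W" "(W :: 'a :: rc_field vec set) \<in> Gr d m" "m < d"
  shows "\<not> transverse_subspaces d V W"
proof
  assume t: "transverse_subspaces d V W"
  obtain L where L: "unitary d L" "W = cs m L" using Gr_unitary(2)[OF assms(2)] by auto
  note Lc = unitaryD[OF L(1)]
  have sub: "subspace class_ring W (module_vec TYPE('a) d)" using assms(2) by (auto simp: Gr_def)
  have "carrier_vec d \<subseteq> W"
  proof
    fix x :: "'a vec" assume "x \<in> carrier_vec d"
    then have "x \<in> {v + w | v w. v \<in> V \<and> w \<in> W}" using t unfolding transverse_subspaces_def by simp
    then obtain v w where "v \<in> V" "w \<in> W" "x = v + w" by blast
    then show "x \<in> W" using assms(1) subspace_module_vecD(3)[OF sub] by blast
  qed
  then have "L *\<^sub>v unit_vec d (d - 1) \<in> W" using Lc(1) by auto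
  then have "(mat_adjoint L *\<^sub>v (L *\<^sub>v unit_vec d (d - 1))) $ (d - 1) = 0"
    unfolding L(2) cs_iff(1)[OF L(1) less_imp_le[OF assms(3)]] using assms(3) by auto
  moreover have "mat_adjoint L *\<^sub>v (L *\<^sub>v unit_vec d (d - 1)) = unit_vec d (d - 1)"
    using assoc_mult_mat_vec[of "mat_adjoint L" d d L d "unit_vec d (d - 1)"] Lc by simp
  ultimately show False using assms(3) by simp
qed

text \<open>For orthonormal u and v there is a k-plane that contains u and is orthogonal to v, as 0
  < k < d. Hence X u is orthogonal to v. Standard basis vectors kill the off-diagonal entries, and
  rotated pairs of them compare the diagonal ones.\<close>

lemma stabilizer_all_scalar:
  assumes X: "(X :: 'a :: rc_field mat) \<in> carrier_mat d d" and k: "0 < k" "k < d"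
    and st: "\<And>V. V \<in> Gr d k \<Longrightarrow> mat_image X V \<subseteq> V"
  shows "\<exists>c. X = c \<cdot>\<^sub>m 1\<^sub>m d"
proof -
  have key: "(\<Sum>a=0..<d. \<Sum>b=0..<d. conjugate (v a) * X $$ (a, b) * u b) = 0"
    if o: "(\<Sum>i=0..<d. conjugate (u i) * u i) = 1" "(\<Sum>i=0..<d. conjugate (v i) * v i) = 1"
      "(\<Sum>i=0..<d. conjugate (u i) * v i) = 0" for u v
  proof -
    have vu: "(\<Sum>i=0..<d. conjugate (v i) * u i) = 0"
    proof -
      have "conjugate (\<Sum>i=0..<d. conjugate (u i) * v i) = 0" using o(3) by simp
      then show ?thesis by (simp add: sum_conjugate conjugate_dist_mul mult.commute)
    qed
    define U where "U = mat d 2 (\<lambda>(i, j). if j = 0 then u i else v i)"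
    have U: "U \<in> carrier_mat d 2" by (auto simp: U_def)
    have "mat_adjoint U * U = 1\<^sub>m 2"
      unfolding adj_mult_self_eq_one_iff[OF U] using o vu by (auto simp: U_def less_2_cases_iff)
    then obtain L where L: "unitary d L" "lcols 2 L = U" using isometric_completion(2)[OF U] by auto
    note Lc = unitaryD[OF L(1)]
    \<comment> \<open>This moves v from column 1 to the last column, out of the first k, while u
      stays in column 0.\<close>
    let ?p = "Transposition.transpose 1 (d - 1)"
    have d2: "1 < d" using k by simp
    define M where "M = mat d d (\<lambda>(i, j). L $$ (i, ?p j))"
    have M: "M \<in> carrier_mat d d" by (auto simp: M_def)
    have p: "?p j < d" if "j < d" for j using that d2 by (auto simp: Transposition.transpose_def)
    have pinj: "?p i = ?p j \<longleftrightarrow> i = j" for i j by (metis transpose_involutory)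
    have uM: "unitary d M"
      unfolding unitary_def adj_mult_self_eq_one_iff[OF M]
      using adj_mult_self_eq_one_iff[OF Lc(1)] Lc(2) p pinj M by (auto simp: M_def)
    have LU: "L $$ (i, j) = U $$ (i, j)" if "i < d" "j < 2" for i j using that L(2) Lc(1) by (metis carrier_matD(1) lcols_index)
    have M0: "M $$ (i, 0) = u i" if "i < d" for i using that LU[of i 0] d2 by (simp add: M_def U_def Transposition.transpose_def)
    have M1: "M $$ (i, d - 1) = v i" if "i < d" for i using that LU[of i 1] d2 by (simp add: M_def U_def Transposition.transpose_def)
    have "M *\<^sub>v unit_vec d 0 \<in> cs k M"
      unfolding cs_iff(2)[OF uM less_imp_le[OF k(2)]] using k by (auto intro!: exI[of _ "unit_vec d 0"])
    then have "X *\<^sub>v (M *\<^sub>v unit_vec d 0) \<in> cs k M"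
      using st[OF unitary_Gr[OF uM less_imp_le[OF k(2)]]] by auto
    then have "(mat_adjoint M *\<^sub>v (X *\<^sub>v (M *\<^sub>v unit_vec d 0))) $ (d - 1) = 0"
      unfolding cs_iff(1)[OF uM less_imp_le[OF k(2)]] using k by auto
    moreover have "mat_adjoint M *\<^sub>v (X *\<^sub>v (M *\<^sub>v unit_vec d 0)) = (mat_adjoint M * X * M) *\<^sub>v unit_vec d 0"
      using X M by (simp add: assoc_mult_mat_vec[of _ d d _ d] mult_carrier_mat[of _ d d] mult_mat_vec_carrier[of _ d d])
    moreover have "((mat_adjoint M * X * M) *\<^sub>v unit_vec d 0) $ (d - 1) = (mat_adjoint M * X * M) $$ (d - 1, 0)"
    proof -
      have "mat_adjoint M * X * M \<in> carrier_mat d d" using X M by (simp add: mult_carrier_mat[of _ d d])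
      then show ?thesis using d2 by auto
    qed
    ultimately have "(mat_adjoint M * X * M) $$ (d - 1, 0) = 0" by simp
    then show ?thesis using adj_sandwich_index[OF M X, of "d - 1" 0] d2 M0 M1 by simp
  qed
  have two: "conjugate r * (X $$ (i, i) * p + X $$ (i, j) * q) + conjugate t * (X $$ (j, i) * p + X $$ (j, j) * q) = 0"
    if ij: "i < d" "j < d" "i \<noteq> j" and o: "conjugate p * p + conjugate q * q = 1" "conjugate r * r + conjugate t * t = 1"
      "conjugate p * r + conjugate q * t = 0" for i j p q r t
  proof -
    let ?u = "\<lambda>a. if a = i then p else if a = j then q else 0" and ?v = "\<lambda>a. if a = i then r else if a = j then t else 0"
    have s: "(\<Sum>a=0..<d. f a) = f i + f j" if "\<And>a. a \<noteq> i \<Longrightarrow> a \<noteq> j \<Longrightarrow> f a = 0" for f :: "nat \<Rightarrow> 'a"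
      using sum.mono_neutral_right[of "{0..<d}" "{i, j}" f] that ij by auto
    have "(\<Sum>a=0..<d. \<Sum>b=0..<d. conjugate (?v a) * X $$ (a, b) * ?u b) = 0"
      by (rule key; subst s) (use o ij(3) in auto)
    then have "(\<Sum>b=0..<d. conjugate r * X $$ (i, b) * ?u b) + (\<Sum>b=0..<d. conjugate t * X $$ (j, b) * ?u b) = 0"
      by (subst (asm) s) (use ij(3) in auto)
    then show ?thesis
      by (subst (asm) s, simp, subst (asm) s, simp) (use ij(3) in \<open>simp add: algebra_simps\<close>)
  qed
  have off: "X $$ (i, j) = 0" if "i < d" "j < d" "i \<noteq> j" for i j
    using two[OF that, of 0 1 1 0] by simp
  have diag: "X $$ (i, i) = X $$ (j, j)" if ij: "i < d" "j < d" "i \<noteq> j" for i j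
  proof -
    \<comment> \<open>The vectors c (e_i + e_j) and c (e_i - e_j) are orthonormal; once the
      off-diagonal entries are gone, the relation between them is the equality of two diagonal
      entries.\<close>
    define c :: 'a where "c = of_real (1 / sqrt 2)"
    have cc: "conjugate c * c = of_real (1 / 2)" unfolding c_def conjugate_of_real of_real_mult[symmetric] by (simp add: real_sqrt_mult_self)
    have c2: "conjugate c * c + conjugate c * c = 1" unfolding cc of_real_add[symmetric] by simp
    have "conjugate c * c * (X $$ (i, i) - X $$ (j, j)) = 0"
      using two[OF ij, of c c c "- c"] c2 off[OF ij] off[OF ij(2,1)] ij(3) by (simp add: conjugate_neg algebra_simps)
    then show ?thesis unfolding cc by simp
  qed
  have "X = X $$ (0, 0) \<cdot>\<^sub>m 1\<^sub>m d"
  proof (rule eq_matI)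
    fix i j assume "i < dim_row (X $$ (0, 0) \<cdot>\<^sub>m 1\<^sub>m d)" "j < dim_col (X $$ (0, 0) \<cdot>\<^sub>m 1\<^sub>m d)"
    then have ij: "i < d" "j < d" by auto
    show "X $$ (i, j) = (X $$ (0, 0) \<cdot>\<^sub>m 1\<^sub>m d) $$ (i, j)"
      using off[OF ij] diag[OF ij(1), of 0] ij k by (cases "i = j"; cases "i = 0") auto
  qed (use X in auto)
  then show ?thesis by blast
qed

subsection \<open>The projective linear group\<close>

lemma smult_mat_vec:
  "A \<in> carrier_mat m n \<Longrightarrow> v \<in> carrier_vec n \<Longrightarrow> (c \<cdot>\<^sub>m A) *\<^sub>v v = c \<cdot>\<^sub>v (A *\<^sub>v (v :: 'a :: comm_semiring_0 vec))"
  by (intro eq_vecI) (auto simp: scalar_prod_def sum_distrib_left mult.assoc)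

lemma GL_simps:
  "carrier (GL d) = {A \<in> carrier_mat d d. det A \<noteq> (0 :: 'a :: field)}"
  "monoid.mult (GL d) = ((*) :: 'a mat \<Rightarrow> _)" "\<one>\<^bsub>GL d\<^esub> = (1\<^sub>m d :: 'a mat)"
proof -
  have "A \<in> Units (ring_mat TYPE('a) d ()) \<longleftrightarrow> A \<in> carrier_mat d d \<and> det A \<noteq> 0" for A
    using unit_imp_det_non_zero[of A d "()"] det_non_zero_imp_unit[of A d "()"]
    by (auto simp: Units_def ring_mat_simps)
  then show "carrier (GL d) = {A \<in> carrier_mat d d. det A \<noteq> (0 :: 'a)}"
    by (auto simp: GL_def units_of_def)
  show "monoid.mult (GL d) = ((*) :: 'a mat \<Rightarrow> _)" "\<one>\<^bsub>GL d\<^esub> = (1\<^sub>m d :: 'a mat)"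
    by (auto simp: GL_def units_of_def ring_mat_simps)
qed

lemma group_GL: "group (GL d :: ('a :: field mat) monoid)"
proof -
  interpret R: ring "ring_mat TYPE('a) d ()" by (rule ring_mat)
  show ?thesis unfolding GL_def by (rule R.units_group)
qed

definition pcl :: "nat \<Rightarrow> ('a :: field) mat \<Rightarrow> 'a mat set" where
  "pcl d A = scalar_mats d #>\<^bsub>GL d\<^esub> A"

lemma pcl_eq:
  assumes "A \<in> carrier_mat d d"
  shows "pcl d A = {c \<cdot>\<^sub>m A | c. c \<noteq> (0 :: 'a :: field)}"
proof -
  have "(c \<cdot>\<^sub>m 1\<^sub>m d) * A = c \<cdot>\<^sub>m A" for c
    using assms mult_smult_assoc_mat[of "1\<^sub>m d" d d A d c] by simp
  then show ?thesis by (auto simp: pcl_def r_coset_def scalar_mats_def GL_simps)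
qed

lemma normal_scalar_mats: "scalar_mats d \<lhd> (GL d :: ('a :: field mat) monoid)"
proof -
  interpret G: group "GL d :: 'a mat monoid" by (rule group_GL)
  have sub: "scalar_mats d \<subseteq> carrier (GL d :: 'a mat monoid)"
    by (auto simp: scalar_mats_def GL_simps)
  have sg: "subgroup (scalar_mats d) (GL d :: 'a mat monoid)"
  proof (rule G.subgroupI[OF sub])
    show "scalar_mats d \<noteq> ({} :: 'a mat set)" by (auto simp: scalar_mats_def intro: exI[of _ 1])
    fix a :: "'a mat" assume a: "a \<in> scalar_mats d"
    then obtain c where c: "a = c \<cdot>\<^sub>m 1\<^sub>m d" "c \<noteq> 0" by (auto simp: scalar_mats_def)
    have "(inverse c \<cdot>\<^sub>m 1\<^sub>m d) \<otimes>\<^bsub>GL d\<^esub> a = \<one>\<^bsub>GL d\<^esub>"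
      unfolding c GL_simps by (rule eq_matI) (use c(2) in auto)
    moreover have "inverse c \<cdot>\<^sub>m 1\<^sub>m d \<in> carrier (GL d :: 'a mat monoid)" using c(2) by (auto simp: GL_simps)
    ultimately have "inv\<^bsub>GL d\<^esub> a = inverse c \<cdot>\<^sub>m 1\<^sub>m d" using a sub by (intro G.inv_equality) auto
    then show "inv\<^bsub>GL d\<^esub> a \<in> scalar_mats d" using c(2) by (auto simp: scalar_mats_def intro: exI[of _ "inverse c"])
  next
    fix a b :: "'a mat" assume "a \<in> scalar_mats d" "b \<in> scalar_mats d"
    then obtain c e where "a = c \<cdot>\<^sub>m 1\<^sub>m d" "b = e \<cdot>\<^sub>m 1\<^sub>m d" "c \<noteq> 0" "e \<noteq> 0" by (auto simp: scalar_mats_def)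
    then have "a * b = (c * e) \<cdot>\<^sub>m 1\<^sub>m d" "c * e \<noteq> 0" by (auto intro!: eq_matI)
    then show "a \<otimes>\<^bsub>GL d\<^esub> b \<in> scalar_mats d" unfolding GL_simps scalar_mats_def by blast
  qed
  show ?thesis
    unfolding G.normal_inv_iff
  proof (intro conjI sg ballI)
    fix x h :: "'a mat" assume x: "x \<in> carrier (GL d)" and h: "h \<in> scalar_mats d"
    obtain c where c: "h = c \<cdot>\<^sub>m 1\<^sub>m d" "c \<noteq> 0" using h by (auto simp: scalar_mats_def)
    have ix: "inv\<^bsub>GL d\<^esub> x \<in> carrier (GL d)" using x by simp
    have "x * h = h * x" using x unfolding c by (auto simp: GL_simps intro!: eq_matI)
    then have "x \<otimes>\<^bsub>GL d\<^esub> h \<otimes>\<^bsub>GL d\<^esub> inv\<^bsub>GL d\<^esub> x = h \<otimes>\<^bsub>GL d\<^esub> (x \<otimes>\<^bsub>GL d\<^esub> inv\<^bsub>GL d\<^esub> x)"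
      using x ix h sub by (subst G.m_assoc[symmetric]) (auto simp: GL_simps)
    also have "\<dots> = h" using x h sub by (simp add: G.r_inv subset_iff)
    finally show "x \<otimes>\<^bsub>GL d\<^esub> h \<otimes>\<^bsub>GL d\<^esub> inv\<^bsub>GL d\<^esub> x \<in> scalar_mats d" using h by simp
  qed
qed

lemma group_PGL: "group (PGL d :: ('a :: field mat set) monoid)"
  unfolding PGL_def by (rule normal.factorgroup_is_group[OF normal_scalar_mats])

lemma PGL_carrier: "carrier (PGL d) = pcl d ` {A \<in> carrier_mat d d. det A \<noteq> (0 :: 'a :: field)}"
  by (auto simp: PGL_def FactGroup_def RCOSETS_def pcl_def GL_simps)

lemma pcl_in_PGL: "A \<in> carrier_mat d d \<Longrightarrow> det A \<noteq> 0 \<Longrightarrow> pcl d A \<in> carrier (PGL d)"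
  by (auto simp: PGL_carrier)

lemma PGL_mult:
  assumes "A \<in> carrier_mat d d" "det A \<noteq> (0 :: 'a :: field)" "B \<in> carrier_mat d d" "det B \<noteq> 0"
  shows "pcl d A \<otimes>\<^bsub>PGL d\<^esub> pcl d B = pcl d (A * B)"
proof -
  have "pcl d A <#>\<^bsub>GL d\<^esub> pcl d B = pcl d (A * B)"
    unfolding pcl_def using normal.rcos_sum[OF normal_scalar_mats, of A d B] assms by (simp add: GL_simps)
  then show ?thesis by (simp add: PGL_def FactGroup_def)
qed

lemma pcl_eq_iff:
  assumes "A \<in> carrier_mat d d" "B \<in> carrier_mat d d"
  shows "pcl d A = pcl d B \<longleftrightarrow> (\<exists>c. c \<noteq> (0 :: 'a :: field) \<and> B = c \<cdot>\<^sub>m A)"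
proof
  assume "pcl d A = pcl d B"
  moreover have "B \<in> pcl d B" unfolding pcl_eq[OF assms(2)] by (auto intro!: exI[of _ 1] simp: one_smult_mat)
  ultimately show "\<exists>c. c \<noteq> 0 \<and> B = c \<cdot>\<^sub>m A" unfolding pcl_eq[OF assms(1)] by auto
next
  assume "\<exists>c. c \<noteq> 0 \<and> B = c \<cdot>\<^sub>m A"
  then obtain c where c: "c \<noteq> 0" "B = c \<cdot>\<^sub>m A" by auto
  have s: "(x * y) \<cdot>\<^sub>m A = x \<cdot>\<^sub>m (y \<cdot>\<^sub>m A)" for x y :: 'a by (rule eq_matI) auto
  show "pcl d A = pcl d B"
    unfolding pcl_eq[OF assms(1)] pcl_eq[OF assms(2)] unfolding c(2)
  proof (intro equalityI subsetI)
    fix X assume "X \<in> {e \<cdot>\<^sub>m A | e. e \<noteq> 0}"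
    then obtain e where e: "X = e \<cdot>\<^sub>m A" "e \<noteq> 0" by auto
    then have "X = (e / c) \<cdot>\<^sub>m (c \<cdot>\<^sub>m A)" using c(1) by (simp flip: s)
    then show "X \<in> {e \<cdot>\<^sub>m (c \<cdot>\<^sub>m A) | e. e \<noteq> 0}" using e(2) c(1) by (auto intro!: exI[of _ "e / c"])
  next
    fix X assume "X \<in> {e \<cdot>\<^sub>m (c \<cdot>\<^sub>m A) | e. e \<noteq> 0}"
    then obtain e where e: "X = e \<cdot>\<^sub>m (c \<cdot>\<^sub>m A)" "e \<noteq> 0" by auto
    then show "X \<in> {e \<cdot>\<^sub>m A | e. e \<noteq> 0}" using c(1) by (auto intro!: exI[of _ "e * c"] simp: s)
  qed
qed

lemma PGL_one: "\<one>\<^bsub>PGL d\<^esub> = pcl d (1\<^sub>m d :: 'a :: field mat)"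
proof -
  have "pcl d (1\<^sub>m d :: 'a mat) = scalar_mats d" by (auto simp: pcl_eq scalar_mats_def)
  then show ?thesis by (simp add: PGL_def FactGroup_def)
qed

lemma PGL_inv:
  assumes "A \<in> carrier_mat d d" "det A \<noteq> (0 :: 'a :: field)" "B \<in> carrier_mat d d" "A * B = 1\<^sub>m d"
  shows "inv\<^bsub>PGL d\<^esub> (pcl d A) = pcl d B"
proof -
  have dB: "det B \<noteq> 0" using mult_eq_one_det[OF assms(1,3,4)] by auto
  have "B * A = 1\<^sub>m d" by (rule mat_mult_left_right_inverse[OF assms(1,3,4)])
  then have "pcl d B \<otimes>\<^bsub>PGL d\<^esub> pcl d A = \<one>\<^bsub>PGL d\<^esub>"
    using PGL_mult[OF assms(3) dB assms(1,2)] by (simp add: PGL_one)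
  then show ?thesis
    using group.inv_equality[OF group_PGL] pcl_in_PGL[OF assms(1,2)] pcl_in_PGL[OF assms(3) dB] by blast
qed

lemma act_pcl:
  assumes A: "A \<in> carrier_mat d d" and W: "W \<subseteq> carrier_vec d" "\<And>c w. w \<in> W \<Longrightarrow> c \<cdot>\<^sub>v w \<in> (W :: 'a :: field vec set)"
  shows "act (pcl d A) W = mat_image A W"
proof (intro equalityI subsetI)
  fix x assume "x \<in> act (pcl d A) W"
  then obtain c w where cw: "c \<noteq> 0" "w \<in> W" "x = (c \<cdot>\<^sub>m A) *\<^sub>v w" unfolding act_def pcl_eq[OF A] by auto
  have "w \<in> carrier_vec d" using cw W by auto
  then have "x = A *\<^sub>v (c \<cdot>\<^sub>v w)" using cw(3) A by (simp add: mult_mat_vec[of _ d d] smult_mat_vec[of _ d d])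
  then show "x \<in> mat_image A W" using W(2)[OF cw(2)] by blast
next
  fix x assume "x \<in> mat_image A W"
  then show "x \<in> act (pcl d A) W"
    unfolding act_def pcl_eq[OF A] by (auto intro!: exI[of _ A] exI[of _ 1] simp: one_smult_mat)
qed

lemma Gr_closed:
  assumes "W \<in> Gr d k"
  shows "W \<subseteq> carrier_vec d" "\<And>c w. w \<in> W \<Longrightarrow> c \<cdot>\<^sub>v w \<in> (W :: 'a :: field vec set)"
    "\<And>v w. v \<in> W \<Longrightarrow> w \<in> W \<Longrightarrow> v + w \<in> W" "0\<^sub>v d \<in> W"
  using subspace_module_vecD[of W d] assms by (auto simp: Gr_def)

lemma act_Gr:
  assumes "A \<in> carrier_mat d d" "W \<in> Gr d k"
  shows "act (pcl d A) W = (\<lambda>w. A *\<^sub>v w) ` (W :: 'a :: field vec set)"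
  by (rule act_pcl[OF assms(1) Gr_closed(1,2)[OF assms(2)]])

subsection \<open>Cartan decompositions\<close>

text \<open>The Cartan decomposition. The product of the entries \<open>s\<close> is 1, so the
  exhibited lift has determinant of modulus 1 and \<open>s\<close> lists the singular values of
  \<open>g\<close> counted from 0.\<close>

definition kak :: "nat \<Rightarrow> ('a :: rc_field) mat set \<Rightarrow> 'a mat \<Rightarrow> (nat \<Rightarrow> real) \<Rightarrow> 'a mat \<Rightarrow> bool" where
  "kak d g L s M \<longleftrightarrow> unitary d L \<and> unitary d M \<and> (\<forall>i<d. 0 < s i) \<and> (\<forall>i j. i \<le> j \<longrightarrow> j < d \<longrightarrow> s j \<le> s i) \<and>
     (\<Prod>i=0..<d. s i) = 1 \<and> g = pcl d (L * rdiag d s * M)"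

lemma det_mat_diag: "det (mat_diag d f) = (\<Prod>i=0..<d. f i :: 'a :: comm_ring_1)"
proof -
  have "det (mat_diag d f) = prod_list (diag_mat (mat_diag d f))"
    by (rule det_upper_triangular) (auto simp: mat_diag_def)
  then show ?thesis by (simp add: prod_list_diag_prod mat_diag_def)
qed

lemma norm_det_kak:
  assumes "unitary d (L :: 'a :: rc_field mat)" "unitary d M"
  shows "norm (det (L * rdiag d s * M)) = \<bar>\<Prod>i=0..<d. s i\<bar>"
proof -
  note L = unitaryD(1)[OF assms(1)] and M = unitaryD(1)[OF assms(2)]
  have "det (L * rdiag d s * M) = det L * (\<Prod>i=0..<d. of_real (s i)) * det M"
    using det_mult[of "L * rdiag d s" d M] det_mult[of L d "rdiag d s"] L M
    by (simp add: det_mat_diag mult_carrier_mat[of _ d d])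
  then show ?thesis using unitary_det[OF assms(1)] unitary_det[OF assms(2)]
    by (simp add: norm_mult flip: of_real_prod)
qed

lemma PGL_lift_det_one:
  assumes "g \<in> carrier (PGL d)" "0 < d"
  shows "\<exists>A \<in> carrier_mat d d. norm (det (A :: 'a :: rc_field mat)) = 1 \<and> g = pcl d A"
proof -
  obtain A where A: "A \<in> carrier_mat d d" "det A \<noteq> 0" "g = pcl d A" using assms(1) by (auto simp: PGL_carrier)
  define t where "t = root d (1 / norm (det A))"
  have t: "t ^ d = 1 / norm (det A)" "0 < t" using A(2) assms(2) by (auto simp: t_def)
  have "norm (det (of_real t \<cdot>\<^sub>m A)) = 1"
    using A t by (simp add: norm_mult norm_power power_abs)
  moreover have "g = pcl d (of_real t \<cdot>\<^sub>m A)"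
    unfolding A(3) using A(1) t(2) by (subst pcl_eq_iff) (auto intro!: exI[of _ "of_real t"])
  ultimately show ?thesis using A(1) by (intro bexI[of _ "of_real t \<cdot>\<^sub>m A"]) auto
qed

lemma kak_exists:
  assumes "g \<in> carrier (PGL d)" "0 < d"
  shows "\<exists>L s M. kak d g L s M"
proof -
  obtain A where A: "A \<in> carrier_mat d d" "norm (det A) = 1" "g = pcl d A"
    using PGL_lift_det_one[OF assms] by auto
  have dA: "det A \<noteq> 0" using A(2) by auto
  obtain L M s where s: "unitary d L" "unitary d M" "A = L * rdiag d s * M"
    "\<forall>i<d. 0 < s i" "\<forall>i j. i \<le> j \<longrightarrow> j < d \<longrightarrow> s j \<le> s i"
    using svd[OF A(1) dA] by (elim exE conjE) (rule that)
  have "0 < (\<Prod>i=0..<d. s i)" using s(4) by (intro prod_pos) auto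
  then have "(\<Prod>i=0..<d. s i) = 1" using norm_det_kak[OF s(1,2), of s] A(2) s(3) by simp
  then show ?thesis using s A(3) unfolding kak_def by blast
qed

lemma kak_carrier:
  assumes "kak d g L s M"
  shows "L \<in> carrier_mat d d" "M \<in> carrier_mat d d" "L * rdiag d s * M \<in> carrier_mat d d"
    "norm (det (L * rdiag d s * M)) = 1" "g \<in> carrier (PGL d)"
proof -
  have u: "unitary d L" "unitary d M" "(\<Prod>i=0..<d. s i) = 1" "g = pcl d (L * rdiag d s * M)"
    using assms by (auto simp: kak_def)
  show 1: "L \<in> carrier_mat d d" "M \<in> carrier_mat d d" by (rule unitaryD(1)[OF u(1)], rule unitaryD(1)[OF u(2)])
  then show 2: "L * rdiag d s * M \<in> carrier_mat d d" by (simp add: mult_carrier_mat[of _ d d])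
  show 3: "norm (det (L * rdiag d s * M)) = 1" using norm_det_kak[OF u(1,2), of s] u(3) by simp
  then have "det (L * rdiag d s * M) \<noteq> 0" by auto
  then show "g \<in> carrier (PGL d)" unfolding u(4) by (intro pcl_in_PGL 2)
qed

lemma unitary_smult:
  assumes "unitary d (L :: 'a :: rc_field mat)" "norm c = 1"
  shows "unitary d (c \<cdot>\<^sub>m L)"
proof -
  note L = unitaryD[OF assms(1)]
  have cc: "conjugate c * c = 1" using assms(2) by (simp add: conjugate_mult_self)
  have L': "c \<cdot>\<^sub>m L \<in> carrier_mat d d" using L(1) by simp
  show ?thesis
    unfolding unitary_def adj_mult_self_eq_one_iff[OF L']
  proof (intro conjI L' allI impI)
    fix a b assume ab: "a < d" "b < d"
    have "(\<Sum>i=0..<d. conjugate ((c \<cdot>\<^sub>m L) $$ (i, a)) * (c \<cdot>\<^sub>m L) $$ (i, b)) =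
      (\<Sum>i=0..<d. (conjugate c * c) * (conjugate (L $$ (i, a)) * L $$ (i, b)))"
      using ab L(1) by (intro sum.cong) (auto simp: conjugate_dist_mul)
    then show "(\<Sum>i=0..<d. conjugate ((c \<cdot>\<^sub>m L) $$ (i, a)) * (c \<cdot>\<^sub>m L) $$ (i, b)) = (if a = b then 1 else 0)"
      unfolding cc using adj_mult_self_eq_one_iff[OF L(1)] L(2) ab by simp
  qed
qed

lemma kak_smult_lift:
  assumes "kak d g L s M" "c \<cdot>\<^sub>m (L * rdiag d s * M) = A" "norm (det (A :: 'a :: rc_field mat)) = 1" "0 < d"
  shows "norm c = 1" "A = (c \<cdot>\<^sub>m L) * rdiag d s * M" "unitary d (c \<cdot>\<^sub>m L)"
proof -
  let ?D = "rdiag d s :: 'a mat"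
  note K = kak_carrier[OF assms(1)]
  have "norm (det A) = norm c ^ d * 1"
    unfolding assms(2)[symmetric] K(4)[symmetric] using K(2,3) by (simp add: norm_mult norm_power)
  then have "norm c ^ d = 1" using assms(3) by simp
  then show c: "norm c = 1" using power_eq_iff_eq_base[of d "norm c" 1] assms(4) by simp
  have "(c \<cdot>\<^sub>m L) * ?D * M = c \<cdot>\<^sub>m (L * ?D) * M" using K(1) by (subst mult_smult_assoc_mat[of _ d d _ d]) auto
  also have "\<dots> = c \<cdot>\<^sub>m (L * ?D * M)"
    using K(1,2) by (intro mult_smult_assoc_mat[of _ d d _ d]) (auto simp: mult_carrier_mat[of _ d d])
  finally show "A = (c \<cdot>\<^sub>m L) * ?D * M" using assms(2) by simp
  show "unitary d (c \<cdot>\<^sub>m L)" using assms(1) c by (intro unitary_smult) (auto simp: kak_def)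
qed

text \<open>Two lifts with determinant of modulus 1 differ by a scalar of modulus 1, which is
  absorbed in \<open>L\<close>. So the lift chosen by \<open>SOME\<close> has the same diagonal
  part.\<close>

lemma kak_sv:
  assumes kak: "kak d g L s M" and i: "i < d"
  shows "sv g (i + 1) = s i"
proof -
  let ?D = "rdiag d s :: 'a mat"
  let ?A = "SOME A. A \<in> g \<and> norm (det A) = 1"
  have s: "\<forall>i<d. 0 < s i" "\<forall>i j. i \<le> j \<longrightarrow> j < d \<longrightarrow> s j \<le> s i" "unitary d M" "g = pcl d (L * ?D * M)"
    using kak by (auto simp: kak_def)
  note K = kak_carrier[OF kak]
  have "L * ?D * M \<in> g" unfolding s(4) pcl_eq[OF K(3)] by (auto intro!: exI[of _ 1] simp: one_smult_mat)
  then have "\<exists>A. A \<in> g \<and> norm (det A) = 1" using K(4) by blast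
  then have A: "?A \<in> g \<and> norm (det ?A) = 1" by (rule someI_ex)
  then obtain c where c: "?A = c \<cdot>\<^sub>m (L * ?D * M)" unfolding s(4) pcl_eq[OF K(3)] by auto
  have d: "0 < d" using i by simp
  note C = kak_smult_lift[OF kak c[symmetric] conjunct2[OF A] d]
  have "singular_values ?A = rev (sort (map s [0..<d]))"
    unfolding C(2) by (rule singular_values_svd[OF C(3) s(3)]) (use s(1) in \<open>auto intro: less_imp_le\<close>)
  also have "\<dots> = map s [0..<d]"
  proof (rule sorted_wrt_ge_unique)
    show "sorted_wrt (\<ge>) (rev (sort (map s [0..<d])))" by (simp add: sorted_wrt_rev)
    show "sorted_wrt (\<ge>) (map s [0..<d])" using s(2) by (auto simp: sorted_wrt_iff_nth_less)
  qed simp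
  finally show ?thesis using i unfolding sv_def by simp
qed

lemma kak_gap:
  assumes "kak d g L s M" "0 < k" "k < d"
  shows "root_gap k g = ln (s (k - 1) / s k)"
  using kak_sv[OF assms(1), of "k - 1"] kak_sv[OF assms(1), of k] assms(2,3) by (simp add: root_gap_def)

lemma kak_gap_pos:
  assumes "kak d g L s M" "0 < k" "k < d" "0 < root_gap k g"
  shows "s k < s (k - 1)"
proof -
  have p: "0 < s k" "0 < s (k - 1)" using assms by (auto simp: kak_def)
  then have "1 < s (k - 1) / s k" using assms(4) unfolding kak_gap[OF assms(1-3)] by (subst (asm) ln_gt_zero_iff) auto
  then show ?thesis using p by (simp add: field_simps)
qed

text \<open>The \<open>THE\<close> in \<open>U_sub\<close> requires independence of the
  decomposition. Two unitary factors diagonalize the same Hermitian matrix with eigenvalues s^2, so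
  the transition matrix between them commutes with that diagonal matrix and vanishes between indices
  with different \<open>s\<close>. The gap separates the indices below k from the others.\<close>

lemma kak_U:
  assumes kak: "kak d g L s M" and k: "0 < k" "k < d" and gap: "s k < s (k - 1)"
  shows "U_sub d k g = cs k L"
proof -
  let ?D = "rdiag d s :: 'a mat"
  have s: "\<forall>i<d. 0 < s i" "\<forall>i j. i \<le> j \<longrightarrow> j < d \<longrightarrow> s j \<le> s i" "unitary d M" "unitary d L" "g = pcl d (L * ?D * M)"
    using kak by (auto simp: kak_def)
  note K = kak_carrier[OF kak]
  have kd: "k \<le> d" using k by simp
  have D: "mat_diag d (\<lambda>i. of_real (sv g (i + 1))) = ?D"
    by (rule eq_matI) (auto simp: mat_diag_def kak_sv[OF kak, simplified])
  have Ag: "L * ?D * M \<in> g" unfolding s(5) pcl_eq[OF K(3)] by (auto intro!: exI[of _ 1] simp: one_smult_mat)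
  have sub: "cs k L1 \<subseteq> cs k L2" if L1: "unitary d L1" and M1: "unitary d M1" and L2: "unitary d L2" and M2: "unitary d M2"
    and e: "L1 * ?D * M1 = c \<cdot>\<^sub>m (L2 * ?D * M2)" "norm c = 1" for L1 L2 M1 M2 c
  proof (rule cs_eqI[OF L1 L2 kd])
    note u1 = unitaryD[OF L1] unitaryD[OF M1] and u2 = unitaryD[OF L2] unitaryD[OF M2]
    let ?L2 = "c \<cdot>\<^sub>m L2" and ?E = "mat_diag d (\<lambda>i. of_real ((s i)\<^sup>2)) :: 'a mat"
    have sq: "(X * ?D * Y) * mat_adjoint (X * ?D * Y) = X * ?E * mat_adjoint X" if X: "X \<in> carrier_mat d d" and Y: "unitary d Y" for X Y
    proof -
      note Yc = unitaryD[OF Y]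
      have aD: "mat_adjoint ?D = ?D" by (rule eq_matI) (auto simp: mat_diag_def)
      have "(X * ?D * Y) * mat_adjoint (X * ?D * Y) = X * (?D * ((Y * mat_adjoint Y) * (?D * mat_adjoint X)))"
        using X Yc(1) by (simp add: adj_mult[of _ d d _ d] aD assoc_mult_mat[of _ d d _ d _ d] mult_carrier_mat[of _ d d] del: mat_diag_diag)
      also have "\<dots> = X * ((?D * ?D) * mat_adjoint X)"
        unfolding Yc(3) using X by (simp add: assoc_mult_mat[of _ d d _ d _ d] mult_carrier_mat[of _ d d] left_mult_one_mat[of _ d d] del: mat_diag_diag)
      also have "?D * ?D = ?E" by (simp add: power2_eq_square)
      finally show ?thesis using X by (simp add: assoc_mult_mat[of _ d d _ d _ d] mult_carrier_mat[of _ d d])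
    qed
    have cL2: "c \<cdot>\<^sub>m (L2 * ?D * M2) = ?L2 * ?D * M2"
    proof -
      have "?L2 * ?D * M2 = c \<cdot>\<^sub>m (L2 * ?D) * M2" using u2(1) by (subst mult_smult_assoc_mat[of _ d d _ d]) auto
      also have "\<dots> = c \<cdot>\<^sub>m (L2 * ?D * M2)"
        using u2(1,4) by (intro mult_smult_assoc_mat[of _ d d _ d]) (auto simp: mult_carrier_mat[of _ d d])
      finally show ?thesis by simp
    qed
    have uc: "unitary d ?L2" by (rule unitary_smult[OF L2 e(2)])
    note uc' = unitaryD[OF uc]
    \<comment> \<open>Multiplying a decomposition by its adjoint eliminates the right unitary
      factor.\<close>
    have H: "L1 * ?E * mat_adjoint L1 = ?L2 * ?E * mat_adjoint ?L2"
      using sq[OF u1(1) M1] sq[OF uc'(1) M2] e(1) cL2 by simp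
    let ?T = "mat_adjoint ?L2 * L1"
    have T: "?T \<in> carrier_mat d d" using u1 uc' by (simp add: mult_carrier_mat[of _ d d])
    have "?T * ?E = mat_adjoint ?L2 * (L1 * ?E * mat_adjoint L1) * L1"
      using u1(1,2) uc'(1)
      by (simp add: assoc_mult_mat[of _ d d _ d _ d] mult_carrier_mat[of _ d d] right_mult_one_mat[of _ d d])
    also have "\<dots> = ?E * ?T"
      unfolding H using u1(1) uc'(1,2) 
      by (simp add: assoc_mult_mat[of _ d d _ d _ d, symmetric] mult_carrier_mat[of _ d d] left_mult_one_mat[of _ d d] right_mult_one_mat[of _ d d])
    finally have TE: "?T * ?E = ?E * ?T" .
    fix i j assume ij: "k \<le> i" "i < d" "j < k"
    have j: "j < d" using ij k by simp
    have "?T $$ (i, j) * of_real ((s j)\<^sup>2) = (?T * ?E) $$ (i, j)" using ij(2) j T by (subst mat_diag_mult_right[OF T]) auto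
    also have "\<dots> = of_real ((s i)\<^sup>2) * ?T $$ (i, j)" unfolding TE using ij(2) j T by (subst mat_diag_mult_left[OF T]) auto
    finally have "?T $$ (i, j) * of_real ((s j)\<^sup>2 - (s i)\<^sup>2) = 0" by (simp add: algebra_simps)
    moreover have "s i < s j"
    proof -
      have "s i \<le> s k" using s(2) ij by auto
      moreover have "s (k - 1) \<le> s j" using s(2) ij k by auto
      ultimately show ?thesis using gap by linarith
    qed
    then have "(s j)\<^sup>2 - (s i)\<^sup>2 \<noteq> 0" using s(1) ij(2) by (simp add: power2_eq_iff_nonneg less_imp_le j)
    ultimately have "?T $$ (i, j) = 0" by (simp del: of_real_diff of_real_power)
    moreover have "?T $$ (i, j) = conjugate c * (mat_adjoint L2 * L1) $$ (i, j)"
      unfolding index_mult_sum[OF adj_carrier[OF uc'(1)] u1(1) ij(2) j] index_mult_sum[OF adj_carrier[OF u2(1)] u1(1) ij(2) j] sum_distrib_left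
      using u2(1) ij by (intro sum.cong) (auto simp: conjugate_dist_mul)
    moreover have "conjugate c \<noteq> 0" using e(2) by auto
    ultimately show "(mat_adjoint L2 * L1) $$ (i, j) = 0" by simp
  qed
  show ?thesis
    unfolding U_sub_def D cs_iff(2)[OF s(4) kd]
  proof (rule the_equality)
    show "\<exists>L' M'. unitary d L' \<and> unitary d M' \<and> L' * ?D * M' \<in> g \<and>
      {L *\<^sub>v v | v. v \<in> carrier_vec d \<and> (\<forall>i<d. k \<le> i \<longrightarrow> v $ i = 0)} = {L' *\<^sub>v v | v. v \<in> carrier_vec d \<and> (\<forall>i<d. k \<le> i \<longrightarrow> v $ i = 0)}"
      using s Ag by blast
  next
    fix W assume "\<exists>L' M'. unitary d L' \<and> unitary d M' \<and> L' * ?D * M' \<in> g \<and>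
      W = {L' *\<^sub>v v | v. v \<in> carrier_vec d \<and> (\<forall>i<d. k \<le> i \<longrightarrow> v $ i = 0)}"
    then obtain L' M' where L': "unitary d L'" "unitary d M'" "L' * ?D * M' \<in> g"
      "W = {L' *\<^sub>v v | v. v \<in> carrier_vec d \<and> (\<forall>i<d. k \<le> i \<longrightarrow> v $ i = 0)}" by blast
    have W: "W = cs k L'" using L'(4) cs_iff(2)[OF L'(1) kd] by simp
    obtain c where c: "c \<noteq> 0" "L' * ?D * M' = c \<cdot>\<^sub>m (L * ?D * M)" using L'(3) unfolding s(5) pcl_eq[OF K(3)] by auto
    have d0: "0 < d" using k by simp
    have "norm (det (L' * ?D * M')) = 1" using norm_det_kak[OF L'(1,2), of s] kak by (simp add: kak_def)
    then have nc: "norm c = 1" using kak_smult_lift(1)[OF kak c(2)[symmetric] _ d0] by simp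
    have "L * ?D * M = inverse c \<cdot>\<^sub>m (L' * ?D * M')" unfolding c(2) by (rule eq_matI) (use c(1) in \<open>auto\<close>)
    then have "cs k L \<subseteq> cs k L'" using sub[OF s(4,3) L'(1,2)] nc by (simp add: norm_inverse)
    moreover have "cs k L' \<subseteq> cs k L" by (rule sub[OF L'(1,2) s(4,3) c(2) nc])
    ultimately show "W = {L *\<^sub>v v | v. v \<in> carrier_vec d \<and> (\<forall>i<d. k \<le> i \<longrightarrow> v $ i = 0)}"
      unfolding W using cs_iff(2)[OF s(4) kd] by simp
  qed
qed

lemma sum_rev_index:
  fixes d :: nat
  shows "(\<Sum>j=0..<d. f (d - 1 - j)) = (\<Sum>j=0..<d. f j :: 'a :: comm_monoid_add)"
  by (rule sum.reindex_bij_witness[of _ "\<lambda>j. d - 1 - j" "\<lambda>j. d - 1 - j"]) auto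

lemma prod_rev_index:
  fixes d :: nat
  shows "(\<Prod>j=0..<d. f (d - 1 - j)) = (\<Prod>j=0..<d. f j :: 'a :: comm_monoid_mult)"
  by (rule prod.reindex_bij_witness[of _ "\<lambda>j. d - 1 - j" "\<lambda>j. d - 1 - j"]) auto

text \<open>Inverting the diagonal part reverses the order of its entries; reversing the columns of
  the adjoint of \<open>M\<close> and those of \<open>L\<close> restores a decreasing sequence
  without changing the product.\<close>

lemma kak_inv:
  assumes kak: "kak d g L s M"
  shows "kak d (inv\<^bsub>PGL d\<^esub> g) (revc (mat_adjoint M)) (\<lambda>i. 1 / s (d - 1 - i)) (mat_adjoint (revc L))"
proof -
  let ?D = "rdiag d s :: 'a mat" and ?E = "mat_diag d (\<lambda>i. of_real (1 / s i)) :: 'a mat"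
    and ?D' = "mat_diag d (\<lambda>i. of_real (1 / s (d - 1 - i))) :: 'a mat"
  have s: "\<forall>i<d. 0 < s i" "\<forall>i j. i \<le> j \<longrightarrow> j < d \<longrightarrow> s j \<le> s i" "unitary d M" "unitary d L" "g = pcl d (L * ?D * M)"
    "(\<Prod>i=0..<d. s i) = 1"
    using kak by (auto simp: kak_def)
  note K = kak_carrier[OF kak] and L = unitaryD[OF s(4)] and M = unitaryD[OF s(3)]
  let ?B = "revc (mat_adjoint M) * ?D' * mat_adjoint (revc L)"
  have R: "revc (mat_adjoint M) \<in> carrier_mat d d" "mat_adjoint (revc L) \<in> carrier_mat d d" using L(1) M(1) by auto
  have "?B = mat_adjoint M * ?E * mat_adjoint L"
  proof (rule eq_matI)
    fix i j assume "i < dim_row (mat_adjoint M * ?E * mat_adjoint L)" "j < dim_col (mat_adjoint M * ?E * mat_adjoint L)"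
    then have ij: "i < d" "j < d" using L(1) M(1) by auto
    have RD: "revc (mat_adjoint M) * ?D' \<in> carrier_mat d d" "mat_adjoint M * ?E \<in> carrier_mat d d"
      using R M(1) by (auto simp: mult_carrier_mat[of _ d d])
    have "?B $$ (i, j) = (\<Sum>l=0..<d. (\<lambda>l. (mat_adjoint M * ?E) $$ (i, l) * mat_adjoint L $$ (l, j)) (d - 1 - l))"
      unfolding index_mult_sum[OF RD(1) R(2) ij] using ij L(1) M(1)
      by (intro sum.cong refl, subst mat_diag_mult_right[OF R(1)], subst mat_diag_mult_right[OF adj_carrier[OF M(1)]])
        (auto simp: revc_index[of _ d d])
    also have "\<dots> = (mat_adjoint M * ?E * mat_adjoint L) $$ (i, j)"
      unfolding index_mult_sum[OF RD(2) adj_carrier[OF L(1)] ij]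
      by (rule sum_rev_index[of "\<lambda>l. (mat_adjoint M * ?E) $$ (i, l) * mat_adjoint L $$ (l, j)"])
    finally show "?B $$ (i, j) = (mat_adjoint M * ?E * mat_adjoint L) $$ (i, j)" .
  qed (use L(1) M(1) in auto)
  moreover have "(L * ?D * M) * (mat_adjoint M * ?E * mat_adjoint L) = 1\<^sub>m d"
  proof -
    have "(L * ?D * M) * (mat_adjoint M * ?E * mat_adjoint L) = L * (?D * ((M * mat_adjoint M) * (?E * mat_adjoint L)))"
      using L(1) M(1) by (simp add: assoc_mult_mat[of _ d d _ d _ d] mult_carrier_mat[of _ d d] del: mat_diag_diag)
    also have "\<dots> = L * ((?D * ?E) * mat_adjoint L)"
      unfolding M(3) using L(1) by (simp add: assoc_mult_mat[of _ d d _ d _ d] mult_carrier_mat[of _ d d] left_mult_one_mat[of _ d d] del: mat_diag_diag)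
    also have "?D * ?E = 1\<^sub>m d" unfolding mat_diag_diag
    proof (rule eq_matI)
      fix i j assume "i < dim_row (1\<^sub>m d :: 'a mat)" "j < dim_col (1\<^sub>m d :: 'a mat)"
      then show "mat_diag d (\<lambda>i. of_real (s i) * of_real (1 / s i)) $$ (i, j) = (1\<^sub>m d :: 'a mat) $$ (i, j)"
        using s(1)[rule_format, of j] by (simp add: mat_diag_carrier_index)
    qed (auto simp: mat_diag_def)
    finally show ?thesis using L by simp
  qed
  ultimately have "(L * ?D * M) * ?B = 1\<^sub>m d" by simp
  moreover have "det (L * ?D * M) \<noteq> 0" using K(4) by auto
  moreover have "?B \<in> carrier_mat d d" using R by (simp add: mult_carrier_mat[of _ d d])
  ultimately have inv: "inv\<^bsub>PGL d\<^esub> g = pcl d ?B" unfolding s(5) by (intro PGL_inv[OF K(3)])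
  have "(\<Prod>i=0..<d. 1 / s (d - 1 - i)) = 1"
    using prod_rev_index[of "\<lambda>i. 1 / s i" d] s(6) by (simp add: prod_dividef)
  moreover have "1 / s (d - 1 - j) \<le> 1 / s (d - 1 - i)" if "i \<le> j" "j < d" for i j
    using s(1,2) that by (intro divide_left_mono) auto
  ultimately show ?thesis
    unfolding kak_def using inv s(1) revc_unitary[OF unitary_adj[OF s(3)]] unitary_adj[OF revc_unitary[OF s(4)]] by auto
qed

subsection \<open>The representation of the projective group\<close>

lemma Phi_det:
  assumes k: "k \<le> d" and A: "A \<in> carrier_mat d d" "det A \<noteq> 0"
  shows "det (Phi d k A) \<noteq> 0"
proof -
  obtain B where B: "B \<in> carrier_mat d d" "A * B = 1\<^sub>m d" using det_inverse[OF A] by auto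
  have "Phi d k A * Phi d k B = 1\<^sub>m (rdim d k)"
    using Phi_mult[OF k A(1) B(1)] Phi_one[OF k, where 'a = 'a] B(2) by simp
  then show ?thesis using mult_eq_one_det[OF Phi_carrier Phi_carrier] by fastforce
qed

definition PhiP :: "nat \<Rightarrow> nat \<Rightarrow> ('a :: rc_field) mat set \<Rightarrow> real mat set" where
  "PhiP d k g = pcl (rdim d k) (Phi d k (SOME A. A \<in> g))"

lemma pcl_self: "A \<in> carrier_mat d d \<Longrightarrow> A \<in> pcl d (A :: 'a :: field mat)"
  by (subst pcl_eq) (auto intro!: exI[of _ 1] simp: one_smult_mat)

lemma PhiP_pcl:
  assumes k: "k \<le> d" and A: "A \<in> carrier_mat d d"
  shows "PhiP d k (pcl d A) = pcl (rdim d k) (Phi d k A)"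
proof -
  let ?B = "SOME B. B \<in> pcl d A"
  have "?B \<in> pcl d A" by (rule someI[of _ A]) (rule pcl_self[OF A])
  then obtain c where c: "c \<noteq> 0" "?B = c \<cdot>\<^sub>m A" unfolding pcl_eq[OF A] by auto
  show ?thesis
    unfolding PhiP_def c(2) Phi_smult[OF k A]
    by (rule sym, subst pcl_eq_iff) (use c(1) in \<open>auto intro!: exI[of _ "norm c ^ (2 * k)"]\<close>)
qed

lemma PhiP_in:
  assumes k: "k \<le> d" and g: "g \<in> carrier (PGL d)"
  shows "PhiP d k g \<in> carrier (PGL (rdim d k))"
proof -
  obtain A where A: "A \<in> carrier_mat d d" "det A \<noteq> 0" "g = pcl d A" using g by (auto simp: PGL_carrier)
  show ?thesis unfolding A(3) PhiP_pcl[OF k A(1)] by (rule pcl_in_PGL[OF Phi_carrier Phi_det[OF k A(1,2)]])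
qed

lemma PhiP_mult:
  assumes k: "k \<le> d" and g: "g \<in> carrier (PGL d)" "h \<in> carrier (PGL d)"
  shows "PhiP d k (g \<otimes>\<^bsub>PGL d\<^esub> h) = PhiP d k g \<otimes>\<^bsub>PGL (rdim d k)\<^esub> PhiP d k h"
proof -
  obtain A B where A: "A \<in> carrier_mat d d" "det A \<noteq> 0" "g = pcl d A" and B: "B \<in> carrier_mat d d" "det B \<noteq> 0" "h = pcl d B"
    using g by (auto simp: PGL_carrier)
  show ?thesis unfolding A(3) B(3) PGL_mult[OF A(1,2) B(1,2)] PhiP_pcl[OF k A(1)] PhiP_pcl[OF k B(1)]
    PhiP_pcl[OF k mult_carrier_mat[OF A(1) B(1)]] Phi_mult[OF k A(1) B(1)]
    by (rule PGL_mult[symmetric]) (auto simp: Phi_det[OF k] A B)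
qed

lemma PhiP_gap:
  assumes k: "0 < k" "k < d" and g: "g \<in> carrier (PGL d)"
  shows "root_gap 1 (PhiP d k g) = root_gap k g"
proof -
  have d: "0 < d" and kd: "k \<le> d" using k by auto
  obtain L s M where kak: "kak d g L s M" using kak_exists[OF g d] by blast
  note K = kak_carrier[OF kak]
  let ?A = "L * rdiag d s * M"
  have gA: "g = pcl d ?A" and s: "unitary d L" "unitary d M" "\<And>i. i < d \<Longrightarrow> 0 < s i" "\<And>i j. i \<le> j \<Longrightarrow> j < d \<Longrightarrow> s j \<le> s i"
    using kak by (auto simp: kak_def)
  have P: "PhiP d k g = pcl (rdim d k) (Phi d k ?A)" unfolding gA by (rule PhiP_pcl[OF kd K(3)])
  let ?B = "SOME B. B \<in> PhiP d k g \<and> norm (det B) = 1"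
  obtain B0 where "B0 \<in> carrier_mat (rdim d k) (rdim d k)" "norm (det B0) = 1" "PhiP d k g = pcl (rdim d k) B0"
    using PGL_lift_det_one[OF PhiP_in[OF kd g] rdim_pos[OF kd]] by auto
  then have "\<exists>B. B \<in> PhiP d k g \<and> norm (det B) = 1" using pcl_self by blast
  then have B: "?B \<in> PhiP d k g" using someI_ex[of "\<lambda>B. B \<in> PhiP d k g \<and> norm (det B) = 1"] by blast
  then obtain c where c: "c \<noteq> 0" "?B = c \<cdot>\<^sub>m Phi d k ?A" unfolding P pcl_eq[OF Phi_carrier] by auto
  \<comment> \<open>The lift chosen in \<open>sv\<close> is a real multiple of \<open>Phi\<close>;
    \<open>singular_values_Phi\<close> expects the factor as sign times modulus.\<close>
  have "c = sgn c * \<bar>c\<bar>" by (simp add: sgn_mult_abs)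
  moreover have "norm (sgn c) = 1" "0 < \<bar>c\<bar>" using c(1) by (auto simp: abs_sgn_eq)
  ultimately have "singular_values ?B ! 0 / singular_values ?B ! 1 = s (k - 1) / s k"
    using singular_values_Phi[OF k s(1,2) s(3,4), where u = "sgn c" and t = "\<bar>c\<bar>"] c(2) by simp
  then show ?thesis unfolding kak_gap[OF kak k] by (simp add: root_gap_def sv_def)
qed

text \<open>If the images of two lifts are proportional, the quotient of the lifts acts on forms by
  a scalar. It fixes the Pluecker line of every k-plane, hence every k-plane, and is scalar by
  \<open>stabilizer_all_scalar\<close>.\<close>

lemma PhiP_inj:
  assumes k: "0 < k" "k < d" and g: "g \<in> carrier (PGL d)" "h \<in> carrier (PGL d)"
    and e: "PhiP d k g = PhiP d k h"
  shows "g = h"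
proof -
  have kd: "k \<le> d" using k by simp
  obtain A B where A: "A \<in> carrier_mat d d" "det A \<noteq> 0" "g = pcl d A" and B: "B \<in> carrier_mat d d" "det B \<noteq> 0" "h = pcl d B"
    using g by (auto simp: PGL_carrier)
  obtain A' where A': "A' \<in> carrier_mat d d" "A * A' = 1\<^sub>m d" "A' * A = 1\<^sub>m d" "det A' \<noteq> 0" using det_inverse[OF A(1,2)] by auto
  obtain c where c: "c \<noteq> 0" "Phi d k B = c \<cdot>\<^sub>m Phi d k A"
    using e unfolding A(3) B(3) PhiP_pcl[OF kd A(1)] PhiP_pcl[OF kd B(1)] pcl_eq_iff[OF Phi_carrier Phi_carrier] by auto
  let ?X = "A' * B"
  have X: "?X \<in> carrier_mat d d" "det ?X \<noteq> 0" using A'(1,4) B(1,2) det_mult[OF A'(1) B(1)] by auto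
  have "Phi d k ?X = Phi d k A' * (c \<cdot>\<^sub>m Phi d k A)" unfolding Phi_mult[OF kd A'(1) B(1)] c(2) ..
  also have "\<dots> = c \<cdot>\<^sub>m (Phi d k A' * Phi d k A)" by (rule mult_smult_distrib[OF Phi_carrier Phi_carrier])
  also have "\<dots> = c \<cdot>\<^sub>m 1\<^sub>m (rdim d k)" unfolding Phi_mult[OF kd A'(1) A(1), symmetric] A'(3) Phi_one[OF kd] ..
  finally have PX: "Phi d k ?X = c \<cdot>\<^sub>m 1\<^sub>m (rdim d k)" .
  have "mat_image ?X V \<subseteq> V" if V: "V \<in> Gr d k" for V
  proof -
    let ?e = "evec (nks d k)"
    have "Phi d k ?X *\<^sub>v pW d k V = c \<cdot>\<^sub>v pW d k V"
      unfolding PX by (simp add: smult_mat_vec[of _ "rdim d k" "rdim d k"])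
    note P = this
    have "?e \<bullet> (c \<cdot>\<^sub>v pW d k V) = c * (?e \<bullet> pW d k V)" by (rule scalar_prod_smult_right) simp
    then have ec: "?e \<bullet> (c \<cdot>\<^sub>v pW d k V) = c" unfolding evec_pW[OF V] by simp
    have "c \<cdot>\<^sub>v pW d k V = c \<cdot>\<^sub>v pW d k (mat_image ?X V)" using Phi_pW(2)[OF V X] unfolding P ec .
    then have "inverse c \<cdot>\<^sub>v (c \<cdot>\<^sub>v pW d k V) = inverse c \<cdot>\<^sub>v (c \<cdot>\<^sub>v pW d k (mat_image ?X V))" by simp
    then have "pW d k V = pW d k (mat_image ?X V)" using c(1) by (simp add: smult_smult_assoc)
    then show ?thesis using pW_injective[OF V Gr_image[OF V X]] by simp
  qed
  then obtain x where x: "?X = x \<cdot>\<^sub>m 1\<^sub>m d" using stabilizer_all_scalar[OF X(1) k] by blast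
  have "B = A * ?X" using A A' B(1) by (simp add: assoc_mult_mat[of _ d d _ d _ d, symmetric])
  also have "\<dots> = x \<cdot>\<^sub>m A" unfolding x using A(1) mult_smult_distrib[OF A(1) one_carrier_mat, of x] by simp
  finally have "B = x \<cdot>\<^sub>m A" .
  moreover from this have "x \<noteq> 0" using B(1,2) k A(1) by auto
  ultimately show ?thesis unfolding A(3) B(3) pcl_eq_iff[OF A(1) B(1)] by blast
qed

subsection \<open>Sequential compactness\<close>

abbreviation subsequence :: "(nat \<Rightarrow> nat) \<Rightarrow> bool" where
  "subsequence \<equiv> strict_mono"

abbreviation Gr_lim :: "nat \<Rightarrow> nat \<Rightarrow> (nat \<Rightarrow> 'a :: real_normed_field vec set) \<Rightarrow> 'a vec set \<Rightarrow> bool" where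
  "Gr_lim d k V W \<equiv> limitin (Gr_topology d k) V W sequentially"

abbreviation flag_lim :: "nat \<Rightarrow> nat set \<Rightarrow> (nat \<Rightarrow> nat \<Rightarrow> 'a :: real_normed_field vec set) \<Rightarrow> (nat \<Rightarrow> 'a vec set) \<Rightarrow> bool" where
  "flag_lim d \<theta> F G \<equiv> limitin (flag_topology d \<theta>) F G sequentially"

lemma finite_family_convergent_subsequence:
  fixes X :: "nat \<Rightarrow> 'i \<Rightarrow> 'a :: {real_normed_vector, heine_borel}"
  assumes "finite I" "\<And>i. i \<in> I \<Longrightarrow> \<exists>C. \<forall>n. norm (X n i) \<le> C"
  shows "\<exists>l r. subsequence r \<and> (\<forall>i\<in>I. (\<lambda>n. X (r n) i) \<longlonglongrightarrow> l i)"
  using assms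
proof (induction I rule: finite_induct)
  case empty
  then show ?case by (intro exI[of _ undefined] exI[of _ id]) (auto simp: strict_mono_def)
next
  case (insert a I)
  then obtain l r where r: "subsequence r" "\<forall>i\<in>I. (\<lambda>n. X (r n) i) \<longlonglongrightarrow> l i" by blast
  obtain C where C: "\<And>n. norm (X n a) \<le> C" using insert.prems[of a] by auto
  have "bounded (range (\<lambda>n. X (r n) a))" unfolding bounded_iff using C by auto
  then obtain m q where q: "subsequence q" "((\<lambda>n. X (r n) a) \<circ> q) \<longlonglongrightarrow> m"
    using bounded_imp_convergent_subsequence by blast
  have "(\<lambda>n. X ((r \<circ> q) n) i) \<longlonglongrightarrow> (l(a := m)) i" if "i \<in> insert a I" for i
  proof (cases "i = a")
    case True
    then show ?thesis using q(2) by (simp add: o_def)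
  next
    case False
    then have "i \<in> I" using that by simp
    then show ?thesis using LIMSEQ_subseq_LIMSEQ[OF r(2)[rule_format] q(1)] False by (simp add: o_def)
  qed
  moreover have "strict_mono (r \<circ> q)" by (rule strict_mono_o[OF r(1) q(1)])
  ultimately show ?case by blast
qed

lemma mconv_subseq: "mconv m n A L \<Longrightarrow> strict_mono r \<Longrightarrow> mconv m n (\<lambda>t. A (r t)) L"
  unfolding mconv_def using LIMSEQ_subseq_LIMSEQ by (fastforce simp: o_def)

lemma mconv_adj:
  assumes "mconv m n A (L :: 'a :: rc_field mat)" "\<And>t. A t \<in> carrier_mat m n" "L \<in> carrier_mat m n"
  shows "mconv n m (\<lambda>t. mat_adjoint (A t)) (mat_adjoint L)"
proof -
  have "dim_row (A t) = m" "dim_col (A t) = n" for t using assms(2)[of t] by auto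
  then show ?thesis using assms(1,3) by (auto simp: mconv_def intro!: tendsto_conjugate)
qed

lemma mconv_lcols:
  assumes "mconv d d A L" "\<And>t. A t \<in> carrier_mat d d" "L \<in> carrier_mat d d" "k \<le> d"
  shows "mconv d k (\<lambda>t. lcols k (A t)) (lcols k L)"
  unfolding mconv_def
proof (intro allI impI)
  fix i j assume ij: "i < d" "j < k"
  have "lcols k (A t) $$ (i, j) = A t $$ (i, j)" for t using assms(2)[of t] ij by auto
  then show "(\<lambda>t. lcols k (A t) $$ (i, j)) \<longlonglongrightarrow> lcols k L $$ (i, j)"
    using assms ij by (auto simp: mconv_def)
qed

lemma unitary_convergent:
  assumes L: "\<And>n. unitary d (L n :: 'a :: rc_field mat)"
  shows "\<exists>K r. subsequence r \<and> unitary d K \<and> mconv d d (\<lambda>n. L (r n)) K"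
proof -
  have "\<exists>l r. subsequence r \<and> (\<forall>i\<in>{0..<d} \<times> {0..<d}. (\<lambda>n. L (r n) $$ i) \<longlonglongrightarrow> l i)"
  proof (rule finite_family_convergent_subsequence)
    fix i assume "i \<in> {0..<d} \<times> {0..<d}"
    then show "\<exists>C. \<forall>n. norm (L n $$ i) \<le> C" using isometric_entry_le[OF unitaryD(1,2)[OF L]] by (cases i) auto
  qed simp
  then obtain l r where r: "subsequence r" "\<forall>i\<in>{0..<d} \<times> {0..<d}. (\<lambda>n. L (r n) $$ i) \<longlonglongrightarrow> l i" by blast
  define K where "K = mat d d l"
  have K: "K \<in> carrier_mat d d" by (simp add: K_def)
  have cv: "mconv d d (\<lambda>n. L (r n)) K" using r(2) by (auto simp: mconv_def K_def)
  have "unitary d K"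
    unfolding unitary_def adj_mult_self_eq_one_iff[OF K]
  proof (intro conjI K allI impI)
    fix a b assume ab: "a < d" "b < d"
    have "(\<lambda>n. \<Sum>i=0..<d. conjugate (L (r n) $$ (i, a)) * L (r n) $$ (i, b)) \<longlonglongrightarrow>
      (\<Sum>i=0..<d. conjugate (K $$ (i, a)) * K $$ (i, b))"
      using cv ab by (intro tendsto_intros tendsto_conjugate) (auto simp: mconv_def)
    moreover have "(\<Sum>i=0..<d. conjugate (L (r n) $$ (i, a)) * L (r n) $$ (i, b)) = (if a = b then 1 else 0)" for n
      using adj_mult_self_eq_one_iff[OF unitaryD(1)[OF L]] unitaryD(2)[OF L] ab by blast
    ultimately have "(\<lambda>n. if a = b then 1 else 0 :: 'a) \<longlonglongrightarrow> (\<Sum>i=0..<d. conjugate (K $$ (i, a)) * K $$ (i, b))" by simp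
    then show "(\<Sum>i=0..<d. conjugate (K $$ (i, a)) * K $$ (i, b)) = (if a = b then 1 else 0)"
      using LIMSEQ_unique tendsto_const by blast
  qed
  then show ?thesis using r(1) cv by blast
qed

subsection \<open>Topologies on matrices and Grassmannians\<close>

lemma topspace_mat_topology [simp]: "topspace (mat_topology m n) = carrier_mat m n"
  by (auto simp: mat_topology_def topspace_pullback_topology)

lemma continuous_map_entry:
  assumes "i < m" "j < n"
  shows "continuous_map (mat_topology m n) euclidean (\<lambda>A. A $$ (i, j))"
proof -
  have "continuous_map (mat_topology m n) euclidean
    ((\<lambda>x. x (i, j)) \<circ> (\<lambda>A. restrict (\<lambda>ij. A $$ ij) ({..<m} \<times> {..<n})))"
    unfolding mat_topology_def using assms
    by (intro continuous_map_pullback continuous_map_product_projection) auto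
  then show ?thesis using assms by (simp add: o_def)
qed

lemma continuous_map_into_mat:
  assumes "\<And>x. x \<in> topspace X \<Longrightarrow> f x \<in> carrier_mat m n"
    "\<And>i j. i < m \<Longrightarrow> j < n \<Longrightarrow> continuous_map X euclidean (\<lambda>x. f x $$ (i, j))"
  shows "continuous_map X (mat_topology m n) f"
  unfolding mat_topology_def
proof (rule continuous_map_pullback')
  show "continuous_map X (product_topology (\<lambda>_. euclidean) ({..<m} \<times> {..<n}))
    ((\<lambda>A. restrict (\<lambda>ij. A $$ ij) ({..<m} \<times> {..<n})) \<circ> f)"
    unfolding o_def using assms(2) by (subst continuous_map_componentwise) auto
  show "topspace X \<subseteq> f -` carrier_mat m n" using assms(1) by auto
qed

lemma limitin_mat:
  assumes "\<And>t. A t \<in> carrier_mat m n" "L \<in> carrier_mat m n" "mconv m n A L"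
  shows "limitin (mat_topology m n) A L sequentially"
  unfolding limitin_def
proof (intro conjI allI impI)
  show "L \<in> topspace (mat_topology m n)" using assms by simp
  let ?f = "\<lambda>A. restrict (\<lambda>ij. A $$ ij) ({..<m} \<times> {..<n})"
  fix U assume U: "openin (mat_topology m n) U \<and> L \<in> U"
  then obtain V where V: "openin (product_topology (\<lambda>_. euclidean) ({..<m} \<times> {..<n})) V" "U = ?f -` V \<inter> carrier_mat m n"
    by (auto simp: mat_topology_def openin_pullback_topology)
  have "limitin (product_topology (\<lambda>_. euclidean) ({..<m} \<times> {..<n})) (\<lambda>t. ?f (A t)) (?f L) sequentially"
    unfolding limitin_componentwise using assms(3) by (auto simp: mconv_def)
  moreover have "?f L \<in> V" using U V(2) by auto
  ultimately have "\<forall>\<^sub>F t in sequentially. ?f (A t) \<in> V" using V(1) by (auto simp: limitin_def)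
  then show "\<forall>\<^sub>F t in sequentially. A t \<in> U" unfolding V(2) using assms(1) by auto
qed

lemma continuous_map_euclideanI:
  assumes "\<And>x. x \<in> topspace X \<Longrightarrow> (f \<longlongrightarrow> f x) (atin X x)"
  shows "continuous_map X euclidean f"
  using assms by (simp add: continuous_map_atin)

lemma continuous_map_euclideanD:
  assumes "continuous_map X euclidean f" "x \<in> topspace X"
  shows "(f \<longlongrightarrow> f x) (atin X x)"
  using assms by (simp add: continuous_map_atin)

abbreviation frames :: "nat \<Rightarrow> nat \<Rightarrow> ('a :: real_normed_field) mat topology" where
  "frames d k \<equiv> subtopology (mat_topology d k) {A. column_space k A \<in> Gr d k}"

lemma quotient_map_Gr: "quotient_map (frames d k) (Gr_topology d k) (column_space k)"
  unfolding Gr_topology_def by (rule quotient_map_quotient_topology)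

lemma topspace_Gr [simp]: "topspace (Gr_topology d k) = (Gr d k :: 'a :: rc_field vec set set)"
proof -
  have "topspace (Gr_topology d k) = column_space k ` topspace (frames d k :: 'a mat topology)"
    unfolding Gr_topology_def by (rule topspace_quotient_topology)
  also have "\<dots> = Gr d k"
  proof (intro equalityI subsetI)
    fix W assume "W \<in> column_space k ` topspace (frames d k :: 'a mat topology)"
    then show "W \<in> Gr d k" by auto
  next
    fix W :: "'a vec set" assume W: "W \<in> Gr d k"
    then obtain L where L: "unitary d L" "W = cs k L" using Gr_unitary(2) by blast
    then have "lcols k L \<in> topspace (frames d k)" using W unitaryD(1)[OF L(1)] by auto
    then show "W \<in> column_space k ` topspace (frames d k :: 'a mat topology)" using L(2) by blast
  qed
  finally show ?thesis .
qed

lemma limitin_Gr_column_space: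
  assumes "\<And>t. B t \<in> carrier_mat d k" "L \<in> carrier_mat d k" "mconv d k B L"
    "\<And>t. column_space k (B t) \<in> Gr d k" "column_space k L \<in> Gr d k"
  shows "Gr_lim d k (\<lambda>t. column_space k (B t)) (column_space k L)"
proof -
  have "limitin (frames d k) B L sequentially"
    unfolding limitin_subtopology using limitin_mat[OF assms(1-3)] assms(4,5) by simp
  then show ?thesis
    using continuous_map_limit[OF quotient_imp_continuous_map[OF quotient_map_Gr]] by (simp add: o_def)
qed

lemma limitin_Gr_unitary:
  assumes "k \<le> d" "\<And>t. unitary d (L t :: 'a :: rc_field mat)" "unitary d K" "mconv d d L K"
  shows "Gr_lim d k (\<lambda>t. cs k (L t)) (cs k K)"
proof (rule limitin_Gr_column_space)
  show "mconv d k (\<lambda>t. lcols k (L t)) (lcols k K)"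
    by (rule mconv_lcols[OF assms(4) unitaryD(1)[OF assms(2)] unitaryD(1)[OF assms(3)] assms(1)])
  show "lcols k (L t) \<in> carrier_mat d k" for t using unitaryD(1)[OF assms(2)] by auto
  show "lcols k K \<in> carrier_mat d k" using unitaryD(1)[OF assms(3)] by auto
  show "cs k (L t) \<in> Gr d k" for t by (rule unitary_Gr[OF assms(2,1)])
  show "cs k K \<in> Gr d k" by (rule unitary_Gr[OF assms(3,1)])
qed

subsection \<open>The Pluecker embedding is a topological embedding\<close>

lemma tendsto_pv:
  assumes "k \<le> d" "\<And>i j. i < d \<Longrightarrow> j < k \<Longrightarrow> ((\<lambda>x. B x $$ (i, j)) \<longlongrightarrow> L $$ (i, j)) F" "y < rdim d k"
  shows "((\<lambda>x. pv d k (B x) $ y) \<longlongrightarrow> pv d k L $ y) F"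
proof -
  have y: "y < nks d k * nks d k" using assms(3) by (simp add: rdim_def)
  have c: "((\<lambda>x. cve d k (B x) i) \<longlongrightarrow> cve d k L i) F" if "i < nks d k" for i
    unfolding cve_def using kel_image(3)[OF assms(1) that] assms(2) by (intro tendsto_emb tendsto_det) auto
  show ?thesis using y c[OF divmod_less(1)[OF y]] c[OF divmod_less(2)[OF y]]
    by (simp add: pv_def zeta_def del: times_complex.sel complex_cnj) (intro tendsto_intros)
qed

lemma tendsto_evec_pv:
  assumes "k \<le> d" "\<And>i j. i < d \<Longrightarrow> j < k \<Longrightarrow> ((\<lambda>x. B x $$ (i, j)) \<longlongrightarrow> L $$ (i, j)) F"
  shows "((\<lambda>x. evec (nks d k) \<bullet> pv d k (B x)) \<longlongrightarrow> evec (nks d k) \<bullet> pv d k L) F"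
proof -
  have "((\<lambda>x. \<Sum>y=0..<rdim d k. evec (nks d k) $ y * pv d k (B x) $ y) \<longlongrightarrow>
    (\<Sum>y=0..<rdim d k. evec (nks d k) $ y * pv d k L $ y)) F"
    by (intro tendsto_intros tendsto_pv[OF assms]) auto
  then show ?thesis by (simp add: scalar_prod_def)
qed

text \<open>\<open>pW\<close> is defined by a choice of frame, but on all frames it equals
  \<open>pv\<close> divided by its trace. That expression is continuous and descends through the
  quotient map of the Grassmannian.\<close>

lemma continuous_map_pW:
  assumes k: "k \<le> d" and y: "y < rdim d k"
  shows "continuous_map (Gr_topology d k) euclidean (\<lambda>W :: 'a :: rc_field vec set. pW d k W $ y)"
proof -
  let ?e = "evec (nks d k)"
  have "continuous_map (frames d k) euclidean (\<lambda>B :: 'a mat. pv d k B $ y / (?e \<bullet> pv d k B))"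
  proof (rule continuous_map_euclideanI)
    fix B :: "'a mat" assume B: "B \<in> topspace (frames d k)"
    then have B': "B \<in> carrier_mat d k" "column_space k B \<in> Gr d k" by auto
    have lim: "((\<lambda>x. x $$ (i, j)) \<longlongrightarrow> B $$ (i, j)) (atin (frames d k) B)" if "i < d" "j < k" for i j
      by (rule continuous_map_euclideanD[OF continuous_map_from_subtopology[OF continuous_map_entry[OF that]] B])
    have "?e \<bullet> pv d k B \<noteq> 0" using pW_frame(1)[OF k B'] by simp
    then show "((\<lambda>B. pv d k B $ y / (?e \<bullet> pv d k B)) \<longlongrightarrow> pv d k B $ y / (?e \<bullet> pv d k B)) (atin (frames d k) B)"
      by (intro tendsto_divide tendsto_pv[OF k lim y] tendsto_evec_pv[OF k lim])
  qed
  moreover have "pv d k B $ y / (?e \<bullet> pv d k B) = ((\<lambda>W. pW d k W $ y) \<circ> column_space k) B" if "B \<in> topspace (frames d k)" for B :: "'a mat"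
  proof -
    have B': "B \<in> carrier_mat d k" "column_space k B \<in> Gr d k" using that by auto
    have "pv d k B $ y = (?e \<bullet> pv d k B) * pW d k (column_space k B) $ y"
      using arg_cong[OF pW_frame(2)[OF k B'], of "\<lambda>v. v $ y"] y by simp
    then show ?thesis using pW_frame(1)[OF k B'] by simp
  qed
  ultimately have "continuous_map (frames d k) euclidean ((\<lambda>W :: 'a vec set. pW d k W $ y) \<circ> column_space k)"
    by (rule continuous_map_eq)
  then show ?thesis using continuous_compose_quotient_map_eq[OF quotient_map_Gr] by blast
qed

lemma limitin_Gr_imp_pW:
  assumes "limitin (Gr_topology d k) V W F" "k \<le> d" "y < rdim d k"
  shows "((\<lambda>t. pW d k (V t) $ y) \<longlongrightarrow> pW d k W $ y) F"
  using continuous_map_limit[OF continuous_map_pW[OF assms(2,3)] assms(1)] by (simp add: o_def)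

lemma not_eventually_subseq:
  assumes "\<not> (\<forall>\<^sub>F n in sequentially. P n)"
  shows "\<exists>r. subsequence r \<and> (\<forall>n. \<not> P (r n))"
proof -
  have "infinite {n. \<not> P n}"
    using assms unfolding infinite_nat_iff_unbounded_le eventually_sequentially by auto
  from infinite_enumerate[OF this] show ?thesis by auto
qed

text \<open>Conversely, suppose a subsequence stays outside a neighbourhood of \<open>W\<close>. Its
  unitary frames converge along a further subsequence, to a plane with the same Pluecker form as
  \<open>W\<close>; by injectivity this plane is \<open>W\<close>.\<close>

lemma limitin_Gr_iff:
  assumes V: "\<And>n. V n \<in> Gr d k" and W: "W \<in> Gr d k"
  shows "Gr_lim d k V W \<longleftrightarrow> (\<forall>y<rdim d k. (\<lambda>n. pW d k (V n) $ y) \<longlonglongrightarrow> pW d k W $ y)"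
proof
  have k: "k \<le> d" using Gr_unitary(1)[OF W] .
  {
    assume "Gr_lim d k V W"
    from limitin_Gr_imp_pW[OF this k]
    show "\<forall>y<rdim d k. (\<lambda>n. pW d k (V n) $ y) \<longlonglongrightarrow> pW d k W $ y" by simp
  }
  assume lim: "\<forall>y<rdim d k. (\<lambda>n. pW d k (V n) $ y) \<longlonglongrightarrow> pW d k W $ y"
  show "Gr_lim d k V W"
    unfolding limitin_def
  proof (intro conjI allI impI)
    show "W \<in> topspace (Gr_topology d k)" using W by simp
    fix U assume U: "openin (Gr_topology d k) U \<and> W \<in> U"
    show "\<forall>\<^sub>F n in sequentially. V n \<in> U"
    proof (rule ccontr)
      assume "\<not> (\<forall>\<^sub>F n in sequentially. V n \<in> U)"
      then obtain r where r: "subsequence r" "\<And>n. V (r n) \<notin> U" using not_eventually_subseq by blast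
      have "\<forall>n. \<exists>L. unitary d L \<and> V (r n) = cs k L" using Gr_unitary(2)[OF V] by blast
      then obtain L where L: "\<And>n. unitary d (L n)" "\<And>n. V (r n) = cs k (L n)" by metis
      obtain K q where K: "subsequence q" "unitary d K" "mconv d d (\<lambda>n. L (q n)) K"
        using unitary_convergent[where L = L, OF L(1)] by (elim exE conjE) (rule that)
      have l: "Gr_lim d k (\<lambda>n. V (r (q n))) (cs k K)"
        unfolding L(2) by (rule limitin_Gr_unitary[OF k L(1) K(2,3)])
      have "pW d k (cs k K) = pW d k W"
      proof (rule eq_vecI)
        fix y assume "y < dim_vec (pW d k W)"
        then have y: "y < rdim d k" by simp
        have "(\<lambda>n. pW d k (V (r (q n))) $ y) \<longlonglongrightarrow> pW d k W $ y"
          using LIMSEQ_subseq_LIMSEQ[OF lim[rule_format, OF y] strict_mono_o[OF r(1) K(1)]] by (simp add: o_def)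
        then show "pW d k (cs k K) $ y = pW d k W $ y"
          using limitin_Gr_imp_pW[OF l k y] LIMSEQ_unique by blast
      qed simp
      then have "cs k K = W" by (rule pW_injective[OF unitary_Gr[OF K(2) k] W])
      then have "\<forall>\<^sub>F n in sequentially. V (r (q n)) \<in> U" using l U by (auto simp: limitin_def)
      then show False using r(2) by (auto simp: eventually_sequentially)
    qed
  qed
qed

lemma limitin_Gr_unique:
  assumes "Gr_lim d k V W" "Gr_lim d k V (W' :: 'a :: rc_field vec set)" "k \<le> d"
  shows "W = W'"
proof -
  have "pW d k W $ y = pW d k W' $ y" if "y < rdim d k" for y
    using limitin_Gr_imp_pW[OF assms(1,3) that] limitin_Gr_imp_pW[OF assms(2,3) that] by (rule LIMSEQ_unique)
  then have "pW d k W = pW d k W'" by (intro eq_vecI) auto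
  then show ?thesis using limitin_topspace[OF assms(1)] limitin_topspace[OF assms(2)] by (intro pW_injective[of _ d k]) auto
qed

lemma LIMSEQ_inverse_Suc:
  assumes "\<And>n. \<bar>f n - l\<bar> \<le> 1 / real (Suc n)"
  shows "f \<longlonglongrightarrow> l"
proof -
  have "(\<lambda>n. 1 / real (Suc n)) \<longlonglongrightarrow> 0" using LIMSEQ_inverse_real_of_nat by (simp only: inverse_eq_divide)
  then have "(\<lambda>n. f n - l) \<longlonglongrightarrow> 0" by (rule Lim_null_comparison[rotated]) (use assms in simp)
  then show ?thesis by (simp add: LIM_zero_iff)
qed

text \<open>The l1-distance of Pluecker forms has open balls, and a sequence in balls of radius 1 /
  (t + 1) converges by \<open>limitin_Gr_iff\<close>. So sequences suffice to test continuity on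
  subsets of the Grassmannian.\<close>

lemma Gr_sequential_continuous:
  fixes f :: "'a :: rc_field vec set \<Rightarrow> 'b"
  assumes k: "k \<le> d" and S: "S \<subseteq> Gr d k" and f: "\<And>x. x \<in> S \<Longrightarrow> f x \<in> topspace Y"
    and s: "\<And>\<sigma> x. Gr_lim d k \<sigma> x \<Longrightarrow> (\<And>n. \<sigma> n \<in> S) \<Longrightarrow> x \<in> S \<Longrightarrow>
      limitin Y (\<lambda>n. f (\<sigma> n)) (f x) sequentially"
  shows "continuous_map (subtopology (Gr_topology d k) S) Y f"
proof -
  have ts: "topspace (subtopology (Gr_topology d k) S) = S" using S by auto
  show ?thesis
    unfolding continuous_map_def ts
  proof (intro conjI allI impI)
    show "f \<in> S \<rightarrow> topspace Y" using f by auto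
    fix V assume V: "openin Y V"
    show "openin (subtopology (Gr_topology d k) S) {x \<in> S. f x \<in> V}"
    proof (subst openin_subopen, rule ballI)
      fix x assume x: "x \<in> {x \<in> S. f x \<in> V}"
      let ?D = "\<lambda>W. \<Sum>y=0..<rdim d k. \<bar>pW d k x $ y - pW d k W $ y\<bar>"
      let ?U = "\<lambda>t :: nat. {W \<in> topspace (Gr_topology d k). ?D W \<in> {..<1 / real (Suc t)}}"
      have "continuous_map (Gr_topology d k) euclidean ?D"
        by (rule continuous_map_euclideanI, intro tendsto_intros continuous_map_euclideanD[OF continuous_map_pW[OF k]]) auto
      then have o: "openin (Gr_topology d k) (?U t)" for t by (rule openin_continuous_map_preimage) auto
      have "\<exists>t. S \<inter> ?U t \<subseteq> {x \<in> S. f x \<in> V}"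
      proof (rule ccontr)
        assume "\<not> ?thesis"
        then have "\<forall>t. \<exists>W. W \<in> S \<inter> ?U t \<and> f W \<notin> V" by blast
        from choice[OF this] obtain \<sigma> where "\<forall>t. \<sigma> t \<in> S \<inter> ?U t \<and> f (\<sigma> t) \<notin> V" ..
        then have \<sigma>: "\<sigma> t \<in> S \<inter> ?U t" "f (\<sigma> t) \<notin> V" for t by blast+
        have l: "(\<lambda>t. pW d k (\<sigma> t) $ y) \<longlonglongrightarrow> pW d k x $ y" if y: "y < rdim d k" for y
        proof (rule LIMSEQ_inverse_Suc)
          fix t
          have "\<bar>pW d k x $ y - pW d k (\<sigma> t) $ y\<bar> \<le> ?D (\<sigma> t)" by (rule member_le_sum[of y]) (use y in auto)
          then show "\<bar>pW d k (\<sigma> t) $ y - pW d k x $ y\<bar> \<le> 1 / real (Suc t)" using \<sigma>(1)[of t] by (auto simp: abs_minus_commute)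
        qed
        have xS: "x \<in> S" "\<sigma> t \<in> S" for t using x \<sigma>(1)[of t] by auto
        then have "x \<in> Gr d k" "\<sigma> t \<in> Gr d k" for t using S by auto
        then have "Gr_lim d k \<sigma> x"
          by (subst limitin_Gr_iff) (auto intro: l)
        then have "limitin Y (\<lambda>n. f (\<sigma> n)) (f x) sequentially" using xS(2,1) by (rule s)
        then have "\<forall>\<^sub>F n in sequentially. f (\<sigma> n) \<in> V" using V x by (simp add: limitin_def)
        then show False using \<sigma>(2) by (auto simp: eventually_sequentially)
      qed
      then obtain t where t: "S \<inter> ?U t \<subseteq> {x \<in> S. f x \<in> V}" by blast
      have "openin (subtopology (Gr_topology d k) S) (S \<inter> ?U t)" using o by (rule openin_subtopology_Int2)
      moreover have "x \<in> S \<inter> ?U t" using x S by auto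
      ultimately show "\<exists>T. openin (subtopology (Gr_topology d k) S) T \<and> x \<in> T \<and> T \<subseteq> {x \<in> S. f x \<in> V}" using t by blast
    qed
  qed
qed

lemma limitin_flag:
  "flag_lim d \<theta> F G \<longleftrightarrow>
    G \<in> flags d \<theta> \<and> (\<forall>\<^sub>F n in sequentially. F n \<in> flags d \<theta>) \<and>
    (\<forall>j\<in>\<theta>. Gr_lim d j (\<lambda>n. F n j) (G j :: 'a :: rc_field vec set))"
proof -
  have sub: "flags d \<theta> \<subseteq> topspace (product_topology (Gr_topology d) \<theta> :: (nat \<Rightarrow> 'a vec set) topology)"
    by (auto simp: flags_def topspace_product_topology PiE_def)
  have "flag_lim d \<theta> F G \<longleftrightarrow>
    G \<in> flags d \<theta> \<and> (\<forall>\<^sub>F n in sequentially. F n \<in> flags d \<theta>) \<and> limitin (product_topology (Gr_topology d) \<theta>) F G sequentially"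
    by (simp add: flag_topology_def limitin_subtopology)
  also have "\<dots> \<longleftrightarrow> G \<in> flags d \<theta> \<and> (\<forall>\<^sub>F n in sequentially. F n \<in> flags d \<theta>) \<and>
    (\<forall>j\<in>\<theta>. Gr_lim d j (\<lambda>n. F n j) (G j))"
    unfolding limitin_componentwise using sub
    by (auto simp: flags_def elim!: eventually_mono)
  finally show ?thesis .
qed

lemma topspace_flag [simp]: "topspace (flag_topology d \<theta>) = (flags d \<theta> :: (nat \<Rightarrow> 'a :: rc_field vec set) set)"
proof -
  have "flags d \<theta> \<subseteq> topspace (product_topology (Gr_topology d) \<theta> :: (nat \<Rightarrow> 'a vec set) topology)"
    by (auto simp: flags_def topspace_product_topology PiE_def)
  then show ?thesis by (auto simp: flag_topology_def)
qed

subsection \<open>Lines\<close>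

definition col1 :: "real vec \<Rightarrow> real mat" where
  "col1 v = mat (dim_vec v) 1 (\<lambda>(i, j). v $ i)"

lemma col1_carrier [simp]: "v \<in> carrier_vec n \<Longrightarrow> col1 v \<in> carrier_mat n 1"
  by (auto simp: col1_def)

lemma column_space_1:
  assumes "B \<in> carrier_mat n 1"
  shows "column_space 1 B = line (col B 0)"
proof -
  have e: "B *\<^sub>v w = w $ 0 \<cdot>\<^sub>v col B 0" if "w \<in> carrier_vec 1" for w
    using that assms by (intro eq_vecI) (auto simp: scalar_prod_def mult.commute)
  show ?thesis
  proof (intro equalityI subsetI)
    fix x assume "x \<in> column_space 1 B"
    then show "x \<in> line (col B 0)" by (auto simp: column_space_def line_def e)
  next
    fix x assume "x \<in> line (col B 0)"
    then obtain c where c: "x = c \<cdot>\<^sub>v col B 0" by (auto simp: line_def)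
    have "x = B *\<^sub>v vec 1 (\<lambda>_. c)" unfolding c by (subst e) auto
    moreover have "vec 1 (\<lambda>_. c) \<in> carrier_vec 1" by simp
    ultimately show "x \<in> column_space 1 B" unfolding column_space_def by (intro CollectI exI[of _ "vec 1 (\<lambda>_. c)"] conjI)
  qed
qed

lemma col_col1: "v \<in> carrier_vec n \<Longrightarrow> col (col1 v) 0 = v"
  by (intro eq_vecI) (auto simp: col1_def)

lemma column_space_col1: "v \<in> carrier_vec n \<Longrightarrow> column_space 1 (col1 v) = line v"
  using column_space_1[OF col1_carrier, of v n] by (simp add: col_col1)

lemma vec_nonzero_iff: "v \<in> carrier_vec n \<Longrightarrow> v \<noteq> 0\<^sub>v n \<longleftrightarrow> (\<exists>i<n. v $ i \<noteq> 0)"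
  by (metis carrier_vecD eq_vecI index_zero_vec)

lemma line_Gr:
  assumes "v \<in> carrier_vec n" "v \<noteq> 0\<^sub>v n"
  shows "line v \<in> Gr n 1"
  unfolding column_space_col1[OF assms(1), symmetric]
proof (rule Gr_column_space[OF col1_carrier[OF assms(1)]])
  fix w :: "real vec" assume w: "w \<in> carrier_vec 1" "col1 v *\<^sub>v w = 0\<^sub>v n"
  obtain i where i: "i < n" "v $ i \<noteq> 0" using vec_nonzero_iff[OF assms(1)] assms(2) by auto
  have "(col1 v *\<^sub>v w) $ i = v $ i * w $ 0" using i w(1) assms(1) by (auto simp: col1_def scalar_prod_def)
  then have "w $ 0 = 0" using w(2) i by simp
  then show "w = 0\<^sub>v 1" using w(1) by (intro eq_vecI) auto
qed

lemma line_smult: "c \<noteq> 0 \<Longrightarrow> line (c \<cdot>\<^sub>v v) = line v"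
proof -
  assume c: "c \<noteq> 0"
  have "a \<cdot>\<^sub>v v = (a / c) \<cdot>\<^sub>v (c \<cdot>\<^sub>v v)" for a using c by (simp add: smult_smult_assoc)
  then have "a \<cdot>\<^sub>v v \<in> line (c \<cdot>\<^sub>v v)" for a unfolding line_def by (intro CollectI exI[of _ "a / c"] conjI TrueI)
  then have "line v \<subseteq> line (c \<cdot>\<^sub>v v)" unfolding line_def[of v] by blast
  moreover have "line (c \<cdot>\<^sub>v v) \<subseteq> line v" unfolding line_def by (auto simp: smult_smult_assoc)
  ultimately show ?thesis by blast
qed

lemma line_self: "v \<in> line v"
  unfolding line_def by (auto intro!: exI[of _ 1])

lemma line_eqD:
  assumes "line u = line v" "v \<in> carrier_vec n" "u \<noteq> 0\<^sub>v n \<or> v \<noteq> 0\<^sub>v n"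
  shows "\<exists>c. c \<noteq> 0 \<and> u = c \<cdot>\<^sub>v v"
proof -
  have "u \<in> line v" "v \<in> line u" using assms(1) line_self by blast+
  then obtain c b where c: "u = c \<cdot>\<^sub>v v" "v = b \<cdot>\<^sub>v u" by (auto simp: line_def)
  have "c \<noteq> 0"
  proof
    assume "c = 0"
    then have "u = 0\<^sub>v n" using c(1) smult_zero_vec_eq[OF assms(2)] by simp
    moreover from this have "v = 0\<^sub>v n" using c(2) by (intro eq_vecI) auto
    ultimately show False using assms(3) by simp
  qed
  then show ?thesis using c(1) by blast
qed

lemma Gr_line:
  assumes "W \<in> Gr n 1"
  shows "\<exists>v\<in>carrier_vec n. v \<noteq> 0\<^sub>v n \<and> W = line v"
proof -
  obtain L where L: "unitary n (L :: real mat)" "W = cs 1 L" using Gr_unitary(2)[OF assms] by auto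
  have n: "1 \<le> n" using Gr_unitary(1)[OF assms] .
  have c: "lcols 1 L \<in> carrier_mat n 1" using unitaryD(1)[OF L(1)] by auto
  let ?v = "col (lcols 1 L) 0"
  have v: "?v \<in> carrier_vec n" using c by auto
  have W: "W = line ?v" unfolding L(2) by (rule column_space_1[OF c])
  have "?v \<noteq> 0\<^sub>v n"
  proof
    assume z: "?v = 0\<^sub>v n"
    have "lcols 1 L *\<^sub>v unit_vec 1 0 = ?v" using c by (intro eq_vecI) auto
    then have "unit_vec 1 0 = (0\<^sub>v 1 :: real vec)"
      using isometric_injective[OF c unitary_lcols[OF L(1) n], of "unit_vec 1 0"] z by simp
    then show False by (metis index_unit_vec(1) index_zero_vec(1) less_one zero_neq_one)
  qed
  then show ?thesis using v W by blast
qed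

lemma limitin_line:
  assumes "\<And>t. v t \<in> carrier_vec n" "\<And>t. v t \<noteq> 0\<^sub>v n" "w \<in> carrier_vec n" "w \<noteq> 0\<^sub>v n"
    "\<And>i. i < n \<Longrightarrow> (\<lambda>t. v t $ i) \<longlonglongrightarrow> w $ i"
  shows "Gr_lim n 1 (\<lambda>t. line (v t)) (line w)"
proof -
  have "Gr_lim n 1 (\<lambda>t. column_space 1 (col1 (v t))) (column_space 1 (col1 w))"
  proof (rule limitin_Gr_column_space)
    show "col1 (v t) \<in> carrier_mat n 1" for t by (rule col1_carrier[OF assms(1)])
    show "col1 w \<in> carrier_mat n 1" by (rule col1_carrier[OF assms(3)])
    show "mconv n 1 (\<lambda>t. col1 (v t)) (col1 w)"
      unfolding mconv_def
    proof (intro allI impI)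
      fix i j assume ij: "i < n" "j < (1 :: nat)"
      have "dim_vec (v t) = n" for t using assms(1)[of t] by simp
      then show "(\<lambda>t. col1 (v t) $$ (i, j)) \<longlonglongrightarrow> col1 w $$ (i, j)" using ij assms(3,5) by (simp add: col1_def)
    qed
    show "column_space 1 (col1 (v t)) \<in> Gr n 1" for t
      unfolding column_space_col1[OF assms(1)] by (rule line_Gr[OF assms(1,2)])
    show "column_space 1 (col1 w) \<in> Gr n 1"
      unfolding column_space_col1[OF assms(3)] by (rule line_Gr[OF assms(3,4)])
  qed
  then show ?thesis unfolding column_space_col1[OF assms(3)] column_space_col1[OF assms(1)] .
qed

text \<open>A scaling invariant condition on vectors is pulled back to frames of one column, where
  small balls around a point can be tested by sequences. In this form openness follows directly from
  sequential compactness of the functionals that define a cone.\<close>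

lemma openin_Gr_lines:
  assumes inv: "\<And>c v. c \<noteq> 0 \<Longrightarrow> v \<in> carrier_vec n \<Longrightarrow> P v \<Longrightarrow> P (c \<cdot>\<^sub>v v)"
    and op: "\<And>w v. v \<in> carrier_vec n \<Longrightarrow> P v \<Longrightarrow> (\<And>t :: nat. w t \<in> carrier_vec n) \<Longrightarrow>
      (\<And>i. i < n \<Longrightarrow> (\<lambda>t. w t $ i) \<longlonglongrightarrow> v $ i) \<Longrightarrow> \<exists>t. P (w t)"
  shows "openin (Gr_topology n 1) {line v | v. v \<in> carrier_vec n \<and> v \<noteq> 0\<^sub>v n \<and> P v}" (is "openin _ ?U")
proof -
  have U: "column_space 1 B \<in> ?U \<longleftrightarrow> P (col B 0)" if B: "B \<in> carrier_mat n 1" "column_space 1 B \<in> Gr n 1" for B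
  proof
    have c: "col B 0 \<in> carrier_vec n" using B by auto
    {
      assume "column_space 1 B \<in> ?U"
      then obtain v where v: "v \<in> carrier_vec n" "v \<noteq> 0\<^sub>v n" "P v" "line (col B 0) = line v"
        unfolding column_space_1[OF B(1)] by auto
      obtain a where "a \<noteq> 0" "col B 0 = a \<cdot>\<^sub>v v" using line_eqD[OF v(4,1)] v(2) by blast
      then show "P (col B 0)" using inv v by simp
    }
    {
      assume P: "P (col B 0)"
      obtain w where w: "w \<in> carrier_vec n" "w \<noteq> 0\<^sub>v n" "line (col B 0) = line w"
        using Gr_line[OF B(2)] unfolding column_space_1[OF B(1)] by auto
      obtain a where "w = a \<cdot>\<^sub>v col B 0" "a \<noteq> 0" using line_eqD[OF w(3)[symmetric] c] w(2) by blast
      then have "P w" using inv P c by simp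
      then show "column_space 1 B \<in> ?U" unfolding column_space_1[OF B(1)] w(3) using w by blast
    }
  qed
  have sub: "?U \<subseteq> Gr n 1" using line_Gr by auto
  have "openin (frames n 1) {B \<in> topspace (frames n 1). column_space 1 B \<in> ?U}"
  proof (subst openin_subopen, rule ballI)
    fix B assume "B \<in> {B \<in> topspace (frames n 1). column_space 1 B \<in> ?U}"
    then have B: "B \<in> carrier_mat n 1" "column_space 1 B \<in> Gr n 1" "column_space 1 B \<in> ?U" "B \<in> topspace (frames n 1)" by auto
    then have PB: "P (col B 0)" using U by blast
    let ?D = "\<lambda>X. \<Sum>i=0..<n. \<bar>X $$ (i, 0) - B $$ (i, 0)\<bar>"
    let ?T = "\<lambda>t :: nat. {X \<in> topspace (frames n 1). ?D X \<in> {..<1 / real (Suc t)}}"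
    have "continuous_map (mat_topology n 1) euclidean ?D"
      by (rule continuous_map_euclideanI, intro tendsto_intros continuous_map_euclideanD[OF continuous_map_entry]) auto
    then have "openin (frames n 1) (?T t)" for t
      by (intro openin_continuous_map_preimage[OF continuous_map_from_subtopology]) auto
    moreover have "B \<in> ?T t" for t using B(4) by simp
    moreover have "\<exists>t. ?T t \<subseteq> {B \<in> topspace (frames n 1). column_space 1 B \<in> ?U}"
    proof (rule ccontr)
      assume "\<not> ?thesis"
      then have "\<forall>t. \<exists>X. X \<in> ?T t \<and> column_space 1 X \<notin> ?U" by blast
      from choice[OF this] obtain X where "\<forall>t. X t \<in> ?T t \<and> column_space 1 (X t) \<notin> ?U" ..
      then have X: "X t \<in> ?T t" "column_space 1 (X t) \<notin> ?U" for t by blast+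
      have Xc: "X t \<in> carrier_mat n 1" "column_space 1 (X t) \<in> Gr n 1" for t using X(1)[of t] by auto
      have "\<exists>t. P (col (X t) 0)"
      proof (rule op[OF _ PB])
        show "col B 0 \<in> carrier_vec n" "col (X t) 0 \<in> carrier_vec n" for t using B(1) Xc(1)[of t] by auto
        fix i assume i: "i < n"
        have e: "col (X t) 0 $ i = X t $$ (i, 0)" "col B 0 $ i = B $$ (i, 0)" for t using i Xc(1)[of t] B(1) by auto
        show "(\<lambda>t. col (X t) 0 $ i) \<longlonglongrightarrow> col B 0 $ i"
          unfolding e
        proof (rule LIMSEQ_inverse_Suc)
          fix t
          have "\<bar>X t $$ (i, 0) - B $$ (i, 0)\<bar> \<le> ?D (X t)" by (rule member_le_sum[of i]) (use i in auto)
          then show "\<bar>X t $$ (i, 0) - B $$ (i, 0)\<bar> \<le> 1 / real (Suc t)" using X(1)[of t] by auto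
        qed
      qed
      then show False using U[OF Xc] X(2) by blast
    qed
    ultimately show "\<exists>T. openin (frames n 1) T \<and> B \<in> T \<and> T \<subseteq> {B \<in> topspace (frames n 1). column_space 1 B \<in> ?U}" by blast
  qed
  moreover have "?U \<subseteq> column_space 1 ` topspace (frames n 1)"
    unfolding quotient_imp_surjective_map[OF quotient_map_Gr] topspace_Gr by (rule sub)
  ultimately show ?thesis unfolding Gr_topology_def openin_quotient_topology by (rule conjI[rotated])
qed

subsection \<open>Dual cones of compact sets of functionals\<close>

text \<open>\<open>S\<close> is a compact set of functionals, with compactness stated by sequences.
  The functional \<open>e\<close> controls its dual cone: it is positive there and bounds all
  coordinates, so the cone is bounded in the affine chart e = 1.\<close>

locale dual_cone =
  fixes n :: nat and S :: "real vec set" and e :: "real vec" and C :: real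
  assumes n2: "2 \<le> n"
    and S_carrier: "S \<subseteq> carrier_vec n"
    and e_carrier: "e \<in> carrier_vec n"
    and S_compact: "\<And>Y. (\<And>t :: nat. Y t \<in> S) \<Longrightarrow>
      \<exists>r l. strict_mono r \<and> l \<in> S \<and> (\<forall>i<n. (\<lambda>t. Y (r t) $ i) \<longlonglongrightarrow> l $ i)"
    and bounded_by_e: "\<And>v i. v \<in> carrier_vec n \<Longrightarrow> (\<And>y. y \<in> S \<Longrightarrow> 0 < y \<bullet> v) \<Longrightarrow> i < n \<Longrightarrow> \<bar>v $ i\<bar> \<le> C * (e \<bullet> v)"
    and e_pos: "\<And>v. v \<in> carrier_vec n \<Longrightarrow> (\<And>y. y \<in> S \<Longrightarrow> 0 < y \<bullet> v) \<Longrightarrow> 0 < e \<bullet> v"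
    and interior_point: "\<exists>v\<in>carrier_vec n. \<forall>y\<in>S. 0 < y \<bullet> v"
begin

definition cone :: "real vec set" where "cone = {v \<in> carrier_vec n. \<forall>y\<in>S. 0 < y \<bullet> v}"

definition Omega :: "real vec set set" where "Omega = {line v | v. v \<in> cone}"

lemma cone_carrier: "v \<in> cone \<Longrightarrow> v \<in> carrier_vec n" by (simp add: cone_def)

lemma S_vec: "y \<in> S \<Longrightarrow> y \<in> carrier_vec n" using S_carrier by blast

lemma S_nonempty: "S \<noteq> {}"
proof
  assume "S = {}"
  then have "0 < e \<bullet> 0\<^sub>v n" by (intro e_pos) auto
  then show False using e_carrier by simp
qed

lemma cone_nonzero: "v \<in> cone \<Longrightarrow> v \<noteq> 0\<^sub>v n"
  using S_nonempty S_vec by (auto simp: cone_def)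

lemma cone_smult: "v \<in> cone \<Longrightarrow> 0 < c \<Longrightarrow> c \<cdot>\<^sub>v v \<in> cone"
  using S_vec by (auto simp: cone_def)

lemma cone_add: "v \<in> cone \<Longrightarrow> w \<in> cone \<Longrightarrow> v + w \<in> cone"
  using S_vec by (auto simp: cone_def scalar_prod_add_distrib[of _ n] intro: add_pos_pos)

lemma cone_segment:
  assumes "u \<in> cone" "v \<in> cone" "t \<in> {0..1}"
  shows "(1 - t) \<cdot>\<^sub>v u + t \<cdot>\<^sub>v v \<in> cone"
proof -
  have c: "u \<in> carrier_vec n" "v \<in> carrier_vec n" using assms by (auto simp: cone_def)
  show ?thesis
    unfolding cone_def
  proof (intro CollectI conjI ballI)
    show "(1 - t) \<cdot>\<^sub>v u + t \<cdot>\<^sub>v v \<in> carrier_vec n" using c by simp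
    fix y assume y: "y \<in> S"
    have p: "0 < y \<bullet> u" "0 < y \<bullet> v" using assms y by (auto simp: cone_def)
    have "y \<bullet> ((1 - t) \<cdot>\<^sub>v u + t \<cdot>\<^sub>v v) = (1 - t) * (y \<bullet> u) + t * (y \<bullet> v)"
      using c S_vec[OF y] by (simp add: scalar_prod_add_distrib[of _ n])
    moreover have "0 < (1 - t) * (y \<bullet> u) + t * (y \<bullet> v)"
    proof (cases "t = 0")
      case True
      then show ?thesis using p by simp
    next
      case False
      then have "0 < t * (y \<bullet> v)" "0 \<le> (1 - t) * (y \<bullet> u)" using p assms(3) by auto
      then show ?thesis by linarith
    qed
    ultimately show "0 < y \<bullet> ((1 - t) \<cdot>\<^sub>v u + t \<cdot>\<^sub>v v)" by simp
  qed
qed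

lemma tendsto_scalar_prod:
  assumes "\<And>i. i < n \<Longrightarrow> (\<lambda>t. Y t $ i) \<longlonglongrightarrow> l $ i" "(v :: real vec) \<in> carrier_vec n"
  shows "(\<lambda>t. Y t \<bullet> v) \<longlonglongrightarrow> l \<bullet> v"
  unfolding scalar_prod_def using assms(2) by (auto intro!: tendsto_sum tendsto_mult assms(1))

text \<open>Otherwise there are functionals in \<open>S\<close> that are not positive at the points
  w(t); a limit of them lies in \<open>S\<close> and is not positive at \<open>v\<close>.\<close>

lemma cone_sequence:
  assumes v: "v \<in> cone" and w: "\<And>t :: nat. w t \<in> carrier_vec n" "\<And>i. i < n \<Longrightarrow> (\<lambda>t. w t $ i) \<longlonglongrightarrow> v $ i"
  shows "\<exists>t. w t \<in> cone"
proof (rule ccontr)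
  assume "\<not> ?thesis"
  then have "\<forall>t. \<exists>y. y \<in> S \<and> y \<bullet> w t \<le> 0" using w(1) by (force simp: cone_def not_less)
  then obtain Y where Y: "\<And>t. Y t \<in> S" "\<And>t. Y t \<bullet> w t \<le> 0" by metis
  obtain r l where r: "strict_mono r" "l \<in> S" "\<forall>i<n. (\<lambda>t. Y (r t) $ i) \<longlonglongrightarrow> l $ i"
    using S_compact[of Y] Y(1) by blast
  have e: "y \<bullet> x = (\<Sum>i=0..<n. y $ i * x $ i)" if "x \<in> carrier_vec n" for x y :: "real vec"
    using that by (simp add: scalar_prod_def)
  have "(\<lambda>t. \<Sum>i=0..<n. Y (r t) $ i * w (r t) $ i) \<longlonglongrightarrow> (\<Sum>i=0..<n. l $ i * v $ i)"
    using r(3) LIMSEQ_subseq_LIMSEQ[OF w(2) r(1)] by (intro tendsto_sum tendsto_mult) (auto simp: o_def)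
  then have "(\<lambda>t. Y (r t) \<bullet> w (r t)) \<longlonglongrightarrow> l \<bullet> v" unfolding e[OF w(1)] e[OF cone_carrier[OF v]] .
  then have "l \<bullet> v \<le> 0" by (rule LIMSEQ_le_const2) (use Y(2) in auto)
  then show False using r(2) v by (auto simp: cone_def)
qed

lemma line_in_Omega:
  assumes "v \<in> carrier_vec n"
  shows "line v \<in> Omega \<longleftrightarrow> v \<in> cone \<or> (- 1) \<cdot>\<^sub>v v \<in> cone"
proof
  assume "line v \<in> Omega"
  then obtain w where w: "w \<in> cone" "line v = line w" by (auto simp: Omega_def)
  obtain c where c: "c \<noteq> 0" "w = c \<cdot>\<^sub>v v" using line_eqD[OF w(2)[symmetric] assms] cone_nonzero[OF w(1)] by blast
  have v: "v = (1 / c) \<cdot>\<^sub>v w" unfolding c(2) using c(1) by (simp add: smult_smult_assoc)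
  show "v \<in> cone \<or> (- 1) \<cdot>\<^sub>v v \<in> cone"
  proof (cases "c > 0")
    case True
    then show ?thesis using cone_smult[OF w(1), of "1 / c"] v by simp
  next
    case False
    then have "0 < - (1 / c)" using c(1) by (simp add: field_simps)
    from cone_smult[OF w(1) this] have "(- 1) \<cdot>\<^sub>v v \<in> cone" unfolding v by (simp add: smult_smult_assoc)
    then show ?thesis ..
  qed
next
  assume "v \<in> cone \<or> (- 1) \<cdot>\<^sub>v v \<in> cone"
  then show "line v \<in> Omega"
    using line_smult[of "- 1" v] unfolding Omega_def by auto
qed

lemma openin_Omega: "openin (Gr_topology n 1) Omega"
proof -
  let ?P = "\<lambda>v. v \<in> cone \<or> (- 1) \<cdot>\<^sub>v v \<in> cone"
  have "openin (Gr_topology n 1) {line v | v. v \<in> carrier_vec n \<and> v \<noteq> 0\<^sub>v n \<and> ?P v}"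
  proof (rule openin_Gr_lines)
    fix c :: real and v assume c: "c \<noteq> 0" "v \<in> carrier_vec n" "?P v"
    have "line (c \<cdot>\<^sub>v v) \<in> Omega" using c line_in_Omega[OF c(2)] line_smult[OF c(1)] by simp
    then show "?P (c \<cdot>\<^sub>v v)" using line_in_Omega[of "c \<cdot>\<^sub>v v"] c(2) by simp
  next
    fix w v assume v: "v \<in> carrier_vec n" "?P v" and w: "\<And>t :: nat. w t \<in> carrier_vec n" "\<And>i. i < n \<Longrightarrow> (\<lambda>t. w t $ i) \<longlonglongrightarrow> v $ i"
    from v(2) show "\<exists>t. ?P (w t)"
    proof
      assume "v \<in> cone"
      from cone_sequence[OF this w] show ?thesis by blast
    next
      assume "(- 1) \<cdot>\<^sub>v v \<in> cone"
      moreover have "(\<lambda>t. ((- 1) \<cdot>\<^sub>v w t) $ i) \<longlonglongrightarrow> ((- 1) \<cdot>\<^sub>v v) $ i" if "i < n" for i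
      proof -
        have "((- 1) \<cdot>\<^sub>v w t) $ i = - w t $ i" for t using w(1)[of t] that by simp
        then show ?thesis using tendsto_minus[OF w(2)[OF that]] v(1) that by simp
      qed
      ultimately have "\<exists>t. (- 1) \<cdot>\<^sub>v w t \<in> cone" using w(1) by (intro cone_sequence) auto
      then show ?thesis by blast
    qed
  qed
  moreover have "{line v | v. v \<in> carrier_vec n \<and> v \<noteq> 0\<^sub>v n \<and> ?P v} = Omega"
  proof (intro equalityI subsetI)
    fix x assume "x \<in> {line v | v. v \<in> carrier_vec n \<and> v \<noteq> 0\<^sub>v n \<and> ?P v}"
    then show "x \<in> Omega" using line_in_Omega by auto
  next
    fix x assume "x \<in> Omega"
    then show "x \<in> {line v | v. v \<in> carrier_vec n \<and> v \<noteq> 0\<^sub>v n \<and> ?P v}"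
      using cone_carrier cone_nonzero unfolding Omega_def by blast
  qed
  ultimately show ?thesis by simp
qed

lemma connectedin_segment:
  assumes "u \<in> cone" "v \<in> cone"
  shows "connectedin (Gr_topology n 1) ((\<lambda>t. line ((1 - t) \<cdot>\<^sub>v u + t \<cdot>\<^sub>v v)) ` {0..1})"
proof -
  let ?w = "\<lambda>t. (1 - t) \<cdot>\<^sub>v u + t \<cdot>\<^sub>v v"
  have uv: "u \<in> carrier_vec n" "v \<in> carrier_vec n" using assms by (auto simp: cone_def)
  then have wc: "?w t \<in> carrier_vec n" for t by simp
  have "continuous_map (top_of_set {0..1}) (frames n 1) (\<lambda>t. col1 (?w t))"
    unfolding continuous_map_in_subtopology
  proof (intro conjI continuous_map_into_mat)
    show "col1 (?w t) \<in> carrier_mat n 1" for t by (rule col1_carrier[OF wc])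
    show "continuous_map (top_of_set {0..1}) euclidean (\<lambda>t. col1 (?w t) $$ (i, j))" if "i < n" "j < 1" for i j
    proof -
      have "col1 (?w t) $$ (i, j) = (1 - t) * u $ i + t * v $ i" for t using that uv by (simp add: col1_def)
      then show ?thesis by (simp add: continuous_on_op_minus) (intro continuous_intros)
    qed
    have "column_space 1 (col1 (?w t)) \<in> Gr n 1" if "t \<in> {0..1}" for t
      unfolding column_space_col1[OF wc] using cone_nonzero[OF cone_segment[OF assms that]] by (intro line_Gr wc)
    then show "(\<lambda>t. col1 (?w t)) \<in> topspace (top_of_set {0..1}) \<rightarrow> {A. column_space 1 A \<in> Gr n 1}" by auto
  qed
  then have "continuous_map (top_of_set {0..1}) (Gr_topology n 1) (column_space 1 \<circ> (\<lambda>t. col1 (?w t)))"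
    by (rule continuous_map_compose[OF _ quotient_imp_continuous_map[OF quotient_map_Gr]])
  then have c: "continuous_map (top_of_set {0..1}) (Gr_topology n 1) (\<lambda>t. line (?w t))"
    unfolding o_def column_space_col1[OF wc] .
  have "connectedin (top_of_set {0..1 :: real}) {0..1}" by (simp add: connectedin_subtopology)
  from connectedin_continuous_map_image[OF c this] show ?thesis .
qed

lemma connectedin_Omega: "connectedin (Gr_topology n 1) Omega"
proof -
  obtain u where u: "u \<in> cone" using interior_point by (auto simp: cone_def)
  let ?I = "\<lambda>v. (\<lambda>t. line ((1 - t) \<cdot>\<^sub>v u + t \<cdot>\<^sub>v v)) ` {0..1}"
  have ends: "line u \<in> ?I v" "line v \<in> ?I v" if v: "v \<in> cone" for v
  proof -
    have e: "(1 - (0 :: real)) \<cdot>\<^sub>v u + 0 \<cdot>\<^sub>v v = u" "(1 - (1 :: real)) \<cdot>\<^sub>v u + 1 \<cdot>\<^sub>v v = v"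
      using cone_carrier[OF u] cone_carrier[OF v] by (auto intro!: eq_vecI)
    show "line u \<in> ?I v" by (rule image_eqI[of _ _ 0]) (simp_all only: e, simp)
    show "line v \<in> ?I v" by (rule image_eqI[of _ _ 1]) (simp_all only: e, simp)
  qed
  have "connectedin (Gr_topology n 1) (\<Union>(?I ` cone))"
  proof (rule connectedin_Union)
    show "connectedin (Gr_topology n 1) T" if "T \<in> ?I ` cone" for T using connectedin_segment[OF u] that by auto
    have "line u \<in> \<Inter>(?I ` cone)" using ends(1) by blast
    then show "\<Inter>(?I ` cone) \<noteq> {}" by blast
  qed
  moreover have "\<Union>(?I ` cone) = Omega"
  proof (intro equalityI subsetI)
    fix x assume "x \<in> \<Union>(?I ` cone)"
    then obtain v t where "v \<in> cone" "t \<in> {0..1}" "x = line ((1 - t) \<cdot>\<^sub>v u + t \<cdot>\<^sub>v v)" by blast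
    then show "x \<in> Omega" unfolding Omega_def using cone_segment[OF u] by blast
  next
    fix x assume "x \<in> Omega"
    then show "x \<in> \<Union>(?I ` cone)" unfolding Omega_def using ends(2) by blast
  qed
  ultimately show ?thesis by simp
qed

theorem properly_convex_Omega: "properly_convex_domain n Omega"
  unfolding properly_convex_domain_def
proof (intro conjI openin_Omega connectedin_Omega bexI[of _ e] e_carrier)
  show "Omega \<noteq> {}" using interior_point by (auto simp: Omega_def cone_def)
  show "\<forall>x\<in>Omega. \<exists>v\<in>x. e \<bullet> v \<noteq> 0"
  proof
    fix x assume "x \<in> Omega"
    then obtain v where v: "v \<in> cone" "x = line v" by (auto simp: Omega_def)
    then have "0 < e \<bullet> v" by (intro e_pos) (auto simp: cone_def)
    then show "\<exists>v\<in>x. e \<bullet> v \<noteq> 0" using line_self v(2) by (intro bexI[of _ v]) auto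
  qed
  let ?S = "{v \<in> carrier_vec n. e \<bullet> v = 1 \<and> line v \<in> Omega}"
  have S: "v \<in> cone" if v: "v \<in> ?S" for v
  proof (rule ccontr)
    assume "v \<notin> cone"
    then have "(- 1) \<cdot>\<^sub>v v \<in> cone" using v line_in_Omega by auto
    then have "0 < e \<bullet> ((- 1) \<cdot>\<^sub>v v)" by (intro e_pos) (auto simp: cone_def)
    then show False using v e_carrier by simp
  qed
  have "(1 - t) \<cdot>\<^sub>v u + t \<cdot>\<^sub>v v \<in> ?S" if uv: "u \<in> ?S" "v \<in> ?S" and t: "t \<in> {0..1}" for u v t
  proof -
    have c: "(1 - t) \<cdot>\<^sub>v u + t \<cdot>\<^sub>v v \<in> cone" using cone_segment S uv t by blast
    have "e \<bullet> ((1 - t) \<cdot>\<^sub>v u + t \<cdot>\<^sub>v v) = 1"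
      using uv e_carrier by (simp add: scalar_prod_add_distrib[of _ n])
    then show ?thesis using c cone_carrier[OF c] by (auto simp: Omega_def)
  qed
  moreover have "\<bar>v $ i\<bar> \<le> C" if "v \<in> ?S" "i < n" for v i
    using bounded_by_e[of v i] S[OF that(1)] that by (auto simp: cone_def)
  ultimately show "let S = ?S in (\<forall>u\<in>S. \<forall>v\<in>S. \<forall>t\<in>{0..1}. (1 - t) \<cdot>\<^sub>v u + t \<cdot>\<^sub>v v \<in> S) \<and> (\<exists>C. \<forall>v\<in>S. \<forall>i<n. \<bar>v $ i\<bar> \<le> C)"
    unfolding Let_def by blast
qed

text \<open>The sign of a single functional is not defined on lines, but the sign of a product of
  two is. That such a product is negative is an open condition, and it excludes all points of
  \<open>Omega\<close>.\<close>

lemma closure_Omega: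
  assumes "v \<in> carrier_vec n" "v \<noteq> 0\<^sub>v n" "line v \<in> Gr_topology n 1 closure_of Omega" "y \<in> S" "y' \<in> S"
  shows "0 \<le> (y \<bullet> v) * (y' \<bullet> v)"
proof (rule ccontr)
  let ?P = "\<lambda>v. (y \<bullet> v) * (y' \<bullet> v) < 0"
  assume neg: "\<not> ?thesis"
  have op: "openin (Gr_topology n 1) {line v | v. v \<in> carrier_vec n \<and> v \<noteq> 0\<^sub>v n \<and> ?P v}"
  proof (rule openin_Gr_lines)
    fix c :: real and v assume c: "c \<noteq> 0" "v \<in> carrier_vec n" "?P v"
    have "(y \<bullet> (c \<cdot>\<^sub>v v)) * (y' \<bullet> (c \<cdot>\<^sub>v v)) = (c * c) * ((y \<bullet> v) * (y' \<bullet> v))"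
      using c(2) S_vec[OF assms(4)] S_vec[OF assms(5)] by (simp add: algebra_simps)
    moreover have "0 < c * c" using c(1) by (metis not_real_square_gt_zero)
    ultimately show "?P (c \<cdot>\<^sub>v v)" using c(3) by (metis mult_pos_neg)
  next
    fix w v assume v: "v \<in> carrier_vec n" "?P v" and w: "\<And>t :: nat. w t \<in> carrier_vec n" "\<And>i. i < n \<Longrightarrow> (\<lambda>t. w t $ i) \<longlonglongrightarrow> v $ i"
    have lim: "(\<lambda>t. x \<bullet> w t) \<longlonglongrightarrow> x \<bullet> v" if "x \<in> carrier_vec n" for x
      using tendsto_scalar_prod[OF w(2) that] comm_scalar_prod[OF that w(1)] comm_scalar_prod[OF that v(1)] by simp
    have "(\<lambda>t. (y \<bullet> w t) * (y' \<bullet> w t)) \<longlonglongrightarrow> (y \<bullet> v) * (y' \<bullet> v)"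
      by (intro tendsto_mult lim S_vec assms)
    then have "\<forall>\<^sub>F t in sequentially. ?P (w t)" by (rule order_tendstoD(2)[OF _ v(2)])
    then show "\<exists>t. ?P (w t)" by (auto simp: eventually_sequentially)
  qed
  have "?P v" using neg by (simp add: not_le)
  then have lv: "line v \<in> {line v | v. v \<in> carrier_vec n \<and> v \<noteq> 0\<^sub>v n \<and> ?P v}"
    by (intro CollectI exI[of _ v] conjI refl assms(1,2))
  have "\<forall>T. line v \<in> T \<and> openin (Gr_topology n 1) T \<longrightarrow> (\<exists>y. y \<in> Omega \<and> y \<in> T)"
    using assms(3) unfolding in_closure_of by (rule conjunct2)
  from this[rule_format, OF conjI[OF lv op]]
  obtain x where x: "x \<in> Omega" "x \<in> {line v | v. v \<in> carrier_vec n \<and> v \<noteq> 0\<^sub>v n \<and> ?P v}" by (elim exE conjE)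
  obtain u where u: "u \<in> carrier_vec n" "u \<noteq> 0\<^sub>v n" "?P u" "x = line u" using x(2) by auto
  have "u \<in> cone \<or> (- 1) \<cdot>\<^sub>v u \<in> cone" using line_in_Omega[OF u(1)] x(1) u(4) by simp
  then have "0 < (y \<bullet> u) * (y' \<bullet> u)"
  proof
    assume "u \<in> cone"
    then show ?thesis using assms(4,5) by (auto simp: cone_def)
  next
    assume "(- 1) \<cdot>\<^sub>v u \<in> cone"
    then have "0 < y \<bullet> ((- 1) \<cdot>\<^sub>v u)" "0 < y' \<bullet> ((- 1) \<cdot>\<^sub>v u)" using assms(4,5) by (auto simp: cone_def)
    then have "y \<bullet> u < 0" "y' \<bullet> u < 0" using u(1) S_vec[OF assms(4)] S_vec[OF assms(5)] by auto
    then show ?thesis by (rule mult_neg_neg)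
  qed
  then show False using u(3) by simp
qed

definition contact :: "real vec \<Rightarrow> real vec \<Rightarrow> bool" where
  "contact p q \<longleftrightarrow> p \<in> carrier_vec n \<and> p \<noteq> 0\<^sub>v n \<and> q \<in> S \<and> q \<bullet> p = 0 \<and> (\<forall>y\<in>S. 0 \<le> y \<bullet> p \<and> (y \<bullet> p = 0 \<longrightarrow> y = q))"

lemma hyperplane_Gr:
  assumes q: "(q :: real vec) \<in> carrier_vec n" "q \<noteq> 0\<^sub>v n"
  shows "{v \<in> carrier_vec n. q \<bullet> v = 0} \<in> Gr n (n - 1)"
proof -
  have "line q \<in> Gr n (n - (n - 1))" using line_Gr[OF q] n2 by simp
  then have "perp n (line q) \<in> Gr n (n - 1)" by (rule perp_Gr) simp
  moreover have "perp n (line q) = {v \<in> carrier_vec n. q \<bullet> v = 0}"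
  proof (intro equalityI subsetI)
    fix v assume "v \<in> perp n (line q)"
    then have v: "v \<in> carrier_vec n" "(\<Sum>i=0..<n. conjugate (q $ i) * v $ i) = 0" using line_self by (auto simp: perp_def)
    then show "v \<in> {v \<in> carrier_vec n. q \<bullet> v = 0}" by (simp add: scalar_prod_def)
  next
    fix v assume v: "v \<in> {v \<in> carrier_vec n. q \<bullet> v = 0}"
    then have vc: "v \<in> carrier_vec n" by simp
    have "(\<Sum>i=0..<n. conjugate ((c \<cdot>\<^sub>v q) $ i) * v $ i) = c * (q \<bullet> v)" for c
      using vc q by (auto simp: scalar_prod_def sum_distrib_left mult.assoc intro!: sum.cong)
    then show "v \<in> perp n (line q)" using v by (auto simp: perp_def line_def)
  qed
  ultimately show ?thesis by simp
qed

lemma Gr_hyperplane: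
  assumes "(H :: real vec set) \<in> Gr n (n - 1)"
  shows "\<exists>h\<in>carrier_vec n. h \<noteq> 0\<^sub>v n \<and> H = {v \<in> carrier_vec n. h \<bullet> v = 0}"
proof -
  obtain L where L: "unitary n (L :: real mat)" "H = cs (n - 1) L" using Gr_unitary(2)[OF assms] by auto
  note Lc = unitaryD[OF L(1)]
  let ?h = "col L (n - 1)"
  have h: "?h \<in> carrier_vec n" using Lc(1) by auto
  have e: "(mat_adjoint L *\<^sub>v v) $ (n - 1) = ?h \<bullet> v" if "v \<in> carrier_vec n" for v
    using n2 Lc(1) that index_mult_vec_sum[OF adj_carrier[OF Lc(1)] that, of "n - 1"]
    by (simp add: scalar_prod_def)
  have "H = {v \<in> carrier_vec n. ?h \<bullet> v = 0}"
  proof (intro equalityI subsetI)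
    fix v assume v: "v \<in> H"
    then have "v \<in> carrier_vec n" "(mat_adjoint L *\<^sub>v v) $ (n - 1) = 0"
      unfolding L(2) cs_iff(1)[OF L(1) diff_le_self] using n2 by auto
    then show "v \<in> {v \<in> carrier_vec n. ?h \<bullet> v = 0}" using e by simp
  next
    fix v assume v: "v \<in> {v \<in> carrier_vec n. ?h \<bullet> v = 0}"
    have "(mat_adjoint L *\<^sub>v v) $ i = 0" if "n - 1 \<le> i" "i < n" for i
    proof -
      have "i = n - 1" using that by simp
      then show ?thesis using e v by simp
    qed
    then show "v \<in> H" unfolding L(2) cs_iff(1)[OF L(1) diff_le_self] using v by simp
  qed
  moreover have "?h \<noteq> 0\<^sub>v n"
  proof
    assume z: "?h = 0\<^sub>v n"
    have "(\<Sum>i=0..<n. conjugate (L $$ (i, n - 1)) * L $$ (i, n - 1)) = 1"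
      using adj_mult_self_eq_one_iff[OF Lc(1)] Lc(2) n2 by auto
    moreover have "L $$ (i, n - 1) = 0" if "i < n" for i using arg_cong[OF z, of "\<lambda>v. v $ i"] that Lc(1) n2 by simp
    ultimately show False by simp
  qed
  ultimately show ?thesis using h by blast
qed

text \<open>If \<open>h\<close> is not a multiple of \<open>q\<close>, some vector Z satisfies h Z <
  0 < q Z. The points p + Z / (t + 1) are outside the cone because \<open>h\<close> is negative
  there, so elements of \<open>S\<close> are nonpositive at them. These elements accumulate at one
  that vanishes at \<open>p\<close>, which can only be \<open>q\<close>, and this yields q Z <=
  0.\<close>

lemma contact_functional_unique:
  assumes c: "contact p q" and h: "h \<in> carrier_vec n" "h \<bullet> p = 0" "\<And>v. v \<in> cone \<Longrightarrow> 0 < h \<bullet> v"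
  shows "\<exists>c. h = c \<cdot>\<^sub>v q"
proof (rule ccontr)
  assume np: "\<not> ?thesis"
  have p: "p \<in> carrier_vec n" and q: "q \<in> S" "q \<bullet> p = 0" and y0: "\<And>y. y \<in> S \<Longrightarrow> 0 \<le> y \<bullet> p" "\<And>y. y \<in> S \<Longrightarrow> y \<bullet> p = 0 \<Longrightarrow> y = q"
    using c by (auto simp: contact_def)
  have qc: "q \<in> carrier_vec n" using S_vec[OF q(1)] .
  obtain v0 where v0: "v0 \<in> carrier_vec n" "0 < q \<bullet> v0" using interior_point q(1) by auto
  have sq: "0 < x \<bullet> x" if x: "x \<in> carrier_vec n" "x \<noteq> 0\<^sub>v n" for x :: "real vec"
  proof -
    obtain i where i: "i < n" "x $ i \<noteq> 0" using vec_nonzero_iff[OF x(1)] x(2) by auto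
    have "0 < x $ i * x $ i" using i(2) by (metis not_real_square_gt_zero)
    also have "\<dots> \<le> (\<Sum>i=0..<n. x $ i * x $ i)" by (rule member_le_sum[of i]) (use i in auto)
    finally show ?thesis using x(1) by (simp add: scalar_prod_def)
  qed
  have "q \<noteq> 0\<^sub>v n" using v0 by auto
  then have qq: "0 < q \<bullet> q" by (rule sq[OF qc])
  \<comment> \<open>A multiple of the component of \<open>h\<close> orthogonal to \<open>q\<close>,
    so that \<open>q\<close> vanishes at \<open>z\<close> and \<open>h\<close> does not.\<close>
  define z where "z = (q \<bullet> q) \<cdot>\<^sub>v h - (h \<bullet> q) \<cdot>\<^sub>v q"
  have zc: "z \<in> carrier_vec n" using h(1) qc by (simp add: z_def)
  have zx: "x \<bullet> z = (q \<bullet> q) * (x \<bullet> h) - (h \<bullet> q) * (x \<bullet> q)" if "x \<in> carrier_vec n" for x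
    unfolding z_def using that h(1) qc by (simp add: scalar_prod_minus_distrib[of _ n])
  have qz: "q \<bullet> z = 0" using zx[OF qc] comm_scalar_prod[OF qc h(1)] by simp
  have "z \<noteq> 0\<^sub>v n"
  proof
    assume z0: "z = 0\<^sub>v n"
    have "h = ((h \<bullet> q) / (q \<bullet> q)) \<cdot>\<^sub>v q"
    proof (rule eq_vecI)
      fix i assume "i < dim_vec (((h \<bullet> q) / (q \<bullet> q)) \<cdot>\<^sub>v q)"
      then have i: "i < n" using qc by simp
      have "z $ i = (q \<bullet> q) * h $ i - (h \<bullet> q) * q $ i" using i h(1) qc by (simp add: z_def)
      then show "h $ i = (((h \<bullet> q) / (q \<bullet> q)) \<cdot>\<^sub>v q) $ i" using i qc qq unfolding z0 by (simp add: field_simps)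
    qed (use h(1) qc in simp)
    then show False using np by blast
  qed
  then have "0 < z \<bullet> z" by (rule sq[OF zc])
  then have hz: "h \<bullet> z \<noteq> 0" using zx[OF zc] comm_scalar_prod[OF zc qc] comm_scalar_prod[OF zc h(1)] qz by auto
  \<comment> \<open>The coefficient makes \<open>h\<close> equal to -1 at \<open>Z\<close>; the
    value of \<open>q\<close> remains that at \<open>v0\<close>, which is positive.\<close>
  define Z where "Z = v0 - ((h \<bullet> v0 + 1) / (h \<bullet> z)) \<cdot>\<^sub>v z"
  have Zc: "Z \<in> carrier_vec n" using v0 zc by (simp add: Z_def)
  have qZ: "0 < q \<bullet> Z" unfolding Z_def using qc v0 zc qz by (simp add: scalar_prod_minus_distrib[of _ n])
  have hZ: "h \<bullet> Z = - 1" unfolding Z_def using h(1) v0 zc hz by (simp add: scalar_prod_minus_distrib[of _ n])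
  have "\<forall>t :: nat. \<exists>y. y \<in> S \<and> y \<bullet> (p + (1 / real (Suc t)) \<cdot>\<^sub>v Z) \<le> 0"
  proof
    fix t :: nat
    let ?X = "p + (1 / real (Suc t)) \<cdot>\<^sub>v Z"
    have "h \<bullet> ?X = - (1 / real (Suc t))" using h(1,2) p Zc hZ by (simp add: scalar_prod_add_distrib[of _ n])
    then have "\<not> 0 < h \<bullet> ?X" by simp
    then have "?X \<notin> cone" using h(3) by blast
    then show "\<exists>y. y \<in> S \<and> y \<bullet> ?X \<le> 0" using p Zc by (auto simp: cone_def not_less)
  qed
  then obtain Y where Y: "\<And>t :: nat. Y t \<in> S" "\<And>t. Y t \<bullet> (p + (1 / real (Suc t)) \<cdot>\<^sub>v Z) \<le> 0" by metis
  have Y': "Y t \<bullet> p + (1 / real (Suc t)) * (Y t \<bullet> Z) \<le> 0" for t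
    using Y(2)[of t] S_vec[OF Y(1)[of t]] p Zc by (simp add: scalar_prod_add_distrib[of _ n])
  \<comment> \<open>All elements of \<open>S\<close> are nonnegative at \<open>p\<close>, so the
    nonpositive contribution has to come from \<open>Z\<close>.\<close>
  have YZ: "Y t \<bullet> Z \<le> 0" for t
  proof -
    have "(1 / real (Suc t)) * (Y t \<bullet> Z) \<le> 0" using Y'[of t] y0(1)[OF Y(1)[of t]] by linarith
    then show ?thesis by (simp add: divide_le_0_iff)
  qed
  obtain r l where r: "strict_mono r" "l \<in> S" "\<forall>i<n. (\<lambda>t. Y (r t) $ i) \<longlonglongrightarrow> l $ i"
    using S_compact[of Y] Y(1) by blast
  have lp: "(\<lambda>t. Y (r t) \<bullet> p) \<longlonglongrightarrow> l \<bullet> p" and lZ: "(\<lambda>t. Y (r t) \<bullet> Z) \<longlonglongrightarrow> l \<bullet> Z"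
    by (rule tendsto_scalar_prod; use r(3) p Zc in auto)+
  have "(\<lambda>t. 1 / real (Suc (r t))) \<longlonglongrightarrow> 0"
    using LIMSEQ_subseq_LIMSEQ[OF LIMSEQ_inverse_real_of_nat r(1)] by (simp add: o_def inverse_eq_divide)
  then have "(\<lambda>t. Y (r t) \<bullet> p + (1 / real (Suc (r t))) * (Y (r t) \<bullet> Z)) \<longlonglongrightarrow> l \<bullet> p + 0 * (l \<bullet> Z)"
    using lp lZ by (intro tendsto_add tendsto_mult)
  then have "l \<bullet> p + 0 * (l \<bullet> Z) \<le> 0" by (rule LIMSEQ_le_const2) (use Y' in auto)
  then have "l \<bullet> p = 0" using y0(1)[OF r(2)] by simp
  then have "l = q" by (rule y0(2)[OF r(2)])
  then have "q \<bullet> Z \<le> 0" using LIMSEQ_le_const2[OF lZ, of 0] YZ by auto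
  then show False using qZ by simp
qed

theorem unique_supporting_hyperplane:
  assumes c: "contact p q"
  shows "\<exists>!H. supporting_hyperplane n Omega (line p) H"
proof -
  have p: "p \<in> carrier_vec n" and q: "q \<in> S" "q \<bullet> p = 0" using c by (auto simp: contact_def)
  have qc: "q \<in> carrier_vec n" using S_vec[OF q(1)] .
  have q0: "q \<noteq> 0\<^sub>v n" using interior_point q(1) by auto
  let ?H = "{v \<in> carrier_vec n. q \<bullet> v = 0}"
  have "supporting_hyperplane n Omega (line p) ?H"
    unfolding supporting_hyperplane_def
  proof (intro conjI ballI)
    show "\<exists>k. k + 1 = n \<and> ?H \<in> Gr n k" using hyperplane_Gr[OF qc q0] n2 by (intro exI[of _ "n - 1"]) auto
    show "line p \<subseteq> ?H" using p q(2) qc by (auto simp: line_def)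
    fix y assume "y \<in> Omega"
    then obtain v where v: "v \<in> cone" "y = line v" by (auto simp: Omega_def)
    then have "0 < q \<bullet> v" using q(1) by (auto simp: cone_def)
    then show "\<not> y \<subseteq> ?H" using v(2) line_self[of v] by auto
  qed
  moreover have "H = ?H" if H: "supporting_hyperplane n Omega (line p) H" for H
  proof -
    obtain k where k: "k + 1 = n" "H \<in> Gr n k" using H by (auto simp: supporting_hyperplane_def)
    then have HG: "H \<in> Gr n (n - 1)" by (metis add_diff_cancel_right')
    have ph: "line p \<subseteq> H" and dis: "\<And>y. y \<in> Omega \<Longrightarrow> \<not> y \<subseteq> H" using H by (auto simp: supporting_hyperplane_def)
    obtain h where h: "h \<in> carrier_vec n" "h \<noteq> 0\<^sub>v n" "H = {v \<in> carrier_vec n. h \<bullet> v = 0}" using Gr_hyperplane[OF HG] by blast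
    have hp: "h \<bullet> p = 0" using ph line_self h(3) by auto
    have hv: "h \<bullet> v \<noteq> 0" if v: "v \<in> cone" for v
    proof
      assume "h \<bullet> v = 0"
      then have "line v \<subseteq> H" using cone_carrier[OF v] h(1,3) by (auto simp: line_def)
      moreover have "line v \<in> Omega" using v by (auto simp: Omega_def)
      ultimately show False using dis by blast
    qed
    obtain u where u: "u \<in> cone" using interior_point by (auto simp: cone_def)
    \<comment> \<open>A supporting hyperplane fixes \<open>h\<close> only up to sign;
      \<open>g\<close> is the choice that is positive at an interior point.\<close>
    define g where "g = sgn (h \<bullet> u) \<cdot>\<^sub>v h"
    have s: "sgn (h \<bullet> u) \<noteq> 0" using hv[OF u] by (simp add: sgn_zero_iff)
    have gc: "g \<in> carrier_vec n" using h(1) by (simp add: g_def)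
    have gdot: "g \<bullet> v = sgn (h \<bullet> u) * (h \<bullet> v)" if "v \<in> carrier_vec n" for v using that h(1) by (simp add: g_def)
    have gu: "0 < g \<bullet> u" using gdot[OF cone_carrier[OF u]] hv[OF u] by (simp add: sgn_mult_self_eq abs_sgn_eq sgn_if split: if_splits)
    have gpos: "0 < g \<bullet> v" if v: "v \<in> cone" for v
    proof (rule ccontr)
      assume "\<not> 0 < g \<bullet> v"
      moreover have "g \<bullet> v \<noteq> 0" using gdot[OF cone_carrier[OF v]] hv[OF v] s by simp
      ultimately have neg: "g \<bullet> v < 0" by simp
      \<comment> \<open>If \<open>g\<close> took both signs on the cone, it would vanish at this
        positive combination, which belongs to the cone.\<close>
      define w where "w = (- (g \<bullet> v)) \<cdot>\<^sub>v u + (g \<bullet> u) \<cdot>\<^sub>v v"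
      have w: "w \<in> cone" unfolding w_def using neg gu by (intro cone_add cone_smult u v) auto
      have "g \<bullet> w = 0"
        unfolding w_def using gc cone_carrier[OF u] cone_carrier[OF v] by (simp add: scalar_prod_add_distrib[of _ n])
      then show False using gdot[OF cone_carrier[OF w]] hv[OF w] s by simp
    qed
    have "g \<bullet> p = 0" using gdot[OF p] hp by simp
    from contact_functional_unique[OF c gc this gpos] obtain a where a: "g = a \<cdot>\<^sub>v q" by blast
    have "a \<noteq> 0" using gu a smult_zero_vec_eq[OF qc] cone_carrier[OF u] by auto
    have "h \<bullet> v = 0 \<longleftrightarrow> q \<bullet> v = 0" if v: "v \<in> carrier_vec n" for v
    proof -
      have "sgn (h \<bullet> u) * (h \<bullet> v) = a * (q \<bullet> v)" using gdot[OF v] a qc v by simp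
      then show ?thesis using s \<open>a \<noteq> 0\<close> by (metis mult_eq_0_iff)
    qed
    then show ?thesis unfolding h(3) by blast
  qed
  ultimately show ?thesis by blast
qed

text \<open>Write the segment with endpoints a p and b p'. If a and b have the same sign, every
  element of \<open>S\<close> is positive on it, up to the common sign: only \<open>q\<close>
  vanishes at \<open>p\<close>, and \<open>q\<close> is positive at \<open>p'\<close>. Otherwise the
  segment is the complementary one and leaves the closure.\<close>

theorem contact_segment:
  assumes c: "contact p q" "contact p' q'" and ne: "q \<noteq> q'"
    and I: "I \<in> open_proj_segments (line p) (line p')" "I \<subseteq> Gr_topology n 1 closure_of Omega"
  shows "I \<subseteq> Omega"
proof -
  have p: "p \<in> carrier_vec n" "p \<noteq> 0\<^sub>v n" and q: "q \<in> S" "q \<bullet> p = 0" and py: "\<And>y. y \<in> S \<Longrightarrow> 0 \<le> y \<bullet> p" "\<And>y. y \<in> S \<Longrightarrow> y \<bullet> p = 0 \<Longrightarrow> y = q"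
    using c(1) by (auto simp: contact_def)
  have p': "p' \<in> carrier_vec n" "p' \<noteq> 0\<^sub>v n" and q': "q' \<in> S" "q' \<bullet> p' = 0" and py': "\<And>y. y \<in> S \<Longrightarrow> 0 \<le> y \<bullet> p'" "\<And>y. y \<in> S \<Longrightarrow> y \<bullet> p' = 0 \<Longrightarrow> y = q'"
    using c(2) by (auto simp: contact_def)
  have pos: "0 < q \<bullet> p'" "0 < q' \<bullet> p" using py'(1)[OF q(1)] py'(2)[OF q(1)] py(1)[OF q'(1)] py(2)[OF q'(1)] ne by force+
  have qc: "q \<in> carrier_vec n" "q' \<in> carrier_vec n" using S_vec q(1) q'(1) by auto
  obtain u v where uv: "I = {line (u + t \<cdot>\<^sub>v v) | t. 0 < t}" "line p = line u" "line p' = line v"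
    using I(1) unfolding open_proj_segments_def by blast
  obtain a where a: "a \<noteq> 0" "u = a \<cdot>\<^sub>v p" using line_eqD[OF uv(2)[symmetric] p(1)] p(2) by blast
  obtain b where b: "b \<noteq> 0" "v = b \<cdot>\<^sub>v p'" using line_eqD[OF uv(3)[symmetric] p'(1)] p'(2) by blast
  have dot: "y \<bullet> (u + t \<cdot>\<^sub>v v) = a * (y \<bullet> p) + t * b * (y \<bullet> p')" if "y \<in> carrier_vec n" for y t
    unfolding a(2) b(2) using that p(1) p'(1) by (simp add: scalar_prod_add_distrib[of _ n])
  have uvc: "u + t \<cdot>\<^sub>v v \<in> carrier_vec n" for t unfolding a(2) b(2) using p(1) p'(1) by simp
  have ab: "0 < a * b"
  proof (rule ccontr)
    assume "\<not> 0 < a * b"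
    then have neg: "a * b < 0" using a(1) b(1) by (simp add: not_less less_le)
    \<comment> \<open>At this point of the segment \<open>q\<close> sees only the part from
      \<open>p'\<close> and \<open>q'\<close> only the part from \<open>p\<close>; for a b < 0 they
      have opposite signs there, contrary to \<open>closure_Omega\<close>.\<close>
    let ?w = "u + 1 \<cdot>\<^sub>v v"
    have dq: "q \<bullet> ?w = b * (q \<bullet> p')" "q' \<bullet> ?w = a * (q' \<bullet> p)" using dot[OF qc(1), of 1] dot[OF qc(2), of 1] q(2) q'(2) by auto
    have "?w \<noteq> 0\<^sub>v n" using dq(1) b(1) pos(1) qc(1) by auto
    moreover have "line ?w \<in> Gr_topology n 1 closure_of Omega"
    proof -
      have "line ?w \<in> I" unfolding uv(1) by (intro CollectI exI[of _ "1 :: real"] conjI refl) simp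
      then show ?thesis using I(2) by blast
    qed
    ultimately have "0 \<le> (q \<bullet> ?w) * (q' \<bullet> ?w)" using closure_Omega[OF uvc _ _ q(1) q'(1)] by blast
    then have "0 \<le> (a * b) * ((q \<bullet> p') * (q' \<bullet> p))" unfolding dq by (simp add: mult_ac)
    moreover have "(a * b) * ((q \<bullet> p') * (q' \<bullet> p)) < 0" using neg mult_pos_pos[OF pos] by (rule mult_neg_pos)
    ultimately show False by linarith
  qed
  show ?thesis
  proof
    fix x assume "x \<in> I"
    then obtain t where t: "0 < t" "x = line (u + t \<cdot>\<^sub>v v)" unfolding uv(1) by blast
    have "(1 / a) \<cdot>\<^sub>v (u + t \<cdot>\<^sub>v v) \<in> cone"
      unfolding cone_def
    proof (intro CollectI conjI ballI)
      show "(1 / a) \<cdot>\<^sub>v (u + t \<cdot>\<^sub>v v) \<in> carrier_vec n" using uvc by simp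
      fix y assume y: "y \<in> S"
      have yc: "y \<in> carrier_vec n" using S_vec[OF y] .
      have ba: "0 < b / a" using ab unfolding zero_less_divide_iff zero_less_mult_iff by blast
      have "y \<bullet> ((1 / a) \<cdot>\<^sub>v (u + t \<cdot>\<^sub>v v)) = (1 / a) * (a * (y \<bullet> p) + t * b * (y \<bullet> p'))"
        unfolding dot[OF yc, symmetric] using yc uvc by simp
      also have "\<dots> = y \<bullet> p + t * (b / a) * (y \<bullet> p')" using a(1) by (simp add: field_simps)
      also have "0 < \<dots>"
      proof (cases "y \<bullet> p = 0")
        case True
        then have yq: "y = q" using py(2)[OF y] by simp
        show ?thesis unfolding yq q(2) using mult_pos_pos[OF mult_pos_pos[OF t(1) ba] pos(1)] by linarith
      next
        case False
        then have "0 < y \<bullet> p" using py(1)[OF y] by simp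
        moreover have "0 \<le> t * (b / a) * (y \<bullet> p')" by (intro mult_nonneg_nonneg less_imp_le[OF t(1)] less_imp_le[OF ba] py'(1)[OF y])
        ultimately show ?thesis by linarith
      qed
      finally show "0 < y \<bullet> ((1 / a) \<cdot>\<^sub>v (u + t \<cdot>\<^sub>v v))" .
    qed
    then have "line ((1 / a) \<cdot>\<^sub>v (u + t \<cdot>\<^sub>v v)) \<in> Omega" by (auto simp: Omega_def)
    then show "x \<in> Omega" using t(2) line_smult[of "1 / a"] a(1) by simp
  qed
qed

end

subsection \<open>Dynamics of divergent sequences\<close>

lemma tendsto_Phi:
  assumes "mconv d d A L" "k \<le> d" "x < rdim d k" "y < rdim d k"
  shows "(\<lambda>t. Phi d k (A t) $$ (x, y)) \<longlonglongrightarrow> Phi d k L $$ (x, y)"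
proof -
  have xy: "x < nks d k * nks d k" "y < nks d k * nks d k" using assms(3,4) by (auto simp: rdim_def)
  then have b: "x div nks d k < nks d k" "y div nks d k < nks d k"
    by (auto simp: less_mult_imp_div_less)
  have n: "0 < nks d k" using xy(1) by (cases "nks d k") auto
  then have b': "x mod nks d k < nks d k" "y mod nks d k < nks d k" by auto
  show ?thesis
    unfolding Phi_def herm_act_index[OF xy]
    by (intro tendsto_intros tendsto_cme[OF assms(1,2)] b b')
qed

text \<open>By \<open>sprod_le\<close>, every quotient except that of the leading subset by itself
  is at most s(k) / s(k - 1).\<close>

lemma sprod_ratio:
  assumes k: "0 < k" "k < d" and i: "i < nks d k"
    and s: "\<And>n i. i < d \<Longrightarrow> 0 < s n i" "\<And>n i j. i \<le> j \<Longrightarrow> j < d \<Longrightarrow> s n j \<le> s n i"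
    and g: "(\<lambda>n. s n k / s n (k - 1)) \<longlonglongrightarrow> 0"
  shows "(\<lambda>n. sprod d k (s n) i / sprod d k (s n) 0) \<longlonglongrightarrow> (if i = 0 then 1 else 0)"
proof -
  have kd: "k \<le> d" using k by simp
  have n0: "0 < nks d k" using i by simp
  have p0: "0 < sprod d k (s n) 0" for n by (rule sprod_pos[OF kd n0]) (rule s(1))
  show ?thesis
  proof (cases "i = 0")
    case True
    have "sprod d k (s n) i / sprod d k (s n) 0 = 1" for n using p0[of n] True by simp
    then show ?thesis using True by simp
  next
    case False
    have "norm (sprod d k (s n) i / sprod d k (s n) 0) \<le> s n k / s n (k - 1)" for n
    proof -
      let ?P = "\<Prod>a=0..<k - 1. s n a"
      have P: "0 < ?P" by (rule prod_pos) (use k s(1) in auto)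
      have le: "sprod d k (s n) i \<le> ?P * s n k" by (rule sprod_le[OF kd i False k(1)]) (rule s(1), assumption, rule s(2))
      have "{0..<k} = insert (k - 1) {0..<k - 1}" using k(1) by auto
      then have e: "sprod d k (s n) 0 = ?P * s n (k - 1)" unfolding sprod_0[OF kd] by simp
      have "0 < s n (k - 1)" using k s(1) by simp
      have pos: "0 < sprod d k (s n) i" by (rule sprod_pos[OF kd i]) (rule s(1))
      have "sprod d k (s n) i / sprod d k (s n) 0 \<le> (?P * s n k) / (?P * s n (k - 1))"
        unfolding e[symmetric] using le p0[of n] by (intro divide_right_mono) auto
      also have "\<dots> = s n k / s n (k - 1)" by (rule mult_divide_mult_cancel_left[OF less_imp_neq[OF P, symmetric]])
      finally show ?thesis using pos p0[of n] by simp
    qed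
    then have "(\<lambda>n. sprod d k (s n) i / sprod d k (s n) 0) \<longlonglongrightarrow> 0"
      by (intro Lim_null_comparison[OF always_eventually g] allI)
    then show ?thesis using False by simp
  qed
qed

text \<open>Divided by its top entry, the diagonal part tends to the matrix unit at position (0, 0).
  What survives is column 0 of the left factor times row 0 of the right one, and
  \<open>Phi_col_0\<close> identifies both.\<close>

theorem kak_sequence_limit:
  fixes L M :: "nat \<Rightarrow> 'a :: rc_field mat"
  assumes k: "0 < k" "k < d"
    and L: "\<And>n. L n \<in> carrier_mat d d" "L' \<in> carrier_mat d d" "mconv d d L L'"
    and M: "\<And>n. M n \<in> carrier_mat d d" "M' \<in> carrier_mat d d" "mconv d d M M'"
    and s: "\<And>n i. i < d \<Longrightarrow> 0 < s n i" "\<And>n i j. i \<le> j \<Longrightarrow> j < d \<Longrightarrow> s n j \<le> s n i"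
    and g: "(\<lambda>n. s n k / s n (k - 1)) \<longlonglongrightarrow> 0"
    and x: "x < rdim d k" and y: "y < rdim d k"
  shows "(\<lambda>n. Phi d k (L n * rdiag d (s n) * M n) $$ (x, y) / (sprod d k (s n) 0)\<^sup>2) \<longlonglongrightarrow>
    pv d k (lcols k L') $ x * pv d k (lcols k (mat_adjoint M')) $ y"
proof -
  have kd: "k \<le> d" using k by simp
  let ?N = "nks d k" and ?R = "rdim d k"
  let ?D = "\<lambda>n. rdiag d (s n) :: 'a mat"
  let ?q = "\<lambda>n i. sprod d k (s n) i / sprod d k (s n) 0"
  have R0: "0 < ?R" using x by simp
  have Dc: "?D n \<in> carrier_mat d d" for n by (rule mat_diag_carrier_index(1))
  have LD: "L n * ?D n \<in> carrier_mat d d" for n using L(1) Dc by (simp add: mult_carrier_mat[of _ d d])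
  have e: "Phi d k (L n * ?D n * M n) $$ (x, y) / (sprod d k (s n) 0)\<^sup>2 =
      (\<Sum>z=0..<?R. Phi d k (L n) $$ (x, z) * (?q n (z div ?N) * ?q n (z mod ?N)) * Phi d k (M n) $$ (z, y))" for n
  proof -
    let ?d = "\<lambda>z. sprod d k (s n) (z div ?N) * sprod d k (s n) (z mod ?N)"
    have "Phi d k (L n * ?D n) $$ (x, z) = Phi d k (L n) $$ (x, z) * ?d z" if z: "z < ?R" for z
    proof -
      have "Phi d k (L n * ?D n) $$ (x, z) = (\<Sum>w=0..<?R. Phi d k (L n) $$ (x, w) * (if w = z then ?d z else 0))"
        unfolding Phi_mult[OF kd L(1) Dc] Phi_diag[OF kd]
          index_mult_sum[OF Phi_carrier mat_diag_carrier_index(1) x z]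
        by (intro sum.cong refl) (simp add: mat_diag_carrier_index(2)[OF _ z])
      also have "\<dots> = Phi d k (L n) $$ (x, z) * ?d z" using z by (subst sum.remove[of _ z]) auto
      finally show ?thesis .
    qed
    then have "Phi d k (L n * ?D n * M n) $$ (x, y) = (\<Sum>z=0..<?R. Phi d k (L n) $$ (x, z) * ?d z * Phi d k (M n) $$ (z, y))"
      unfolding Phi_mult[OF kd LD M(1)] index_mult_sum[OF Phi_carrier Phi_carrier x y] by (intro sum.cong refl) simp
    then show ?thesis by (simp add: sum_divide_distrib power2_eq_square)
  qed
  have N0: "0 < ?N" using R0 by (cases ?N) (auto simp: rdim_def)
  have b: "z div ?N < ?N" "z mod ?N < ?N" if "z < ?R" for z
    using that N0 by (auto simp: rdim_def less_mult_imp_div_less)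
  have "(\<lambda>n. \<Sum>z=0..<?R. Phi d k (L n) $$ (x, z) * (?q n (z div ?N) * ?q n (z mod ?N)) * Phi d k (M n) $$ (z, y)) \<longlonglongrightarrow>
    (\<Sum>z=0..<?R. Phi d k L' $$ (x, z) * ((if z div ?N = 0 then 1 else 0) * (if z mod ?N = 0 then 1 else 0)) * Phi d k M' $$ (z, y))"
  proof (intro tendsto_sum tendsto_mult)
    fix z assume "z \<in> {0..<?R}"
    then have z: "z < ?R" by simp
    show "(\<lambda>n. Phi d k (L n) $$ (x, z)) \<longlonglongrightarrow> Phi d k L' $$ (x, z)" by (rule tendsto_Phi[OF L(3) kd x z])
    show "(\<lambda>n. Phi d k (M n) $$ (z, y)) \<longlonglongrightarrow> Phi d k M' $$ (z, y)" by (rule tendsto_Phi[OF M(3) kd z y])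
    show "(\<lambda>n. ?q n (z div ?N)) \<longlonglongrightarrow> (if z div ?N = 0 then 1 else 0)" by (rule sprod_ratio[OF k b(1)[OF z]]) (rule s(1), assumption, rule s(2), assumption, assumption, rule g)
    show "(\<lambda>n. ?q n (z mod ?N)) \<longlonglongrightarrow> (if z mod ?N = 0 then 1 else 0)" by (rule sprod_ratio[OF k b(2)[OF z]]) (rule s(1), assumption, rule s(2), assumption, assumption, rule g)
  qed
  also have "(\<Sum>z=0..<?R. Phi d k L' $$ (x, z) * ((if z div ?N = 0 then 1 else 0) * (if z mod ?N = 0 then 1 else 0)) * Phi d k M' $$ (z, y))
      = Phi d k L' $$ (x, 0) * Phi d k M' $$ (0, y)"
  proof -
    have "(if z div ?N = 0 then 1 else 0) * (if z mod ?N = 0 then 1 else 0) = (if z = 0 then 1 else (0 :: real))" for z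
    proof -
      have "z = z div ?N * ?N + z mod ?N" by (rule div_mult_mod_eq[symmetric])
      then have "z = 0" if "z div ?N = 0" "z mod ?N = 0" unfolding that by simp
      then show ?thesis by auto
    qed
    then show ?thesis using R0 by (subst sum.remove[of _ 0]) auto
  qed
  also have "Phi d k L' $$ (x, 0) = pv d k (lcols k L') $ x" by (rule Phi_col_0[OF kd L(2) x])
  also have "Phi d k M' $$ (0, y) = Phi d k (mat_adjoint M') $$ (y, 0)"
    unfolding Phi_adj[OF kd M(2)] using y R0 by simp
  also have "\<dots> = pv d k (lcols k (mat_adjoint M')) $ y" by (rule Phi_col_0[OF kd adj_carrier[OF M(2)] y])
  finally show ?thesis unfolding e .
qed

text \<open>Divergence concerns pairwise distinct elements only; this dichotomy makes it applicable
  to arbitrary sequences.\<close>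

lemma const_or_inj_subseq:
  fixes g :: "nat \<Rightarrow> 'b"
  shows "\<exists>r. subsequence r \<and> ((\<forall>n. g (r n) = g (r 0)) \<or> inj (\<lambda>n. g (r n)))"
proof (cases "\<exists>x. infinite {n. g n = x}")
  case True
  then obtain x where x: "infinite {n. g n = x}" by blast
  let ?r = "enumerate {n. g n = x}"
  have "g (?r n) = x" for n using enumerate_in_set[OF x, of n] by simp
  then show ?thesis using strict_mono_enumerate[OF x] by (intro exI[of _ ?r]) auto
next
  case False
  have "\<exists>m>n. g m \<notin> g ` {..n}" for n
  proof (rule ccontr)
    assume "\<not> ?thesis"
    then have "{n<..} \<subseteq> (\<Union>x\<in>g ` {..n}. {m. g m = x})" by auto
    moreover have "finite (\<Union>x\<in>g ` {..n}. {m. g m = x})" using False by auto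
    ultimately show False using infinite_Ioi finite_subset by blast
  qed
  then obtain h where h: "\<And>n. n < h n" "\<And>n. g (h n) \<notin> g ` {..n}" by metis
  define r where "r n = (h ^^ n) 0" for n
  have rS: "r (Suc n) = h (r n)" for n by (simp add: r_def)
  have r: "strict_mono r" unfolding strict_mono_Suc_iff rS using h(1) by blast
  have ne: "g (r m) \<noteq> g (r n)" if mn: "m < n" for m n
  proof -
    obtain l where l: "n = Suc l" "m \<le> l" using mn by (cases n) auto
    then have "r m \<le> r l" using r by (simp add: strict_mono_less_eq)
    then have m: "g (r m) \<in> g ` {..r l}" by (intro imageI) simp
    show ?thesis
    proof
      assume "g (r m) = g (r n)"
      then have "g (h (r l)) \<in> g ` {..r l}" using m unfolding l(1) rS by (simp only:)
      then show False by (rule notE[OF h(2)])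
    qed
  qed
  have "inj (\<lambda>n. g (r n))" 
  proof (rule injI)
    fix a b assume "g (r a) = g (r b)"
    then show "a = b" using ne[of a b] ne[of b a] by (cases a b rule: linorder_cases) auto
  qed
  then show ?thesis using r by blast
qed

section \<open>Limit flags and the dynamics of transverse groups\<close>

lemma flag_unitary:
  assumes L: "unitary d L" and \<theta>: "\<theta> \<subseteq> {1..<d}"
  shows "restrict (\<lambda>j. cs j L) \<theta> \<in> flags d \<theta>"
  unfolding flags_def
proof (intro CollectI conjI ballI impI)
  have jd: "j \<le> d" if "j \<in> \<theta>" for j using that \<theta> by force
  show "restrict (\<lambda>j. cs j L) \<theta> \<in> extensional \<theta>" by simp
  show "restrict (\<lambda>j. cs j L) \<theta> j \<in> Gr d j" if "j \<in> \<theta>" for j using that unitary_Gr[OF L jd[OF that]] by simp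
  show "restrict (\<lambda>j. cs j L) \<theta> j \<subseteq> restrict (\<lambda>j. cs j L) \<theta> l" if "j \<in> \<theta>" "l \<in> \<theta>" "j \<le> l" for j l
    using that cs_iff(1)[OF L jd[OF that(1)]] cs_iff(1)[OF L jd[OF that(2)]] by auto
qed

lemma limitin_flag_unitary:
  assumes L: "\<And>n. unitary d (L n :: 'a :: rc_field mat)" "unitary d K" "mconv d d L K" and \<theta>: "\<theta> \<subseteq> {1..<d}"
  shows "flag_lim d \<theta> (\<lambda>n. restrict (\<lambda>j. cs j (L n)) \<theta>) (restrict (\<lambda>j. cs j K) \<theta>)"
  unfolding limitin_flag
proof (intro conjI always_eventually allI ballI)
  show "restrict (\<lambda>j. cs j K) \<theta> \<in> flags d \<theta>" by (rule flag_unitary[OF L(2) \<theta>])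
  show "restrict (\<lambda>j. cs j (L n)) \<theta> \<in> flags d \<theta>" for n by (rule flag_unitary[OF L(1) \<theta>])
  fix j assume j: "j \<in> \<theta>"
  then have "j \<le> d" using \<theta> by force
  from limitin_Gr_unitary[OF this L] j
  show "Gr_lim d j (\<lambda>n. restrict (\<lambda>j. cs j (L n)) \<theta> j) (restrict (\<lambda>j. cs j K) \<theta> j)" by simp
qed

lemma mconv_revc:
  assumes "mconv d d A L" "\<And>t. A t \<in> carrier_mat d d" "L \<in> carrier_mat d d"
  shows "mconv d d (\<lambda>t. revc (A t)) (revc L)"
  unfolding mconv_def
proof (intro allI impI)
  fix i j assume ij: "i < d" "j < d"
  have "d - 1 - j < d" using ij(2) by simp
  then show "(\<lambda>t. revc (A t) $$ (i, j)) \<longlonglongrightarrow> revc L $$ (i, j)"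
    unfolding revc_index[OF assms(2) ij] revc_index[OF assms(3) ij] using assms(1) ij(1) by (simp add: mconv_def)
qed

definition Uflag :: "nat \<Rightarrow> nat set \<Rightarrow> ('a :: rc_field) mat set \<Rightarrow> nat \<Rightarrow> 'a vec set" where
  "Uflag d \<theta> g = restrict (\<lambda>j. U_sub d j g) \<theta>"

locale transverse =
  fixes d :: nat and \<theta> :: "nat set" and \<Gamma> :: "('a :: rc_field) mat set set"
  assumes sym: "symmetric_type d \<theta>" and ne: "\<theta> \<noteq> {}" and tg: "transverse_group d \<theta> \<Gamma>"
begin

abbreviation Lam :: "(nat \<Rightarrow> 'a vec set) set" where "Lam \<equiv> flag_limit_set d \<theta> \<Gamma>"

lemma theta: "\<theta> \<subseteq> {1..<d}" "finite \<theta>" "j \<in> \<theta> \<Longrightarrow> 0 < j" "j \<in> \<theta> \<Longrightarrow> j < d" "j \<in> \<theta> \<Longrightarrow> j \<le> d" "j \<in> \<theta> \<Longrightarrow> d - j \<in> \<theta>"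
proof -
  show 1: "\<theta> \<subseteq> {1..<d}" using sym by (simp add: symmetric_type_def)
  then show "finite \<theta>" by (rule finite_subset) simp
  show 2: "j \<in> \<theta> \<Longrightarrow> 0 < j" "j \<in> \<theta> \<Longrightarrow> j < d" "j \<in> \<theta> \<Longrightarrow> j \<le> d" using 1 by force+
  show "j \<in> \<theta> \<Longrightarrow> d - j \<in> \<theta>" using sym 2(1,2) unfolding symmetric_type_def by (metis atLeastLessThan_iff Suc_leI One_nat_def)
qed

lemma Gamma: "subgroup \<Gamma> (PGL d)" "g \<in> \<Gamma> \<Longrightarrow> g \<in> carrier (PGL d)" "g \<in> \<Gamma> \<Longrightarrow> inv\<^bsub>PGL d\<^esub> g \<in> \<Gamma>"
  "g \<in> \<Gamma> \<Longrightarrow> h \<in> \<Gamma> \<Longrightarrow> g \<otimes>\<^bsub>PGL d\<^esub> h \<in> \<Gamma>" "\<one>\<^bsub>PGL d\<^esub> \<in> \<Gamma>"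
proof -
  show s: "subgroup \<Gamma> (PGL d)" using tg by (simp add: transverse_group_def)
  show "g \<in> \<Gamma> \<Longrightarrow> g \<in> carrier (PGL d)" using subgroup.subset[OF s] by blast
  show "g \<in> \<Gamma> \<Longrightarrow> inv\<^bsub>PGL d\<^esub> g \<in> \<Gamma>" by (rule subgroup.m_inv_closed[OF s])
  show "g \<in> \<Gamma> \<Longrightarrow> h \<in> \<Gamma> \<Longrightarrow> g \<otimes>\<^bsub>PGL d\<^esub> h \<in> \<Gamma>" by (rule subgroup.m_closed[OF s])
  show "\<one>\<^bsub>PGL d\<^esub> \<in> \<Gamma>" by (rule subgroup.one_closed[OF s])
qed

lemma Gamma_lift:
  assumes "g \<in> \<Gamma>"
  shows "\<exists>A\<in>carrier_mat d d. det A \<noteq> 0 \<and> g = pcl d A"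
  using Gamma(2)[OF assms] unfolding PGL_carrier by auto

lemma Lam_flags: "F \<in> Lam \<Longrightarrow> F \<in> flags d \<theta>"
  using tg by (auto simp: transverse_group_def transverse_set_def)

lemma Lam_Gr: "F \<in> Lam \<Longrightarrow> j \<in> \<theta> \<Longrightarrow> F j \<in> Gr d j"
  using Lam_flags by (auto simp: flags_def)

lemma Lam_transverse: "F \<in> Lam \<Longrightarrow> G \<in> Lam \<Longrightarrow> F \<noteq> G \<Longrightarrow> j \<in> \<theta> \<Longrightarrow> transverse_subspaces d (F j) (G (d - j))"
  using tg by (auto simp: transverse_group_def transverse_set_def transverse_flags_def)

lemma Lam_Uflag: "F \<in> Lam \<longleftrightarrow> (\<exists>\<gamma> :: nat \<Rightarrow> _. inj \<gamma> \<and> range \<gamma> \<subseteq> \<Gamma> \<and> flag_lim d \<theta> (\<lambda>n. Uflag d \<theta> (\<gamma> n)) F)"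
  by (simp add: flag_limit_set_def Uflag_def)

text \<open>\<open>F\<close> is the attracting and \<open>G\<close> the repelling flag of the lifts
  \<open>A n\<close>. All types in \<theta> are covered by one sequence: type k serves the domain,
  while the action on flags needs every type.\<close>

definition rank_one_limit :: "(nat \<Rightarrow> 'a mat) \<Rightarrow> (nat \<Rightarrow> nat \<Rightarrow> real) \<Rightarrow> (nat \<Rightarrow> 'a vec set) \<Rightarrow> (nat \<Rightarrow> 'a vec set) \<Rightarrow> bool" where
  "rank_one_limit A c F G \<longleftrightarrow> (\<forall>n. A n \<in> carrier_mat d d \<and> det (A n) \<noteq> 0) \<and> (\<forall>n. \<forall>j\<in>\<theta>. 0 < c n j) \<and>
    (\<forall>j\<in>\<theta>. \<forall>x<rdim d j. \<forall>y<rdim d j. (\<lambda>n. Phi d j (A n) $$ (x, y) / c n j) \<longlonglongrightarrow> pW d j (F j) $ x * qW d j (G (d - j)) $ y)"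

text \<open>The unitary factors of Cartan decompositions converge along a subsequence, and
  divergence sends the ratios of consecutive singular values to 0 at each type in \<theta>. The flag
  \<open>F\<close> is read off from the limit of the left factors, and \<open>G\<close> from the
  limit of the right ones, because inverting exchanges the two.\<close>

theorem dynamics:
  assumes inj: "inj (\<gamma> :: nat \<Rightarrow> _)" and ran: "\<And>n. \<gamma> n \<in> \<Gamma>"
  shows "\<exists>r A c F G. subsequence r \<and> F \<in> Lam \<and> G \<in> Lam \<and> rank_one_limit A c F G \<and>
    (\<forall>n. \<gamma> (r n) = pcl d (A n)) \<and>
    flag_lim d \<theta> (\<lambda>n. Uflag d \<theta> (\<gamma> (r n))) F \<and>
    flag_lim d \<theta> (\<lambda>n. Uflag d \<theta> (inv\<^bsub>PGL d\<^esub> (\<gamma> (r n)))) G"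
proof -
  obtain j where "j \<in> \<theta>" using ne by blast
  then have d0: "0 < d" using theta(4)[of j] by simp
  have "\<exists>L s M. kak d (\<gamma> n) L s M" for n by (rule kak_exists[OF Gamma(2)[OF ran] d0])
  then obtain L s M where kak: "\<And>n. kak d (\<gamma> n) (L n) (s n) (M n)" by metis
  have u: "unitary d (L n)" "unitary d (M n)" for n using kak[of n] by (auto simp: kak_def)
  have s: "i < d \<Longrightarrow> 0 < s n i" "i \<le> j \<Longrightarrow> j < d \<Longrightarrow> s n j \<le> s n i" for n i j using kak[of n] by (auto simp: kak_def)
  have div: "filterlim (\<lambda>n. root_gap j (\<gamma> n)) at_top sequentially" if "j \<in> \<theta>" for j
  proof -
    have "P_divergent j \<Gamma>" using tg that by (simp add: transverse_group_def)
    then show ?thesis unfolding P_divergent_def using inj ran by blast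
  qed
  have gap: "(\<lambda>n. s n j / s n (j - 1)) \<longlonglongrightarrow> 0" if j: "j \<in> \<theta>" for j
  proof -
    have e: "s n j / s n (j - 1) = exp (- root_gap j (\<gamma> n))" for n
    proof -
      have "0 < s n j" "0 < s n (j - 1)" using s(1) theta(3,4)[OF j] by auto
      then show ?thesis unfolding kak_gap[OF kak theta(3,4)[OF j]] by (simp add: exp_minus exp_ln)
    qed
    have "filterlim (\<lambda>n. - root_gap j (\<gamma> n)) at_bot sequentially"
      using div[OF j] by (simp add: filterlim_uminus_at_bot)
    from filterlim_compose[OF exp_at_bot this] show ?thesis unfolding e .
  qed
  have "\<forall>\<^sub>F n in sequentially. \<forall>j\<in>\<theta>. s n j < s n (j - 1)"
  proof (rule eventually_ball_finite[OF theta(2)], rule ballI)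
    fix j assume j: "j \<in> \<theta>"
    have "\<forall>\<^sub>F n in sequentially. 0 < root_gap j (\<gamma> n)" using div[OF j] by (simp add: filterlim_at_top_dense)
    then show "\<forall>\<^sub>F n in sequentially. s n j < s n (j - 1)"
      by (rule eventually_mono) (rule kak_gap_pos[OF kak theta(3,4)[OF j]])
  qed
  \<comment> \<open>\<open>U_sub\<close> is described by the decomposition only when the gap is
    positive, which holds from some index on; hence the shift by \<open>N\<close> in the
    subsequence.\<close>
  then obtain N where N: "\<And>n j. N \<le> n \<Longrightarrow> j \<in> \<theta> \<Longrightarrow> s n j < s n (j - 1)" unfolding eventually_sequentially by blast
  obtain L' r1 where r1: "strict_mono r1" "unitary d L'" "mconv d d (\<lambda>n. L (r1 n)) L'"
    using unitary_convergent[of d L, OF u(1)] by (elim exE conjE) (rule that)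
  obtain M' r2 where r2: "strict_mono r2" "unitary d M'" "mconv d d (\<lambda>n. M (r1 (r2 n))) M'"
    using unitary_convergent[of d "\<lambda>n. M (r1 n)", OF u(2)] by (elim exE conjE) (rule that)
  define r where "r n = r1 (r2 (n + N))" for n
  have r: "strict_mono r" using r1(1) r2(1) by (simp add: strict_mono_def r_def)
  have sh: "strict_mono (\<lambda>n. n + N)" by (simp add: strict_mono_def)
  have rN: "N \<le> r n" for n
    using seq_suble[OF r1(1), of "r2 (n + N)"] seq_suble[OF r2(1), of "n + N"] unfolding r_def by linarith
  have cL: "mconv d d (\<lambda>n. L (r n)) L'"
    unfolding r_def using mconv_subseq[OF mconv_subseq[OF r1(3) r2(1)] sh] .
  have cM: "mconv d d (\<lambda>n. M (r n)) M'" unfolding r_def using mconv_subseq[OF r2(3) sh] .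
  define A where "A n = L (r n) * rdiag d (s (r n)) * M (r n)" for n
  define c where "c n j = (sprod d j (s (r n)) 0)\<^sup>2" for n j
  define F where "F = restrict (\<lambda>j. cs j L') \<theta>"
  define G where "G = restrict (\<lambda>j. cs j (revc (mat_adjoint M'))) \<theta>"
  have Mc: "mat_adjoint (M n) \<in> carrier_mat d d" "mat_adjoint M' \<in> carrier_mat d d" for n
    using unitaryD(1)[OF u(2)] unitaryD(1)[OF r2(2)] by auto
  have U: "Uflag d \<theta> (\<gamma> (r n)) = restrict (\<lambda>j. cs j (L (r n))) \<theta>" for n
    unfolding Uflag_def using kak_U[OF kak theta(3,4)] N[OF rN] by (intro restrict_ext) auto
  have Ui: "Uflag d \<theta> (inv\<^bsub>PGL d\<^esub> (\<gamma> (r n))) = restrict (\<lambda>j. cs j (revc (mat_adjoint (M (r n))))) \<theta>" for n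
    unfolding Uflag_def
  proof (rule restrict_ext)
    fix j assume j: "j \<in> \<theta>"
    note b = theta(3,4)[OF j]
    \<comment> \<open>Type j of the inverse has the gap of type d - j of the original element; this
      is where the symmetry of \<theta> enters.\<close>
    have "s (r n) (d - j) < s (r n) (d - j - 1)" by (rule N[OF rN theta(6)[OF j]])
    moreover have "0 < s (r n) (d - j)" using s(1) b by simp
    ultimately have "1 / s (r n) (d - 1 - j) < 1 / s (r n) (d - 1 - (j - 1))"
      using b by (simp add: frac_less2)
    from kak_U[OF kak_inv[OF kak] b this] show "U_sub d j (inv\<^bsub>PGL d\<^esub> (\<gamma> (r n))) = cs j (revc (mat_adjoint (M (r n))))" .
  qed
  have lF: "flag_lim d \<theta> (\<lambda>n. Uflag d \<theta> (\<gamma> (r n))) F"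
    unfolding U F_def by (rule limitin_flag_unitary[OF u(1) r1(2) cL theta(1)])
  have lG: "flag_lim d \<theta> (\<lambda>n. Uflag d \<theta> (inv\<^bsub>PGL d\<^esub> (\<gamma> (r n)))) G"
    unfolding Ui G_def
    by (rule limitin_flag_unitary[OF revc_unitary[OF unitary_adj[OF u(2)]] revc_unitary[OF unitary_adj[OF r2(2)]]
      mconv_revc[OF mconv_adj[OF cM unitaryD(1)[OF u(2)] unitaryD(1)[OF r2(2)]] Mc] theta(1)])
  have inj': "inj (\<lambda>n. \<gamma> (r n))" using inj_compose[OF inj strict_mono_imp_inj_on[OF r]] by (simp add: o_def)
  have FL: "F \<in> Lam" unfolding Lam_Uflag using inj' ran lF by (intro exI[of _ "\<lambda>n. \<gamma> (r n)"]) auto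
  have inji: "inj (\<lambda>n. inv\<^bsub>PGL d\<^esub> (\<gamma> (r n)))"
    by (rule injI) (use injD[OF inj'] group.inv_inv[OF group_PGL Gamma(2)[OF ran]] in metis)
  have GL: "G \<in> Lam" unfolding Lam_Uflag using inji Gamma(3)[OF ran] lG by (intro exI[of _ "\<lambda>n. inv\<^bsub>PGL d\<^esub> (\<gamma> (r n))"]) auto
  have Ag: "\<gamma> (r n) = pcl d (A n)" for n using kak[of "r n"] by (simp add: kak_def A_def)
  have A: "A n \<in> carrier_mat d d" "det (A n) \<noteq> 0" for n
    using kak_carrier(3,4)[OF kak[of "r n"]] unfolding A_def by auto
  have "rank_one_limit A c F G"
    unfolding rank_one_limit_def
  proof (intro conjI allI ballI impI A)
    fix j assume j: "j \<in> \<theta>"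
    note b = theta(3,4,5)[OF j]
    show "0 < c n j" for n
    proof -
      have "0 < sprod d j (s (r n)) 0" unfolding sprod_0[OF b(3)] by (rule prod_pos) (use s(1) b in auto)
      then show ?thesis by (simp add: c_def)
    qed
    fix x y assume xy: "x < rdim d j" "y < rdim d j"
    have F: "pW d j (F j) = pv d j (lcols j L')" using j pW_unitary[OF b(3) r1(2)] by (simp add: F_def)
    \<comment> \<open>The plane G^(d-j) is spanned by the last d - j columns of the adjoint of
      \<open>M'\<close>, so its complement is spanned by the first j, and those form the row factor
      of the limit.\<close>
    have "perp d (G (d - j)) = cs j (mat_adjoint M')"
      using perp_revc[OF unitary_adj[OF r2(2)] b(3)] theta(6)[OF j] by (simp add: G_def)
    then have G: "qW d j (G (d - j)) = pv d j (lcols j (mat_adjoint M'))"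
      unfolding qW_def using pW_unitary[OF b(3) unitary_adj[OF r2(2)]] by simp
    show "(\<lambda>n. Phi d j (A n) $$ (x, y) / c n j) \<longlonglongrightarrow> pW d j (F j) $ x * qW d j (G (d - j)) $ y"
      unfolding F G A_def c_def
    proof (rule kak_sequence_limit[OF b(1,2) _ _ cL _ _ cM _ _ _ xy])
      show "L (r n) \<in> carrier_mat d d" "M (r n) \<in> carrier_mat d d" for n using unitaryD(1) u by auto
      show "L' \<in> carrier_mat d d" "M' \<in> carrier_mat d d" using unitaryD(1) r1(2) r2(2) by auto
      show "0 < s (r n) i" if "i < d" for n i using s(1) that .
      show "s (r n) j \<le> s (r n) i" if "i \<le> j" "j < d" for n i j using s(2) that .
      show "(\<lambda>n. s (r n) j / s (r n) (j - 1)) \<longlonglongrightarrow> 0" using LIMSEQ_subseq_LIMSEQ[OF gap[OF j] r] by (simp add: o_def)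
    qed
  qed
  then show ?thesis using r FL GL Ag lF lG by (intro exI[of _ r] exI[of _ A] exI[of _ c] exI[of _ F] exI[of _ G] conjI allI)
qed

end

lemma limitin_flag_unique:
  assumes "flag_lim d \<theta> F G" "flag_lim d \<theta> F (G' :: nat \<Rightarrow> 'a :: rc_field vec set)"
    and \<theta>: "\<And>j. j \<in> \<theta> \<Longrightarrow> j \<le> d"
  shows "G = G'"
proof
  fix j
  have e: "G \<in> extensional \<theta>" "G' \<in> extensional \<theta>" using assms(1,2) by (auto simp: limitin_flag flags_def)
  show "G j = G' j"
  proof (cases "j \<in> \<theta>")
    case True
    show ?thesis by (rule limitin_Gr_unique[of d j "\<lambda>n. F n j"]) (use assms(1,2) True \<theta> in \<open>auto simp: limitin_flag\<close>)
  next
    case False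
    then show ?thesis using e by (simp add: extensional_def)
  qed
qed

lemma limitin_subseq:
  assumes "limitin X f l sequentially" "subsequence r"
  shows "limitin X (\<lambda>n. f (r n)) l sequentially"
  using assms limitin_subsequence[of r X f l] by (simp add: o_def)

text \<open>With B the inverse of A, the product of B w with the adjoint of A applied to u is the
  product of w and u; so the adjoint of A carries the complement of W to that of B W.\<close>

lemma perp_image:
  assumes A: "(A :: 'a :: rc_field mat) \<in> carrier_mat d d" and B: "B \<in> carrier_mat d d" "A * B = 1\<^sub>m d" "B * A = 1\<^sub>m d"
    and W: "W \<subseteq> carrier_vec d"
  shows "(\<lambda>v. mat_adjoint A *\<^sub>v v) ` perp d W = perp d (mat_image B W)"
proof -
  have adj: "mat_adjoint B * mat_adjoint A = 1\<^sub>m d" "mat_adjoint A * mat_adjoint B = 1\<^sub>m d"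
    unfolding adj_mult[OF A B(1), symmetric] adj_mult[OF B(1) A, symmetric] B(2,3) by (rule adj_one)+
  show ?thesis
  proof (intro equalityI subsetI)
    fix x assume "x \<in> (\<lambda>v. mat_adjoint A *\<^sub>v v) ` perp d W"
    then obtain u where u: "u \<in> carrier_vec d" "\<And>w. w \<in> W \<Longrightarrow> (\<Sum>i=0..<d. conjugate (w $ i) * u $ i) = 0" "x = mat_adjoint A *\<^sub>v u"
      by (auto simp: perp_def)
    have xc: "x \<in> carrier_vec d" unfolding u(3) using adj_carrier[OF A] u(1) by simp
    have "(\<Sum>i=0..<d. conjugate ((B *\<^sub>v w) $ i) * x $ i) = 0" if w: "w \<in> W" for w
    proof -
      have wc: "w \<in> carrier_vec d" using w W by blast
      have "mat_adjoint B *\<^sub>v x = u"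
        unfolding u(3) assoc_mult_mat_vec[OF adj_carrier[OF B(1)] adj_carrier[OF A] u(1), symmetric] adj using u(1) by simp
      then show ?thesis unfolding adj_inner[OF B(1) wc xc] using u(2)[OF w] by simp
    qed
    then show "x \<in> perp d (mat_image B W)" using xc by (auto simp: perp_def)
  next
    fix x assume x: "x \<in> perp d (mat_image B W)"
    then have xc: "x \<in> carrier_vec d" by (simp add: perp_def)
    have x0: "(\<Sum>i=0..<d. conjugate ((B *\<^sub>v w) $ i) * x $ i) = 0" if "w \<in> W" for w using x that by (auto simp: perp_def)
    have Bx: "mat_adjoint B *\<^sub>v x \<in> carrier_vec d" using adj_carrier[OF B(1)] xc by simp
    have "mat_adjoint B *\<^sub>v x \<in> perp d W"
      unfolding perp_def
    proof (intro CollectI conjI ballI Bx)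
      fix w assume w: "w \<in> W"
      then have wc: "w \<in> carrier_vec d" using W by blast
      show "(\<Sum>i=0..<d. conjugate (w $ i) * (mat_adjoint B *\<^sub>v x) $ i) = 0"
        unfolding adj_inner[OF B(1) wc xc, symmetric] by (rule x0[OF w])
    qed
    moreover have "mat_adjoint A *\<^sub>v (mat_adjoint B *\<^sub>v x) = x"
      unfolding assoc_mult_mat_vec[OF adj_carrier[OF A] adj_carrier[OF B(1)] xc, symmetric] adj using xc by simp
    ultimately show "x \<in> (\<lambda>v. mat_adjoint A *\<^sub>v v) ` perp d W" by (intro image_eqI[of _ _ "mat_adjoint B *\<^sub>v x"]) auto
  qed
qed

lemma transpose_dot:
  assumes "M \<in> carrier_mat n n" "v \<in> carrier_vec n" "w \<in> carrier_vec n"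
  shows "(transpose_mat M *\<^sub>v w) \<bullet> v = w \<bullet> (M *\<^sub>v (v :: real vec))"
proof -
  have "(transpose_mat M *\<^sub>v w) \<bullet> v = (\<Sum>i=0..<n. \<Sum>l=0..<n. M $$ (l, i) * w $ l * v $ i)"
    using assms by (auto simp: scalar_prod_def sum_distrib_right intro!: sum.cong)
  also have "\<dots> = (\<Sum>l=0..<n. \<Sum>i=0..<n. M $$ (l, i) * w $ l * v $ i)" by (rule sum.swap)
  also have "\<dots> = w \<bullet> (M *\<^sub>v v)"
    using assms by (auto simp: scalar_prod_def sum_distrib_left intro!: sum.cong)
  finally show ?thesis .
qed

text \<open>The transpose of \<open>Phi\<close> belongs to the adjoint of \<open>A\<close>, which
  acts on complements by \<open>perp_image\<close>.\<close>

lemma Phi_qW: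
  assumes A: "A \<in> carrier_mat d d" and B: "B \<in> carrier_mat d d" "A * B = 1\<^sub>m d" "B * A = 1\<^sub>m d"
    and W: "W \<in> Gr d (d - k)" and k: "k \<le> d"
  shows "\<exists>c>0. transpose_mat (Phi d k A) *\<^sub>v qW d k W = c \<cdot>\<^sub>v qW d k (mat_image B W)"
proof -
  have dA: "det (mat_adjoint A) \<noteq> 0"
  proof -
    have "det A * det B = 1" using det_mult[OF A B(1)] B(2) by simp
    then show ?thesis using det_adj[OF A] by auto
  qed
  note P = Phi_pW[OF perp_Gr[OF W k] adj_carrier[OF A] dA]
  show ?thesis
    unfolding qW_def perp_image[OF A B Gr_closed(1)[OF W], symmetric]
    using P unfolding Phi_adj[OF k A] by blast
qed

lemma pW_image_index:
  assumes W: "W \<in> Gr d k" and A: "A \<in> carrier_mat d d" "det A \<noteq> 0" and y: "y < rdim d k"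
  shows "pW d k (mat_image A W) $ y = (Phi d k A *\<^sub>v pW d k W) $ y / (evec (nks d k) \<bullet> (Phi d k A *\<^sub>v pW d k W))"
proof -
  define l where "l = evec (nks d k) \<bullet> (Phi d k A *\<^sub>v pW d k W)"
  have l: "0 < l" "Phi d k A *\<^sub>v pW d k W = l \<cdot>\<^sub>v pW d k (mat_image A W)"
    unfolding l_def by (rule Phi_pW[OF W A])+
  have "(l \<cdot>\<^sub>v pW d k (mat_image A W)) $ y = l * pW d k (mat_image A W) $ y" using y by simp
  then show ?thesis unfolding l_def[symmetric] unfolding l(2) using l(1) by simp
qed

lemma flag_act_flags:
  assumes A: "(A :: 'a :: rc_field mat) \<in> carrier_mat d d" "det A \<noteq> 0" and F: "F \<in> flags d \<theta>"
  shows "flag_act \<theta> (pcl d A) F \<in> flags d \<theta>" "j \<in> \<theta> \<Longrightarrow> flag_act \<theta> (pcl d A) F j = mat_image A (F j)"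
proof -
  have G: "F j \<in> Gr d j" if "j \<in> \<theta>" for j using F that by (simp add: flags_def)
  have e: "flag_act \<theta> (pcl d A) F j = mat_image A (F j)" if "j \<in> \<theta>" for j
    using act_Gr[OF A(1) G[OF that]] that by (simp add: flag_act_def)
  then show "j \<in> \<theta> \<Longrightarrow> flag_act \<theta> (pcl d A) F j = mat_image A (F j)" .
  show "flag_act \<theta> (pcl d A) F \<in> flags d \<theta>"
    unfolding flags_def
  proof (intro CollectI conjI ballI impI)
    show "flag_act \<theta> (pcl d A) F \<in> extensional \<theta>" by (simp add: flag_act_def)
    show "flag_act \<theta> (pcl d A) F j \<in> Gr d j" if "j \<in> \<theta>" for j unfolding e[OF that] by (rule Gr_image[OF G[OF that] A])
    show "flag_act \<theta> (pcl d A) F i \<subseteq> flag_act \<theta> (pcl d A) F j" if "i \<in> \<theta>" "j \<in> \<theta>" "i \<le> j" for i j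
      unfolding e[OF that(1)] e[OF that(2)] using F that by (intro image_mono) (auto simp: flags_def)
  qed
qed

text \<open>Choose recursively outside the finite set of earlier values. Diagonal arguments use this
  to obtain pairwise distinct group elements.\<close>

lemma infinite_sets_choice:
  assumes "\<And>n :: nat. infinite (S n)"
  shows "\<exists>f. inj f \<and> (\<forall>n. f n \<in> S n)"
proof -
  have "\<exists>x. x \<in> S n \<and> x \<notin> T" if "finite T" for n T
  proof -
    have "S n - T \<noteq> {}" by (rule infinite_imp_nonempty[OF Diff_infinite_finite[OF that assms[of n]]])
    then show ?thesis by blast
  qed
  moreover define ch where "ch n T = (SOME x. x \<in> S n \<and> x \<notin> T)" for n T
  ultimately have ch: "ch n T \<in> S n \<and> ch n T \<notin> T" if "finite T" for n T
    using someI_ex[of "\<lambda>x. x \<in> S n \<and> x \<notin> T"] that by simp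
  \<comment> \<open>The first component collects all values chosen so far, the second is the current
    value.\<close>
  define h where "h = rec_nat ({ch 0 {}}, ch 0 {}) (\<lambda>n p. (insert (ch (Suc n) (fst p)) (fst p), ch (Suc n) (fst p)))"
  have h0: "h 0 = ({ch 0 {}}, ch 0 {})" and hS: "h (Suc n) = (insert (ch (Suc n) (fst (h n))) (fst (h n)), ch (Suc n) (fst (h n)))" for n
    by (simp_all add: h_def)
  have fin: "finite (fst (h n))" for n by (induction n) (simp_all add: h0 hS)
  have mem: "snd (h m) \<in> fst (h n)" if mn: "m \<le> n" for m n
    using mn by (induction n) (auto simp: h0 hS le_Suc_eq)
  have inS: "snd (h n) \<in> S n" for n
    using ch[OF finite.emptyI, of 0] ch[OF fin, of "Suc (n - 1)" "n - 1"] by (cases n) (simp_all add: h0 hS)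
  have ne: "snd (h m) \<noteq> snd (h n)" if mn: "m < n" for m n
  proof -
    obtain l where l: "n = Suc l" "m \<le> l" using mn by (cases n) auto
    have "snd (h n) \<notin> fst (h l)" unfolding l(1) hS using ch[OF fin] by simp
    then show ?thesis using mem[OF l(2)] by auto
  qed
  have "inj (\<lambda>n. snd (h n))"
  proof (rule injI)
    fix a b assume "snd (h a) = snd (h b)"
    then show "a = b" using ne[of a b] ne[of b a] by (cases a b rule: linorder_cases) auto
  qed
  then show ?thesis using inS by blast
qed

context transverse
begin

lemma rank_one_limitD:
  assumes "rank_one_limit A c F G"
  shows "A n \<in> carrier_mat d d" "det (A n) \<noteq> 0" "j \<in> \<theta> \<Longrightarrow> 0 < c n j"
    "j \<in> \<theta> \<Longrightarrow> x < rdim d j \<Longrightarrow> y < rdim d j \<Longrightarrow> (\<lambda>n. Phi d j (A n) $$ (x, y) / c n j) \<longlonglongrightarrow> pW d j (F j) $ x * qW d j (G (d - j)) $ y"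
  using assms by (auto simp: rank_one_limit_def)

lemma rank_one_vec:
  assumes R: "rank_one_limit A c F G" and j: "j \<in> \<theta>" and v: "v \<in> carrier_vec (rdim d j)" and x: "x < rdim d j"
  shows "(\<lambda>n. (Phi d j (A n) *\<^sub>v v) $ x / c n j) \<longlonglongrightarrow> (qW d j (G (d - j)) \<bullet> v) * pW d j (F j) $ x"
proof -
  have "(\<lambda>n. \<Sum>y=0..<rdim d j. (Phi d j (A n) $$ (x, y) / c n j) * v $ y) \<longlonglongrightarrow>
      (\<Sum>y=0..<rdim d j. (pW d j (F j) $ x * qW d j (G (d - j)) $ y) * v $ y)"
    by (intro tendsto_sum tendsto_mult tendsto_const rank_one_limitD(4)[OF R j x]) auto
  also have "(\<Sum>y=0..<rdim d j. (pW d j (F j) $ x * qW d j (G (d - j)) $ y) * v $ y) = (qW d j (G (d - j)) \<bullet> v) * pW d j (F j) $ x"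
    using v by (simp add: scalar_prod_def sum_distrib_left sum_distrib_right mult_ac)
  also have "(\<lambda>n. \<Sum>y=0..<rdim d j. (Phi d j (A n) $$ (x, y) / c n j) * v $ y) = (\<lambda>n. (Phi d j (A n) *\<^sub>v v) $ x / c n j)"
    unfolding index_mult_vec_sum[OF Phi_carrier v x] sum_divide_distrib by (intro ext sum.cong refl) simp
  finally show ?thesis .
qed

lemma rank_one_dot:
  assumes R: "rank_one_limit A c F G" and j: "j \<in> \<theta>" and v: "v \<in> carrier_vec (rdim d j)" and w: "w \<in> carrier_vec (rdim d j)"
  shows "(\<lambda>n. (w \<bullet> (Phi d j (A n) *\<^sub>v v)) / c n j) \<longlonglongrightarrow> (qW d j (G (d - j)) \<bullet> v) * (w \<bullet> pW d j (F j))"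
proof -
  have Pc: "Phi d j (A n) *\<^sub>v v \<in> carrier_vec (rdim d j)" for n using v by (simp add: mult_mat_vec_carrier[OF Phi_carrier])
  have "(\<lambda>n. \<Sum>x=0..<rdim d j. w $ x * ((Phi d j (A n) *\<^sub>v v) $ x / c n j)) \<longlonglongrightarrow>
      (\<Sum>x=0..<rdim d j. w $ x * ((qW d j (G (d - j)) \<bullet> v) * pW d j (F j) $ x))"
    by (intro tendsto_sum tendsto_mult tendsto_const rank_one_vec[OF R j v]) auto
  also have "(\<Sum>x=0..<rdim d j. w $ x * ((qW d j (G (d - j)) \<bullet> v) * pW d j (F j) $ x)) = (qW d j (G (d - j)) \<bullet> v) * (w \<bullet> pW d j (F j))"
    by (simp add: scalar_prod_def[of w] sum_distrib_left mult_ac)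
  also have "(\<lambda>n. \<Sum>x=0..<rdim d j. w $ x * ((Phi d j (A n) *\<^sub>v v) $ x / c n j)) = (\<lambda>n. (w \<bullet> (Phi d j (A n) *\<^sub>v v)) / c n j)"
    by (simp add: scalar_prod_def[of w] sum_divide_distrib)
  finally show ?thesis .
qed

text \<open>Every q has trace 1, so the identity form is never in the kernel of a rank one limit and
  can be used to read off its image.\<close>

lemma qW_Lam_pos: "G \<in> Lam \<Longrightarrow> j \<in> \<theta> \<Longrightarrow> qW d j (G (d - j)) \<bullet> evec (nks d j) = 1"
proof -
  assume G: "G \<in> Lam" and j: "j \<in> \<theta>"
  have "perp d (G (d - j)) \<in> Gr d j" by (rule perp_Gr[OF Lam_Gr[OF G theta(6)[OF j]] theta(5)[OF j]])
  from evec_pW[OF this] show ?thesis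
    using comm_scalar_prod[OF evec_carrier(1)[of d j] pW_carrier(1)[of d j "perp d (G (d - j))"]] by (simp add: qW_def)
qed

text \<open>Dividing by the trace removes both the normalisation \<open>c n j\<close> and the factor
  q v, which is nonzero; only the direction of the image remains. The fixed left factor
  \<open>B\<close> is needed to compare a sequence with its translate.\<close>

lemma rank_one_direction:
  assumes R: "rank_one_limit A c F G" and F: "F \<in> Lam" and j: "j \<in> \<theta>" and B: "B \<in> carrier_mat d d" "det B \<noteq> 0"
    and v: "v \<in> carrier_vec (rdim d j)" and nz: "qW d j (G (d - j)) \<bullet> v \<noteq> 0" and x: "x < rdim d j"
  shows "(\<lambda>n. (Phi d j (B * A n) *\<^sub>v v) $ x / (evec (nks d j) \<bullet> (Phi d j (B * A n) *\<^sub>v v))) \<longlonglongrightarrow> pW d j (mat_image B (F j)) $ x"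
proof -
  let ?n = "rdim d j" and ?e = "evec (nks d j)" and ?q = "qW d j (G (d - j)) \<bullet> v"
  note jd = theta(5)[OF j]
  note FG = Lam_Gr[OF F j]
  note P = Phi_pW[OF FG B]
  have Ac: "A n \<in> carrier_mat d d" for n using rank_one_limitD(1)[OF R] .
  have m: "Phi d j (B * A n) *\<^sub>v v = Phi d j B *\<^sub>v (Phi d j (A n) *\<^sub>v v)" for n
    unfolding Phi_mult[OF jd B(1) Ac] by (rule assoc_mult_mat_vec[OF Phi_carrier Phi_carrier v])
  have Av: "Phi d j (A n) *\<^sub>v v \<in> carrier_vec ?n" for n using mult_mat_vec_carrier[OF Phi_carrier v] .
  have BAv: "Phi d j (B * A n) *\<^sub>v v \<in> carrier_vec ?n" for n using mult_mat_vec_carrier[OF Phi_carrier v] .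
  have lim: "(\<lambda>n. (w \<bullet> (Phi d j (B * A n) *\<^sub>v v)) / c n j) \<longlonglongrightarrow> ?q * (w \<bullet> (Phi d j B *\<^sub>v pW d j (F j)))" if w: "w \<in> carrier_vec ?n" for w
  proof -
    have "transpose_mat (Phi d j B) *\<^sub>v w \<in> carrier_vec ?n" using w by (simp add: mult_mat_vec_carrier[of _ _ ?n])
    from rank_one_dot[OF R j v this] show ?thesis
      unfolding m transpose_dot[OF Phi_carrier Av w] transpose_dot[OF Phi_carrier pW_carrier(1) w] .
  qed
  let ?u = "unit_vec ?n x :: real vec"
  have ux: "?u \<bullet> z = z $ x" if "z \<in> carrier_vec ?n" for z using scalar_prod_left_unit[OF that x] by simp
  have uc: "?u \<in> carrier_vec ?n" by simp
  have "(\<lambda>n. ((?u \<bullet> (Phi d j (B * A n) *\<^sub>v v)) / c n j) / ((?e \<bullet> (Phi d j (B * A n) *\<^sub>v v)) / c n j)) \<longlonglongrightarrow>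
      (?q * (?u \<bullet> (Phi d j B *\<^sub>v pW d j (F j)))) / (?q * (?e \<bullet> (Phi d j B *\<^sub>v pW d j (F j))))"
    using P(1) nz by (intro tendsto_divide lim uc evec_carrier(1)) auto
  also have "(\<lambda>n. ((?u \<bullet> (Phi d j (B * A n) *\<^sub>v v)) / c n j) / ((?e \<bullet> (Phi d j (B * A n) *\<^sub>v v)) / c n j)) =
      (\<lambda>n. (Phi d j (B * A n) *\<^sub>v v) $ x / (?e \<bullet> (Phi d j (B * A n) *\<^sub>v v)))"
  proof
    fix n
    have "c n j \<noteq> 0" using rank_one_limitD(3)[OF R j, of n] by simp
    then show "((?u \<bullet> (Phi d j (B * A n) *\<^sub>v v)) / c n j) / ((?e \<bullet> (Phi d j (B * A n) *\<^sub>v v)) / c n j) =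
      (Phi d j (B * A n) *\<^sub>v v) $ x / (?e \<bullet> (Phi d j (B * A n) *\<^sub>v v))" unfolding ux[OF BAv] by simp
  qed
  also have "(?q * (?u \<bullet> (Phi d j B *\<^sub>v pW d j (F j)))) / (?q * (?e \<bullet> (Phi d j B *\<^sub>v pW d j (F j)))) = pW d j (mat_image B (F j)) $ x"
  proof -
    let ?l = "?e \<bullet> (Phi d j B *\<^sub>v pW d j (F j))"
    have "?u \<bullet> (Phi d j B *\<^sub>v pW d j (F j)) = ?l * pW d j (mat_image B (F j)) $ x"
    proof -
      have "?u \<bullet> (Phi d j B *\<^sub>v pW d j (F j)) = (Phi d j B *\<^sub>v pW d j (F j)) $ x"
        by (rule ux[OF mult_mat_vec_carrier[OF Phi_carrier pW_carrier(1)]])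
      also have "\<dots> = (?l \<cdot>\<^sub>v pW d j (mat_image B (F j))) $ x" by (rule arg_cong[OF P(2)])
      finally show ?thesis using x by simp
    qed
    then show ?thesis using P(1) nz by simp
  qed
  finally show ?thesis .
qed

lemma rank_one_direction_one:
  assumes R: "rank_one_limit A c F G" and F: "F \<in> Lam" and j: "j \<in> \<theta>"
    and v: "v \<in> carrier_vec (rdim d j)" and nz: "qW d j (G (d - j)) \<bullet> v \<noteq> 0" and x: "x < rdim d j"
  shows "(\<lambda>n. (Phi d j (A n) *\<^sub>v v) $ x / (evec (nks d j) \<bullet> (Phi d j (A n) *\<^sub>v v))) \<longlonglongrightarrow> pW d j (F j) $ x"
proof -
  have i: "(\<lambda>w. 1\<^sub>m d *\<^sub>v w) ` F j = F j" using Gr_closed(1)[OF Lam_Gr[OF F j]] by (force simp: image_iff)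
  have "1\<^sub>m d * A n = A n" for n using rank_one_limitD(1)[OF R] by (rule left_mult_one_mat)
  then show ?thesis using rank_one_direction[OF R F j one_carrier_mat _ v nz x] unfolding i by simp
qed

text \<open>Transversality of \<open>E\<close> to the repelling flag says that no Pluecker form of
  \<open>E\<close> lies in the kernel of the limit, so each is attracted to that of
  \<open>F\<close>.\<close>

theorem rank_one_flag:
  assumes R: "rank_one_limit A c F G" and F: "F \<in> Lam" and G: "G \<in> Lam" and E: "E \<in> flags d \<theta>" "transverse_flags d \<theta> E G"
  shows "flag_lim d \<theta> (\<lambda>n. flag_act \<theta> (pcl d (A n)) E) F"
  unfolding limitin_flag
proof (intro conjI Lam_flags[OF F] always_eventually allI ballI)
  note A = rank_one_limitD(1,2)[OF R]
  show "flag_act \<theta> (pcl d (A n)) E \<in> flags d \<theta>" for n by (rule flag_act_flags(1)[OF A E(1)])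
  fix j assume j: "j \<in> \<theta>"
  have EG: "E j \<in> Gr d j" using E(1) j by (simp add: flags_def)
  have nz: "qW d j (G (d - j)) \<bullet> pW d j (E j) \<noteq> 0"
    using transverse_iff[OF EG Lam_Gr[OF G theta(6)[OF j]]] E(2) j comm_scalar_prod[OF qW_carrier(1)[of d j "G (d - j)"] pW_carrier(1)[of d j "E j"]]
    by (simp add: transverse_flags_def)
  have I: "(\<lambda>w. A n *\<^sub>v w) ` E j \<in> Gr d j" for n by (rule Gr_image[OF EG A])
  have "pW d j ((\<lambda>w. A n *\<^sub>v w) ` E j) $ y = (Phi d j (A n) *\<^sub>v pW d j (E j)) $ y / (evec (nks d j) \<bullet> (Phi d j (A n) *\<^sub>v pW d j (E j)))"
    if y: "y < rdim d j" for n y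
    by (rule pW_image_index[OF EG A y])
  then show "Gr_lim d j (\<lambda>n. flag_act \<theta> (pcl d (A n)) E j) (F j)"
    unfolding flag_act_flags(2)[OF A E(1) j] limitin_Gr_iff[where V = "\<lambda>n. (\<lambda>w. A n *\<^sub>v w) ` E j", OF I Lam_Gr[OF F j]]
    using rank_one_direction_one[OF R F j pW_carrier(1) nz] by simp
qed

lemma evec_direction_scale:
  assumes "A \<in> carrier_mat d d" "a \<noteq> 0" "j \<in> \<theta>" "v \<in> carrier_vec (rdim d j)" "x < rdim d j"
  shows "(Phi d j (a \<cdot>\<^sub>m A) *\<^sub>v v) $ x / (evec (nks d j) \<bullet> (Phi d j (a \<cdot>\<^sub>m A) *\<^sub>v v)) =
    (Phi d j A *\<^sub>v v) $ x / (evec (nks d j) \<bullet> (Phi d j A *\<^sub>v v))"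
proof -
  have "Phi d j (a \<cdot>\<^sub>m A) *\<^sub>v v = norm a ^ (2 * j) \<cdot>\<^sub>v (Phi d j A *\<^sub>v v)"
    unfolding Phi_smult[OF theta(5)[OF assms(3)] assms(1)] by (rule smult_mat_vec[OF Phi_carrier assms(4)])
  moreover define t where "t = norm a ^ (2 * j)"
  ultimately have e: "Phi d j (a \<cdot>\<^sub>m A) *\<^sub>v v = t \<cdot>\<^sub>v (Phi d j A *\<^sub>v v)" by simp
  have t: "t \<noteq> 0" using assms(2) by (simp add: t_def)
  have Pc: "Phi d j A *\<^sub>v v \<in> carrier_vec (rdim d j)" using mult_mat_vec_carrier[OF Phi_carrier assms(4)] .
  have "(t \<cdot>\<^sub>v (Phi d j A *\<^sub>v v)) $ x = t * (Phi d j A *\<^sub>v v) $ x" using Pc assms(5) by simp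
  moreover have "evec (nks d j) \<bullet> (t \<cdot>\<^sub>v (Phi d j A *\<^sub>v v)) = t * (evec (nks d j) \<bullet> (Phi d j A *\<^sub>v v))"
    using Pc evec_carrier(1) by simp
  ultimately show ?thesis unfolding e using t by simp
qed

lemma Lam_dynamics:
  assumes F: "F \<in> Lam"
  shows "\<exists>\<gamma> A c G. inj (\<gamma> :: nat \<Rightarrow> _) \<and> (\<forall>n. \<gamma> n \<in> \<Gamma> \<and> \<gamma> n = pcl d (A n)) \<and> G \<in> Lam \<and> rank_one_limit A c F G"
proof -
  obtain \<gamma> :: "nat \<Rightarrow> 'a mat set" where \<gamma>: "inj \<gamma>" "range \<gamma> \<subseteq> \<Gamma>" "flag_lim d \<theta> (\<lambda>n. Uflag d \<theta> (\<gamma> n)) F"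
    using F unfolding Lam_Uflag by blast
  have \<gamma>G: "\<gamma> n \<in> \<Gamma>" for n using \<gamma>(2) by blast
  obtain r A c F1 G1 where 1: "subsequence r" "F1 \<in> Lam" "G1 \<in> Lam" "rank_one_limit A c F1 G1" "\<forall>n. \<gamma> (r n) = pcl d (A n)"
    "flag_lim d \<theta> (\<lambda>n. Uflag d \<theta> (\<gamma> (r n))) F1"
    using dynamics[OF \<gamma>(1) \<gamma>G] by (elim exE conjE) (rule that; assumption)
  have F1: "F1 = F" by (rule limitin_flag_unique[OF 1(6) limitin_subseq[OF \<gamma>(3) 1(1)] theta(5)])
  have "inj (\<lambda>n. \<gamma> (r n))" using inj_compose[OF \<gamma>(1) strict_mono_imp_inj_on[OF 1(1)]] by (simp add: o_def)
  then show ?thesis using 1(3-5) \<gamma>G unfolding F1 by blast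
qed

text \<open>The planes \<open>U_sub\<close> are not equivariant, so the limit for the translated
  sequence g \<gamma>(n) is found indirectly: \<open>dynamics\<close> gives it some limit flag F2,
  and the image directions of the identity form converge to F2 as well as to the translate of
  F.\<close>

theorem Lam_act:
  assumes F: "F \<in> Lam" and g: "g \<in> \<Gamma>"
  shows "flag_act \<theta> g F \<in> Lam"
proof -
  obtain B where B: "B \<in> carrier_mat d d" "det B \<noteq> 0" "g = pcl d B" using Gamma_lift[OF g] by blast
  obtain \<gamma> A c G1 where 1: "inj (\<gamma> :: nat \<Rightarrow> _)" "\<forall>n. \<gamma> n \<in> \<Gamma> \<and> \<gamma> n = pcl d (A n)" "G1 \<in> Lam" "rank_one_limit A c F G1"
    using Lam_dynamics[OF F] by (elim exE conjE) (rule that; assumption)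
  have \<gamma>G: "\<gamma> n \<in> \<Gamma>" "\<gamma> n = pcl d (A n)" for n using 1(2) by blast+
  let ?\<delta> = "\<lambda>n. g \<otimes>\<^bsub>PGL d\<^esub> \<gamma> n"
  have \<delta>G: "?\<delta> n \<in> \<Gamma>" for n by (rule Gamma(4)[OF g \<gamma>G(1)])
  have "?\<delta> m = ?\<delta> n \<longleftrightarrow> \<gamma> m = \<gamma> n" for m n
  proof (rule monoid.Units_l_cancel[OF group.is_monoid[OF group_PGL]])
    show "g \<in> Units (PGL d)" unfolding group.Units_eq[OF group_PGL] by (rule Gamma(2)[OF g])
    show "\<gamma> m \<in> carrier (PGL d)" "\<gamma> n \<in> carrier (PGL d)" by (rule Gamma(2)[OF \<gamma>G(1)])+
  qed
  then have "inj ?\<delta>" using 1(1) by (simp add: inj_on_def)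
  from dynamics[OF this \<delta>G]
  obtain r' A' c' F2 G2 where 2: "subsequence r'" "F2 \<in> Lam" "G2 \<in> Lam" "rank_one_limit A' c' F2 G2" "\<forall>n. ?\<delta> (r' n) = pcl d (A' n)"
    by (elim exE conjE) (rule that; assumption)
  note Ac = rank_one_limitD(1,2)[OF 1(4)] and Ac' = rank_one_limitD(1,2)[OF 2(4)]
  have gF: "flag_act \<theta> g F \<in> flags d \<theta>" "j \<in> \<theta> \<Longrightarrow> flag_act \<theta> g F j = mat_image B (F j)" for j
    unfolding B(3) by (rule flag_act_flags[OF B(1,2) Lam_flags[OF F]], rule flag_act_flags(2)[OF B(1,2) Lam_flags[OF F]])
  have "F2 j = flag_act \<theta> g F j" if j: "j \<in> \<theta>" for j
  proof -
    let ?e = "evec (nks d j)"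
    have e: "?e \<in> carrier_vec (rdim d j)" by simp
    have "pW d j (F2 j) = pW d j (mat_image B (F j))"
    proof (rule eq_vecI)
      fix x assume "x < dim_vec (pW d j (mat_image B (F j)))"
      then have x: "x < rdim d j" by simp
      have "(\<lambda>n. (Phi d j (A' n) *\<^sub>v ?e) $ x / (?e \<bullet> (Phi d j (A' n) *\<^sub>v ?e))) \<longlonglongrightarrow> pW d j (F2 j) $ x"
        by (rule rank_one_direction_one[OF 2(4,2) j e _ x]) (simp add: qW_Lam_pos[OF 2(3) j])
      moreover have "(\<lambda>n. (Phi d j (B * A n) *\<^sub>v ?e) $ x / (?e \<bullet> (Phi d j (B * A n) *\<^sub>v ?e))) \<longlonglongrightarrow> pW d j (mat_image B (F j)) $ x"
        using rank_one_direction[OF 1(4) F j B(1,2) e _ x] qW_Lam_pos[OF 1(3) j] by simp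
      then have "(\<lambda>n. (Phi d j (B * A (r' n)) *\<^sub>v ?e) $ x / (?e \<bullet> (Phi d j (B * A (r' n)) *\<^sub>v ?e))) \<longlonglongrightarrow> pW d j (mat_image B (F j)) $ x"
        using LIMSEQ_subseq_LIMSEQ[OF _ 2(1)] by (force simp: o_def)
      moreover have "(Phi d j (A' n) *\<^sub>v ?e) $ x / (?e \<bullet> (Phi d j (A' n) *\<^sub>v ?e)) = (Phi d j (B * A (r' n)) *\<^sub>v ?e) $ x / (?e \<bullet> (Phi d j (B * A (r' n)) *\<^sub>v ?e))" for n
      proof -
        have BA: "B * A (r' n) \<in> carrier_mat d d" using B(1) Ac(1) by (simp add: mult_carrier_mat[of _ d d])
        have "pcl d (B * A (r' n)) = pcl d (A' n)"
          unfolding 2(5)[rule_format, symmetric] \<gamma>G(2) B(3) by (rule PGL_mult[OF B(1,2) Ac, symmetric])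
        then obtain a where a: "a \<noteq> 0" "A' n = a \<cdot>\<^sub>m (B * A (r' n))" unfolding pcl_eq_iff[OF BA Ac'(1)] by blast
        show ?thesis unfolding a(2) by (rule evec_direction_scale[OF BA a(1) j e x])
      qed
      ultimately show "pW d j (F2 j) $ x = pW d j (mat_image B (F j)) $ x" by (simp add: LIMSEQ_unique)
    qed simp
    then show ?thesis unfolding gF(2)[OF j] by (rule pW_injective[OF Lam_Gr[OF 2(2) j] Gr_image[OF Lam_Gr[OF F j] B(1,2)]])
  qed
  then have "F2 = flag_act \<theta> g F"
    using Lam_flags[OF 2(2)] gF(1) by (intro extensionalityI[of _ \<theta>]) (auto simp: flags_def)
  then show ?thesis using 2(2) by simp
qed

text \<open>Approximate F(n) up to 1 / (n + 1) by the flag of a group element f(n). Infinitely many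
  elements qualify for each n, so the f(n) can be pairwise distinct, and \<open>dynamics\<close>
  makes their flags converge along a subsequence to an element of \<open>Lam\<close>.\<close>

theorem Lam_seq_compact:
  assumes F: "\<And>n. F n \<in> Lam"
  shows "\<exists>r G. subsequence r \<and> G \<in> Lam \<and> flag_lim d \<theta> (\<lambda>n. F (r n)) G"
proof -
  let ?S = "\<lambda>n. {g \<in> \<Gamma>. Uflag d \<theta> g \<in> flags d \<theta> \<and>
    (\<forall>j\<in>\<theta>. \<forall>y\<in>{0..<rdim d j}. \<bar>pW d j (Uflag d \<theta> g j) $ y - pW d j (F n j) $ y\<bar> < 1 / real (Suc n))}"
  have "infinite (?S n)" for n
  proof -
    obtain \<gamma> :: "nat \<Rightarrow> 'a mat set" where \<gamma>: "inj \<gamma>" "range \<gamma> \<subseteq> \<Gamma>" "flag_lim d \<theta> (\<lambda>m. Uflag d \<theta> (\<gamma> m)) (F n)"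
      using F[of n] unfolding Lam_Uflag by blast
    have ev: "\<forall>\<^sub>F m in sequentially. \<forall>j\<in>\<theta>. \<forall>y\<in>{0..<rdim d j}. \<bar>pW d j (Uflag d \<theta> (\<gamma> m) j) $ y - pW d j (F n j) $ y\<bar> < 1 / real (Suc n)"
    proof (intro eventually_ball_finite theta(2) finite_atLeastLessThan ballI)
      fix j y assume j: "j \<in> \<theta>" and y: "y \<in> {0..<rdim d j}"
      have "Gr_lim d j (\<lambda>m. Uflag d \<theta> (\<gamma> m) j) (F n j)" using \<gamma>(3) j by (simp add: limitin_flag)
      then have "(\<lambda>m. pW d j (Uflag d \<theta> (\<gamma> m) j) $ y) \<longlonglongrightarrow> pW d j (F n j) $ y"
        by (rule limitin_Gr_imp_pW[OF _ theta(5)[OF j]]) (use y in simp)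
      from tendstoD[OF this, of "1 / real (Suc n)"]
      show "\<forall>\<^sub>F m in sequentially. \<bar>pW d j (Uflag d \<theta> (\<gamma> m) j) $ y - pW d j (F n j) $ y\<bar> < 1 / real (Suc n)" by (simp add: dist_real_def)
    qed
    have "\<forall>\<^sub>F m in sequentially. Uflag d \<theta> (\<gamma> m) \<in> flags d \<theta>" using \<gamma>(3) by (simp add: limitin_flag)
    from eventually_conj[OF this ev]
    obtain N where N: "\<And>m. N \<le> m \<Longrightarrow> \<gamma> m \<in> ?S n" unfolding eventually_sequentially using \<gamma>(2) by blast
    have "infinite (\<gamma> ` {N..})" using \<gamma>(1) by (simp add: finite_image_iff inj_on_subset infinite_Ici)
    moreover have "\<gamma> ` {N..} \<subseteq> ?S n" using N by blast
    ultimately show ?thesis using finite_subset by blast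
  qed
  then obtain f where f: "inj f" "\<And>n. f n \<in> ?S n" using infinite_sets_choice[of ?S] by blast
  have f\<Gamma>: "f n \<in> \<Gamma>" for n using f(2)[of n] by auto
  obtain r A c G G' where r: "subsequence r" "G \<in> Lam" "G' \<in> Lam" "rank_one_limit A c G G'"
    "\<forall>n. f (r n) = pcl d (A n)" "flag_lim d \<theta> (\<lambda>n. Uflag d \<theta> (f (r n))) G"
    using dynamics[OF f(1) f\<Gamma>] by (elim exE conjE) (rule that; assumption)
  have "flag_lim d \<theta> (\<lambda>n. F (r n)) G"
    unfolding limitin_flag
  proof (intro conjI Lam_flags[OF r(2)] Lam_flags[OF F] always_eventually allI ballI)
    fix j assume j: "j \<in> \<theta>"
    have "(\<lambda>n. pW d j (F (r n) j) $ y) \<longlonglongrightarrow> pW d j (G j) $ y" if y: "y < rdim d j" for y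
    proof -
      have "Gr_lim d j (\<lambda>m. Uflag d \<theta> (f (r m)) j) (G j)" using r(6) j by (simp add: limitin_flag)
      then have 1: "(\<lambda>m. pW d j (Uflag d \<theta> (f (r m)) j) $ y) \<longlonglongrightarrow> pW d j (G j) $ y"
        by (rule limitin_Gr_imp_pW[OF _ theta(5)[OF j] y])
      have "(\<lambda>n. pW d j (Uflag d \<theta> (f n) j) $ y - pW d j (F n j) $ y) \<longlonglongrightarrow> 0"
      proof (rule LIMSEQ_inverse_Suc)
        show "\<bar>pW d j (Uflag d \<theta> (f n) j) $ y - pW d j (F n j) $ y - 0\<bar> \<le> 1 / real (Suc n)" for n
          using f(2)[of n] j y by (intro less_imp_le) simp
      qed
      from tendsto_diff[OF 1 LIMSEQ_subseq_LIMSEQ[OF this r(1)]] show ?thesis by (simp add: o_def)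
    qed
    then show "Gr_lim d j (\<lambda>n. F (r n) j) (G j)"
      unfolding limitin_Gr_iff[where V = "\<lambda>n. F (r n) j", OF Lam_Gr[OF F j] Lam_Gr[OF r(2) j]] by blast
  qed
  then show ?thesis using r(1,2) by blast
qed

end

section \<open>Positivity of perturbed traces and the normalised functionals\<close>

lemma subseq_of_union:
  assumes "\<And>t :: nat. Y t \<in> A \<or> Y t \<in> B"
  shows "\<exists>r. subsequence r \<and> ((\<forall>t. Y (r t) \<in> A) \<or> (\<forall>t. Y (r t) \<in> B))"
proof (cases "\<forall>\<^sub>F t in sequentially. Y t \<notin> A")
  case True
  then obtain N where "\<And>t. N \<le> t \<Longrightarrow> Y t \<notin> A" unfolding eventually_sequentially by blast
  then have "Y (t + N) \<in> B" for t using assms[of "t + N"] by simp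
  then show ?thesis by (intro exI[of _ "\<lambda>t. t + N"]) (simp add: strict_mono_def)
next
  case False
  from not_eventually_subseq[OF this] show ?thesis by blast
qed

lemma det_nz_vec:
  assumes "M \<in> carrier_mat n n" "det M \<noteq> (0 :: 'a :: field)" "v \<in> carrier_vec n" "v \<noteq> 0\<^sub>v n"
  shows "M *\<^sub>v v \<noteq> 0\<^sub>v n"
proof
  assume z: "M *\<^sub>v v = 0\<^sub>v n"
  obtain B where B: "B \<in> carrier_mat n n" "B * M = 1\<^sub>m n" using det_inverse[OF assms(1,2)] by blast
  have "v = (B * M) *\<^sub>v v" unfolding B(2) using assms(3) by simp
  also have "\<dots> = B *\<^sub>v (M *\<^sub>v v)" by (rule assoc_mult_mat_vec[OF B(1) assms(1,3)])
  also have "\<dots> = 0\<^sub>v n" unfolding z using B(1) by (intro eq_vecI) auto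
  finally show False using assms(4) by simp
qed

lemma act_line:
  assumes "M \<in> carrier_mat n n" "v \<in> carrier_vec n" "v \<noteq> 0\<^sub>v n"
  shows "act (pcl n M) (line v) = line (M *\<^sub>v v)"
proof -
  have "M *\<^sub>v (c \<cdot>\<^sub>v v) = c \<cdot>\<^sub>v (M *\<^sub>v v)" for c using assms(1,2) by (rule mult_mat_vec)
  then have "c \<cdot>\<^sub>v (M *\<^sub>v v) \<in> (\<lambda>w. M *\<^sub>v w) ` line v" "M *\<^sub>v (c \<cdot>\<^sub>v v) \<in> line (M *\<^sub>v v)" for c
    unfolding line_def by (auto intro!: image_eqI[of _ _ "c \<cdot>\<^sub>v v"])
  then show ?thesis
    unfolding act_Gr[OF assms(1) line_Gr[OF assms(2,3)]]
    by (intro equalityI subsetI) (auto simp: line_def[of v] line_def[of "M *\<^sub>v v"])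
qed

text \<open>All \<open>pv d k B\<close> have coordinates bounded by twice their trace, so a perturbation of the trace by
  \<open>1/4\<close> of a coordinate stays positive on them, while positivity of all these perturbations bounds every
  coordinate of a vector by four times its trace.\<close>

definition kaps :: "nat \<Rightarrow> nat \<Rightarrow> real vec set" where
  "kaps d k = (\<lambda>(a, t). evec (nks d k) + t \<cdot>\<^sub>v unit_vec (rdim d k) a) ` ({0..<rdim d k} \<times> {1 / 4, - (1 / 4)})"

lemma kaps_finite: "finite (kaps d k)"
  by (simp add: kaps_def)

lemma kaps_carrier: "x \<in> kaps d k \<Longrightarrow> x \<in> carrier_vec (rdim d k)"
  by (auto simp: kaps_def)

lemma kaps_dot:
  assumes "a < rdim d k" "v \<in> carrier_vec (rdim d k)"
  shows "(evec (nks d k) + t \<cdot>\<^sub>v unit_vec (rdim d k) a) \<bullet> v = evec (nks d k) \<bullet> v + t * v $ a"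
proof -
  have "unit_vec (rdim d k) a \<bullet> v = v $ a" using assms by simp
  then show ?thesis using assms add_scalar_prod_distrib[OF evec_carrier(1) _ assms(2), of "t \<cdot>\<^sub>v unit_vec (rdim d k) a"] by simp
qed

lemma kaps_lower:
  assumes x: "x \<in> kaps d k" and v: "v \<in> carrier_vec (rdim d k)" "\<And>a. a < rdim d k \<Longrightarrow> \<bar>v $ a\<bar> \<le> 2 * (evec (nks d k) \<bullet> v)"
  shows "(evec (nks d k) \<bullet> v) / 2 \<le> x \<bullet> v"
proof -
  obtain a t where at: "a < rdim d k" "t = 1 / 4 \<or> t = - (1 / 4)" "x = evec (nks d k) + t \<cdot>\<^sub>v unit_vec (rdim d k) a"
  proof -
    obtain z where z: "z \<in> {0..<rdim d k} \<times> {1 / 4, - (1 / 4)}" "x = (\<lambda>(a, t). evec (nks d k) + t \<cdot>\<^sub>v unit_vec (rdim d k) a) z"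
      using x unfolding kaps_def by blast
    show ?thesis by (rule that[of "fst z" "snd z"]) (use z in auto)
  qed
  have b: "v $ a \<le> 2 * (evec (nks d k) \<bullet> v)" "- (v $ a) \<le> 2 * (evec (nks d k) \<bullet> v)"
    using v(2)[OF at(1)] by linarith+
  from at(2) show ?thesis
  proof
    assume t: "t = 1 / 4"
    show ?thesis unfolding at(3) kaps_dot[OF at(1) v(1)] t using b by linarith
  next
    assume t: "t = - (1 / 4)"
    show ?thesis unfolding at(3) kaps_dot[OF at(1) v(1)] t using b by linarith
  qed
qed

lemma kaps_pW:
  assumes x: "x \<in> kaps d k" and W: "W \<in> Gr d k"
  shows "0 < x \<bullet> pW d k W"
proof -
  have "(evec (nks d k) \<bullet> pW d k W) / 2 \<le> x \<bullet> pW d k W"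
    by (rule kaps_lower[OF x]) (auto simp: pW_def intro: pv_le)
  then show ?thesis unfolding evec_pW[OF W] by simp
qed

text \<open>The image of the identity form is a sum of Pluecker forms, and the bound of
  \<open>pv_le\<close> is additive.\<close>

lemma Phi_evec_bound:
  assumes k: "k \<le> d" and x: "x < rdim d k"
  shows "\<bar>(Phi d k A *\<^sub>v evec (nks d k)) $ x\<bar> \<le> 2 * (evec (nks d k) \<bullet> (Phi d k A *\<^sub>v evec (nks d k)))"
proof -
  let ?u = "unit_vec (rdim d k) x :: real vec" and ?e = "evec (nks d k)"
  have u: "?u \<in> carrier_vec (rdim d k)" by simp
  have ux: "?u \<bullet> z = z $ x" if "z \<in> carrier_vec (rdim d k)" for z using that x by simp
  have "(Phi d k A *\<^sub>v ?e) $ x = ?u \<bullet> (Phi d k A *\<^sub>v ?e)"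
    by (rule ux[OF mult_mat_vec_carrier[OF Phi_carrier evec_carrier(1)], symmetric])
  also have "\<dots> = (\<Sum>m=0..<nks d k. pv d k (colsel d k m A) $ x)"
    unfolding Phi_evec_dot[OF k u] ux[OF pv_carrier(1)] ..
  also have "\<bar>\<dots>\<bar> \<le> (\<Sum>m=0..<nks d k. 2 * (?e \<bullet> pv d k (colsel d k m A)))"
    by (rule order_trans[OF sum_abs], rule sum_mono, rule pv_le[OF x])
  also have "\<dots> = 2 * (?e \<bullet> (Phi d k A *\<^sub>v ?e))"
    unfolding Phi_evec_dot[OF k evec_carrier(1)] sum_distrib_left ..
  finally show ?thesis .
qed

lemma evec_nonzero:
  assumes "k \<le> d"
  shows "evec (nks d k) \<noteq> 0\<^sub>v (rdim d k)"
proof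
  assume z: "evec (nks d k) = 0\<^sub>v (rdim d k)"
  have "evec (nks d k) \<bullet> pW d k (cs k (1\<^sub>m d :: real mat)) = 1" by (rule evec_pW[OF unitary_Gr[OF unitary_one assms]])
  then show False unfolding z by simp
qed

text \<open>If the trace were not positive, \<open>Phi_evec_bound\<close> would make every
  coordinate zero, but \<open>Phi d k A\<close> is invertible.\<close>

lemma Phi_evec_pos:
  assumes k: "k \<le> d" and A: "A \<in> carrier_mat d d" "det A \<noteq> 0"
  shows "0 < evec (nks d k) \<bullet> (Phi d k A *\<^sub>v evec (nks d k))"
proof (rule ccontr)
  let ?e = "evec (nks d k)" and ?n = "rdim d k"
  assume "\<not> 0 < ?e \<bullet> (Phi d k A *\<^sub>v ?e)"
  then have z: "(Phi d k A *\<^sub>v ?e) $ x = 0" if "x < ?n" for x using Phi_evec_bound[OF k that, of A] by linarith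
  have "Phi d k A *\<^sub>v ?e = 0\<^sub>v ?n"
  proof (rule eq_vecI)
    fix x assume "x < dim_vec (0\<^sub>v ?n :: real vec)"
    then show "(Phi d k A *\<^sub>v ?e) $ x = 0\<^sub>v ?n $ x" using z[of x] by simp
  qed simp
  then show False using det_nz_vec[OF Phi_carrier Phi_det[OF k A] evec_carrier(1) evec_nonzero[OF k]] by blast
qed

lemma kaps_Phi_evec:
  assumes k: "k \<le> d" and A: "A \<in> carrier_mat d d" "det A \<noteq> 0" and x: "x \<in> kaps d k"
  shows "0 < x \<bullet> (Phi d k A *\<^sub>v evec (nks d k))"
proof -
  have "(evec (nks d k) \<bullet> (Phi d k A *\<^sub>v evec (nks d k))) / 2 \<le> x \<bullet> (Phi d k A *\<^sub>v evec (nks d k))"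
    by (rule kaps_lower[OF x mult_mat_vec_carrier[OF Phi_carrier evec_carrier(1)] Phi_evec_bound[OF k]])
  then show ?thesis using Phi_evec_pos[OF k A] by linarith
qed

text \<open>The scaling gives the value 1 at the identity form. It makes the functional independent
  of the lift and keeps sequences of them from degenerating.\<close>

definition functional :: "nat \<Rightarrow> nat \<Rightarrow> ('a :: rc_field) mat \<Rightarrow> real vec \<Rightarrow> real vec" where
  "functional d k A x = (1 / (x \<bullet> (Phi d k A *\<^sub>v evec (nks d k)))) \<cdot>\<^sub>v (transpose_mat (Phi d k A) *\<^sub>v x)"

lemma functional_carrier: "x \<in> carrier_vec (rdim d k) \<Longrightarrow> functional d k A x \<in> carrier_vec (rdim d k)"
  by (simp add: functional_def mult_mat_vec_carrier[of _ _ "rdim d k"])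

lemma functional_dot:
  assumes "x \<in> carrier_vec (rdim d k)" "v \<in> carrier_vec (rdim d k)"
  shows "functional d k A x \<bullet> v = (x \<bullet> (Phi d k A *\<^sub>v v)) / (x \<bullet> (Phi d k A *\<^sub>v evec (nks d k)))"
proof -
  have c: "transpose_mat (Phi d k A) *\<^sub>v x \<in> carrier_vec (rdim d k)" using assms(1) by (simp add: mult_mat_vec_carrier[of _ _ "rdim d k"])
  show ?thesis
    unfolding functional_def smult_scalar_prod_distrib[OF c assms(2)] transpose_dot[OF Phi_carrier assms(2,1)] by simp
qed

lemma functional_smult:
  assumes k: "k \<le> d" and A: "(A :: 'a :: rc_field mat) \<in> carrier_mat d d" and a: "a \<noteq> 0" and x: "x \<in> carrier_vec (rdim d k)"
  shows "functional d k (a \<cdot>\<^sub>m A) x = functional d k A x"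
proof -
  define t where "t = norm a ^ (2 * k)"
  have t: "t \<noteq> 0" using a by (simp add: t_def)
  have P: "Phi d k (a \<cdot>\<^sub>m A) = t \<cdot>\<^sub>m Phi d k A" unfolding t_def by (rule Phi_smult[OF k A])
  let ?T = "transpose_mat (Phi d k A)"
  have Tc: "?T \<in> carrier_mat (rdim d k) (rdim d k)" by simp
  have T: "transpose_mat (t \<cdot>\<^sub>m Phi d k A) = t \<cdot>\<^sub>m ?T" by (rule eq_matI) auto
  have ec: "Phi d k A *\<^sub>v evec (nks d k) \<in> carrier_vec (rdim d k)" by (rule mult_mat_vec_carrier[OF Phi_carrier evec_carrier(1)])
  show ?thesis
    unfolding functional_def P T smult_mat_vec[OF Phi_carrier evec_carrier(1)] smult_mat_vec[OF Tc x]
      scalar_prod_smult_distrib[OF x ec] smult_smult_assoc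
    using t by simp
qed

section \<open>The invariant domain of a transverse group\<close>

locale transverse_k = transverse d \<theta> \<Gamma> for d \<theta> and \<Gamma> :: "('a :: rc_field) mat set set" +
  fixes k :: nat
  assumes k_theta: "k \<in> \<theta>" and k_half: "k \<le> d - k"
begin

abbreviation R where "R \<equiv> rdim d k"
abbreviation e where "e \<equiv> evec (nks d k)"
abbreviation p :: "(nat \<Rightarrow> 'a vec set) \<Rightarrow> real vec" where "p F \<equiv> pW d k (F k)"
abbreviation q :: "(nat \<Rightarrow> 'a vec set) \<Rightarrow> real vec" where "q F \<equiv> qW d k (F (d - k))"

definition S :: "real vec set" where
  "S = {functional d k A x | A x. A \<in> carrier_mat d d \<and> det A \<noteq> 0 \<and> pcl d A \<in> \<Gamma> \<and> x \<in> kaps d k} \<union> q ` Lam"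

lemma k_bounds: "0 < k" "k < d" "k \<le> d" using theta(3,4,5)[OF k_theta] by auto

lemma p_eq_iff: "F \<in> Lam \<Longrightarrow> G \<in> Lam \<Longrightarrow> p F \<bullet> q G = 0 \<longleftrightarrow> F = G"
proof -
  assume F: "F \<in> Lam" and G: "G \<in> Lam"
  note t = transverse_iff[OF Lam_Gr[OF F k_theta] Lam_Gr[OF G theta(6)[OF k_theta]]]
  show ?thesis
  proof
    assume "p F \<bullet> q G = 0"
    then show "F = G" using t Lam_transverse[OF F G _ k_theta] by blast
  next
    assume e: "F = G"
    have "F k \<subseteq> F (d - k)" using Lam_flags[OF F] k_theta theta(6)[OF k_theta] k_half by (simp add: flags_def)
    moreover have "d - k < d" using k_bounds by simp
    ultimately have "\<not> transverse_subspaces d (F k) (F (d - k))"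
      using not_transverse_nested[OF _ Lam_Gr[OF F theta(6)[OF k_theta]]] by blast
    then show "p F \<bullet> q G = 0" using t e by blast
  qed
qed

lemma qp_eq_iff: "F \<in> Lam \<Longrightarrow> G \<in> Lam \<Longrightarrow> q G \<bullet> p F = 0 \<longleftrightarrow> F = G"
  using p_eq_iff comm_scalar_prod[OF qW_carrier(1)[of d k "G (d - k)"] pW_carrier(1)[of d k "F k"]] by simp

lemma qp_nonneg: "F \<in> Lam \<Longrightarrow> G \<in> Lam \<Longrightarrow> 0 \<le> q G \<bullet> p F"
  unfolding qW_def using pW_dot_nonneg[OF perp_Gr[OF Lam_Gr[OF _ theta(6)[OF k_theta]] k_bounds(3)] Lam_Gr[OF _ k_theta]] by simp

lemma S_functional:
  "A \<in> carrier_mat d d \<Longrightarrow> det A \<noteq> 0 \<Longrightarrow> pcl d A \<in> \<Gamma> \<Longrightarrow> x \<in> kaps d k \<Longrightarrow> functional d k A x \<in> S"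
  unfolding S_def by blast

lemma S_q: "F \<in> Lam \<Longrightarrow> q F \<in> S"
  unfolding S_def by blast

lemma S_cases:
  assumes "y \<in> S"
  obtains (lift) A x where "A \<in> carrier_mat d d" "det A \<noteq> 0" "pcl d A \<in> \<Gamma>" "x \<in> kaps d k" "y = functional d k A x"
    | (limit) F where "F \<in> Lam" "y = q F"
  using assms unfolding S_def by blast

text \<open>One unitary matrix describes both a (d - k)-plane, by its last columns, and the
  complement of that plane, by its first. Convergence of these matrices therefore transfers the
  limit of the flags to the functionals.\<close>

lemma q_seq_compact:
  assumes F: "\<And>t :: nat. F t \<in> Lam"
  shows "\<exists>r G. strict_mono r \<and> G \<in> Lam \<and> (\<forall>i<R. (\<lambda>t. q (F (r t)) $ i) \<longlonglongrightarrow> q G $ i)"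
proof -
  note kd = k_bounds(3)
  have "\<exists>M. unitary d (M :: 'a mat) \<and> F t (d - k) = cs (d - k) (revc M) \<and> perp d (F t (d - k)) = cs k M" for t
    by (rule Gr_codim_unitary[OF Lam_Gr[OF F theta(6)[OF k_theta]] kd])
  then obtain M :: "nat \<Rightarrow> 'a mat" where M: "\<And>t. unitary d (M t)" "\<And>t. F t (d - k) = cs (d - k) (revc (M t))" "\<And>t. perp d (F t (d - k)) = cs k (M t)"
    by metis
  obtain r G where r: "subsequence r" "G \<in> Lam" "flag_lim d \<theta> (\<lambda>n. F (r n)) G"
    using Lam_seq_compact[of F, OF F] by (elim exE conjE) (rule that)
  obtain M' r2 where r2: "subsequence r2" "unitary d M'" "mconv d d (\<lambda>n. M (r (r2 n))) M'"
    using unitary_convergent[of d "\<lambda>n. M (r n)", OF M(1)] by (elim exE conjE) (rule that)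
  have Mc: "M t \<in> carrier_mat d d" "M' \<in> carrier_mat d d" for t using unitaryD(1) M(1) r2(2) by auto
  have "Gr_lim d (d - k) (\<lambda>n. F (r (r2 n)) (d - k)) (cs (d - k) (revc M'))"
    unfolding M(2) by (rule limitin_Gr_unitary[OF diff_le_self revc_unitary[OF M(1)] revc_unitary[OF r2(2)] mconv_revc[OF r2(3) Mc]])
  moreover have "Gr_lim d (d - k) (\<lambda>n. F (r (r2 n)) (d - k)) (G (d - k))"
    using limitin_subseq[OF r(3) r2(1)] theta(6)[OF k_theta] by (simp add: limitin_flag)
  ultimately have "cs (d - k) (revc M') = G (d - k)" by (rule limitin_Gr_unique) simp
  then have G: "q G = pv d k (lcols k M')"
    using perp_revc[OF r2(2) kd] pW_unitary[OF kd r2(2)] by (simp add: qW_def)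
  have Fq: "q (F t) = pv d k (lcols k (M t))" for t unfolding qW_def M(3) by (rule pW_unitary[OF kd M(1)])
  have "(\<lambda>t. q (F (r (r2 t))) $ i) \<longlonglongrightarrow> q G $ i" if i: "i < R" for i
    unfolding G Fq
  proof (rule tendsto_pv[OF kd _ i])
    fix a b assume "a < d" "b < k"
    then show "(\<lambda>t. lcols k (M (r (r2 t))) $$ (a, b)) \<longlonglongrightarrow> lcols k M' $$ (a, b)"
      using mconv_lcols[OF r2(3) Mc kd] by (auto simp: mconv_def)
  qed
  moreover have "strict_mono (\<lambda>t. r (r2 t))" using r(1) r2(1) by (simp add: strict_mono_def)
  ultimately show ?thesis using r(2) by (intro exI[of _ "\<lambda>t. r (r2 t)"] exI[of _ G]) auto
qed

text \<open>If the classes are constant, so is the functional. If they are distinct, numerator and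
  denominator converge with the common factor x p(F), which is positive and cancels; the limit q(G)
  no longer depends on \<open>x\<close>.\<close>

lemma functional_seq_compact:
  assumes A: "\<And>t :: nat. A t \<in> carrier_mat d d" "\<And>t. det (A t) \<noteq> 0" "\<And>t. pcl d (A t) \<in> \<Gamma>" and x: "x \<in> kaps d k"
  shows "\<exists>r l. strict_mono r \<and> l \<in> S \<and> (\<forall>i<R. (\<lambda>t. functional d k (A (r t)) x $ i) \<longlonglongrightarrow> l $ i)"
proof -
  note kd = k_bounds(3)
  have xc: "x \<in> carrier_vec R" by (rule kaps_carrier[OF x])
  obtain r where r: "subsequence r" "(\<forall>n. pcl d (A (r n)) = pcl d (A (r 0))) \<or> inj (\<lambda>n. pcl d (A (r n)))"
    using const_or_inj_subseq[of "\<lambda>t. pcl d (A t)"] by blast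
  from r(2) show ?thesis
  proof
    assume c: "\<forall>n. pcl d (A (r n)) = pcl d (A (r 0))"
    define l where "l = functional d k (A (r 0)) x"
    have "functional d k (A (r n)) x = l" for n
    proof -
      obtain a where a: "a \<noteq> 0" "A (r n) = a \<cdot>\<^sub>m A (r 0)" using c[rule_format, of n] pcl_eq_iff[OF A(1,1), of "r 0" "r n"] by metis
      show ?thesis unfolding a(2) l_def by (rule functional_smult[OF kd A(1) a(1) xc])
    qed
    moreover have "l \<in> S" unfolding l_def by (rule S_functional[OF A x])
    ultimately show ?thesis using r(1) by (intro exI[of _ r] exI[of _ l]) simp
  next
    assume inj: "inj (\<lambda>n. pcl d (A (r n)))"
    obtain r' B c F G where D: "subsequence r'" "F \<in> Lam" "G \<in> Lam" "rank_one_limit B c F G" "\<forall>n. pcl d (A (r (r' n))) = pcl d (B n)"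
      using dynamics[OF inj A(3)] by (elim exE conjE) (rule that; assumption)
    note Bc = rank_one_limitD(1,2)[OF D(4)]
    have f: "functional d k (A (r (r' n))) x = functional d k (B n) x" for n
    proof -
      obtain a where a: "a \<noteq> 0" "A (r (r' n)) = a \<cdot>\<^sub>m B n" using D(5)[rule_format, of n] pcl_eq_iff[OF Bc(1) A(1), of n "r (r' n)"] by metis
      show ?thesis unfolding a(2) by (rule functional_smult[OF kd Bc(1) a(1) xc])
    qed
    have xp: "0 < x \<bullet> p F" by (rule kaps_pW[OF x Lam_Gr[OF D(2) k_theta]])
    have "(\<lambda>n. functional d k (B n) x $ i) \<longlonglongrightarrow> q G $ i" if i: "i < R" for i
    proof -
      let ?u = "unit_vec R i :: real vec"
      have u: "?u \<in> carrier_vec R" by simp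
      have yu: "y \<bullet> ?u = y $ i" if "y \<in> carrier_vec R" for y using that i by simp
      have l: "(\<lambda>n. ((x \<bullet> (Phi d k (B n) *\<^sub>v ?u)) / c n k) / ((x \<bullet> (Phi d k (B n) *\<^sub>v e)) / c n k)) \<longlonglongrightarrow>
          ((q G \<bullet> ?u) * (x \<bullet> p F)) / ((q G \<bullet> e) * (x \<bullet> p F))"
        using xp qW_Lam_pos[OF D(3) k_theta] by (intro tendsto_divide rank_one_dot[OF D(4) k_theta] u xc evec_carrier(1)) simp
      have "((x \<bullet> (Phi d k (B n) *\<^sub>v ?u)) / c n k) / ((x \<bullet> (Phi d k (B n) *\<^sub>v e)) / c n k) = functional d k (B n) x $ i" for n
      proof -
        have "c n k \<noteq> 0" using rank_one_limitD(3)[OF D(4) k_theta, of n] by simp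
        then show ?thesis
          unfolding yu[OF functional_carrier[OF xc], symmetric] functional_dot[OF xc u] by simp
      qed
      moreover have "((q G \<bullet> ?u) * (x \<bullet> p F)) / ((q G \<bullet> e) * (x \<bullet> p F)) = q G $ i"
        unfolding yu[OF qW_carrier(1)] qW_Lam_pos[OF D(3) k_theta] using xp by simp
      ultimately show ?thesis using l by simp
    qed
    moreover have "strict_mono (\<lambda>t. r (r' t))" using r(1) D(1) by (simp add: strict_mono_def)
    ultimately show ?thesis using S_q[OF D(3)] unfolding f[symmetric] by (intro exI[of _ "\<lambda>t. r (r' t)"] exI[of _ "q G"]) auto
  qed
qed

lemma S_seq_compact:
  assumes Y: "\<And>t :: nat. Y t \<in> S"
  shows "\<exists>r l. strict_mono r \<and> l \<in> S \<and> (\<forall>i<R. (\<lambda>t. Y (r t) $ i) \<longlonglongrightarrow> l $ i)"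
proof -
  let ?L = "{functional d k A x | A x. A \<in> carrier_mat d d \<and> det A \<noteq> 0 \<and> pcl d A \<in> \<Gamma> \<and> x \<in> kaps d k}"
  obtain r where r: "subsequence r" "(\<forall>t. Y (r t) \<in> ?L) \<or> (\<forall>t. Y (r t) \<in> q ` Lam)"
    using subseq_of_union[of Y ?L "q ` Lam"] Y unfolding S_def by blast
  from r(2) show ?thesis
  proof
    assume "\<forall>t. Y (r t) \<in> ?L"
    then have "\<forall>t. \<exists>A x. A \<in> carrier_mat d d \<and> det A \<noteq> 0 \<and> pcl d A \<in> \<Gamma> \<and> x \<in> kaps d k \<and> Y (r t) = functional d k A x" by blast
    then obtain A x where A: "\<And>t. A t \<in> carrier_mat d d" "\<And>t. det (A t) \<noteq> 0" "\<And>t. pcl d (A t) \<in> \<Gamma>" "\<And>t. x t \<in> kaps d k" "\<And>t. Y (r t) = functional d k (A t) (x t)"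
      by metis
    obtain r1 where r1: "subsequence r1" "(\<forall>n. x (r1 n) = x (r1 0)) \<or> inj (\<lambda>n. x (r1 n))"
      using const_or_inj_subseq[of x] by blast
    \<comment> \<open>\<open>kaps\<close> is finite, so the perturbation can be taken constant along
      the subsequence.\<close>
    have "\<not> inj (\<lambda>n. x (r1 n))"
    proof
      assume "inj (\<lambda>n. x (r1 n))"
      moreover have "finite (range (\<lambda>n. x (r1 n)))" by (rule finite_subset[OF _ kaps_finite[of d k]]) (use A(4) in auto)
      ultimately show False using finite_imageD infinite_UNIV_nat by blast
    qed
    then have c: "x (r1 n) = x (r1 0)" for n using r1(2) by blast
    obtain r2 l where r2: "subsequence r2" "l \<in> S" "\<forall>i<R. (\<lambda>t. functional d k (A (r1 (r2 t))) (x (r1 0)) $ i) \<longlonglongrightarrow> l $ i"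
      using functional_seq_compact[of "\<lambda>t. A (r1 t)", OF A(1,2,3) A(4)[of "r1 0"]] by (elim exE conjE) (rule that)
    have "Y (r (r1 (r2 t))) = functional d k (A (r1 (r2 t))) (x (r1 0))" for t unfolding A(5) c[of "r2 t"] ..
    moreover have "strict_mono (\<lambda>t. r (r1 (r2 t)))" using r(1) r1(1) r2(1) by (simp add: strict_mono_def)
    ultimately show ?thesis using r2(2,3) by (intro exI[of _ "\<lambda>t. r (r1 (r2 t))"] exI[of _ l]) simp
  next
    assume "\<forall>t. Y (r t) \<in> q ` Lam"
    then have "\<forall>t. \<exists>F. F \<in> Lam \<and> Y (r t) = q F" by blast
    then obtain F where F: "\<And>t. F t \<in> Lam" "\<And>t. Y (r t) = q (F t)" by metis
    obtain r1 G where r1: "subsequence r1" "G \<in> Lam" "\<forall>i<R. (\<lambda>t. q (F (r1 t)) $ i) \<longlonglongrightarrow> q G $ i"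
      using q_seq_compact[of F, OF F(1)] by (elim exE conjE) (rule that)
    have "strict_mono (\<lambda>t. r (r1 t))" using r(1) r1(1) by (simp add: strict_mono_def)
    then show ?thesis using S_q[OF r1(2)] r1(3) unfolding F(2)[symmetric] by (intro exI[of _ "\<lambda>t. r (r1 t)"] exI[of _ "q G"]) simp
  qed
qed

lemma one_lift: "1\<^sub>m d \<in> carrier_mat d d" "det (1\<^sub>m d :: 'a mat) \<noteq> 0" "pcl d (1\<^sub>m d) \<in> \<Gamma>"
  using Gamma(5) unfolding PGL_one by auto

lemma R2: "2 \<le> R"
proof -
  obtain i where "i < nks d k" "i \<noteq> 0" using sprod_second[OF k_bounds(2,1)] by blast
  then have n: "2 \<le> nks d k" by simp
  have "2 * 1 \<le> nks d k * nks d k" by (rule mult_le_mono) (use n in auto)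
  then show ?thesis by (simp add: rdim_def)
qed

text \<open>The identity of \<Gamma> contributes positive multiples of all elements of
  \<open>kaps\<close>. Positivity of the trace plus and minus 1/4 of coordinate i gives the constant
  4.\<close>

lemma positive_on_S:
  assumes v: "v \<in> carrier_vec R" "\<And>y. y \<in> S \<Longrightarrow> 0 < y \<bullet> v" and i: "i < R"
  shows "\<bar>v $ i\<bar> < 4 * (e \<bullet> v)"
proof -
  have "0 < x \<bullet> v" if x: "x \<in> kaps d k" for x
  proof -
    have "0 < functional d k (1\<^sub>m d :: 'a mat) x \<bullet> v" by (rule v(2)[OF S_functional[OF one_lift x]])
    then have "0 < (x \<bullet> v) / (x \<bullet> (Phi d k (1\<^sub>m d :: 'a mat) *\<^sub>v e))"
      unfolding functional_dot[OF kaps_carrier[OF x] v(1)] Phi_one[OF k_bounds(3)] using v(1) by simp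
    moreover have "0 < x \<bullet> (Phi d k (1\<^sub>m d :: 'a mat) *\<^sub>v e)" by (rule kaps_Phi_evec[OF k_bounds(3) one_lift(1,2) x])
    ultimately show ?thesis by (simp add: zero_less_divide_iff)
  qed
  moreover have "e + t \<cdot>\<^sub>v unit_vec R i \<in> kaps d k" if "t \<in> {1 / 4, - (1 / 4)}" for t
    unfolding kaps_def by (rule image_eqI[of _ _ "(i, t)"]) (use i that in auto)
  ultimately have "0 < e \<bullet> v + t * v $ i" if "t \<in> {1 / 4, - (1 / 4)}" for t
    using that unfolding kaps_dot[OF i v(1), symmetric] by blast
  from this[of "1 / 4"] this[of "- (1 / 4)"] show ?thesis by (auto simp: abs_if)
qed

lemma e_positive:
  assumes "y \<in> S"
  shows "0 < y \<bullet> e"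
  using assms
proof (cases rule: S_cases)
  case (lift A x)
  then show ?thesis
    unfolding lift(5) functional_dot[OF kaps_carrier[OF lift(4)] evec_carrier(1)]
    using kaps_Phi_evec[OF k_bounds(3) lift(1,2,4)] by simp
next
  case (limit F)
  then show ?thesis using qW_Lam_pos[OF limit(1) k_theta] by simp
qed

sublocale dual_cone R S e 4
proof
  show "2 \<le> R" by (rule R2)
  show "S \<subseteq> carrier_vec R"
    by (rule subsetI, erule S_cases) (auto intro: functional_carrier kaps_carrier)
  show "e \<in> carrier_vec R" by simp
  show "\<exists>r l. strict_mono r \<and> l \<in> S \<and> (\<forall>i<R. (\<lambda>t. Y (r t) $ i) \<longlonglongrightarrow> l $ i)" if "\<And>t :: nat. Y t \<in> S" for Y
    by (rule S_seq_compact[OF that])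
  show "\<bar>v $ i\<bar> \<le> 4 * (e \<bullet> v)" if "v \<in> carrier_vec R" "\<And>y. y \<in> S \<Longrightarrow> 0 < y \<bullet> v" "i < R" for v i
    by (rule less_imp_le[OF positive_on_S[OF that]])
  show "0 < e \<bullet> v" if "v \<in> carrier_vec R" "\<And>y. y \<in> S \<Longrightarrow> 0 < y \<bullet> v" for v
  proof -
    have "0 < R" using R2 by simp
    from positive_on_S[OF that this] show ?thesis by linarith
  qed
  show "\<exists>v\<in>carrier_vec R. \<forall>y\<in>S. 0 < y \<bullet> v" using e_positive by (intro bexI[of _ e]) auto
qed

lemma e_cone: "e \<in> cone"
  using e_positive by (simp add: cone_def)

lemma p_nonzero: "F \<in> Lam \<Longrightarrow> p F \<noteq> 0\<^sub>v R"
  using evec_pW[OF Lam_Gr[OF _ k_theta]] by fastforce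

text \<open>An orbit functional does not vanish at p(F): \<open>Phi d k A\<close> sends p(F) to a
  positive multiple of the form of another k-plane, where elements of \<open>kaps\<close> are
  positive. Zeros can only come from the q(G), and those are settled by transversality.\<close>

theorem contact_limit:
  assumes F: "F \<in> Lam"
  shows "contact (p F) (q F)"
  unfolding contact_def
proof (intro conjI pW_carrier(1) p_nonzero[OF F] S_q[OF F] ballI)
  show "q F \<bullet> p F = 0" using qp_eq_iff[OF F F] by simp
  fix y assume "y \<in> S"
  then have "0 \<le> y \<bullet> p F \<and> (y \<bullet> p F = 0 \<longrightarrow> y = q F)"
  proof (cases rule: S_cases)
    case (lift A x)
    note FG = Lam_Gr[OF F k_theta]
    have "x \<bullet> (Phi d k A *\<^sub>v p F) = (e \<bullet> (Phi d k A *\<^sub>v p F)) * (x \<bullet> pW d k (mat_image A (F k)))"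
      by (subst Phi_pW(2)[OF FG lift(1,2)]) (rule scalar_prod_smult_distrib[OF kaps_carrier[OF lift(4)] pW_carrier(1)])
    then have "0 < x \<bullet> (Phi d k A *\<^sub>v p F)"
      using Phi_pW(1)[OF FG lift(1,2)] kaps_pW[OF lift(4) Gr_image[OF FG lift(1,2)]] by simp
    then have "0 < y \<bullet> p F"
      unfolding lift(5) functional_dot[OF kaps_carrier[OF lift(4)] pW_carrier(1)]
      using kaps_Phi_evec[OF k_bounds(3) lift(1,2,4)] by simp
    then show ?thesis by simp
  next
    case (limit G)
    show ?thesis unfolding limit(2) using qp_nonneg[OF F limit(1)] qp_eq_iff[OF F limit(1)] by blast
  qed
  then show "0 \<le> y \<bullet> p F" "y \<bullet> p F = 0 \<longrightarrow> y = q F" by auto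
qed

text \<open>Up to positive factors, the transpose of \<open>Phi d k A\<close> maps \<open>S\<close>
  into itself: the functional of \<open>B\<close> goes to that of \<open>B * A\<close>, and q(F)
  goes to q of the translate of F by the inverse of \<open>A\<close>.\<close>

lemma cone_act:
  assumes A: "A \<in> carrier_mat d d" "det A \<noteq> 0" "pcl d A \<in> \<Gamma>" and v: "v \<in> cone"
  shows "Phi d k A *\<^sub>v v \<in> cone"
  unfolding cone_def
proof (intro CollectI conjI ballI)
  have vc: "v \<in> carrier_vec R" and vp: "\<And>y. y \<in> S \<Longrightarrow> 0 < y \<bullet> v" using v by (auto simp: cone_def)
  show Av: "Phi d k A *\<^sub>v v \<in> carrier_vec R" by (rule mult_mat_vec_carrier[OF Phi_carrier vc])
  fix y assume "y \<in> S"
  then show "0 < y \<bullet> (Phi d k A *\<^sub>v v)"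
  proof (cases rule: S_cases)
    case (lift B x)
    have BA: "B * A \<in> carrier_mat d d" "det (B * A) \<noteq> 0" "pcl d (B * A) \<in> \<Gamma>"
      using lift(1,2) A det_mult[OF lift(1) A(1)] Gamma(4)[OF lift(3) A(3)] PGL_mult[OF lift(1,2) A(1,2)]
      by (auto simp: mult_carrier_mat[of _ d d])
    have m: "Phi d k B *\<^sub>v (Phi d k A *\<^sub>v v) = Phi d k (B * A) *\<^sub>v v"
      unfolding Phi_mult[OF k_bounds(3) lift(1) A(1)] by (rule assoc_mult_mat_vec[OF Phi_carrier Phi_carrier vc, symmetric])
    note xc = kaps_carrier[OF lift(4)]
    have "0 < functional d k (B * A) x \<bullet> v" by (rule vp[OF S_functional[OF BA lift(4)]])
    then have "0 < x \<bullet> (Phi d k (B * A) *\<^sub>v v)"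
      unfolding functional_dot[OF xc vc] using kaps_Phi_evec[OF k_bounds(3) BA(1,2) lift(4)] by (simp add: zero_less_divide_iff)
    then show ?thesis unfolding lift(5) functional_dot[OF xc Av] m using kaps_Phi_evec[OF k_bounds(3) lift(1,2,4)] by simp
  next
    case (limit F)
    obtain B where B: "B \<in> carrier_mat d d" "A * B = 1\<^sub>m d" "B * A = 1\<^sub>m d" "det B \<noteq> 0" using det_inverse[OF A(1,2)] by blast
    have Bi: "pcl d B \<in> \<Gamma>" using Gamma(3)[OF A(3)] PGL_inv[OF A(1,2) B(1,2)] by simp
    obtain c where c: "c > 0" "transpose_mat (Phi d k A) *\<^sub>v q F = c \<cdot>\<^sub>v qW d k (mat_image B (F (d - k)))"
      using Phi_qW[OF A(1) B(1,2,3) Lam_Gr[OF limit(1) theta(6)[OF k_theta]] k_bounds(3)] by blast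
    let ?F = "flag_act \<theta> (pcl d B) F"
    have F': "?F \<in> Lam" by (rule Lam_act[OF limit(1) Bi])
    have "mat_image B (F (d - k)) = ?F (d - k)"
      by (rule flag_act_flags(2)[OF B(1,4) Lam_flags[OF limit(1)] theta(6)[OF k_theta], symmetric])
    then have "y \<bullet> (Phi d k A *\<^sub>v v) = (c \<cdot>\<^sub>v q ?F) \<bullet> v"
      unfolding limit(2) transpose_dot[OF Phi_carrier vc qW_carrier(1), symmetric] c(2) by simp
    also have "\<dots> = c * (q ?F \<bullet> v)" by (rule smult_scalar_prod_distrib[OF qW_carrier(1) vc])
    finally show ?thesis using c(1) vp[OF S_q[OF F']] by simp
  qed
qed

abbreviation Gamma0 where "Gamma0 \<equiv> PhiP d k ` \<Gamma>"

lemma PhiP_line: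
  assumes "A \<in> carrier_mat d d" "v \<in> carrier_vec R" "v \<noteq> 0\<^sub>v R"
  shows "act (PhiP d k (pcl d A)) (line v) = line (Phi d k A *\<^sub>v v)"
  unfolding PhiP_pcl[OF k_bounds(3) assms(1)] by (rule act_line[OF Phi_carrier assms(2,3)])

lemma Omega_act:
  assumes g: "g \<in> \<Gamma>"
  shows "act (PhiP d k g) ` Omega = Omega"
proof -
  have sub: "act (PhiP d k (pcl d A)) x \<in> Omega" if A: "A \<in> carrier_mat d d" "det A \<noteq> 0" "pcl d A \<in> \<Gamma>" and x: "x \<in> Omega" for A x
  proof -
    obtain v where v: "v \<in> cone" "x = line v" using x by (auto simp: Omega_def)
    show ?thesis unfolding v(2) PhiP_line[OF A(1) cone_carrier[OF v(1)] cone_nonzero[OF v(1)]] Omega_def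
      using cone_act[OF A v(1)] by blast
  qed
  obtain A where A: "A \<in> carrier_mat d d" "det A \<noteq> 0" "g = pcl d A" using Gamma_lift[OF g] by blast
  obtain B where B: "B \<in> carrier_mat d d" "A * B = 1\<^sub>m d" "B * A = 1\<^sub>m d" "det B \<noteq> 0" using det_inverse[OF A(1,2)] by blast
  have gA: "pcl d A \<in> \<Gamma>" using g A(3) by simp
  have Bi: "pcl d B \<in> \<Gamma>" using Gamma(3)[OF gA] PGL_inv[OF A(1,2) B(1,2)] by simp
  show ?thesis
  proof (intro equalityI subsetI)
    fix x assume "x \<in> act (PhiP d k g) ` Omega"
    then show "x \<in> Omega" using sub[OF A(1,2) gA] A(3) by blast
  next
    fix x assume x: "x \<in> Omega"
    then obtain v where v: "v \<in> cone" "x = line v" by (auto simp: Omega_def)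
    let ?u = "Phi d k B *\<^sub>v v"
    have u: "?u \<in> cone" by (rule cone_act[OF B(1,4) Bi v(1)])
    have "Phi d k A *\<^sub>v ?u = Phi d k (A * B) *\<^sub>v v"
      unfolding Phi_mult[OF k_bounds(3) A(1) B(1)] by (rule assoc_mult_mat_vec[OF Phi_carrier Phi_carrier cone_carrier[OF v(1)], symmetric])
    also have "\<dots> = v" unfolding B(2) Phi_one[OF k_bounds(3)] using cone_carrier[OF v(1)] by simp
    finally have "x = act (PhiP d k g) (line ?u)"
      unfolding A(3) PhiP_line[OF A(1) cone_carrier[OF u] cone_nonzero[OF u]] v(2) by simp
    moreover have "line ?u \<in> Omega" using u by (auto simp: Omega_def)
    ultimately show "x \<in> act (PhiP d k g) ` Omega" by blast
  qed
qed

text \<open>Scalars do not matter for lines, so the normalised vectors may be used; they converge to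
  (q(G) v) p(F), which is nonzero.\<close>

lemma limitin_orbit:
  assumes RL: "rank_one_limit A c F G" and F: "F \<in> Lam" and v: "v \<in> carrier_vec R" "q G \<bullet> v \<noteq> 0"
  shows "Gr_lim R 1 (\<lambda>t. act (PhiP d k (pcl d (A t))) (line v)) (line (p F))"
proof -
  note A = rank_one_limitD(1,2)[OF RL]
  have v0: "v \<noteq> 0\<^sub>v R" using v(2) by auto
  have c: "c t k \<noteq> 0" for t using rank_one_limitD(3)[OF RL k_theta, of t] by simp
  have Av: "Phi d k (A t) *\<^sub>v v \<in> carrier_vec R" "Phi d k (A t) *\<^sub>v v \<noteq> 0\<^sub>v R" for t
    by (rule mult_mat_vec_carrier[OF Phi_carrier v(1)], rule det_nz_vec[OF Phi_carrier Phi_det[OF k_bounds(3) A] v(1) v0])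
  have nz: "a \<cdot>\<^sub>v w \<noteq> 0\<^sub>v R" if aw: "a \<noteq> 0" "w \<in> carrier_vec R" "w \<noteq> 0\<^sub>v R" for a and w :: "real vec"
  proof
    assume z: "a \<cdot>\<^sub>v w = 0\<^sub>v R"
    obtain i where i: "i < R" "w $ i \<noteq> 0" using vec_nonzero_iff[OF aw(2)] aw(3) by blast
    have "(a \<cdot>\<^sub>v w) $ i = a * w $ i" using i(1) aw(2) by simp
    then show False using i aw(1) unfolding z by simp
  qed
  have "Gr_lim R 1 (\<lambda>t. line ((1 / c t k) \<cdot>\<^sub>v (Phi d k (A t) *\<^sub>v v))) (line ((q G \<bullet> v) \<cdot>\<^sub>v p F))"
  proof (rule limitin_line)
    show "(1 / c t k) \<cdot>\<^sub>v (Phi d k (A t) *\<^sub>v v) \<in> carrier_vec R" for t using Av(1) by simp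
    show "(1 / c t k) \<cdot>\<^sub>v (Phi d k (A t) *\<^sub>v v) \<noteq> 0\<^sub>v R" for t using c by (intro nz Av) simp
    show "(q G \<bullet> v) \<cdot>\<^sub>v p F \<in> carrier_vec R" by simp
    show "(q G \<bullet> v) \<cdot>\<^sub>v p F \<noteq> 0\<^sub>v R" by (rule nz[OF v(2) pW_carrier(1) p_nonzero[OF F]])
    fix i assume i: "i < R"
    have "((1 / c t k) \<cdot>\<^sub>v (Phi d k (A t) *\<^sub>v v)) $ i = (Phi d k (A t) *\<^sub>v v) $ i / c t k" for t
      using i carrier_vecD[OF Av(1)[of t]] by (simp only: index_smult_vec(1)) simp
    then show "(\<lambda>t. ((1 / c t k) \<cdot>\<^sub>v (Phi d k (A t) *\<^sub>v v)) $ i) \<longlonglongrightarrow> ((q G \<bullet> v) \<cdot>\<^sub>v p F) $ i"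
      using rank_one_vec[OF RL k_theta v(1) i] i by simp
  qed
  then show ?thesis
    unfolding PhiP_line[OF A(1) v(1) v0] line_smult[OF v(2)]
    using line_smult[of "1 / c _ k"] c by simp
qed

end

section \<open>Subsequence and discreteness criteria\<close>

lemma limitin_from_subseqs:
  assumes l: "l \<in> topspace Y"
    and s: "\<And>r. subsequence r \<Longrightarrow> \<exists>r'. subsequence r' \<and> limitin Y (\<lambda>n. f (r (r' n))) l sequentially"
  shows "limitin Y f l sequentially"
  unfolding limitin_def
proof (intro conjI l allI impI)
  fix U assume U: "openin Y U \<and> l \<in> U"
  show "\<forall>\<^sub>F n in sequentially. f n \<in> U"
  proof (rule ccontr)
    assume "\<not> (\<forall>\<^sub>F n in sequentially. f n \<in> U)"
    from not_eventually_subseq[OF this] obtain r where r: "subsequence r" "\<And>n. f (r n) \<notin> U" by blast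
    obtain r' where r': "limitin Y (\<lambda>n. f (r (r' n))) l sequentially" using s[OF r(1)] by blast
    then have "\<forall>\<^sub>F n in sequentially. f (r (r' n)) \<in> U" using U by (simp add: limitin_def)
    then show False using r(2) by (simp add: eventually_sequentially)
  qed
qed

text \<open>A neighbourhood of g meets \<Gamma> in finitely many elements, and intersecting it with
  finitely many separating open sets leaves only g.\<close>

lemma discrete_topologyI:
  assumes G: "\<Gamma> \<subseteq> topspace X"
    and fin: "\<And>g. g \<in> \<Gamma> \<Longrightarrow> \<exists>U. openin X U \<and> g \<in> U \<and> finite (U \<inter> \<Gamma>)"
    and sep: "\<And>g h. g \<in> \<Gamma> \<Longrightarrow> h \<in> \<Gamma> \<Longrightarrow> g \<noteq> h \<Longrightarrow> \<exists>W. openin X W \<and> g \<in> W \<and> h \<notin> W"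
  shows "subtopology X \<Gamma> = discrete_topology \<Gamma>"
proof -
  have "openin (subtopology X \<Gamma>) {g}" if g: "g \<in> \<Gamma>" for g
  proof -
    obtain U where U: "openin X U" "g \<in> U" "finite (U \<inter> \<Gamma>)" using fin[OF g] by blast
    have "\<forall>h. \<exists>W. h \<in> \<Gamma> \<and> g \<noteq> h \<longrightarrow> openin X W \<and> g \<in> W \<and> h \<notin> W" using sep[OF g] by blast
    then obtain W where W: "\<And>h. h \<in> \<Gamma> \<Longrightarrow> g \<noteq> h \<Longrightarrow> openin X (W h) \<and> g \<in> W h \<and> h \<notin> W h" by metis
    let ?I = "U \<inter> \<Gamma> - {g}" and ?T = "U \<inter> ((\<Inter>h\<in>U \<inter> \<Gamma> - {g}. W h) \<inter> topspace X)"
    have "openin X ((\<Inter>h\<in>?I. W h) \<inter> topspace X)" by (rule openin_INT) (use U(3) W in auto)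
    then have "openin X ?T" by (rule openin_Int[OF U(1)])
    moreover have "{g} = ?T \<inter> \<Gamma>" using U(2) W g G by blast
    ultimately show ?thesis unfolding openin_subtopology by blast
  qed
  moreover have "topspace (subtopology X \<Gamma>) = \<Gamma>" using G by auto
  ultimately show ?thesis using discrete_topology_unique[of \<Gamma> "subtopology X \<Gamma>"] by simp
qed

subsection \<open>Open subsets of the projective linear group\<close>

lemma topspace_PGL: "topspace (PGL_topology n) = (carrier (PGL n) :: real mat set set)"
  unfolding PGL_topology_def topspace_quotient_topology PGL_carrier by (auto simp: GL_simps pcl_def)

lemma openin_PGL_positive:
  fixes f :: "real mat \<Rightarrow> real"
  assumes cont: "continuous_map (mat_topology n n) euclidean f"
    and inv: "\<And>X c. X \<in> carrier_mat n n \<Longrightarrow> c \<noteq> 0 \<Longrightarrow> 0 < f X \<Longrightarrow> 0 < f (c \<cdot>\<^sub>m X)"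
  shows "openin (PGL_topology n) (pcl n ` {X \<in> carrier (GL n). 0 < f X})" (is "openin _ (pcl n ` ?P)")
proof -
  let ?X = "subtopology (mat_topology n n) (carrier (GL n)) :: real mat topology"
  have ts: "topspace ?X = carrier (GL n)" by (auto simp: GL_simps)
  have "{X \<in> topspace ?X. pcl n X \<in> pcl n ` ?P} = {X \<in> topspace ?X. f X \<in> {0<..}}"
  proof (intro equalityI subsetI)
    fix X assume "X \<in> {X \<in> topspace ?X. pcl n X \<in> pcl n ` ?P}"
    then obtain Z where Z: "X \<in> carrier (GL n)" "Z \<in> carrier (GL n)" "0 < f Z" "pcl n Z = pcl n X" unfolding ts by force
    have c: "X \<in> carrier_mat n n" "Z \<in> carrier_mat n n" using Z(1,2) by (auto simp: GL_simps)
    obtain a where "a \<noteq> 0" "X = a \<cdot>\<^sub>m Z" using Z(4) unfolding pcl_eq_iff[OF c(2,1)] by blast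
    then show "X \<in> {X \<in> topspace ?X. f X \<in> {0<..}}" using inv[OF c(2) _ Z(3)] Z(1) unfolding ts by simp
  qed (auto simp: GL_simps)
  moreover have "openin ?X {X \<in> topspace ?X. f X \<in> {0<..}}"
    by (rule openin_continuous_map_preimage[OF continuous_map_from_subtopology[OF cont]]) auto
  ultimately show ?thesis
    unfolding PGL_topology_def openin_quotient_topology ts pcl_def[symmetric] by auto
qed

text \<open>The sign is invariant under scaling. It is positive at a given invertible matrix once \<open>b\<close> is
  large, and negative at every nonzero singular matrix.\<close>

definition gauge :: "nat \<Rightarrow> real \<Rightarrow> real mat \<Rightarrow> real" where
  "gauge n b X = b * (det X)\<^sup>2 - (\<Sum>i=0..<n. \<Sum>j=0..<n. (X $$ (i, j))\<^sup>2) ^ n"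

lemma continuous_map_gauge: "continuous_map (mat_topology n n) euclidean (gauge n b)"
proof -
  have "continuous_map (mat_topology n n) euclidean (\<lambda>X. gauge n b (mat n n (\<lambda>(i, j). X $$ (i, j))))"
    unfolding gauge_def
    by (rule continuous_map_euclideanI, intro tendsto_intros) (auto intro: continuous_map_euclideanD[OF continuous_map_entry])
  moreover have "mat n n (\<lambda>(i, j). X $$ (i, j)) = X" if "X \<in> carrier_mat n n" for X :: "real mat"
    using that by (intro eq_matI) auto
  ultimately show ?thesis by (elim continuous_map_eq) simp
qed

lemma tendsto_gauge:
  assumes "\<And>t. X t \<in> carrier_mat n n" "L \<in> carrier_mat n n" "mconv n n X L"
  shows "(\<lambda>t. gauge n b (X t)) \<longlonglongrightarrow> gauge n b L"
  using continuous_map_limit[OF continuous_map_gauge limitin_mat[OF assms]] by (simp add: o_def)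

lemma gauge_smult:
  assumes "X \<in> carrier_mat n n"
  shows "gauge n b (c \<cdot>\<^sub>m X) = c ^ (2 * n) * gauge n b X"
proof -
  have s: "(\<Sum>i=0..<n. \<Sum>j=0..<n. ((c \<cdot>\<^sub>m X) $$ (i, j))\<^sup>2) = c\<^sup>2 * (\<Sum>i=0..<n. \<Sum>j=0..<n. (X $$ (i, j))\<^sup>2)"
    using assms by (simp add: sum_distrib_left power_mult_distrib)
  have t: "det (c \<cdot>\<^sub>m X) = c ^ n * det X" using assms by simp
  have "(c ^ n)\<^sup>2 = c ^ (2 * n)" "(c\<^sup>2) ^ n = c ^ (2 * n)" by (simp_all add: power_mult[symmetric] mult.commute)
  then show ?thesis
    unfolding gauge_def s t power_mult_distrib by (simp add: algebra_simps)
qed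

text \<open>If X and H are not proportional, some expression X_ij H_kl - X_kl H_ij is nonzero. Its
  square, as a function of the first matrix, is homogeneous of degree 2, positive at X and zero on
  the class of H.\<close>

lemma PGL_separate:
  assumes X: "X \<in> carrier_mat n n" "det X \<noteq> 0" and H: "H \<in> carrier_mat n n" "det H \<noteq> 0" and ne: "pcl n X \<noteq> pcl n (H :: real mat)"
  shows "\<exists>W. openin (PGL_topology n) W \<and> pcl n X \<in> W \<and> pcl n H \<notin> W"
proof -
  have H0: "\<exists>k<n. \<exists>l<n. H $$ (k, l) \<noteq> 0"
  proof (rule ccontr)
    assume z: "\<not> ?thesis"
    have "H = 0\<^sub>m n n" by (rule eq_matI) (use z H(1) in auto)
    show False
    \<comment> \<open>The zero matrix has determinant 0 unless n = 0; in that case X and H are both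
      the empty matrix and thus equal.\<close>
    proof (cases "n = 0")
      case True
      have "X = H" by (rule eq_matI) (use True X(1) H(1) in auto)
      then show False using ne by simp
    next
      case False
      then show False using H(2) \<open>H = 0\<^sub>m n n\<close> by (simp add: det_zero)
    qed
  qed
  then obtain k l where kl: "k < n" "l < n" "H $$ (k, l) \<noteq> 0" by blast
  have "\<exists>i<n. \<exists>j<n. X $$ (i, j) * H $$ (k, l) \<noteq> X $$ (k, l) * H $$ (i, j)"
  proof (rule ccontr)
    assume z: "\<not> ?thesis"
    define a where "a = X $$ (k, l) / H $$ (k, l)"
    have e: "X = a \<cdot>\<^sub>m H"
    proof (rule eq_matI)
      fix i j assume "i < dim_row (a \<cdot>\<^sub>m H)" "j < dim_col (a \<cdot>\<^sub>m H)"
      then have ij: "i < n" "j < n" using H(1) by auto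
      then have "X $$ (i, j) * H $$ (k, l) = X $$ (k, l) * H $$ (i, j)" using z by blast
      then show "X $$ (i, j) = (a \<cdot>\<^sub>m H) $$ (i, j)" using ij H(1) kl(3) by (simp add: a_def field_simps)
    qed (use X(1) H(1) in auto)
    have "a \<noteq> 0"
    proof
      assume "a = 0"
      then have "det X = 0 ^ n * det H" unfolding e using H(1) by simp
      then show False using X(2) kl(1) by simp
    qed
    then have "pcl n H = pcl n X" unfolding pcl_eq_iff[OF H(1) X(1)] using e by blast
    then show False using ne by simp
  qed
  then obtain i j where ij: "i < n" "j < n" "X $$ (i, j) * H $$ (k, l) \<noteq> X $$ (k, l) * H $$ (i, j)" by blast
  define f where "f Z = (Z $$ (i, j) * H $$ (k, l) - Z $$ (k, l) * H $$ (i, j))\<^sup>2" for Z :: "real mat"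
  have fs: "f (c \<cdot>\<^sub>m Z) = c\<^sup>2 * f Z" if "Z \<in> carrier_mat n n" for c Z
    using that ij(1,2) kl(1,2) by (simp add: f_def power_mult_distrib[symmetric] right_diff_distrib mult.assoc)
  let ?W = "pcl n ` {Z \<in> carrier (GL n). 0 < f Z}"
  have "openin (PGL_topology n) ?W"
  proof (rule openin_PGL_positive)
    show "continuous_map (mat_topology n n) euclidean f"
    proof (rule continuous_map_euclideanI)
      fix Z :: "real mat" assume Z: "Z \<in> topspace (mat_topology n n)"
      show "(f \<longlongrightarrow> f Z) (atin (mat_topology n n) Z)"
        unfolding f_def[abs_def] by (intro tendsto_intros continuous_map_euclideanD[OF continuous_map_entry Z] ij kl)
    qed
    show "0 < f (c \<cdot>\<^sub>m Z)" if "Z \<in> carrier_mat n n" "c \<noteq> 0" "0 < f Z" for Z c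
      unfolding fs[OF that(1)] using that(2,3) by simp
  qed
  moreover have "pcl n X \<in> ?W" using X ij(3) by (auto simp: f_def GL_simps)
  moreover have "pcl n H \<notin> ?W"
  proof
    assume "pcl n H \<in> ?W"
    then obtain Z where Z: "Z \<in> carrier_mat n n" "0 < f Z" "pcl n H = pcl n Z" by (auto simp: GL_simps)
    obtain a where a: "Z = a \<cdot>\<^sub>m H" using Z(3) unfolding pcl_eq_iff[OF H(1) Z(1)] by blast
    have "f Z = a\<^sup>2 * f H" unfolding a by (rule fs[OF H(1)])
    moreover have "f H = 0" by (simp add: f_def)
    ultimately show False using Z(2) by simp
  qed
  ultimately show ?thesis by blast
qed

context transverse_k
begin

subsection \<open>The limit set\<close>

definition ell :: "(nat \<Rightarrow> 'a vec set) \<Rightarrow> real vec set" where "ell F = line (p F)"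

lemma ell_inj: "inj_on ell Lam"
proof (rule inj_onI)
  fix F G assume FG: "F \<in> Lam" "G \<in> Lam" "ell F = ell G"
  obtain c where c: "p F = c \<cdot>\<^sub>v p G" using line_eqD[OF FG(3)[unfolded ell_def] pW_carrier(1)] p_nonzero[OF FG(1)] by blast
  have "q G \<bullet> p F = c * (q G \<bullet> p G)" unfolding c by (rule scalar_prod_smult_distrib[OF qW_carrier(1) pW_carrier(1)])
  also have "\<dots> = 0" using qp_eq_iff[OF FG(2,2)] by simp
  finally show "F = G" using qp_eq_iff[OF FG(1,2)] by blast
qed

lemma ell_Gr: "F \<in> Lam \<Longrightarrow> ell F \<in> Gr R 1"
  unfolding ell_def by (rule line_Gr[OF pW_carrier(1) p_nonzero])

lemma ell_notin_Omega:
  assumes F: "F \<in> Lam"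
  shows "ell F \<notin> Omega"
proof
  assume "ell F \<in> Omega"
  then have "p F \<in> cone \<or> (- 1) \<cdot>\<^sub>v p F \<in> cone" unfolding ell_def line_in_Omega[OF pW_carrier(1)] .
  moreover have "q F \<bullet> p F = 0" using qp_eq_iff[OF F F] by simp
  moreover have "q F \<bullet> ((- 1) \<cdot>\<^sub>v p F) = (- 1) * (q F \<bullet> p F)" by (rule scalar_prod_smult_distrib[OF qW_carrier(1) pW_carrier(1)])
  ultimately show False using S_q[OF F] by (auto simp: cone_def)
qed

lemma cone_q: "v \<in> cone \<Longrightarrow> G \<in> Lam \<Longrightarrow> q G \<bullet> v \<noteq> 0"
  using S_q[of G] by (auto simp: cone_def)

text \<open>If a single group element occurred infinitely often, the limit would be its image of b
  and lie in \<open>Omega\<close>. So a subsequence consists of distinct elements and has a rank one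
  limit, whose kernel misses b because every q(G) is positive on the cone.\<close>

lemma orbit_accumulation:
  assumes g: "\<And>n :: nat. g n \<in> \<Gamma>" and b: "b \<in> Omega" and z: "z \<notin> Omega"
    and lim: "Gr_lim R 1 (\<lambda>n. act (PhiP d k (g n)) b) z"
  shows "\<exists>r A c F G. subsequence r \<and> F \<in> Lam \<and> G \<in> Lam \<and> rank_one_limit A c F G \<and>
    (\<forall>n. g (r n) = pcl d (A n)) \<and> z = ell F \<and>
    flag_lim d \<theta> (\<lambda>n. Uflag d \<theta> (g (r n))) F \<and>
    flag_lim d \<theta> (\<lambda>n. Uflag d \<theta> (inv\<^bsub>PGL d\<^esub> (g (r n)))) G"
proof -
  obtain v where v: "v \<in> cone" "b = line v" using b by (auto simp: Omega_def)
  obtain r where r: "subsequence r" "(\<forall>n. g (r n) = g (r 0)) \<or> inj (\<lambda>n. g (r n))"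
    using const_or_inj_subseq[of g] by blast
  have one: "1 \<le> R" using R2 by simp
  note lim_r = limitin_subseq[OF lim r(1)]
  have "inj (\<lambda>n. g (r n))"
  proof (rule ccontr)
    assume "\<not> inj (\<lambda>n. g (r n))"
    then obtain h where h: "\<And>n. g (r n) = h" using r(2) by blast
    have O: "act (PhiP d k h) b \<in> Omega" unfolding h[of 0, symmetric] using Omega_act[OF g] b by blast
    have "Gr_lim R 1 (\<lambda>n. act (PhiP d k (g (r n))) b) (act (PhiP d k h) b)"
      unfolding h using O openin_subset[OF openin_Omega] by (auto simp: limitin_def)
    from limitin_Gr_unique[OF this lim_r one] show False using O z by simp
  qed
  from dynamics[OF this g]
  obtain r' A c F G where D: "subsequence r'" "F \<in> Lam" "G \<in> Lam" "rank_one_limit A c F G" "\<forall>n. g (r (r' n)) = pcl d (A n)"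
    "flag_lim d \<theta> (\<lambda>n. Uflag d \<theta> (g (r (r' n)))) F"
    "flag_lim d \<theta> (\<lambda>n. Uflag d \<theta> (inv\<^bsub>PGL d\<^esub> (g (r (r' n))))) G"
    by (elim exE conjE) (rule that; assumption)
  have "Gr_lim R 1 (\<lambda>n. act (PhiP d k (g (r (r' n)))) b) (ell F)"
    unfolding D(5)[rule_format] v(2) ell_def by (rule limitin_orbit[OF D(4,2) cone_carrier[OF v(1)] cone_q[OF v(1) D(3)]])
  from limitin_Gr_unique[OF limitin_subseq[OF lim_r D(1)] this one] have "z = ell F" .
  moreover have "strict_mono (\<lambda>t. r (r' t))" using r(1) D(1) by (simp add: strict_mono_def)
  ultimately show ?thesis using D(2-7) by (intro exI[of _ "\<lambda>t. r (r' t)"] exI[of _ A] exI[of _ c] exI[of _ F] exI[of _ G] conjI)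
qed

abbreviation Pset where "Pset \<equiv> orbit_limit_set R Omega Gamma0"

text \<open>Limits of orbits are covered by \<open>orbit_accumulation\<close>. Conversely each
  \<open>ell F\<close> is a limit of the orbit of the line of the identity form, and it lies on the
  frontier because q(F) vanishes there.\<close>

theorem orbit_limit_set_eq: "Pset = ell ` Lam"
proof (intro equalityI subsetI)
  fix z assume "z \<in> Pset"
  then obtain b \<gamma> where z: "z \<in> Gr_topology R 1 frontier_of Omega" "b \<in> Omega" "range (\<gamma> :: nat \<Rightarrow> _) \<subseteq> Gamma0"
    "Gr_lim R 1 (\<lambda>n. act (\<gamma> n) b) z" unfolding orbit_limit_set_def by blast
  have "\<forall>n. \<exists>g. g \<in> \<Gamma> \<and> \<gamma> n = PhiP d k g" using z(3) by blast
  then obtain g where g: "\<And>n. g n \<in> \<Gamma>" "\<And>n. \<gamma> n = PhiP d k (g n)" by metis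
  have "z \<notin> Omega" using z(1) interior_of_openin[OF openin_Omega] by (simp add: frontier_of_def)
  from orbit_accumulation[of g, OF g(1) z(2) this] z(4) show "z \<in> ell ` Lam" unfolding g(2) by blast
next
  fix z assume "z \<in> ell ` Lam"
  then obtain F where F: "F \<in> Lam" "z = ell F" by blast
  obtain A c G where D: "G \<in> Lam" "rank_one_limit A c F G" "\<And>n. pcl d (A n) \<in> \<Gamma>" using Lam_dynamics[OF F(1)] by metis
  have lim: "Gr_lim R 1 (\<lambda>n. act (PhiP d k (pcl d (A n))) (line e)) z"
    unfolding F(2) ell_def by (rule limitin_orbit[OF D(2) F(1) evec_carrier(1) cone_q[OF e_cone D(1)]])
  have eO: "line e \<in> Omega" using e_cone by (auto simp: Omega_def)
  have "z \<in> Gr_topology R 1 closure_of Omega"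
    unfolding in_closure_of
  proof (intro conjI allI impI)
    show "z \<in> topspace (Gr_topology R 1)" using ell_Gr[OF F(1)] F(2) by simp
    fix T assume "z \<in> T \<and> openin (Gr_topology R 1) T"
    then have "\<forall>\<^sub>F n in sequentially. act (PhiP d k (pcl d (A n))) (line e) \<in> T" using lim by (simp add: limitin_def)
    then obtain n where "act (PhiP d k (pcl d (A n))) (line e) \<in> T" unfolding eventually_sequentially by blast
    moreover have "act (PhiP d k (pcl d (A n))) (line e) \<in> Omega" using Omega_act[OF D(3)] eO by blast
    ultimately show "\<exists>y. y \<in> Omega \<and> y \<in> T" by blast
  qed
  then have "z \<in> Gr_topology R 1 frontier_of Omega"
    using ell_notin_Omega[OF F(1)] F(2) interior_of_openin[OF openin_Omega] by (simp add: frontier_of_def)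
  then show "z \<in> Pset"
    unfolding orbit_limit_set_def using eO lim D(3)
    by (intro CollectI conjI bexI[of _ "line e"] exI[of _ "\<lambda>n. PhiP d k (pcl d (A n))"]) auto
qed

lemma PhiP_hom: "group_hom (PGL d) (PGL R) (PhiP d k)"
  using PhiP_in[OF k_bounds(3)] PhiP_mult[OF k_bounds(3)]
  by (intro group_hom.intro group_PGL group_hom_axioms.intro homI) auto

lemma Gamma0_subgroup: "subgroup Gamma0 (PGL R)"
  by (rule group_hom.subgroup_img_is_subgroup[OF PhiP_hom Gamma(1)])

theorem Gamma0_discrete: "discrete_subgroup R Gamma0"
  unfolding discrete_subgroup_def
proof (intro conjI Gamma0_subgroup discrete_topologyI)
  have sub: "Gamma0 \<subseteq> carrier (PGL R)" by (rule subgroup.subset[OF Gamma0_subgroup])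
  then show "Gamma0 \<subseteq> topspace (PGL_topology R)" unfolding topspace_PGL .
  have lift: "\<exists>X. X \<in> carrier_mat R R \<and> det X \<noteq> 0 \<and> g = pcl R X" if "g \<in> Gamma0" for g using that sub unfolding PGL_carrier by blast
  show "\<exists>W. openin (PGL_topology R) W \<and> g \<in> W \<and> h \<notin> W" if gh: "g \<in> Gamma0" "h \<in> Gamma0" "g \<noteq> h" for g h
  proof -
    obtain X where X: "X \<in> carrier_mat R R" "det X \<noteq> 0" "g = pcl R X" using lift[OF gh(1)] by blast
    obtain H where H: "H \<in> carrier_mat R R" "det H \<noteq> 0" "h = pcl R H" using lift[OF gh(2)] by blast
    show ?thesis using PGL_separate[OF X(1,2) H(1,2)] gh(3) X(3) H(3) by blast
  qed
  fix g assume "g \<in> Gamma0"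
  then obtain X where X: "X \<in> carrier_mat R R" "det X \<noteq> 0" "g = pcl R X" using lift by blast
  \<comment> \<open>With this constant \<open>gauge R b X\<close> equals 1, so the class of
    \<open>X\<close> belongs to the open set \<open>?U\<close>.\<close>
  define b where "b = ((\<Sum>i=0..<R. \<Sum>j=0..<R. (X $$ (i, j))\<^sup>2) ^ R + 1) / (det X)\<^sup>2"
  let ?U = "pcl R ` {Z \<in> carrier (GL R). 0 < gauge R b Z}"
  have sc: "0 < gauge R b (c \<cdot>\<^sub>m Z)" if "Z \<in> carrier_mat R R" "c \<noteq> 0" "0 < gauge R b Z" for Z c
    unfolding gauge_smult[OF that(1)] using that(2,3) by (simp add: power_mult)
  have "openin (PGL_topology R) ?U" by (rule openin_PGL_positive[OF continuous_map_gauge sc])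
  moreover have "g \<in> ?U"
  proof -
    have "gauge R b X = 1" using X(2) by (simp add: gauge_def b_def)
    then show ?thesis unfolding X(3) using X(1,2) by (intro imageI) (simp add: GL_simps)
  qed
  moreover have "finite (?U \<inter> Gamma0)"
  proof (rule ccontr)
    assume "infinite (?U \<inter> Gamma0)"
    then obtain h :: "nat \<Rightarrow> real mat set" where h: "inj h" "range h \<subseteq> ?U \<inter> Gamma0" using infinite_countable_subset by blast
    have "\<forall>n. \<exists>g. g \<in> \<Gamma> \<and> h n = PhiP d k g" using h(2) by blast
    then obtain g where g: "\<And>n. g n \<in> \<Gamma>" "\<And>n. h n = PhiP d k (g n)" by metis
    have "inj g" using h(1) unfolding inj_on_def g(2) by metis
    from dynamics[OF this g(1)]
    obtain r A c F G where D: "subsequence r" "F \<in> Lam" "G \<in> Lam" "rank_one_limit A c F G" "\<forall>n. g (r n) = pcl d (A n)"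
      by (elim exE conjE) (rule that; assumption)
    note A = rank_one_limitD(1,2)[OF D(4)]
    have c: "0 < c n k" for n by (rule rank_one_limitD(3)[OF D(4) k_theta])
    \<comment> \<open>The limit of infinitely many elements of \<open>?U\<close> has nonnegative
      gauge by continuity. As \<open>?L\<close> is nonzero and singular, its gauge is
      negative.\<close>
    let ?L = "mat R R (\<lambda>(x, y). p F $ x * q G $ y)"
    have "0 \<le> gauge R b ?L"
    proof (rule LIMSEQ_le_const)
      show "(\<lambda>n. gauge R b ((1 / c n k) \<cdot>\<^sub>m Phi d k (A n))) \<longlonglongrightarrow> gauge R b ?L"
      proof (rule tendsto_gauge)
        show "mconv R R (\<lambda>n. (1 / c n k) \<cdot>\<^sub>m Phi d k (A n)) ?L"
          unfolding mconv_def
        proof (intro allI impI)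
          fix x y assume xy: "x < R" "y < R"
          show "(\<lambda>n. ((1 / c n k) \<cdot>\<^sub>m Phi d k (A n)) $$ (x, y)) \<longlonglongrightarrow> ?L $$ (x, y)"
            using rank_one_limitD(4)[OF D(4) k_theta xy] xy by simp
        qed
      qed auto
      have "0 < gauge R b ((1 / c n k) \<cdot>\<^sub>m Phi d k (A n))" for n
      proof -
        have "h (r n) \<in> ?U" using h(2) by blast
        then have "pcl R (Phi d k (A n)) \<in> ?U" unfolding g(2) D(5)[rule_format] PhiP_pcl[OF k_bounds(3) A(1)] .
        then obtain Z where Z: "Z \<in> carrier_mat R R" "0 < gauge R b Z" "pcl R Z = pcl R (Phi d k (A n))" by (auto simp: GL_simps)
        obtain a where a: "a \<noteq> 0" "Phi d k (A n) = a \<cdot>\<^sub>m Z" using Z(3) unfolding pcl_eq_iff[OF Z(1) Phi_carrier] by blast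
        have "0 < gauge R b (Phi d k (A n))" unfolding a(2) by (rule sc[OF Z(1) a(1) Z(2)])
        moreover have "1 / c n k \<noteq> 0" using c[of n] by simp
        ultimately show ?thesis by (intro sc Phi_carrier)
      qed
      then show "\<exists>N. \<forall>n\<ge>N. 0 \<le> gauge R b ((1 / c n k) \<cdot>\<^sub>m Phi d k (A n))" using less_imp_le by blast
    qed
    moreover have "det ?L = 0"
    proof (rule ccontr)
      assume nz: "det ?L \<noteq> 0"
      \<comment> \<open>The form p(G) spans a line in the kernel of q(G), since a limit flag is not
        transverse to itself.\<close>
      have "?L *\<^sub>v p G = 0\<^sub>v R"
      proof (rule eq_vecI)
        fix x assume "x < dim_vec (0\<^sub>v R :: real vec)"
        then have x: "x < R" by simp
        have "(?L *\<^sub>v p G) $ x = (\<Sum>y=0..<R. p F $ x * (q G $ y * p G $ y))"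
          using x by (simp add: scalar_prod_def mult.assoc)
        also have "\<dots> = p F $ x * (q G \<bullet> p G)" by (simp add: scalar_prod_def sum_distrib_left)
        also have "\<dots> = 0" using qp_eq_iff[OF D(3,3)] by simp
        finally show "(?L *\<^sub>v p G) $ x = 0\<^sub>v R $ x" using x by simp
      qed simp
      then show False using det_nz_vec[OF mat_carrier nz pW_carrier(1) p_nonzero[OF D(3)]] by blast
    qed
    moreover have "0 < (\<Sum>i=0..<R. \<Sum>j=0..<R. (?L $$ (i, j))\<^sup>2)"
    proof -
      obtain x where x: "x < R" "p F $ x \<noteq> 0" using vec_nonzero_iff[OF pW_carrier(1)] p_nonzero[OF D(2)] by blast
      have "q G \<noteq> 0\<^sub>v R" using qW_Lam_pos[OF D(3) k_theta] by auto
      then obtain y where y: "y < R" "q G $ y \<noteq> 0" using vec_nonzero_iff[OF qW_carrier(1)] by blast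
      have "0 < (?L $$ (x, y))\<^sup>2" using x y by simp
      also have "\<dots> \<le> (\<Sum>j=0..<R. (?L $$ (x, j))\<^sup>2)" by (rule member_le_sum[of y]) (use y in auto)
      also have "\<dots> \<le> (\<Sum>i=0..<R. \<Sum>j=0..<R. (?L $$ (i, j))\<^sup>2)"
        by (rule member_le_sum[of x]) (use x in \<open>auto intro: sum_nonneg\<close>)
      finally show ?thesis .
    qed
    then have "0 < (\<Sum>i=0..<R. \<Sum>j=0..<R. (?L $$ (i, j))\<^sup>2) ^ R" by (rule zero_less_power)
    ultimately show False by (simp add: gauge_def)
  qed
  ultimately show "\<exists>U. openin (PGL_topology R) U \<and> g \<in> U \<and> finite (U \<inter> Gamma0)" by blast
qed

theorem Gamma0_visible: "projectively_visible R Omega Gamma0"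
  unfolding projectively_visible_def orbit_limit_set_eq
proof (intro conjI Gamma0_discrete ballI impI subsetI)
  show "g \<in> Aut R Omega" if "g \<in> Gamma0" for g
    using that subgroup.subset[OF Gamma0_subgroup] Omega_act by (auto simp: Aut_def)
  show "\<exists>!H. supporting_hyperplane R Omega x H" if x: "x \<in> ell ` Lam" for x
  proof -
    obtain F where F: "F \<in> Lam" "x = ell F" using x by blast
    show ?thesis unfolding F(2) ell_def by (rule unique_supporting_hyperplane[OF contact_limit[OF F(1)]])
  qed
  fix x y I z assume h: "x \<in> ell ` Lam" "y \<in> ell ` Lam" "x \<noteq> y" "I \<in> open_proj_segments x y" "I \<subseteq> Gr_topology R 1 closure_of Omega" "z \<in> I"
  obtain F where F: "F \<in> Lam" "x = ell F" using h(1) by blast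
  obtain G where G: "G \<in> Lam" "y = ell G" using h(2) by blast
  have "q F \<noteq> q G"
  proof
    assume "q F = q G"
    then have "q G \<bullet> p F = 0" using qp_eq_iff[OF F(1,1)] by simp
    then show False using qp_eq_iff[OF F(1) G(1)] h(3) F(2) G(2) by blast
  qed
  from contact_segment[OF contact_limit[OF F(1)] contact_limit[OF G(1)] this] h(4-6)
  show "z \<in> Omega" unfolding F(2) G(2) ell_def by blast
qed

subsection \<open>The representation and its limit map\<close>

definition rho :: "real mat set \<Rightarrow> 'a mat set" where "rho = inv_into \<Gamma> (PhiP d k)"

definition xi :: "real vec set \<Rightarrow> nat \<Rightarrow> 'a vec set" where "xi = inv_into Lam ell"

lemma PhiP_inj_on: "inj_on (PhiP d k) \<Gamma>"
  using PhiP_inj[OF k_bounds(1,2) Gamma(2) Gamma(2)] by (auto simp: inj_on_def)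

lemma rho_PhiP [simp]: "g \<in> \<Gamma> \<Longrightarrow> rho (PhiP d k g) = g"
  unfolding rho_def by (rule inv_into_f_f[OF PhiP_inj_on])

lemma xi_ell [simp]: "F \<in> Lam \<Longrightarrow> xi (ell F) = F"
  unfolding xi_def by (rule inv_into_f_f[OF ell_inj])

lemma act_ell:
  assumes g: "g \<in> \<Gamma>" and F: "F \<in> Lam"
  shows "act (PhiP d k g) (ell F) = ell (flag_act \<theta> g F)"
proof -
  obtain A where A: "A \<in> carrier_mat d d" "det A \<noteq> 0" "g = pcl d A" using Gamma_lift[OF g] by blast
  note P = Phi_pW[OF Lam_Gr[OF F k_theta] A(1,2)]
  have "act (PhiP d k g) (ell F) = line (Phi d k A *\<^sub>v p F)"
    unfolding A(3) ell_def by (rule PhiP_line[OF A(1) pW_carrier(1) p_nonzero[OF F]])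
  also have "\<dots> = line (pW d k (mat_image A (F k)))"
    by (subst P(2)) (rule line_smult, use P(1) in simp)
  also have "\<dots> = ell (flag_act \<theta> g F)"
    unfolding ell_def A(3) flag_act_flags(2)[OF A(1,2) Lam_flags[OF F] k_theta] ..
  finally show ?thesis .
qed

lemma limitin_ell:
  assumes F: "\<And>n. F n \<in> Lam" and G: "G \<in> Lam" and lim: "flag_lim d \<theta> F G"
  shows "Gr_lim R 1 (\<lambda>n. ell (F n)) (ell G)"
  unfolding ell_def
proof (rule limitin_line)
  fix i assume i: "i < R"
  have "Gr_lim d k (\<lambda>n. F n k) (G k)" using lim k_theta by (simp add: limitin_flag)
  then show "(\<lambda>t. p (F t) $ i) \<longlonglongrightarrow> p G $ i" by (rule limitin_Gr_imp_pW[OF _ k_bounds(3) i])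
qed (use F G p_nonzero in auto)

text \<open>The inverse of a continuous injection of a compact set is continuous. In terms of
  sequences: each subsequence of flags has a further one converging to some G', and
  \<open>ell G' = ell G\<close> forces G' = G.\<close>

lemma continuous_map_xi:
  "continuous_map (subtopology (Gr_topology R 1) (ell ` Lam)) (subtopology (flag_topology d \<theta>) Lam) xi"
proof (rule Gr_sequential_continuous)
  show one: "1 \<le> R" using R2 by simp
  show "ell ` Lam \<subseteq> Gr R 1" using ell_Gr by auto
  show "xi x \<in> topspace (subtopology (flag_topology d \<theta>) Lam)" if "x \<in> ell ` Lam" for x
    using that Lam_flags by auto
  fix \<sigma> x assume lim: "Gr_lim R 1 \<sigma> x"
    and \<sigma>: "\<And>n. \<sigma> n \<in> ell ` Lam" and x: "x \<in> ell ` Lam"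
  obtain G where G: "G \<in> Lam" "x = ell G" using x by blast
  have "\<forall>n. \<exists>F. F \<in> Lam \<and> \<sigma> n = ell F" using \<sigma> by blast
  then obtain F where F: "\<And>n. F n \<in> Lam" "\<And>n. \<sigma> n = ell (F n)" by metis
  have l: "Gr_lim R 1 (\<lambda>n. ell (F n)) (ell G)"
    using lim unfolding G(2) F(2) .
  have "flag_lim d \<theta> F G"
  proof (rule limitin_from_subseqs)
    show "G \<in> topspace (flag_topology d \<theta>)" using Lam_flags[OF G(1)] by simp
    fix r :: "nat \<Rightarrow> nat" assume r: "strict_mono r"
    obtain r' G' where r': "subsequence r'" "G' \<in> Lam" "flag_lim d \<theta> (\<lambda>n. F (r (r' n))) G'"
      using Lam_seq_compact[of "\<lambda>n. F (r n)", OF F(1)] by (elim exE conjE) (rule that)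
    have "ell G' = ell G"
      by (rule limitin_Gr_unique[OF limitin_ell[OF F(1) r'(2,3)] limitin_subseq[OF limitin_subseq[OF l r] r'(1)] one])
    then have "G' = G" using inj_onD[OF ell_inj _ r'(2) G(1)] by blast
    then show "\<exists>r'. strict_mono r' \<and> flag_lim d \<theta> (\<lambda>n. F (r (r' n))) G" using r' by blast
  qed
  then show "limitin (subtopology (flag_topology d \<theta>) Lam) (\<lambda>n. xi (\<sigma> n)) (xi x) sequentially"
    unfolding limitin_subtopology F(2) G(2) xi_ell[OF F(1)] xi_ell[OF G(1)] using F(1) G(1) by simp
qed

lemma continuous_map_ell:
  "continuous_map (subtopology (flag_topology d \<theta>) Lam) (subtopology (Gr_topology R 1) (ell ` Lam)) ell"
proof -
  let ?X = "subtopology (flag_topology d \<theta>) Lam"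
  have tX: "topspace ?X = Lam" using Lam_flags by auto
  have k: "continuous_map ?X (Gr_topology d k) (\<lambda>F. F k)"
    unfolding flag_topology_def
    by (intro continuous_map_from_subtopology continuous_map_product_projection k_theta)
  have "continuous_map ?X (frames R 1) (\<lambda>F. col1 (p F))"
    unfolding continuous_map_in_subtopology
  proof (intro conjI continuous_map_into_mat)
    show "col1 (p F) \<in> carrier_mat R 1" for F by (rule col1_carrier[OF pW_carrier(1)])
    fix i j :: nat assume ij: "i < R" "j < 1"
    have "continuous_map ?X euclidean ((\<lambda>W. pW d k W $ i) \<circ> (\<lambda>F. F k))"
      by (rule continuous_map_compose[OF k continuous_map_pW[OF k_bounds(3) ij(1)]])
    then show "continuous_map ?X euclidean (\<lambda>F. col1 (p F) $$ (i, j))" using ij by (simp add: col1_def o_def)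
  next
    have "column_space 1 (col1 (p F)) \<in> Gr R 1" if "F \<in> Lam" for F
      unfolding column_space_col1[OF pW_carrier(1)] by (rule line_Gr[OF pW_carrier(1) p_nonzero[OF that]])
    then show "(\<lambda>F. col1 (p F)) \<in> topspace ?X \<rightarrow> {A. column_space 1 A \<in> Gr R 1}" unfolding tX by auto
  qed
  then have "continuous_map ?X (Gr_topology R 1) (column_space 1 \<circ> (\<lambda>F. col1 (p F)))"
    by (rule continuous_map_compose[OF _ quotient_imp_continuous_map[OF quotient_map_Gr]])
  then have "continuous_map ?X (Gr_topology R 1) ell"
    unfolding o_def column_space_col1[OF pW_carrier(1)] ell_def[symmetric] .
  then show ?thesis unfolding continuous_map_in_subtopology tX by auto
qed

lemma xi_image: "xi ` Pset = Lam"
  unfolding orbit_limit_set_eq by (force simp: image_iff)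

lemma xi_embedding: "embedding_map (subtopology (Gr_topology R 1) Pset) (flag_topology d \<theta>) xi"
proof -
  have t: "topspace (subtopology (Gr_topology R 1) (ell ` Lam)) = ell ` Lam" "topspace (subtopology (flag_topology d \<theta>) Lam) = Lam"
    using ell_Gr Lam_flags by auto
  have "xi ` topspace (subtopology (Gr_topology R 1) Pset) = Lam" using xi_image t(1) unfolding orbit_limit_set_eq by simp
  moreover have "homeomorphic_maps (subtopology (Gr_topology R 1) (ell ` Lam)) (subtopology (flag_topology d \<theta>) Lam) xi ell"
    unfolding homeomorphic_maps_def t using continuous_map_xi continuous_map_ell by auto
  ultimately show ?thesis
    unfolding embedding_map_def homeomorphic_map_maps orbit_limit_set_eq by auto
qed

theorem rho_transverse: "transverse_rep R Omega Gamma0 d \<theta> rho xi"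
  unfolding transverse_rep_def
proof (intro conjI xi_embedding)
  show "rho \<in> hom (PGL R\<lparr>carrier := Gamma0\<rparr>) (PGL d)"
  proof (rule homI)
    fix x assume "x \<in> carrier (PGL R\<lparr>carrier := Gamma0\<rparr>)"
    then show "rho x \<in> carrier (PGL d)" using Gamma(2) by auto
  next
    fix x y assume "x \<in> carrier (PGL R\<lparr>carrier := Gamma0\<rparr>)" "y \<in> carrier (PGL R\<lparr>carrier := Gamma0\<rparr>)"
    then obtain g h where gh: "g \<in> \<Gamma>" "h \<in> \<Gamma>" "x = PhiP d k g" "y = PhiP d k h" by auto
    have "x \<otimes>\<^bsub>PGL R\<^esub> y = PhiP d k (g \<otimes>\<^bsub>PGL d\<^esub> h)"
      unfolding gh(3,4) by (rule PhiP_mult[OF k_bounds(3) Gamma(2)[OF gh(1)] Gamma(2)[OF gh(2)], symmetric])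
    then show "rho (x \<otimes>\<^bsub>PGL R\<lparr>carrier := Gamma0\<rparr>\<^esub> y) = rho x \<otimes>\<^bsub>PGL d\<^esub> rho y"
      using gh Gamma(4)[OF gh(1,2)] by simp
  qed
  show "\<forall>\<gamma>\<in>Gamma0. \<forall>x\<in>Pset. xi (act \<gamma> x) = flag_act \<theta> (rho \<gamma>) (xi x)"
    unfolding orbit_limit_set_eq using act_ell Lam_act by auto
  show "transverse_set d \<theta> (xi ` Pset)" unfolding xi_image using tg by (simp add: transverse_group_def)
  show "\<forall>\<gamma> :: nat \<Rightarrow> _. \<forall>b\<in>Omega. \<forall>x\<in>Pset. \<forall>y\<in>Pset. range \<gamma> \<subseteq> Gamma0 \<and>
      Gr_lim R 1 (\<lambda>n. act (\<gamma> n) b) x \<and>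
      Gr_lim R 1 (\<lambda>n. act (inv\<^bsub>PGL R\<^esub> \<gamma> n) b) y \<longrightarrow>
      (\<forall>F\<in>flags d \<theta>. transverse_flags d \<theta> F (xi y) \<longrightarrow> flag_lim d \<theta> (\<lambda>n. flag_act \<theta> (rho (\<gamma> n)) F) (xi x))"
    unfolding orbit_limit_set_eq
  proof (intro allI ballI impI, elim conjE)
    fix \<gamma> :: "nat \<Rightarrow> real mat set" and b x y E
    assume b: "b \<in> Omega" and x: "x \<in> ell ` Lam" and y: "y \<in> ell ` Lam" and E: "E \<in> flags d \<theta>" "transverse_flags d \<theta> E (xi y)"
      and \<gamma>: "range \<gamma> \<subseteq> Gamma0" and lx: "Gr_lim R 1 (\<lambda>n. act (\<gamma> n) b) x"
      and ly: "Gr_lim R 1 (\<lambda>n. act (inv\<^bsub>PGL R\<^esub> \<gamma> n) b) y"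
    have "\<forall>n. \<exists>g. g \<in> \<Gamma> \<and> \<gamma> n = PhiP d k g" using \<gamma> by blast
    then obtain g where g: "\<And>n. g n \<in> \<Gamma>" "\<And>n. \<gamma> n = PhiP d k (g n)" by metis
    have gi: "inv\<^bsub>PGL R\<^esub> (\<gamma> n) = PhiP d k (inv\<^bsub>PGL d\<^esub> (g n))" for n
      unfolding g(2) by (rule group_hom.hom_inv[OF PhiP_hom Gamma(2)[OF g(1)], symmetric])
    have O: "x \<notin> Omega" "y \<notin> Omega" using x y ell_notin_Omega by auto
    show "flag_lim d \<theta> (\<lambda>n. flag_act \<theta> (rho (\<gamma> n)) E) (xi x)"
      unfolding g(2) rho_PhiP[OF g(1)]
    \<comment> \<open>Rank one limits exist only along subsequences, but all of them attract
      \<open>E\<close> to the same flag \<open>xi x\<close>, so the whole sequence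
      converges.\<close>
    proof (rule limitin_from_subseqs)
      show "xi x \<in> topspace (flag_topology d \<theta>)" using x Lam_flags by auto
      fix r :: "nat \<Rightarrow> nat" assume r: "strict_mono r"
      have "Gr_lim R 1 (\<lambda>n. act (PhiP d k (g (r n))) b) x"
        using limitin_subseq[OF lx r] unfolding g(2) .
      from orbit_accumulation[of "\<lambda>n. g (r n)", OF g(1) b O(1) this]
      obtain r' A c F G where D: "subsequence r'" "F \<in> Lam" "G \<in> Lam" "rank_one_limit A c F G"
        "\<forall>n. g (r (r' n)) = pcl d (A n)" "x = ell F"
        "flag_lim d \<theta> (\<lambda>n. Uflag d \<theta> (inv\<^bsub>PGL d\<^esub> (g (r (r' n))))) G"
        by (elim exE conjE) (rule that; assumption)
      \<comment> \<open>The repelling flag G of this subsequence is still unrelated to y. Applying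
        \<open>orbit_accumulation\<close> to the inverses, whose attracting flag is G, identifies it
        with \<open>xi y\<close>.\<close>
      have "Gr_lim R 1 (\<lambda>n. act (PhiP d k (inv\<^bsub>PGL d\<^esub> (g (r (r' n))))) b) y"
        using limitin_subseq[OF limitin_subseq[OF ly r] D(1)] unfolding gi .
      from orbit_accumulation[of "\<lambda>n. inv\<^bsub>PGL d\<^esub> (g (r (r' n)))", OF Gamma(3)[OF g(1)] b O(2) this]
      obtain r'' F' where D': "subsequence r''" "F' \<in> Lam" "y = ell F'"
        "flag_lim d \<theta> (\<lambda>n. Uflag d \<theta> (inv\<^bsub>PGL d\<^esub> (g (r (r' (r'' n)))))) F'"
        by (elim exE conjE) (rule that; assumption)
      have "F' = G" by (rule limitin_flag_unique[OF D'(4) limitin_subseq[OF D(7) D'(1)] theta(5)])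
      then have "transverse_flags d \<theta> E G" using E(2) xi_ell[OF D'(2)] D'(3) by simp
      from rank_one_flag[OF D(4,2,3) E(1) this]
      have "flag_lim d \<theta> (\<lambda>n. flag_act \<theta> (g (r (r' n))) E) (xi x)"
        unfolding D(5)[rule_format] D(6) xi_ell[OF D(2)] .
      then show "\<exists>r'. strict_mono r' \<and> flag_lim d \<theta> (\<lambda>n. flag_act \<theta> (g (r (r' n))) E) (xi x)"
        using D(1) by blast
    qed
  qed
qed

theorem transverse_realization:
  "\<exists>d\<^sub>0 \<Omega> \<Gamma>\<^sub>0 \<rho> \<xi>. d\<^sub>0 \<ge> 2 \<and> properly_convex_domain d\<^sub>0 \<Omega> \<and> projectively_visible d\<^sub>0 \<Omega> \<Gamma>\<^sub>0 \<and>
    transverse_rep d\<^sub>0 \<Omega> \<Gamma>\<^sub>0 d \<theta> \<rho> \<xi> \<and> inj_on \<rho> \<Gamma>\<^sub>0 \<and> \<rho> ` \<Gamma>\<^sub>0 = \<Gamma> \<and>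
    \<xi> ` orbit_limit_set d\<^sub>0 \<Omega> \<Gamma>\<^sub>0 = flag_limit_set d \<theta> \<Gamma> \<and>
    (\<forall>\<gamma>\<in>\<Gamma>\<^sub>0. root_gap 1 \<gamma> = root_gap k (\<rho> \<gamma>))"
proof (intro exI conjI)
  show "2 \<le> R" by (rule R2)
  show "properly_convex_domain R Omega" by (rule properly_convex_Omega)
  show "projectively_visible R Omega Gamma0" by (rule Gamma0_visible)
  show "transverse_rep R Omega Gamma0 d \<theta> rho xi" by (rule rho_transverse)
  show "inj_on rho Gamma0" by (auto simp: inj_on_def)
  show "rho ` Gamma0 = \<Gamma>" by (auto simp: image_image)
  show "xi ` Pset = Lam" by (rule xi_image)
  show "\<forall>\<gamma>\<in>Gamma0. root_gap 1 \<gamma> = root_gap k (rho \<gamma>)"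
    using PhiP_gap[OF k_bounds(1,2) Gamma(2)] by auto
qed

end

lemma transverse_kI:
  "symmetric_type d \<theta> \<Longrightarrow> k \<in> \<theta> \<Longrightarrow> k \<le> d - k \<Longrightarrow> transverse_group d \<theta> \<Gamma> \<Longrightarrow> transverse_k d \<theta> \<Gamma> k"
  by unfold_locales auto

theorem theorem4p2:
  fixes d k :: nat and \<theta> :: "nat set"
  assumes "symmetric_type d \<theta>" and "k \<in> \<theta>" and "k \<le> d - k"
  shows
    "(\<forall>\<Gamma> :: real mat set set. transverse_group d \<theta> \<Gamma> \<longrightarrow>
       (\<exists>d\<^sub>0 \<Omega> \<Gamma>\<^sub>0 \<rho> \<xi>. d\<^sub>0 \<ge> 2 \<and> properly_convex_domain d\<^sub>0 \<Omega> \<and> projectively_visible d\<^sub>0 \<Omega> \<Gamma>\<^sub>0 \<and>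
          transverse_rep d\<^sub>0 \<Omega> \<Gamma>\<^sub>0 d \<theta> \<rho> \<xi> \<and> inj_on \<rho> \<Gamma>\<^sub>0 \<and>
          \<rho> ` \<Gamma>\<^sub>0 = \<Gamma> \<and>
          \<xi> ` orbit_limit_set d\<^sub>0 \<Omega> \<Gamma>\<^sub>0 = flag_limit_set d \<theta> \<Gamma> \<and>
          (\<forall>\<gamma>\<in>\<Gamma>\<^sub>0. root_gap 1 \<gamma> = root_gap k (\<rho> \<gamma>)))) \<and>
     (\<forall>\<Gamma> :: complex mat set set. transverse_group d \<theta> \<Gamma> \<longrightarrow>
       (\<exists>d\<^sub>0 \<Omega> \<Gamma>\<^sub>0 \<rho> \<xi>. d\<^sub>0 \<ge> 2 \<and> properly_convex_domain d\<^sub>0 \<Omega> \<and> projectively_visible d\<^sub>0 \<Omega> \<Gamma>\<^sub>0 \<and>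
          transverse_rep d\<^sub>0 \<Omega> \<Gamma>\<^sub>0 d \<theta> \<rho> \<xi> \<and> inj_on \<rho> \<Gamma>\<^sub>0 \<and>
          \<rho> ` \<Gamma>\<^sub>0 = \<Gamma> \<and>
          \<xi> ` orbit_limit_set d\<^sub>0 \<Omega> \<Gamma>\<^sub>0 = flag_limit_set d \<theta> \<Gamma> \<and>
          (\<forall>\<gamma>\<in>\<Gamma>\<^sub>0. root_gap 1 \<gamma> = root_gap k (\<rho> \<gamma>))))"
  by (intro conjI allI impI transverse_k.transverse_realization[OF transverse_kI[OF assms]])

end
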